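(* Let $A$ be a braided bialgebra over a field $K$ with braiding $c_A$ and infinitesimal part $(P,c_P)$, and let $\lambda:P\to A$ be the inclusion. Let $b_A=(b_A^{[n]})_{n\in\mathbb N}$ be the canonical bracket of the braided algebra $A$, so that $(A,c_A,b_A)$ is a braided Lie algebra. Then this braided Lie algebra structure induces a braided Lie algebra structure $(P,c_P,b_P)$ on the infinitesimal part: for each $n\in\mathbb N$ there is a unique linear map $b_P^{[n]}:P_P^{[n]}\to P$ with $\lambda\, b_P^{[n]}=b_A^{[n]}P_\lambda^{[n]}$ (the $b_P^{[n]}$ and the maps $P_\lambda^{[n]}:P_P^{[n]}\to P_A^{[n]}$ being constructed recursively on $n$), the family $b_P=(b_P^{[n]})_{n\in\mathbb N}$ is a bracket on $(P,c_P)$, and $(P,c_P,b_P)$ is a braided Lie algebra.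
   Context: Fix a field $K$; all vector spaces, tensor products and maps are over $K$ ($K$-linear). An object also denotes its identity map. Braided vector space $(V,c)$: $c:V\otimes V\to V\otimes V$ linear with $(c\otimes V)(V\otimes c)(c\otimes V)=(V\otimes c)(c\otimes V)(V\otimes c)$; a morphism $f:(V,c_V)\to(W,c_W)$ is linear with $c_W(f\otimes f)=(f\otimes f)c_V$. Braided algebra $(A,m,u,c)$: an associative unital algebra and braided vector space with $c(m\otimes A)=(A\otimes m)(c\otimes A)(A\otimes c)$, $c(A\otimes m)=(m\otimes A)(A\otimes c)(c\otimes A)$, $c(u\otimes A)=A\otimes u$, $c(A\otimes u)=u\otimes A$. Braided coalgebra $(C,\Delta,\varepsilon,c)$: a coassociative counital coalgebra and braided vector space with $(\Delta\otimes C)c=(C\otimes c)(c\otimes C)(C\otimes\Delta)$, $(C\otimes\Delta)c=(c\otimes C)(C\otimes c)(\Delta\otimes C)$, $(\varepsilon\otimes C)c=C\otimes\varepsilon$, $(C\otimes\varepsilon)c=\varepsilon\otimes C$. Braided bialgebra $(B,m,u,\Delta,\varepsilon,c)$: a braided algebra and braided coalgebra with $\Delta m=(m\otimes m)(B\otimes c\otimes B)(\Delta\otimes\Delta)$, $\Delta(1)=1\otimes 1$, and $\varepsilon$ an algebra map. Morphisms of braided (bi)algebras are (bi)algebra maps that are morphisms of braided vector spaces. $P(B)=\{x\in B\mid \Delta(x)=x\otimes1+1\otimes x\}$. The braiding $c$ of $B$ satisfies $c(P(B)\otimes B)\subseteq B\otimes P(B)$ and $c(B\otimes P(B))\subseteq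 P(B)\otimes B$, so it restricts to a braiding $c_P$ on $P(B)$; $(P(B),c_P)$ is the infinitesimal part of $B$. A braided bialgebra map $f:B\to B'$ induces $P(f):P(B)\to P(B')$. Braided tensor algebra $T(V,c)$: the tensor algebra $T(V)$ with the unique braiding $c_T$ extending $c$ and making it a braided algebra, and with $\Delta_T$, $\varepsilon_T$ the algebra maps $\Delta_T:T(V)\to T(V)\otimes_c T(V)$, $\varepsilon_T:T(V)\to K$ such that $\Delta_T(v)=v\otimes1+1\otimes v$, $\varepsilon_T(v)=0$ for $v\in V$, where $T\otimes_cT$ has multiplication $(m_T\otimes m_T)(T\otimes c_T\otimes T)$. A bracket on a braided vector space $(V,c)$ is a family $b=(b^{[n]})_{n\in\mathbb N}$ of linear maps defined together with braided bialgebras $U^{[n]}=U_V^{[n]}$ and braided vector space morphisms $i^{[n]}=i_V^{[n]}:V\to P^{[n]}=P_V^{[n]}:=P(U^{[n]})$ as follows. $U^{[0]}=T(V,c)$ and $i^{[0]}$ is the inclusion. For each $n$, $b^{[n]}:P^{[n]}\to V$ is linear and, with $V^{[n]}:=i^{[n]}(V)$ and $c$ the braiding of $U^{[n]}$, one has on $P^{[n]}\otimes V^{[n]}$ and $V^{[n]}\otimes P^{[n]}$ respectively $c(i^{[n]}b^{[n]}\otimes V^{[n]})=(V^{[n]}\otimes i^{[n]}b^{[n]})c$ and $c(V^{[n]}\otimes i^{[n]}b^{[n]})=(i^{[n]}b^{[n]}\otimes V^{[n]})c$ (these make sense as $c$ maps $P^{[n]}\otimes V^{[n]}$ into $V^{[n]}\otimes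 P^{[n]}$ and conversely). Then $U^{[n+1]}=U^{[n]}/\big((\mathrm{Id}-i^{[n]}b^{[n]})[P^{[n]}]\big)$ (quotient by the two-sided ideal generated) with the unique braided bialgebra structure making the projection $\pi_n^{n+1}:U^{[n]}\to U^{[n+1]}$ a braided bialgebra map, and $i^{[n+1]}=P(\pi_n^{n+1})i^{[n]}$. The universal enveloping algebra is the direct limit $U(V,c,b)=\varinjlim U^{[n]}$ (a braided bialgebra), with canonical map $i_U:V\to U(V,c,b)$. $(V,c,b)$ is a braided Lie algebra if $i_U$ is injective. Canonical bracket of a braided algebra $(A,c_A)$: $\varphi^{[0]}:U_A^{[0]}=T(A,c_A)\to A$ is the unique algebra map extending $\mathrm{Id}_A$; recursively $b_A^{[n]}:P_A^{[n]}\to A$ is the restriction of $\varphi^{[n]}:U_A^{[n]}\to A$ to $P_A^{[n]}$, and $\varphi^{[n+1]}:U_A^{[n+1]}\to A$ is the map induced by $\varphi^{[n]}$ on the quotient. (This is a well-defined bracket on $(A,c_A)$, and $(A,c_A,b_A)$ is a braided Lie algebra.) Maps $P_h^{[n]}$ for a morphism of braided vector spaces $h:(V,c_V)\to(W,c_W)$: $U_h^{[0]}:T(V,c_V)\to T(W,c_W)$ is the braided bialgebra map extending $h$; $P_h^{[n]}:P_V^{[n]}\to P_W^{[n]}$ is induced by $U_h^{[n]}:U_V^{[n]}\to U_W^{[n]}$ on primitive elements; once $h\,b_V^{[n]}=b_W^{[n]}P_h^{[n]}$ holds, $U_h^{[n+1]}:U_V^{[n+1]}\to U_W^{[n+1]}$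 is the map induced by $U_h^{[n]}$ on the quotients. Here this is applied to $h=\lambda$. *)

theory Defs
  imports "HOL-Algebra.Module" "HOL-Algebra.Ideal" "HOL-Library.FuncSet"
begin

section \<open>Linear maps, spans, quotients\<close>

definition lin :: "('k, 'z) ring_scheme \<Rightarrow> ('k, 'a, 'm) module_scheme \<Rightarrow> ('k, 'b, 'n) module_scheme \<Rightarrow> ('a \<Rightarrow> 'b) \<Rightarrow> bool"
  where "lin K M N f \<longleftrightarrow> f \<in> carrier M \<rightarrow> carrier N \<and>
    (\<forall>x\<in>carrier M. \<forall>y\<in>carrier M. f (x \<oplus>\<^bsub>M\<^esub> y) = f x \<oplus>\<^bsub>N\<^esub> f y) \<and>
    (\<forall>a\<in>carrier K. \<forall>x\<in>carrier M. f (a \<odot>\<^bsub>M\<^esub> x) = a \<odot>\<^bsub>N\<^esub> f x)"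

definition lspan :: "('k, 'z) ring_scheme \<Rightarrow> ('k, 'a, 'm) module_scheme \<Rightarrow> 'a set \<Rightarrow> 'a set"
  where "lspan K M S = \<Inter>{H. submodule H K M \<and> S \<subseteq> H}"

text \<open>The locale \<open>algebra\<close> of the library is commutative; this is the noncommutative version.\<close>

definition assoc_algebra :: "('k, 'z) ring_scheme \<Rightarrow> ('k, 'a, 'm) module_scheme \<Rightarrow> bool"
  where "assoc_algebra K A \<longleftrightarrow> module K A \<and> ring A \<and>
    (\<forall>a\<in>carrier K. \<forall>x\<in>carrier A. \<forall>y\<in>carrier A.
      (a \<odot>\<^bsub>A\<^esub> x) \<otimes>\<^bsub>A\<^esub> y = a \<odot>\<^bsub>A\<^esub> (x \<otimes>\<^bsub>A\<^esub> y) \<and> x \<otimes>\<^bsub>A\<^esub> (a \<odot>\<^bsub>A\<^esub> y) = a \<odot>\<^bsub>A\<^esub> (x \<otimes>\<^bsub>A\<^esub> y))"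

definition alg_hom :: "('k, 'z) ring_scheme \<Rightarrow> ('k, 'a, 'm) module_scheme \<Rightarrow> ('k, 'b, 'n) module_scheme \<Rightarrow> ('a \<Rightarrow> 'b) \<Rightarrow> bool"
  where "alg_hom K A B f \<longleftrightarrow> lin K A B f \<and> f \<in> ring_hom A B"

definition ground :: "('k, 'z) ring_scheme \<Rightarrow> ('k, 'k) module"
  where "ground K = \<lparr>carrier = carrier K, monoid.mult = monoid.mult K, one = one K, ring.zero = ring.zero K, ring.add = ring.add K, smult = monoid.mult K\<rparr>"

text \<open>
  The quotient of an algebra by a two-sided ideal is realised on a set of coset
  representatives rather than on the set of cosets, so that iterated quotients stay
  in one type.  The projection sends an element to the chosen representative of its coset.
\<close>

definition quot_proj :: "('k, 'a, 'm) module_scheme \<Rightarrow> 'a set \<Rightarrow> 'a \<Rightarrow> 'a"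
  where "quot_proj A I x = (SOME y. y \<in> I +>\<^bsub>A\<^esub> x)"

definition quot_alg :: "('k, 'a, 'm) module_scheme \<Rightarrow> 'a set \<Rightarrow> ('k, 'a) module"
  where "quot_alg A I = \<lparr>
    carrier = quot_proj A I ` carrier A,
    monoid.mult = (\<lambda>x y. quot_proj A I (x \<otimes>\<^bsub>A\<^esub> y)),
    one = quot_proj A I \<one>\<^bsub>A\<^esub>,
    ring.zero = quot_proj A I \<zero>\<^bsub>A\<^esub>,
    ring.add = (\<lambda>x y. quot_proj A I (x \<oplus>\<^bsub>A\<^esub> y)),
    smult = (\<lambda>a x. quot_proj A I (a \<odot>\<^bsub>A\<^esub> x))\<rparr>"

text \<open>\<open>induced S p f\<close> is the map \<open>g\<close> on \<open>p ` S\<close> with \<open>g \<circ> p = f\<close> on \<open>S\<close>, if there is one.\<close>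

definition induced :: "'a set \<Rightarrow> ('a \<Rightarrow> 'b) \<Rightarrow> ('a \<Rightarrow> 'c) \<Rightarrow> 'b \<Rightarrow> 'c"
  where "induced S p f = f \<circ> inv_into S p"


section \<open>The tensor algebra and tensor powers\<close>

text \<open>
  The free algebra on a set \<open>X\<close>: finitely supported functions on words over \<open>X\<close>
  with the convolution product.
\<close>

definition free_alg :: "('k, 'z) ring_scheme \<Rightarrow> 'a set \<Rightarrow> ('k, 'a list \<Rightarrow> 'k) module"
  where "free_alg K X = \<lparr>
    carrier = {f. range f \<subseteq> carrier K \<and> finite {w. f w \<noteq> \<zero>\<^bsub>K\<^esub>} \<and> {w. f w \<noteq> \<zero>\<^bsub>K\<^esub>} \<subseteq> lists X},
    monoid.mult = (\<lambda>f g w. \<Oplus>\<^bsub>K\<^esub>k\<in>{..length w}. f (take k w) \<otimes>\<^bsub>K\<^esub> g (drop k w)),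
    one = (\<lambda>w. if w = [] then \<one>\<^bsub>K\<^esub> else \<zero>\<^bsub>K\<^esub>),
    ring.zero = (\<lambda>w. \<zero>\<^bsub>K\<^esub>),
    ring.add = (\<lambda>f g w. f w \<oplus>\<^bsub>K\<^esub> g w),
    smult = (\<lambda>a f w. a \<otimes>\<^bsub>K\<^esub> f w)\<rparr>"

definition letter :: "('k, 'z) ring_scheme \<Rightarrow> 'a \<Rightarrow> 'a list \<Rightarrow> 'k"
  where "letter K x = (\<lambda>w. if w = [x] then \<one>\<^bsub>K\<^esub> else \<zero>\<^bsub>K\<^esub>)"

definition tensor_ideal :: "('k, 'z) ring_scheme \<Rightarrow> ('k, 'a, 'm) module_scheme \<Rightarrow> ('a list \<Rightarrow> 'k) set"
  where "tensor_ideal K V = (let F = free_alg K (carrier V) in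
    genideal F
     ({letter K (x \<oplus>\<^bsub>V\<^esub> y) \<ominus>\<^bsub>F\<^esub> (letter K x \<oplus>\<^bsub>F\<^esub> letter K y) | x y. x \<in> carrier V \<and> y \<in> carrier V} \<union>
      {letter K (a \<odot>\<^bsub>V\<^esub> x) \<ominus>\<^bsub>F\<^esub> a \<odot>\<^bsub>F\<^esub> letter K x | a x. a \<in> carrier K \<and> x \<in> carrier V}))"

text \<open>
  All tensors live in the tensor algebra \<open>T(V)\<close>: the tensor power \<open>V\<^sup>\<otimes>\<^sup>n\<close> is its homogeneous
  component of degree \<open>n\<close>, and \<open>x \<otimes> y\<close> is the product of \<open>T(V)\<close>.  Hence the tensor product is
  strictly associative and strictly unital (\<open>K\<close> being \<open>V\<^sup>\<otimes>\<^sup>0\<close>), and no associativity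
  isomorphisms have to be inserted.  An element \<open>v\<close> of \<open>V\<close>, seen in \<open>V\<^sup>\<otimes>\<^sup>1\<close>, is \<open>\<iota> K V v\<close>.
\<close>

definition tensor_alg :: "('k, 'z) ring_scheme \<Rightarrow> ('k, 'a, 'm) module_scheme \<Rightarrow> ('k, 'a list \<Rightarrow> 'k) module"
  where "tensor_alg K V = quot_alg (free_alg K (carrier V)) (tensor_ideal K V)"

definition \<iota> :: "('k, 'z) ring_scheme \<Rightarrow> ('k, 'a, 'm) module_scheme \<Rightarrow> 'a \<Rightarrow> 'a list \<Rightarrow> 'k"
  where "\<iota> K V v = quot_proj (free_alg K (carrier V)) (tensor_ideal K V) (letter K v)"

definition pure_tensor :: "('k, 'z) ring_scheme \<Rightarrow> ('k, 'a, 'm) module_scheme \<Rightarrow> 'a list \<Rightarrow> 'a list \<Rightarrow> 'k"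
  where "pure_tensor K V w = foldr (\<lambda>v t. \<iota> K V v \<otimes>\<^bsub>tensor_alg K V\<^esub> t) w \<one>\<^bsub>tensor_alg K V\<^esub>"

definition tpow :: "('k, 'z) ring_scheme \<Rightarrow> ('k, 'a, 'm) module_scheme \<Rightarrow> nat \<Rightarrow> ('a list \<Rightarrow> 'k) set"
  where "tpow K V n = lspan K (tensor_alg K V)
    (pure_tensor K V ` {w. w \<in> lists (carrier V) \<and> length w = n})"

abbreviation tpow_mod :: "('k, 'z) ring_scheme \<Rightarrow> ('k, 'a, 'm) module_scheme \<Rightarrow> nat \<Rightarrow> ('k, 'a list \<Rightarrow> 'k) module"
  where "tpow_mod K V n \<equiv> (tensor_alg K V)\<lparr>carrier := tpow K V n\<rparr>"

text \<open>
  For subspaces \<open>X\<close>, \<open>Y\<close> of tensor powers of \<open>V\<close>, \<open>tsub K V X Y\<close> is the subspace \<open>X \<otimes> Y\<close>, and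
  \<open>tmap K V W X Y f g\<close> is the tensor product \<open>f \<otimes> g\<close> of linear maps \<open>f\<close>, \<open>g\<close> defined on \<open>X\<close>, \<open>Y\<close>
  with values in tensor powers of \<open>W\<close>.
\<close>

definition tsub :: "('k, 'z) ring_scheme \<Rightarrow> ('k, 'a, 'm) module_scheme \<Rightarrow> ('a list \<Rightarrow> 'k) set \<Rightarrow> ('a list \<Rightarrow> 'k) set \<Rightarrow> ('a list \<Rightarrow> 'k) set"
  where "tsub K V X Y = lspan K (tensor_alg K V) {x \<otimes>\<^bsub>tensor_alg K V\<^esub> y | x y. x \<in> X \<and> y \<in> Y}"

definition tmap :: "('k, 'z) ring_scheme \<Rightarrow> ('k, 'a, 'm) module_scheme \<Rightarrow> ('k, 'b, 'n) module_scheme \<Rightarrow>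
    ('a list \<Rightarrow> 'k) set \<Rightarrow> ('a list \<Rightarrow> 'k) set \<Rightarrow> (('a list \<Rightarrow> 'k) \<Rightarrow> ('b list \<Rightarrow> 'k)) \<Rightarrow>
    (('a list \<Rightarrow> 'k) \<Rightarrow> ('b list \<Rightarrow> 'k)) \<Rightarrow> ('a list \<Rightarrow> 'k) \<Rightarrow> ('b list \<Rightarrow> 'k)"
  where "tmap K V W X Y f g = (SOME h.
    lin K ((tensor_alg K V)\<lparr>carrier := tsub K V X Y\<rparr>) (tensor_alg K W) h \<and>
    (\<forall>x\<in>X. \<forall>y\<in>Y. h (x \<otimes>\<^bsub>tensor_alg K V\<^esub> y) = f x \<otimes>\<^bsub>tensor_alg K W\<^esub> g y))"

text \<open>
  \<open>tpm K V p f r g\<close> is \<open>f \<otimes> g\<close> for \<open>f\<close> defined on \<open>V\<^sup>\<otimes>\<^sup>p\<close> and \<open>g\<close> on \<open>V\<^sup>\<otimes>\<^sup>r\<close>, both with values in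
  tensor powers of \<open>V\<close>; \<open>deg1\<close> turns \<open>f : V \<Rightarrow> W\<close> into a map \<open>V\<^sup>\<otimes>\<^sup>1 \<Rightarrow> W\<^sup>\<otimes>\<^sup>1\<close>; and
  \<open>tsquare K V W f\<close> is \<open>f \<otimes> f : V \<otimes> V \<Rightarrow> W \<otimes> W\<close>.
\<close>

abbreviation tpm :: "('k, 'z) ring_scheme \<Rightarrow> ('k, 'a, 'm) module_scheme \<Rightarrow>
    nat \<Rightarrow> (('a list \<Rightarrow> 'k) \<Rightarrow> ('a list \<Rightarrow> 'k)) \<Rightarrow> nat \<Rightarrow> (('a list \<Rightarrow> 'k) \<Rightarrow> ('a list \<Rightarrow> 'k)) \<Rightarrow>
    ('a list \<Rightarrow> 'k) \<Rightarrow> ('a list \<Rightarrow> 'k)"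
  where "tpm K V p f r g \<equiv> tmap K V V (tpow K V p) (tpow K V r) f g"

definition deg1 :: "('k, 'z) ring_scheme \<Rightarrow> ('k, 'a, 'm) module_scheme \<Rightarrow> ('k, 'b, 'n) module_scheme \<Rightarrow>
    ('a \<Rightarrow> 'b) \<Rightarrow> ('a list \<Rightarrow> 'k) \<Rightarrow> ('b list \<Rightarrow> 'k)"
  where "deg1 K V W f = induced (carrier V) (\<iota> K V) (\<iota> K W \<circ> f)"

definition tsquare :: "('k, 'z) ring_scheme \<Rightarrow> ('k, 'a, 'm) module_scheme \<Rightarrow> ('k, 'b, 'n) module_scheme \<Rightarrow>
    ('a \<Rightarrow> 'b) \<Rightarrow> ('a list \<Rightarrow> 'k) \<Rightarrow> ('b list \<Rightarrow> 'k)"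
  where "tsquare K V W f = tmap K V W (tpow K V 1) (tpow K V 1) (deg1 K V W f) (deg1 K V W f)"


section \<open>Braided vector spaces, algebras, coalgebras, bialgebras\<close>

definition braided_vs :: "('k, 'z) ring_scheme \<Rightarrow> ('k, 'a, 'm) module_scheme \<Rightarrow> (('a list \<Rightarrow> 'k) \<Rightarrow> ('a list \<Rightarrow> 'k)) \<Rightarrow> bool"
  where "braided_vs K V c \<longleftrightarrow> module K V \<and> lin K (tpow_mod K V 2) (tpow_mod K V 2) c \<and>
    (\<forall>t\<in>tpow K V 3.
      tpm K V 2 c 1 id (tpm K V 1 id 2 c (tpm K V 2 c 1 id t)) =
      tpm K V 1 id 2 c (tpm K V 2 c 1 id (tpm K V 1 id 2 c t)))"

definition braided_mor :: "('k, 'z) ring_scheme \<Rightarrow> ('k, 'a, 'm) module_scheme \<Rightarrow> (('a list \<Rightarrow> 'k) \<Rightarrow> ('a list \<Rightarrow> 'k)) \<Rightarrow>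
    ('k, 'b, 'n) module_scheme \<Rightarrow> (('b list \<Rightarrow> 'k) \<Rightarrow> ('b list \<Rightarrow> 'k)) \<Rightarrow> ('a \<Rightarrow> 'b) \<Rightarrow> bool"
  where "braided_mor K V cV W cW f \<longleftrightarrow> lin K V W f \<and>
    (\<forall>t\<in>tpow K V 2. cW (tsquare K V W f t) = tsquare K V W f (cV t))"

text \<open>The multiplication as a map \<open>A\<^sup>\<otimes>\<^sup>2 \<Rightarrow> A\<^sup>\<otimes>\<^sup>1\<close>.\<close>

definition mulT :: "('k, 'z) ring_scheme \<Rightarrow> ('k, 'a, 'm) module_scheme \<Rightarrow> ('a list \<Rightarrow> 'k) \<Rightarrow> ('a list \<Rightarrow> 'k)"
  where "mulT K A = (SOME h. lin K (tpow_mod K A 2) (tpow_mod K A 1) h \<and>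
    (\<forall>x\<in>carrier A. \<forall>y\<in>carrier A. h (\<iota> K A x \<otimes>\<^bsub>tensor_alg K A\<^esub> \<iota> K A y) = \<iota> K A (x \<otimes>\<^bsub>A\<^esub> y)))"

definition braided_algebra :: "('k, 'z) ring_scheme \<Rightarrow> ('k, 'a, 'm) module_scheme \<Rightarrow> (('a list \<Rightarrow> 'k) \<Rightarrow> ('a list \<Rightarrow> 'k)) \<Rightarrow> bool"
  where "braided_algebra K A c \<longleftrightarrow> assoc_algebra K A \<and> braided_vs K A c \<and>
    (\<forall>t\<in>tpow K A 3.
      c (tpm K A 2 (mulT K A) 1 id t) = tpm K A 1 id 2 (mulT K A) (tpm K A 2 c 1 id (tpm K A 1 id 2 c t)) \<and>
      c (tpm K A 1 id 2 (mulT K A) t) = tpm K A 2 (mulT K A) 1 id (tpm K A 1 id 2 c (tpm K A 2 c 1 id t))) \<and>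
    (\<forall>x\<in>carrier A.
      c (\<iota> K A \<one>\<^bsub>A\<^esub> \<otimes>\<^bsub>tensor_alg K A\<^esub> \<iota> K A x) = \<iota> K A x \<otimes>\<^bsub>tensor_alg K A\<^esub> \<iota> K A \<one>\<^bsub>A\<^esub> \<and>
      c (\<iota> K A x \<otimes>\<^bsub>tensor_alg K A\<^esub> \<iota> K A \<one>\<^bsub>A\<^esub>) = \<iota> K A \<one>\<^bsub>A\<^esub> \<otimes>\<^bsub>tensor_alg K A\<^esub> \<iota> K A x)"

text \<open>The algebra \<open>A \<otimes>\<^sub>c A\<close>, with multiplication \<open>(m \<otimes> m)(A \<otimes> c \<otimes> A)\<close>.\<close>

definition braided_tensor_square :: "('k, 'z) ring_scheme \<Rightarrow> ('k, 'a, 'm) module_scheme \<Rightarrow> (('a list \<Rightarrow> 'k) \<Rightarrow> ('a list \<Rightarrow> 'k)) \<Rightarrow> ('k, 'a list \<Rightarrow> 'k) module"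
  where "braided_tensor_square K A c = (tpow_mod K A 2)\<lparr>
    monoid.mult := (\<lambda>s t. tpm K A 2 (mulT K A) 2 (mulT K A)
       (tpm K A 1 id 3 (tpm K A 2 c 1 id) (s \<otimes>\<^bsub>tensor_alg K A\<^esub> t))),
    one := \<iota> K A \<one>\<^bsub>A\<^esub> \<otimes>\<^bsub>tensor_alg K A\<^esub> \<iota> K A \<one>\<^bsub>A\<^esub>\<rparr>"

text \<open>\<open>comult\<close> takes values in, and \<open>braiding\<close> acts on, the second tensor power.\<close>

record ('k, 'a) bialg = "('k, 'a) module" +
  comult :: "'a \<Rightarrow> 'a list \<Rightarrow> 'k"
  counit :: "'a \<Rightarrow> 'k"
  braiding :: "('a list \<Rightarrow> 'k) \<Rightarrow> ('a list \<Rightarrow> 'k)"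

text \<open>The comultiplication \<open>C\<^sup>\<otimes>\<^sup>1 \<Rightarrow> C\<^sup>\<otimes>\<^sup>2\<close> and the counit \<open>C\<^sup>\<otimes>\<^sup>1 \<Rightarrow> C\<^sup>\<otimes>\<^sup>0\<close>.\<close>

definition comultT :: "('k, 'z) ring_scheme \<Rightarrow> ('k, 'a) bialg \<Rightarrow> ('a list \<Rightarrow> 'k) \<Rightarrow> ('a list \<Rightarrow> 'k)"
  where "comultT K C = induced (carrier C) (\<iota> K C) (comult C)"

definition counitT :: "('k, 'z) ring_scheme \<Rightarrow> ('k, 'a) bialg \<Rightarrow> ('a list \<Rightarrow> 'k) \<Rightarrow> ('a list \<Rightarrow> 'k)"
  where "counitT K C = induced (carrier C) (\<iota> K C) (\<lambda>x. counit C x \<odot>\<^bsub>tensor_alg K C\<^esub> \<one>\<^bsub>tensor_alg K C\<^esub>)"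

definition braided_coalgebra :: "('k, 'z) ring_scheme \<Rightarrow> ('k, 'a) bialg \<Rightarrow> bool"
  where "braided_coalgebra K C \<longleftrightarrow> braided_vs K C (braiding C) \<and>
    lin K C (tpow_mod K C 2) (comult C) \<and> lin K C (ground K) (counit C) \<and>
    (\<forall>x\<in>carrier C.
      tpm K C 1 (comultT K C) 1 id (comult C x) = tpm K C 1 id 1 (comultT K C) (comult C x) \<and>
      tpm K C 1 (counitT K C) 1 id (comult C x) = \<iota> K C x \<and>
      tpm K C 1 id 1 (counitT K C) (comult C x) = \<iota> K C x) \<and>
    (\<forall>t\<in>tpow K C 2.
      tpm K C 1 (comultT K C) 1 id (braiding C t) =
        tpm K C 1 id 2 (braiding C) (tpm K C 2 (braiding C) 1 id (tpm K C 1 id 1 (comultT K C) t)) \<and>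
      tpm K C 1 id 1 (comultT K C) (braiding C t) =
        tpm K C 2 (braiding C) 1 id (tpm K C 1 id 2 (braiding C) (tpm K C 1 (comultT K C) 1 id t)) \<and>
      tpm K C 1 (counitT K C) 1 id (braiding C t) = tpm K C 1 id 1 (counitT K C) t \<and>
      tpm K C 1 id 1 (counitT K C) (braiding C t) = tpm K C 1 (counitT K C) 1 id t)"

definition braided_bialgebra :: "('k, 'z) ring_scheme \<Rightarrow> ('k, 'a) bialg \<Rightarrow> bool"
  where "braided_bialgebra K B \<longleftrightarrow> braided_algebra K B (braiding B) \<and> braided_coalgebra K B \<and>
    alg_hom K B (braided_tensor_square K B (braiding B)) (comult B) \<and> alg_hom K B (ground K) (counit B)"

definition bialg_mor :: "('k, 'z) ring_scheme \<Rightarrow> ('k, 'a) bialg \<Rightarrow> ('k, 'b) bialg \<Rightarrow> ('a \<Rightarrow> 'b) \<Rightarrow> bool"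
  where "bialg_mor K B B' f \<longleftrightarrow> alg_hom K B B' f \<and> braided_mor K B (braiding B) B' (braiding B') f \<and>
    (\<forall>x\<in>carrier B. comult B' (f x) = tsquare K B B' f (comult B x) \<and> counit B' (f x) = counit B x)"

definition prims :: "('k, 'z) ring_scheme \<Rightarrow> ('k, 'a) bialg \<Rightarrow> 'a set"
  where "prims K B = {x \<in> carrier B. comult B x =
    (\<iota> K B x \<otimes>\<^bsub>tensor_alg K B\<^esub> \<iota> K B \<one>\<^bsub>B\<^esub>) \<oplus>\<^bsub>tensor_alg K B\<^esub> (\<iota> K B \<one>\<^bsub>B\<^esub> \<otimes>\<^bsub>tensor_alg K B\<^esub> \<iota> K B x)}"

text \<open>
  The infinitesimal part \<open>(P(B), c\<^sub>P)\<close>; only the vector space structure of \<open>prim_mod K B\<close> is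
  meaningful.  With \<open>\<lambda>\<close> the inclusion, \<open>c\<^sub>P\<close> is the map with \<open>(\<lambda> \<otimes> \<lambda>) c\<^sub>P = c (\<lambda> \<otimes> \<lambda>)\<close>.
\<close>

definition prim_mod :: "('k, 'z) ring_scheme \<Rightarrow> ('k, 'a) bialg \<Rightarrow> ('k, 'a) module"
  where "prim_mod K B = (module.truncate B)\<lparr>carrier := prims K B\<rparr>"

definition prim_braiding :: "('k, 'z) ring_scheme \<Rightarrow> ('k, 'a) bialg \<Rightarrow> ('a list \<Rightarrow> 'k) \<Rightarrow> ('a list \<Rightarrow> 'k)"
  where "prim_braiding K B =
    inv_into (tpow K (prim_mod K B) 2) (tsquare K (prim_mod K B) B id) \<circ> braiding B \<circ> tsquare K (prim_mod K B) B id"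


section \<open>The braided tensor algebra and quotients of braided bialgebras\<close>

definition tensor_braiding :: "('k, 'z) ring_scheme \<Rightarrow> ('k, 'a, 'm) module_scheme \<Rightarrow> (('a list \<Rightarrow> 'k) \<Rightarrow> ('a list \<Rightarrow> 'k)) \<Rightarrow>
    (('a list \<Rightarrow> 'k) list \<Rightarrow> 'k) \<Rightarrow> (('a list \<Rightarrow> 'k) list \<Rightarrow> 'k)"
  where "tensor_braiding K V c = (SOME c'. braided_algebra K (tensor_alg K V) c' \<and>
    (\<forall>t\<in>tpow K V 2. c' (tsquare K V (tensor_alg K V) (\<iota> K V) t) = tsquare K V (tensor_alg K V) (\<iota> K V) (c t)))"

definition tensor_comult :: "('k, 'z) ring_scheme \<Rightarrow> ('k, 'a, 'm) module_scheme \<Rightarrow> (('a list \<Rightarrow> 'k) \<Rightarrow> ('a list \<Rightarrow> 'k)) \<Rightarrow>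
    ('a list \<Rightarrow> 'k) \<Rightarrow> (('a list \<Rightarrow> 'k) list \<Rightarrow> 'k)"
  where "tensor_comult K V c = (let T = tensor_alg K V; TT = tensor_alg K T in
    SOME D. alg_hom K T (braided_tensor_square K T (tensor_braiding K V c)) D \<and>
      (\<forall>v\<in>carrier V. D (\<iota> K V v) =
        (\<iota> K T (\<iota> K V v) \<otimes>\<^bsub>TT\<^esub> \<iota> K T \<one>\<^bsub>T\<^esub>) \<oplus>\<^bsub>TT\<^esub> (\<iota> K T \<one>\<^bsub>T\<^esub> \<otimes>\<^bsub>TT\<^esub> \<iota> K T (\<iota> K V v))))"

definition tensor_counit :: "('k, 'z) ring_scheme \<Rightarrow> ('k, 'a, 'm) module_scheme \<Rightarrow> ('a list \<Rightarrow> 'k) \<Rightarrow> 'k"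
  where "tensor_counit K V = (SOME e. alg_hom K (tensor_alg K V) (ground K) e \<and>
    (\<forall>v\<in>carrier V. e (\<iota> K V v) = \<zero>\<^bsub>K\<^esub>))"

definition tensor_bialg :: "('k, 'z) ring_scheme \<Rightarrow> ('k, 'a, 'm) module_scheme \<Rightarrow> (('a list \<Rightarrow> 'k) \<Rightarrow> ('a list \<Rightarrow> 'k)) \<Rightarrow>
    ('k, 'a list \<Rightarrow> 'k) bialg"
  where "tensor_bialg K V c = module.extend (tensor_alg K V)
    (bialg.fields (tensor_comult K V c) (tensor_counit K V) (tensor_braiding K V c))"

text \<open>
  The structure maps of the quotient are the ones induced along the projection \<open>p\<close>,
  e.g. the braiding \<open>c'\<close> is determined by \<open>c' (p \<otimes> p) = (p \<otimes> p) c\<close>.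
\<close>

definition quot_bialg :: "('k, 'z) ring_scheme \<Rightarrow> ('k, 'a) bialg \<Rightarrow> 'a set \<Rightarrow> ('k, 'a) bialg"
  where "quot_bialg K B J = (let Q = quot_alg B J; p = quot_proj B J; pp = tsquare K B Q p in
    module.extend Q (bialg.fields
      (induced (carrier B) p (pp \<circ> comult B))
      (induced (carrier B) p (counit B))
      (induced (tpow K B 2) pp (pp \<circ> braiding B))))"


section \<open>Brackets\<close>

definition bracket_ideal :: "('k, 'z) ring_scheme \<Rightarrow> ('k, 'u) bialg \<Rightarrow> ('a \<Rightarrow> 'u) \<Rightarrow> ('u \<Rightarrow> 'a) \<Rightarrow> 'u set"
  where "bracket_ideal K U i \<beta> = genideal U {p \<ominus>\<^bsub>U\<^esub> i (\<beta> p) | p. p \<in> prims K U}"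

definition next_U :: "('k, 'z) ring_scheme \<Rightarrow> ('k, 'u) bialg \<Rightarrow> ('a \<Rightarrow> 'u) \<Rightarrow> ('u \<Rightarrow> 'a) \<Rightarrow> ('k, 'u) bialg"
  where "next_U K U i \<beta> = quot_bialg K U (bracket_ideal K U i \<beta>)"

definition next_proj :: "('k, 'z) ring_scheme \<Rightarrow> ('k, 'u) bialg \<Rightarrow> ('a \<Rightarrow> 'u) \<Rightarrow> ('u \<Rightarrow> 'a) \<Rightarrow> 'u \<Rightarrow> 'u"
  where "next_proj K U i \<beta> = quot_proj U (bracket_ideal K U i \<beta>)"

text \<open>The pair \<open>(U\<^sup>[\<^sup>n\<^sup>], i\<^sup>[\<^sup>n\<^sup>])\<close>; it only depends on \<open>b 0, \<dots>, b (n - 1)\<close>.\<close>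

primrec bracket_stage :: "('k, 'z) ring_scheme \<Rightarrow> ('k, 'a, 'm) module_scheme \<Rightarrow> (('a list \<Rightarrow> 'k) \<Rightarrow> ('a list \<Rightarrow> 'k)) \<Rightarrow>
    (nat \<Rightarrow> ('a list \<Rightarrow> 'k) \<Rightarrow> 'a) \<Rightarrow> nat \<Rightarrow> ('k, 'a list \<Rightarrow> 'k) bialg \<times> ('a \<Rightarrow> 'a list \<Rightarrow> 'k)"
  where
    "bracket_stage K V c b 0 = (tensor_bialg K V c, \<iota> K V)"
  | "bracket_stage K V c b (Suc n) = (let (U, i) = bracket_stage K V c b n in
      (next_U K U i (b n), next_proj K U i (b n) \<circ> i))"

definition stage_U :: "('k, 'z) ring_scheme \<Rightarrow> ('k, 'a, 'm) module_scheme \<Rightarrow> (('a list \<Rightarrow> 'k) \<Rightarrow> ('a list \<Rightarrow> 'k)) \<Rightarrow>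
    (nat \<Rightarrow> ('a list \<Rightarrow> 'k) \<Rightarrow> 'a) \<Rightarrow> nat \<Rightarrow> ('k, 'a list \<Rightarrow> 'k) bialg"
  where "stage_U K V c b n = fst (bracket_stage K V c b n)"

definition stage_i :: "('k, 'z) ring_scheme \<Rightarrow> ('k, 'a, 'm) module_scheme \<Rightarrow> (('a list \<Rightarrow> 'k) \<Rightarrow> ('a list \<Rightarrow> 'k)) \<Rightarrow>
    (nat \<Rightarrow> ('a list \<Rightarrow> 'k) \<Rightarrow> 'a) \<Rightarrow> nat \<Rightarrow> 'a \<Rightarrow> 'a list \<Rightarrow> 'k"
  where "stage_i K V c b n = snd (bracket_stage K V c b n)"

definition stage_proj :: "('k, 'z) ring_scheme \<Rightarrow> ('k, 'a, 'm) module_scheme \<Rightarrow> (('a list \<Rightarrow> 'k) \<Rightarrow> ('a list \<Rightarrow> 'k)) \<Rightarrow>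
    (nat \<Rightarrow> ('a list \<Rightarrow> 'k) \<Rightarrow> 'a) \<Rightarrow> nat \<Rightarrow> ('a list \<Rightarrow> 'k) \<Rightarrow> 'a list \<Rightarrow> 'k"
  where "stage_proj K V c b n = next_proj K (stage_U K V c b n) (stage_i K V c b n) (b n)"

abbreviation stage_P :: "('k, 'z) ring_scheme \<Rightarrow> ('k, 'a, 'm) module_scheme \<Rightarrow> (('a list \<Rightarrow> 'k) \<Rightarrow> ('a list \<Rightarrow> 'k)) \<Rightarrow>
    (nat \<Rightarrow> ('a list \<Rightarrow> 'k) \<Rightarrow> 'a) \<Rightarrow> nat \<Rightarrow> ('k, 'a list \<Rightarrow> 'k) module"
  where "stage_P K V c b n \<equiv> prim_mod K (stage_U K V c b n)"

text \<open>
  The last conjunct states \<open>c (ib \<otimes> V\<^sup>[\<^sup>n\<^sup>]) = (V\<^sup>[\<^sup>n\<^sup>] \<otimes> ib) c\<close> on \<open>P\<^sup>[\<^sup>n\<^sup>] \<otimes> V\<^sup>[\<^sup>n\<^sup>]\<close> and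
  \<open>c (V\<^sup>[\<^sup>n\<^sup>] \<otimes> ib) = (ib \<otimes> V\<^sup>[\<^sup>n\<^sup>]) c\<close> on \<open>V\<^sup>[\<^sup>n\<^sup>] \<otimes> P\<^sup>[\<^sup>n\<^sup>]\<close>, these being subspaces of \<open>U\<^sup>[\<^sup>n\<^sup>] \<otimes> U\<^sup>[\<^sup>n\<^sup>]\<close>.
\<close>

definition bracket :: "('k, 'z) ring_scheme \<Rightarrow> ('k, 'a, 'm) module_scheme \<Rightarrow> (('a list \<Rightarrow> 'k) \<Rightarrow> ('a list \<Rightarrow> 'k)) \<Rightarrow>
    (nat \<Rightarrow> ('a list \<Rightarrow> 'k) \<Rightarrow> 'a) \<Rightarrow> bool"
  where "bracket K V c b \<longleftrightarrow> braided_vs K V c \<and> (\<forall>n.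
    let U = stage_U K V c b n; i = stage_i K V c b n; cU = braiding U;
        X = \<iota> K U ` prims K U; Y = \<iota> K U ` i ` carrier V; ib = deg1 K U U (i \<circ> b n)
    in braided_bialgebra K U \<and>
       braided_mor K V c (prim_mod K U) (prim_braiding K U) i \<and>
       lin K (prim_mod K U) V (b n) \<and>
       (\<forall>t\<in>tsub K U X Y. cU (tmap K U U X Y ib id t) = tmap K U U Y X id ib (cU t)) \<and>
       (\<forall>t\<in>tsub K U Y X. cU (tmap K U U Y X id ib t) = tmap K U U X Y ib id (cU t)))"


section \<open>The universal enveloping algebra\<close>

text \<open>
  The direct limit of a sequence \<open>U 0 \<rightarrow> U 1 \<rightarrow> \<dots>\<close> of braided bialgebras with transition maps
  \<open>p n : U n \<rightarrow> U (n + 1)\<close>: elements are classes of pairs \<open>(n, x)\<close> with \<open>x\<close> in \<open>U n\<close>, two pairs being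
  identified if they have the same image at some later stage.
\<close>

primrec trans_map :: "(nat \<Rightarrow> 'u \<Rightarrow> 'u) \<Rightarrow> nat \<Rightarrow> nat \<Rightarrow> 'u \<Rightarrow> 'u"
  where
    "trans_map p n 0 = id"
  | "trans_map p n (Suc k) = p (n + k) \<circ> trans_map p n k"

definition dlim_in :: "(nat \<Rightarrow> ('k, 'u) bialg) \<Rightarrow> (nat \<Rightarrow> 'u \<Rightarrow> 'u) \<Rightarrow> nat \<Rightarrow> 'u \<Rightarrow> (nat \<times> 'u) set"
  where "dlim_in U p n x =
    {(m, y). y \<in> carrier (U m) \<and> (\<exists>k l. n + k = m + l \<and> trans_map p n k x = trans_map p m l y)}"

definition dlim_alg :: "(nat \<Rightarrow> ('k, 'u) bialg) \<Rightarrow> (nat \<Rightarrow> 'u \<Rightarrow> 'u) \<Rightarrow> ('k, (nat \<times> 'u) set) module"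
  where "dlim_alg U p = (let j = dlim_in U p in \<lparr>
    carrier = (\<Union>n. j n ` carrier (U n)),
    monoid.mult = (\<lambda>X Y. SOME Z. \<exists>n. \<exists>x\<in>carrier (U n). \<exists>y\<in>carrier (U n). X = j n x \<and> Y = j n y \<and> Z = j n (x \<otimes>\<^bsub>U n\<^esub> y)),
    one = j 0 \<one>\<^bsub>U 0\<^esub>,
    ring.zero = j 0 \<zero>\<^bsub>U 0\<^esub>,
    ring.add = (\<lambda>X Y. SOME Z. \<exists>n. \<exists>x\<in>carrier (U n). \<exists>y\<in>carrier (U n). X = j n x \<and> Y = j n y \<and> Z = j n (x \<oplus>\<^bsub>U n\<^esub> y)),
    smult = (\<lambda>a X. SOME Z. \<exists>n. \<exists>x\<in>carrier (U n). X = j n x \<and> Z = j n (a \<odot>\<^bsub>U n\<^esub> x))\<rparr>)"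

definition dlim_bialg :: "('k, 'z) ring_scheme \<Rightarrow> (nat \<Rightarrow> ('k, 'u) bialg) \<Rightarrow> (nat \<Rightarrow> 'u \<Rightarrow> 'u) \<Rightarrow> ('k, (nat \<times> 'u) set) bialg"
  where "dlim_bialg K U p = (let j = dlim_in U p; L = dlim_alg U p; jj = (\<lambda>n. tsquare K (U n) L (j n)) in
    module.extend L (bialg.fields
      (\<lambda>X. SOME t. \<exists>n. \<exists>x\<in>carrier (U n). X = j n x \<and> t = jj n (comult (U n) x))
      (\<lambda>X. SOME a. \<exists>n. \<exists>x\<in>carrier (U n). X = j n x \<and> a = counit (U n) x)
      (\<lambda>t. SOME t'. \<exists>n. \<exists>s\<in>tpow K (U n) 2. t = jj n s \<and> t' = jj n (braiding (U n) s))))"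

definition UEA :: "('k, 'z) ring_scheme \<Rightarrow> ('k, 'a, 'm) module_scheme \<Rightarrow> (('a list \<Rightarrow> 'k) \<Rightarrow> ('a list \<Rightarrow> 'k)) \<Rightarrow>
    (nat \<Rightarrow> ('a list \<Rightarrow> 'k) \<Rightarrow> 'a) \<Rightarrow> ('k, (nat \<times> ('a list \<Rightarrow> 'k)) set) bialg"
  where "UEA K V c b = dlim_bialg K (stage_U K V c b) (stage_proj K V c b)"

definition UEA_in :: "('k, 'z) ring_scheme \<Rightarrow> ('k, 'a, 'm) module_scheme \<Rightarrow> (('a list \<Rightarrow> 'k) \<Rightarrow> ('a list \<Rightarrow> 'k)) \<Rightarrow>
    (nat \<Rightarrow> ('a list \<Rightarrow> 'k) \<Rightarrow> 'a) \<Rightarrow> 'a \<Rightarrow> (nat \<times> ('a list \<Rightarrow> 'k)) set"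
  where "UEA_in K V c b = dlim_in (stage_U K V c b) (stage_proj K V c b) 0 \<circ> stage_i K V c b 0"

definition braided_lie_algebra :: "('k, 'z) ring_scheme \<Rightarrow> ('k, 'a, 'm) module_scheme \<Rightarrow> (('a list \<Rightarrow> 'k) \<Rightarrow> ('a list \<Rightarrow> 'k)) \<Rightarrow>
    (nat \<Rightarrow> ('a list \<Rightarrow> 'k) \<Rightarrow> 'a) \<Rightarrow> bool"
  where "braided_lie_algebra K V c b \<longleftrightarrow> bracket K V c b \<and>
    UEA_in K V c b \<in> carrier V \<rightarrow> carrier (UEA K V c b) \<and> inj_on (UEA_in K V c b) (carrier V)"


section \<open>The canonical bracket and functoriality\<close>

text \<open>The triple \<open>(U\<^sub>A\<^sup>[\<^sup>n\<^sup>], i\<^sub>A\<^sup>[\<^sup>n\<^sup>], \<phi>\<^sup>[\<^sup>n\<^sup>])\<close>; only the restriction of \<open>\<phi>\<^sup>[\<^sup>n\<^sup>]\<close> to primitive elements enters the next stage.\<close>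

primrec canonical_stage :: "('k, 'z) ring_scheme \<Rightarrow> ('k, 'a, 'm) module_scheme \<Rightarrow> (('a list \<Rightarrow> 'k) \<Rightarrow> ('a list \<Rightarrow> 'k)) \<Rightarrow>
    nat \<Rightarrow> ('k, 'a list \<Rightarrow> 'k) bialg \<times> ('a \<Rightarrow> 'a list \<Rightarrow> 'k) \<times> (('a list \<Rightarrow> 'k) \<Rightarrow> 'a)"
  where
    "canonical_stage K A c 0 = (tensor_bialg K A c, \<iota> K A,
      SOME f. alg_hom K (tensor_alg K A) A f \<and> (\<forall>x\<in>carrier A. f (\<iota> K A x) = x))"
  | "canonical_stage K A c (Suc n) = (let (U, i, \<phi>) = canonical_stage K A c n in
      (next_U K U i \<phi>, next_proj K U i \<phi> \<circ> i, induced (carrier U) (next_proj K U i \<phi>) \<phi>))"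

definition canonical_bracket :: "('k, 'z) ring_scheme \<Rightarrow> ('k, 'a, 'm) module_scheme \<Rightarrow> (('a list \<Rightarrow> 'k) \<Rightarrow> ('a list \<Rightarrow> 'k)) \<Rightarrow>
    nat \<Rightarrow> ('a list \<Rightarrow> 'k) \<Rightarrow> 'a"
  where "canonical_bracket K A c n = (let (U, i, \<phi>) = canonical_stage K A c n in restrict \<phi> (prims K U))"

text \<open>
  \<open>U_map K V cV bV W cW bW h n\<close> is \<open>U\<^sub>h\<^sup>[\<^sup>n\<^sup>] : U\<^sub>V\<^sup>[\<^sup>n\<^sup>] \<rightarrow> U\<^sub>W\<^sup>[\<^sup>n\<^sup>]\<close>; it has its intended meaning as soon as
  \<open>h\<close> commutes with the brackets in all degrees below \<open>n\<close>.
\<close>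

primrec U_map :: "('k, 'z) ring_scheme \<Rightarrow>
    ('k, 'a, 'm) module_scheme \<Rightarrow> (('a list \<Rightarrow> 'k) \<Rightarrow> ('a list \<Rightarrow> 'k)) \<Rightarrow> (nat \<Rightarrow> ('a list \<Rightarrow> 'k) \<Rightarrow> 'a) \<Rightarrow>
    ('k, 'b, 'n) module_scheme \<Rightarrow> (('b list \<Rightarrow> 'k) \<Rightarrow> ('b list \<Rightarrow> 'k)) \<Rightarrow> (nat \<Rightarrow> ('b list \<Rightarrow> 'k) \<Rightarrow> 'b) \<Rightarrow>
    ('a \<Rightarrow> 'b) \<Rightarrow> nat \<Rightarrow> ('a list \<Rightarrow> 'k) \<Rightarrow> ('b list \<Rightarrow> 'k)"
  where
    "U_map K V cV bV W cW bW h 0 = (SOME f. bialg_mor K (tensor_bialg K V cV) (tensor_bialg K W cW) f \<and>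
      (\<forall>v\<in>carrier V. f (\<iota> K V v) = \<iota> K W (h v)))"
  | "U_map K V cV bV W cW bW h (Suc n) =
      induced (carrier (stage_U K V cV bV n)) (stage_proj K V cV bV n)
        (stage_proj K W cW bW n \<circ> U_map K V cV bV W cW bW h n)"

definition P_map :: "('k, 'z) ring_scheme \<Rightarrow>
    ('k, 'a, 'm) module_scheme \<Rightarrow> (('a list \<Rightarrow> 'k) \<Rightarrow> ('a list \<Rightarrow> 'k)) \<Rightarrow> (nat \<Rightarrow> ('a list \<Rightarrow> 'k) \<Rightarrow> 'a) \<Rightarrow>
    ('k, 'b, 'n) module_scheme \<Rightarrow> (('b list \<Rightarrow> 'k) \<Rightarrow> ('b list \<Rightarrow> 'k)) \<Rightarrow> (nat \<Rightarrow> ('b list \<Rightarrow> 'k) \<Rightarrow> 'b) \<Rightarrow>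
    ('a \<Rightarrow> 'b) \<Rightarrow> nat \<Rightarrow> ('a list \<Rightarrow> 'k) \<Rightarrow> ('b list \<Rightarrow> 'k)"
  where "P_map K V cV bV W cW bW h n = restrict (U_map K V cV bV W cW bW h n) (prims K (stage_U K V cV bV n))"

text \<open>
  \<open>\<beta>\<close> is a linear map \<open>P\<^sub>V\<^sup>[\<^sup>n\<^sup>] \<rightarrow> V\<close> with \<open>h \<beta> = b\<^sub>W\<^sup>[\<^sup>n\<^sup>] P\<^sub>h\<^sup>[\<^sup>n\<^sup>]\<close>; extensionality makes
  uniqueness of \<open>\<beta>\<close> an equality of functions.
\<close>

definition lifts_bracket :: "('k, 'z) ring_scheme \<Rightarrow>
    ('k, 'a, 'm) module_scheme \<Rightarrow> (('a list \<Rightarrow> 'k) \<Rightarrow> ('a list \<Rightarrow> 'k)) \<Rightarrow> (nat \<Rightarrow> ('a list \<Rightarrow> 'k) \<Rightarrow> 'a) \<Rightarrow>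
    ('k, 'b, 'n) module_scheme \<Rightarrow> (('b list \<Rightarrow> 'k) \<Rightarrow> ('b list \<Rightarrow> 'k)) \<Rightarrow> (nat \<Rightarrow> ('b list \<Rightarrow> 'k) \<Rightarrow> 'b) \<Rightarrow>
    ('a \<Rightarrow> 'b) \<Rightarrow> nat \<Rightarrow> (('a list \<Rightarrow> 'k) \<Rightarrow> 'a) \<Rightarrow> bool"
  where "lifts_bracket K V cV bV W cW bW h n \<beta> \<longleftrightarrow>
    \<beta> \<in> extensional (carrier (stage_P K V cV bV n)) \<and>
    lin K (stage_P K V cV bV n) V \<beta> \<and>
    P_map K V cV bV W cW bW h n \<in> carrier (stage_P K V cV bV n) \<rightarrow> carrier (stage_P K W cW bW n) \<and>
    (\<forall>x\<in>carrier (stage_P K V cV bV n). h (\<beta> x) = bW n (P_map K V cV bV W cW bW h n x))"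

end

theory Submission
 imports Defs
begin

text \<open>
 All tensors live in a tensor algebra, so that an identity between maps built from the structure maps is
 an identity between words in operators "apply \<open>f\<close> at position \<open>i\<close>"; such an identity lifts to all positions.

 Let \<open>V \<subseteq> A\<close> be \<open>A\<close> itself or \<open>P(A)\<close>, and let \<open>\<psi> : U \<rightarrow> A\<close> be the algebra map from the current stage with \<open>\<psi> i = id\<close>
 on \<open>V\<close>. Primitive elements of \<open>U\<close> are sent into \<open>V\<close>, for \<open>V = P(A)\<close> because \<open>\<psi>\<close> is then a map of braided
 bialgebras; so \<open>\<psi>\<close> itself restricts to the bracket. As \<open>\<psi> \<otimes> \<psi>\<close> is injective on \<open>i(V) \<otimes> i(V)\<close> and compatible with
 the braidings, \<open>i b\<close> commutes with the braiding on \<open>P(U) \<otimes> i(V)\<close>, hence on \<open>P(U) \<otimes> U\<close> because \<open>i(V)\<close> generates \<open>U\<close>.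
 Therefore the ideal generated by the elements \<open>x - i b x\<close> is compatible with the braiding, the quotient is again a
 braided bialgebra, and \<open>\<psi>\<close> descends to it. Since \<open>\<psi> i = id\<close> at every stage, \<open>V\<close> embeds into the direct limit.
\<close>

text \<open>Two obstacles shape the proof. First, many steps concern subspaces of tensor products: c
  maps P \<otimes> B into B \<otimes> P, a tensor dies in B/J \<otimes> B/J, a tensor lies in i(V)
  \<otimes> i(V). Membership in such a span combines badly with operators. Over a field every
  subspace is the image of a linear projection, so each statement is replaced by an equation: w lies
  in B \<otimes> P when the projection onto P, applied at the second position, fixes w; w lies in B
  \<otimes> J when a linear map with kernel J, applied there, kills w. Such equations move through
  words in operators just as the axioms do. Second, several objects are specified only by
  \<open>SOME\<close> or by an arbitrary preimage: the braiding, comultiplication and counit of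
  T(V,c), the structure maps of quotients, the maps \<open>U_map\<close>. Each needs an existence or
  well-definedness proof before its specification can be used. The hardest is the braiding of
  T(V,c): it is built from V \<otimes> V in two passes, each an action of the free algebra T(V), and
  the braid relation is then verified one tensor factor at a time.\<close>

abbreviation (input) amult ("_ \<cdot>[_] _" [70, 0, 71] 70) where "x \<cdot>[R] y \<equiv> x \<otimes>\<^bsub>R\<^esub> y"
abbreviation (input) aplus ("_ +[_] _" [65, 0, 66] 65) where "x +[M] y \<equiv> x \<oplus>\<^bsub>M\<^esub> y"
abbreviation (input) ascale ("_ *:[_] _" [70, 0, 71] 70) where "a *:[M] x \<equiv> a \<odot>\<^bsub>M\<^esub> x"

locale fld = fixes K :: "('k, 'z) ring_scheme" assumes field_K: "field K"

sublocale fld \<subseteq> field K by (rule field_K)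

context fld
begin

section \<open>Modules, algebras, linear maps\<close>

lemma mod_abg: "module K M ==> abelian_group M"
 by (simp add: module_def)

lemma mod_abm: "module K M ==> abelian_monoid M"
 using abelian_group.axioms(1) mod_abg by blast

lemma add_cl [simp]: "module K M ==> x \<in> carrier M ==> y \<in> carrier M ==> x +[M] y \<in> carrier M"
 by (simp add: abelian_monoid.a_closed mod_abm)

lemma zero_cl [simp]: "module K M ==> \<zero>\<^bsub>M\<^esub> \<in> carrier M"
 by (simp add: abelian_monoid.zero_closed mod_abm)

lemma neg_cl [simp]: "module K M ==> x \<in> carrier M ==> \<ominus>\<^bsub>M\<^esub> x \<in> carrier M"
 by (simp add: abelian_group.a_inv_closed mod_abg)

lemma minus_cl [simp]: "module K M ==> x \<in> carrier M ==> y \<in> carrier M ==> x \<ominus>\<^bsub>M\<^esub> y \<in> carrier M"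
 by (simp add: a_minus_def)

lemma smult_cl [simp]: "module K M ==> a \<in> carrier K ==> x \<in> carrier M ==> a *:[M] x \<in> carrier M"
 by (rule module.smult_closed)

lemma add_zero [simp]: "module K M ==> x \<in> carrier M ==> x +[M] \<zero>\<^bsub>M\<^esub> = x"
 "module K M ==> x \<in> carrier M ==> \<zero>\<^bsub>M\<^esub> +[M] x = x"
 by (simp_all add: abelian_monoid.l_zero abelian_monoid.r_zero mod_abm)

lemma add_assoc: "module K M ==> x \<in> carrier M ==> y \<in> carrier M ==> z \<in> carrier M ==>
 (x +[M] y) +[M] z = x +[M] (y +[M] z)"
 by (simp add: abelian_monoid.a_assoc mod_abm)

lemma add_comm: "module K M ==> x \<in> carrier M ==> y \<in> carrier M ==> x +[M] y = y +[M] x"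
 by (simp add: abelian_monoid.a_comm mod_abm)

lemma add_lcomm: "module K M ==> x \<in> carrier M ==> y \<in> carrier M ==> z \<in> carrier M ==>
 x +[M] (y +[M] z) = y +[M] (x +[M] z)"
 by (simp add: abelian_monoid.a_lcomm mod_abm)

lemmas add_ac = add_assoc add_comm add_lcomm

lemma add_neg [simp]: "module K M ==> x \<in> carrier M ==> x +[M] \<ominus>\<^bsub>M\<^esub> x = \<zero>\<^bsub>M\<^esub>"
 "module K M ==> x \<in> carrier M ==> \<ominus>\<^bsub>M\<^esub> x +[M] x = \<zero>\<^bsub>M\<^esub>"
 by (simp_all add: abelian_group.r_neg abelian_group.l_neg mod_abg)

lemma neg_eq_smult: "module K M ==> x \<in> carrier M ==> \<ominus>\<^bsub>M\<^esub> x = (\<ominus>\<^bsub>K\<^esub> \<one>\<^bsub>K\<^esub>) *:[M] x"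
 by (simp add: module.smult_l_minus module.smult_one)

lemma minus_self [simp]: "module K M ==> x \<in> carrier M ==> x \<ominus>\<^bsub>M\<^esub> x = \<zero>\<^bsub>M\<^esub>"
 by (simp add: a_minus_def)

lemma minus_eq_zero_iff: "module K M ==> x \<in> carrier M ==> y \<in> carrier M ==>
 (x \<ominus>\<^bsub>M\<^esub> y = \<zero>\<^bsub>M\<^esub>) = (x = y)"
 by (metis a_minus_def add_assoc add_neg(2) add_zero(2) minus_self neg_cl add_zero(1))

lemma minus_add_cancel: "module K M ==> x \<in> carrier M ==> y \<in> carrier M ==>
 (x \<ominus>\<^bsub>M\<^esub> y) +[M] y = x"
 by (simp add: a_minus_def add_assoc)

lemma smult_add: "module K M ==> a \<in> carrier K ==> x \<in> carrier M ==> y \<in> carrier M ==>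
 a *:[M] (x +[M] y) = a *:[M] x +[M] a *:[M] y"
 by (rule module.smult_r_distr)

lemma add_smult: "module K M ==> a \<in> carrier K ==> b \<in> carrier K ==> x \<in> carrier M ==>
 (a +[K] b) *:[M] x = a *:[M] x +[M] b *:[M] x"
 by (rule module.smult_l_distr)

lemma smult_smult: "module K M ==> a \<in> carrier K ==> b \<in> carrier K ==> x \<in> carrier M ==>
 a *:[M] (b *:[M] x) = (a \<cdot>[K] b) *:[M] x"
 by (rule module.smult_assoc1 [symmetric])

lemma smult_one [simp]: "module K M ==> x \<in> carrier M ==> \<one>\<^bsub>K\<^esub> *:[M] x = x"
 by (rule module.smult_one)

lemma smult_zero [simp]: "module K M ==> a \<in> carrier K ==> a *:[M] \<zero>\<^bsub>M\<^esub> = \<zero>\<^bsub>M\<^esub>"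
 by (rule module.smult_r_null)

lemma zero_smult [simp]: "module K M ==> x \<in> carrier M ==> \<zero>\<^bsub>K\<^esub> *:[M] x = \<zero>\<^bsub>M\<^esub>"
 by (rule module.smult_l_null)

lemma alg_mod [simp]: "assoc_algebra K A ==> module K A"
 by (simp add: assoc_algebra_def)

lemma alg_ring: "assoc_algebra K A ==> ring A"
 by (simp add: assoc_algebra_def)

lemma mult_cl [simp]: "assoc_algebra K A ==> x \<in> carrier A ==> y \<in> carrier A ==> x \<cdot>[A] y \<in> carrier A"
 by (meson alg_ring monoid.m_closed ring.is_monoid)

lemma one_cl [simp]: "assoc_algebra K A ==> \<one>\<^bsub>A\<^esub> \<in> carrier A"
 by (meson alg_ring monoid.one_closed ring.is_monoid)

lemma mult_assoc: "assoc_algebra K A ==> x \<in> carrier A ==> y \<in> carrier A ==> z \<in> carrier A ==>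
 (x \<cdot>[A] y) \<cdot>[A] z = x \<cdot>[A] (y \<cdot>[A] z)"
 by (meson alg_ring monoid.m_assoc ring.is_monoid)

lemma mult_one [simp]: "assoc_algebra K A ==> x \<in> carrier A ==> \<one>\<^bsub>A\<^esub> \<cdot>[A] x = x"
 "assoc_algebra K A ==> x \<in> carrier A ==> x \<cdot>[A] \<one>\<^bsub>A\<^esub> = x"
 by (meson alg_ring monoid.l_one monoid.r_one ring.is_monoid)+

lemma mult_add: "assoc_algebra K A ==> x \<in> carrier A ==> y \<in> carrier A ==> z \<in> carrier A ==>
 z \<cdot>[A] (x +[A] y) = z \<cdot>[A] x +[A] z \<cdot>[A] y"
 by (simp add: alg_ring ring.ring_simprules)

lemma add_mult: "assoc_algebra K A ==> x \<in> carrier A ==> y \<in> carrier A ==> z \<in> carrier A ==>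
 (x +[A] y) \<cdot>[A] z = x \<cdot>[A] z +[A] y \<cdot>[A] z"
 by (simp add: alg_ring ring.ring_simprules)

lemma mult_zero [simp]: "assoc_algebra K A ==> x \<in> carrier A ==> x \<cdot>[A] \<zero>\<^bsub>A\<^esub> = \<zero>\<^bsub>A\<^esub>"
 "assoc_algebra K A ==> x \<in> carrier A ==> \<zero>\<^bsub>A\<^esub> \<cdot>[A] x = \<zero>\<^bsub>A\<^esub>"
 using ring.ring_simprules(24,25) alg_ring by fastforce+

lemma mult_smult: "assoc_algebra K A ==> a \<in> carrier K ==> x \<in> carrier A ==> y \<in> carrier A ==>
 (a *:[A] x) \<cdot>[A] y = a *:[A] (x \<cdot>[A] y)"
 "assoc_algebra K A ==> a \<in> carrier K ==> x \<in> carrier A ==> y \<in> carrier A ==>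
 x \<cdot>[A] (a *:[A] y) = a *:[A] (x \<cdot>[A] y)"
 by (auto simp add: assoc_algebra_def)

lemma neg_mult: "assoc_algebra K A ==> x \<in> carrier A ==> y \<in> carrier A ==>
 (\<ominus>\<^bsub>A\<^esub> x) \<cdot>[A] y = \<ominus>\<^bsub>A\<^esub> (x \<cdot>[A] y)"
 "assoc_algebra K A ==> x \<in> carrier A ==> y \<in> carrier A ==>
 x \<cdot>[A] (\<ominus>\<^bsub>A\<^esub> y) = \<ominus>\<^bsub>A\<^esub> (x \<cdot>[A] y)"
 by (simp_all add: alg_ring ring.l_minus ring.r_minus)

lemma linI: "(\<And>x. x \<in> carrier M ==> f x \<in> carrier N) ==>
 (\<And>x y. x \<in> carrier M ==> y \<in> carrier M ==> f (x +[M] y) = f x +[N] f y) ==>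
 (\<And>a x. a \<in> carrier K ==> x \<in> carrier M ==> f (a *:[M] x) = a *:[N] f x) ==> lin K M N f"
 by (auto simp add: lin_def)

lemma lin_cl: "lin K M N f ==> x \<in> carrier M ==> f x \<in> carrier N"
 by (auto simp add: lin_def)

lemma lin_add: "lin K M N f ==> x \<in> carrier M ==> y \<in> carrier M ==> f (x +[M] y) = f x +[N] f y"
 by (auto simp add: lin_def)

lemma lin_smult: "lin K M N f ==> a \<in> carrier K ==> x \<in> carrier M ==> f (a *:[M] x) = a *:[N] f x"
 by (auto simp add: lin_def)

lemma lin_zero: "lin K M N f ==> module K M ==> module K N ==> f \<zero>\<^bsub>M\<^esub> = \<zero>\<^bsub>N\<^esub>"
 using lin_smult[of M N f "\<zero>\<^bsub>K\<^esub>" "\<zero>\<^bsub>M\<^esub>"] by (simp add: lin_cl)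

lemma lin_neg: "lin K M N f ==> module K M ==> module K N ==> x \<in> carrier M ==> f (\<ominus>\<^bsub>M\<^esub> x) = \<ominus>\<^bsub>N\<^esub> f x"
 by (simp add: neg_eq_smult lin_smult lin_cl)

lemma lin_minus: "lin K M N f ==> module K M ==> module K N ==> x \<in> carrier M ==> y \<in> carrier M ==>
 f (x \<ominus>\<^bsub>M\<^esub> y) = f x \<ominus>\<^bsub>N\<^esub> f y"
 by (simp add: a_minus_def lin_add lin_neg)

lemma lin_comp: "lin K M N f ==> lin K N L g ==> lin K M L (g \<circ> f)"
 by (rule linI) (auto simp add: lin_cl lin_add lin_smult)

lemma lin_comp': "lin K M N f ==> lin K N L g ==> lin K M L (%x. g (f x))"
 by (rule linI) (auto simp add: lin_cl lin_add lin_smult)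

lemma lin_id [simp]: "lin K M M id" "lin K M M (%x. x)"
 by (auto simp add: lin_def)

lemma lin_const_zero: "module K N ==> lin K M N (%x. \<zero>\<^bsub>N\<^esub>)"
 by (auto intro: linI)

lemma lin_sum: "module K N ==> lin K M N f ==> lin K M N g ==> lin K M N (%x. f x +[N] g x)"
 by (rule linI) (auto simp add: lin_cl lin_add lin_smult smult_add add_ac)

lemma lin_scale: "module K N ==> a \<in> carrier K ==> lin K M N f ==> lin K M N (%x. a *:[N] f x)"
 by (rule linI) (auto simp add: lin_cl lin_add lin_smult smult_add smult_smult m_comm)

lemma lin_diff: "module K N ==> lin K M N f ==> lin K M N g ==> lin K M N (%x. f x \<ominus>\<^bsub>N\<^esub> g x)"
 unfolding a_minus_def
 by (rule lin_sum, assumption, assumption, rule linI)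
  (auto simp add: lin_cl lin_add lin_smult smult_add neg_eq_smult smult_smult m_comm)

lemma lin_mult_left: "assoc_algebra K A ==> x \<in> carrier A ==> lin K M A f ==> lin K M A (%y. x \<cdot>[A] f y)"
 by (rule linI) (auto simp add: lin_cl lin_add lin_smult mult_add mult_smult)

lemma lin_mult_right: "assoc_algebra K A ==> x \<in> carrier A ==> lin K M A f ==> lin K M A (%y. f y \<cdot>[A] x)"
 by (rule linI) (auto simp add: lin_cl lin_add lin_smult add_mult mult_smult)

lemma lin_sub: "lin K M N f ==> H \<subseteq> carrier M ==> lin K (M\<lparr>carrier := H\<rparr>) N f"
 by (rule linI) (auto simp add: lin_cl lin_add lin_smult subset_iff)

lemma lin_subD: "lin K M (N\<lparr>carrier := H\<rparr>) f ==> H \<subseteq> carrier N ==> lin K M N f"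
 by (auto simp add: lin_def)

lemma lin_subI: "lin K M N f ==> (\<And>x. x \<in> carrier M ==> f x \<in> H) ==> lin K M (N\<lparr>carrier := H\<rparr>) f"
 by (auto simp add: lin_def)

lemma lin_cong: "(\<And>x. x \<in> carrier M ==> f x = g x) ==> module K M ==> lin K M N f = lin K M N g"
 by (auto simp add: lin_def Pi_def)

lemma subm_subset: "submodule H K M ==> H \<subseteq> carrier M"
 using submodule.axioms(1) subgroup.subset by fastforce

lemma subm_mod: "module K M ==> submodule H K M ==> module K (M\<lparr>carrier := H\<rparr>)"
 by (rule submodule.submodule_is_module)

lemma submI:
 assumes "module K M" "H \<subseteq> carrier M" "\<zero>\<^bsub>M\<^esub> \<in> H"
  "\<And>x y. x \<in> H ==> y \<in> H ==> x +[M] y \<in> H" "\<And>a x. a \<in> carrier K ==> x \<in> H ==> a *:[M] x \<in> H"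
 shows "submodule H K M"
 by (rule module.submoduleI) (use assms in \<open>auto simp add: neg_eq_smult subset_iff\<close>)

lemma subm_zero: "module K M ==> submodule H K M ==> \<zero>\<^bsub>M\<^esub> \<in> H"
 using submodule.axioms(1) subgroup.one_closed by fastforce

lemma subm_add: "module K M ==> submodule H K M ==> x \<in> H ==> y \<in> H ==> x +[M] y \<in> H"
 by (simp add: module.submoduleE(5))

lemma subm_smult: "module K M ==> submodule H K M ==> a \<in> carrier K ==> x \<in> H ==> a *:[M] x \<in> H"
 by (simp add: module.submoduleE(4))

lemma subm_neg: "module K M ==> submodule H K M ==> x \<in> H ==> \<ominus>\<^bsub>M\<^esub> x \<in> H"
 by (simp add: module.submoduleE(3))

lemma lspan_incl: "S \<subseteq> lspan K M S"
 by (auto simp add: lspan_def)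

lemma lspan_min: "submodule H K M ==> S \<subseteq> H ==> lspan K M S \<subseteq> H"
 by (auto simp add: lspan_def)

lemma lspan_subset: "module K M ==> S \<subseteq> carrier M ==> lspan K M S \<subseteq> carrier M"
 by (simp add: lspan_min module.carrier_is_submodule)

lemma lspan_subm: "module K M ==> S \<subseteq> carrier M ==> submodule (lspan K M S) K M"
 by (rule submI, assumption, rule lspan_subset)
  (auto simp add: lspan_def subm_add subm_zero subm_smult)

lemma lspan_mono: "S \<subseteq> S' ==> lspan K M S \<subseteq> lspan K M S'"
 by (auto simp add: lspan_def)

lemma lspan_induct [consumes 3, case_names base zero add smult]:
 assumes "x \<in> lspan K M S" "module K M" "S \<subseteq> carrier M"
  and "\<And>x. x \<in> S ==> Q x" "Q \<zero>\<^bsub>M\<^esub>"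
  and "\<And>x y. x \<in> lspan K M S ==> y \<in> lspan K M S ==> x \<in> carrier M ==> y \<in> carrier M ==> Q x ==> Q y ==> Q (x +[M] y)"
  and "\<And>a x. a \<in> carrier K ==> x \<in> lspan K M S ==> x \<in> carrier M ==> Q x ==> Q (a *:[M] x)"
 shows "Q x"
proof -
 note s = lspan_subm[OF assms(2,3)]
 have "submodule {x \<in> lspan K M S. Q x} K M"
  by (intro submI) (auto intro!: assms(2,5-7) subm_zero[OF _ s] subm_add[OF _ s] subm_smult[OF _ s]
    dest: subsetD[OF subm_subset[OF s]])
 then have "lspan K M S \<subseteq> {x \<in> lspan K M S. Q x}"
  by (rule lspan_min) (use assms(4) lspan_incl[of S M] in auto)
 then show ?thesis using assms(1) by auto
qed

lemma lin_eq_lspan: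
 assumes x: "x \<in> lspan K M S" and M: "module K M" "S \<subseteq> carrier M" "module K N"
  and f: "lin K (M\<lparr>carrier := lspan K M S\<rparr>) N f" and g: "lin K (M\<lparr>carrier := lspan K M S\<rparr>) N g"
  and eq: "\<And>s. s \<in> S ==> f s = g s"
 shows "f x = g x"
 using x M(1,2)
proof (induction rule: lspan_induct)
 case zero
 show ?case using lin_zero[OF f] lin_zero[OF g] M subm_mod[OF M(1) lspan_subm[OF M(1,2)]] by simp
next
 case (add x y)
 then show ?case using lin_add[OF f] lin_add[OF g] by simp
next
 case (smult a x)
 then show ?case using lin_smult[OF f] lin_smult[OF g] by simp
qed (rule eq)

lemma lin_image_lspan:
 assumes x: "x \<in> lspan K M S" and M: "module K M" "S \<subseteq> carrier M" "module K N"
  and f: "lin K M N f" and H: "submodule H K N" and eq: "\<And>s. s \<in> S ==> f s \<in> H"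
 shows "f x \<in> H"
 using x M(1,2)
proof (induction rule: lspan_induct)
 case zero
 show ?case using lin_zero[OF f] M subm_zero[OF _ H] by simp
next
 case (add x y)
 then show ?case using lin_add[OF f] subm_add[OF _ H] M by simp
next
 case (smult a x)
 then show ?case using lin_smult[OF f] subm_smult[OF _ H] M by simp
qed (rule eq)

lemma module_ground [simp]: "module K (ground K)"
 apply (rule moduleI)
 subgoal by (rule is_cring)
 subgoal by (rule abelian_groupI) (auto simp add: ground_def a_ac intro: exI[of _ "\<ominus>\<^bsub>K\<^esub> _"] l_neg)
 by (auto simp add: ground_def l_distr r_distr m_assoc)

lemma alg_ground [simp]: "assoc_algebra K (ground K)"
proof -
 have "ring (ground K)"
  apply (rule ringI)
  using module_ground apply (simp add: module_def)
   apply (rule monoidI)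
     apply (auto simp add: ground_def m_assoc l_distr r_distr)
  done
 then show ?thesis
  by (auto simp add: assoc_algebra_def) (auto simp add: ground_def m_ac)
qed

end

context fld
begin

section \<open>Quotients by two-sided ideals\<close>

lemma assoc_algebraI: "module K A ==> ring A ==>
 (\<And>a x y. a \<in> carrier K ==> x \<in> carrier A ==> y \<in> carrier A ==> (a *:[A] x) \<cdot>[A] y = a *:[A] (x \<cdot>[A] y)) ==>
 (\<And>a x y. a \<in> carrier K ==> x \<in> carrier A ==> y \<in> carrier A ==> x \<cdot>[A] (a *:[A] y) = a *:[A] (x \<cdot>[A] y)) ==>
 assoc_algebra K A"
 unfolding assoc_algebra_def by blast

lemma ideal_carrier: "ideal I A ==> I \<subseteq> carrier A"
 by (meson ideal.Icarr subsetI)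

lemma ideal_smult:
 assumes "assoc_algebra K A" "ideal I A" "a \<in> carrier K" "x \<in> I"
 shows "a *:[A] x \<in> I"
proof -
 have x: "x \<in> carrier A" using assms ideal.Icarr by fast
 have "a *:[A] x = (a *:[A] \<one>\<^bsub>A\<^esub>) \<cdot>[A] x" using assms x by (simp add: mult_smult)
 also have "\<dots> \<in> I" using assms by (simp add: ideal.I_l_closed)
 finally show ?thesis .
qed

lemma ideal_subm: "assoc_algebra K A ==> ideal I A ==> submodule I K A"
 by (rule submI) (auto simp: ideal_carrier ideal_smult additive_subgroup.zero_closed
   additive_subgroup.a_closed ideal.axioms(1) dest: ideal.Icarr)

context
 fixes A :: "('k, 'a, 'm) module_scheme" and I
 assumes A: "assoc_algebra K A" and I: "ideal I A"
begin

lemma coset_mem: "x \<in> carrier A ==> y \<in> I +>\<^bsub>A\<^esub> x \<longleftrightarrow> (\<exists>i\<in>I. y = i +[A] x)"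
 by (auto simp add: a_r_coset_def' )

lemma quot_proj_mem: assumes "x \<in> carrier A" shows "\<exists>i\<in>I. quot_proj A I x = i +[A] x"
proof -
 have "\<exists>y. y \<in> I +>\<^bsub>A\<^esub> x"
  using coset_mem[OF assms] additive_subgroup.zero_closed[OF ideal.axioms(1)[OF I]] by blast
 then have "quot_proj A I x \<in> I +>\<^bsub>A\<^esub> x"
  unfolding quot_proj_def by (rule someI_ex)
 then show ?thesis using coset_mem[OF assms] by blast
qed

lemma quot_proj_cl [simp]: "x \<in> carrier A ==> quot_proj A I x \<in> carrier A"
 using quot_proj_mem[of x] ideal_carrier[OF I] A by auto

text \<open>The representative is picked by \<open>SOME\<close> from the coset, so it is enough that
  the two cosets are equal as sets.\<close>

lemma quot_proj_shift: assumes "x \<in> carrier A" "i \<in> I" shows "quot_proj A I (i +[A] x) = quot_proj A I x"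
proof -
 have i: "i \<in> carrier A" using assms ideal_carrier[OF I] by auto
 note s = ideal_subm[OF A I]
 have "I +>\<^bsub>A\<^esub> (i +[A] x) = I +>\<^bsub>A\<^esub> x"
 proof (rule Set.set_eqI)
  fix y
  have 1: "\<exists>k\<in>I. y = k +[A] x" if "j \<in> I" "y = j +[A] (i +[A] x)" for j
   using that assms A i ideal_carrier[OF I] subm_add[OF _ s]
   by (intro bexI[of _ "j +[A] i"]) (auto simp: add_assoc subset_iff)
  have 2: "\<exists>k\<in>I. y = k +[A] (i +[A] x)" if "j \<in> I" "y = j +[A] x" for j
  proof (intro bexI[of _ "j +[A] \<ominus>\<^bsub>A\<^esub> i"])
   have j: "j \<in> carrier A" using that ideal_carrier[OF I] by auto
   have "\<ominus>\<^bsub>A\<^esub> i +[A] (i +[A] x) = x" using A i assms by (simp flip: add_assoc)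
   then show "y = j +[A] \<ominus>\<^bsub>A\<^esub> i +[A] (i +[A] x)" using that A i j assms by (simp add: add_assoc)
   show "j +[A] \<ominus>\<^bsub>A\<^esub> i \<in> I" using that assms subm_add[OF _ s] subm_neg[OF _ s] A by simp
  qed
  show "y \<in> I +>\<^bsub>A\<^esub> (i +[A] x) \<longleftrightarrow> y \<in> I +>\<^bsub>A\<^esub> x"
   using coset_mem[of x] coset_mem[of "i +[A] x"] A i assms 1 2 by auto
 qed
 then show ?thesis unfolding quot_proj_def by simp
qed

lemma quot_proj_eq_iff: assumes "x \<in> carrier A" "y \<in> carrier A"
 shows "quot_proj A I x = quot_proj A I y \<longleftrightarrow> x \<ominus>\<^bsub>A\<^esub> y \<in> I"
proof
 note s = ideal_subm[OF A I]
 assume e: "quot_proj A I x = quot_proj A I y"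
 obtain i j where i: "i \<in> I" "quot_proj A I x = i +[A] x" and j: "j \<in> I" "quot_proj A I y = j +[A] y"
  using quot_proj_mem assms by meson
 have ij: "i \<in> carrier A" "j \<in> carrier A" using i j ideal_carrier[OF I] by auto
 have "\<ominus>\<^bsub>A\<^esub> i +[A] (i +[A] x) = x" using A ij assms by (simp flip: add_assoc)
 then have "x = \<ominus>\<^bsub>A\<^esub> i +[A] (j +[A] y)" using i j e by simp
 then have "x \<ominus>\<^bsub>A\<^esub> y = \<ominus>\<^bsub>A\<^esub> i +[A] j"
  using A ij assms by (simp add: a_minus_def add_assoc)
 then show "x \<ominus>\<^bsub>A\<^esub> y \<in> I" using i j A subm_add[OF _ s] subm_neg[OF _ s] by simp
next
 assume "x \<ominus>\<^bsub>A\<^esub> y \<in> I"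
 from quot_proj_shift[OF assms(2) this] show "quot_proj A I x = quot_proj A I y"
  using A assms by (simp add: minus_add_cancel)
qed

lemma quot_proj_idem [simp]: "x \<in> carrier A ==> quot_proj A I (quot_proj A I x) = quot_proj A I x"
 using quot_proj_mem[of x] quot_proj_shift[of x] by auto

lemma quot_proj_zero_iff: "x \<in> carrier A ==> quot_proj A I x = \<zero>\<^bsub>quot_alg A I\<^esub> \<longleftrightarrow> x \<in> I"
 using A quot_proj_eq_iff[of x "\<zero>\<^bsub>A\<^esub>"] by (simp add: quot_alg_def a_minus_def neg_eq_smult)

lemma quot_proj_add: assumes "x \<in> carrier A" "y \<in> carrier A"
 shows "quot_proj A I (quot_proj A I x +[A] quot_proj A I y) = quot_proj A I (x +[A] y)"
proof -
 obtain i j where i: "i \<in> I" "quot_proj A I x = i +[A] x" and j: "j \<in> I" "quot_proj A I y = j +[A] y"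
  using quot_proj_mem assms by meson
 have ij: "i \<in> carrier A" "j \<in> carrier A" using i j ideal_carrier[OF I] by auto
 have "quot_proj A I x +[A] quot_proj A I y = (i +[A] j) +[A] (x +[A] y)"
  using i j ij assms A by (simp add: add_ac)
 then show ?thesis using quot_proj_shift assms A i j subm_add[OF _ ideal_subm[OF A I]] by simp
qed

lemma quot_proj_smult: assumes "a \<in> carrier K" "x \<in> carrier A"
 shows "quot_proj A I (a *:[A] quot_proj A I x) = quot_proj A I (a *:[A] x)"
proof -
 obtain i where i: "i \<in> I" "quot_proj A I x = i +[A] x"
  using quot_proj_mem assms by meson
 have ij: "i \<in> carrier A" using i ideal_carrier[OF I] by auto
 have "a *:[A] quot_proj A I x = a *:[A] i +[A] a *:[A] x"
  using i ij assms A by (simp add: smult_add)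
 then show ?thesis using quot_proj_shift assms A i ideal_smult[OF A I] by simp
qed

lemma quot_proj_mult: assumes "x \<in> carrier A" "y \<in> carrier A"
 shows "quot_proj A I (quot_proj A I x \<cdot>[A] quot_proj A I y) = quot_proj A I (x \<cdot>[A] y)"
proof -
 obtain i j where i: "i \<in> I" "quot_proj A I x = i +[A] x" and j: "j \<in> I" "quot_proj A I y = j +[A] y"
  using quot_proj_mem assms by meson
 have ij: "i \<in> carrier A" "j \<in> carrier A" using i j ideal_carrier[OF I] by auto
 have "quot_proj A I x \<cdot>[A] quot_proj A I y = (i \<cdot>[A] j +[A] (i \<cdot>[A] y +[A] x \<cdot>[A] j)) +[A] (x \<cdot>[A] y)"
  using i j ij assms A by (simp add: add_mult mult_add add_ac)
 moreover have "i \<cdot>[A] j +[A] (i \<cdot>[A] y +[A] x \<cdot>[A] j) \<in> I"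
  using i j ij assms A subm_add[OF _ ideal_subm[OF A I]] ideal.I_l_closed[OF I] ideal.I_r_closed[OF I] by simp
 ultimately show ?thesis using quot_proj_shift assms A by simp
qed

lemma quot_sel:
 "carrier (quot_alg A I) = quot_proj A I ` carrier A"
 "\<one>\<^bsub>quot_alg A I\<^esub> = quot_proj A I \<one>\<^bsub>A\<^esub>" "\<zero>\<^bsub>quot_alg A I\<^esub> = quot_proj A I \<zero>\<^bsub>A\<^esub>"
 "x \<in> carrier A ==> y \<in> carrier A ==> quot_proj A I x \<cdot>[quot_alg A I] quot_proj A I y = quot_proj A I (x \<cdot>[A] y)"
 "x \<in> carrier A ==> y \<in> carrier A ==> quot_proj A I x +[quot_alg A I] quot_proj A I y = quot_proj A I (x +[A] y)"
 "a \<in> carrier K ==> x \<in> carrier A ==> a *:[quot_alg A I] quot_proj A I x = quot_proj A I (a *:[A] x)"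
 by (simp_all add: quot_alg_def quot_proj_add quot_proj_mult quot_proj_smult)

lemma quot_module: "module K (quot_alg A I)"
proof (rule moduleI)
 show "abelian_group (quot_alg A I)"
 proof (rule abelian_groupI)
  fix x assume "x \<in> carrier (quot_alg A I)"
  then obtain x' where x: "x' \<in> carrier A" "x = quot_proj A I x'" by (auto simp: quot_sel)
  then show "\<exists>y\<in>carrier (quot_alg A I). y +[quot_alg A I] x = \<zero>\<^bsub>quot_alg A I\<^esub>"
   using A by (intro bexI[of _ "quot_proj A I (\<ominus>\<^bsub>A\<^esub> x')"]) (auto simp: quot_sel)
 qed (use A in \<open>auto simp: quot_sel add_ac\<close>)
qed (use A is_cring in \<open>auto simp: quot_sel smult_add add_smult smult_smult\<close>)

lemma quot_assoc_algebra [simp]: "assoc_algebra K (quot_alg A I)"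
proof -
 have "ring (quot_alg A I)"
 proof (rule ringI)
  show "abelian_group (quot_alg A I)" by (rule mod_abg[OF quot_module])
  show "monoid (quot_alg A I)" by (rule monoidI) (use A in \<open>auto simp: quot_sel mult_assoc\<close>)
 qed (use A in \<open>auto simp: quot_sel mult_add add_mult\<close>)
 then show ?thesis by (rule assoc_algebraI[OF quot_module]) (use A in \<open>auto simp: quot_sel mult_smult\<close>)
qed

lemma quot_proj_lin: "lin K A (quot_alg A I) (quot_proj A I)"
 by (rule linI) (auto simp: quot_sel)

lemma quot_proj_hom: "alg_hom K A (quot_alg A I) (quot_proj A I)"
 by (auto simp: alg_hom_def quot_proj_lin ring_hom_def quot_sel)

end

lemma alg_hom_lin: "alg_hom K A B f ==> lin K A B f"
 by (simp add: alg_hom_def)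

lemma alg_hom_mult: "alg_hom K A B f ==> x \<in> carrier A ==> y \<in> carrier A ==> f (x \<cdot>[A] y) = f x \<cdot>[B] f y"
 by (simp add: alg_hom_def ring_hom_def)

lemma alg_hom_one: "alg_hom K A B f ==> f \<one>\<^bsub>A\<^esub> = \<one>\<^bsub>B\<^esub>"
 by (simp add: alg_hom_def ring_hom_def)

lemma alg_homI: "lin K A B f ==> (\<And>x y. x \<in> carrier A ==> y \<in> carrier A ==> f (x \<cdot>[A] y) = f x \<cdot>[B] f y) ==>
 f \<one>\<^bsub>A\<^esub> = \<one>\<^bsub>B\<^esub> ==> alg_hom K A B f"
 by (auto simp add: alg_hom_def ring_hom_def lin_def)

lemma alg_hom_comp: "alg_hom K A B f ==> alg_hom K B C g ==> alg_hom K A C (g \<circ> f)"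
 by (rule alg_homI) (auto simp: alg_hom_lin alg_hom_one alg_hom_mult lin_cl[OF alg_hom_lin] intro: lin_comp alg_hom_lin)

lemma ker_subm: assumes "module K M" "module K N" "lin K M N f"
 shows "submodule {x \<in> carrier M. f x = \<zero>\<^bsub>N\<^esub>} K M"
 using assms by (intro submI) (auto simp: lin_zero lin_add lin_smult)

lemma idealI':
 assumes A: "assoc_algebra K A" and "submodule I K A"
  "\<And>a x. a \<in> I ==> x \<in> carrier A ==> x \<cdot>[A] a \<in> I"
  "\<And>a x. a \<in> I ==> x \<in> carrier A ==> a \<cdot>[A] x \<in> I"
 shows "ideal I A"
 by (rule idealI) (use assms alg_ring submodule.axioms(1) in auto)

lemma gen_ideal: "assoc_algebra K A ==> S \<subseteq> carrier A ==> ideal (genideal A S) A"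
 by (simp add: alg_ring ring.genideal_ideal)

lemma gen_ideal_incl: "assoc_algebra K A ==> S \<subseteq> carrier A ==> S \<subseteq> genideal A S"
 by (simp add: alg_ring ring.genideal_self)

lemma gen_ideal_min: "assoc_algebra K A ==> S \<subseteq> I ==> ideal I A ==> genideal A S \<subseteq> I"
 by (simp add: alg_ring ring.genideal_minimal)

lemma alg_hom_ker_ideal:
 assumes "assoc_algebra K A" "assoc_algebra K B" "alg_hom K A B f"
 shows "ideal {x \<in> carrier A. f x = \<zero>\<^bsub>B\<^esub>} A"
 using assms by (intro idealI' ker_subm) (auto simp: alg_hom_lin alg_hom_mult lin_cl[OF alg_hom_lin])

section \<open>The free algebra\<close>

definition conv :: "('b list \<Rightarrow> 'k) \<Rightarrow> ('b list \<Rightarrow> 'k) \<Rightarrow> 'b list \<Rightarrow> 'k"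
 where "conv f g = (%w. \<Oplus>\<^bsub>K\<^esub>k\<in>{..length w}. f (take k w) \<cdot>[K] g (drop k w))"

lemma conv_Nil: "range f \<subseteq> carrier K ==> range g \<subseteq> carrier K ==> conv f g [] = f [] \<cdot>[K] g []"
 unfolding conv_def by (simp add: finsum_0 image_subset_iff Pi_def)

text \<open>Separating the empty prefix turns the sum over all cuts of a word into a recursion on
  the word, in which the left factor is shifted by one letter. Bilinearity and associativity then
  become inductions with the left factor arbitrary, and no double sums occur.\<close>

lemma conv_Cons: "range f \<subseteq> carrier K ==> range g \<subseteq> carrier K ==>
 conv f g (x # w) = f [] \<cdot>[K] g (x # w) +[K] conv (%u. f (x # u)) g w"
 unfolding conv_def by (simp add: finsum_Suc2 image_subset_iff Pi_def a_comm del: finsum_Suc)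

lemma conv_cl: "range f \<subseteq> carrier K ==> range g \<subseteq> carrier K ==> conv f g w \<in> carrier K"
 unfolding conv_def by (rule finsum_closed) (auto simp: image_subset_iff Pi_def)

lemma conv_range: "range f \<subseteq> carrier K ==> range g \<subseteq> carrier K ==> range (conv f g) \<subseteq> carrier K"
 using conv_cl by auto

lemma conv_add_left: "range f \<subseteq> carrier K ==> range g \<subseteq> carrier K ==> range h \<subseteq> carrier K ==>
 conv (%w. f w +[K] g w) h w = conv f h w +[K] conv g h w"
proof (induction w arbitrary: f g)
 case Nil
 then show ?case by (simp add: conv_Nil image_subset_iff l_distr)
next
 case (Cons x w)
 then show ?case using Cons.IH[of "%u. f (x # u)" "%u. g (x # u)"]
  by (simp add: conv_Cons conv_cl image_subset_iff l_distr a_ac)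
qed

lemma conv_add_right: "range f \<subseteq> carrier K ==> range g \<subseteq> carrier K ==> range h \<subseteq> carrier K ==>
 conv h (%w. f w +[K] g w) w = conv h f w +[K] conv h g w"
proof (induction w arbitrary: h)
 case Nil
 then show ?case by (simp add: conv_Nil image_subset_iff r_distr)
next
 case (Cons x w)
 then show ?case using Cons.IH[of "%u. h (x # u)"]
  by (simp add: conv_Cons conv_cl image_subset_iff r_distr a_ac)
qed

lemma conv_smult_left: "range f \<subseteq> carrier K ==> range h \<subseteq> carrier K ==> a \<in> carrier K ==>
 conv (%w. a \<cdot>[K] f w) h w = a \<cdot>[K] conv f h w"
proof (induction w arbitrary: f)
 case Nil
 then show ?case by (simp add: conv_Nil image_subset_iff m_assoc)
next
 case (Cons x w)
 then show ?case using Cons.IH[of "%u. f (x # u)"]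
  by (simp add: conv_Cons conv_cl image_subset_iff r_distr m_assoc)
qed

lemma conv_smult_right: "range f \<subseteq> carrier K ==> range h \<subseteq> carrier K ==> a \<in> carrier K ==>
 conv h (%w. a \<cdot>[K] f w) w = a \<cdot>[K] conv h f w"
proof (induction w arbitrary: h)
 case Nil
 then show ?case by (simp add: conv_Nil image_subset_iff m_lcomm)
next
 case (Cons x w)
 then show ?case using Cons.IH[of "%u. h (x # u)"]
  by (simp add: conv_Cons conv_cl image_subset_iff r_distr m_lcomm)
qed

lemma conv_assoc: "range f \<subseteq> carrier K ==> range g \<subseteq> carrier K ==> range h \<subseteq> carrier K ==>
 conv (conv f g) h w = conv f (conv g h) w"
proof (induction w arbitrary: f g)
 case Nil
 then show ?case by (simp add: conv_Nil conv_range conv_cl image_subset_iff m_assoc)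
next
 case (Cons x w)
 have r: "range (%u. f (x # u)) \<subseteq> carrier K" "range (%u. g (x # u)) \<subseteq> carrier K" "f [] \<in> carrier K"
  "range (%u. f [] \<cdot>[K] g (x # u)) \<subseteq> carrier K"
  using Cons.prems by (auto simp: image_subset_iff)
 have 1: "(%u. conv f g (x # u)) = (%u. f [] \<cdot>[K] g (x # u) +[K] conv (%u. f (x # u)) g u)"
  using Cons.prems by (simp add: conv_Cons)
 have "conv (%u. conv f g (x # u)) h w = f [] \<cdot>[K] conv (%u. g (x # u)) h w +[K] conv (conv (%u. f (x # u)) g) h w"
  unfolding 1 using Cons.prems r by (subst conv_add_left) (auto simp: conv_cl conv_smult_left)
 moreover have "conv (%u. f (x # u)) (conv g h) w = conv (conv (%u. f (x # u)) g) h w"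
  using Cons.IH[of "%u. f (x # u)" g] Cons.prems r by simp
 ultimately show ?case using Cons.prems r
  by (simp add: conv_Cons conv_Nil conv_range conv_cl image_subset_iff r_distr m_assoc a_ac)
qed

abbreviation "sing u \<equiv> (%w. if w = u then \<one>\<^bsub>K\<^esub> else \<zero>\<^bsub>K\<^esub>)"

lemma sing_range: "range (sing u) \<subseteq> carrier K"
 by auto

lemma conv_zero_left: "range f \<subseteq> carrier K ==> conv (%w. \<zero>\<^bsub>K\<^esub>) f w = \<zero>\<^bsub>K\<^esub>"
 by (induction w) (simp_all add: conv_Nil conv_Cons image_subset_iff)

lemma conv_sing_Nil: "range f \<subseteq> carrier K ==> conv (sing []) f w = f w"
 by (cases w) (simp_all add: conv_Nil conv_Cons sing_range conv_zero_left image_subset_iff)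

lemma conv_sing: "range f \<subseteq> carrier K ==> conv (sing u) f w = (if take (length u) w = u then f (drop (length u) w) else \<zero>\<^bsub>K\<^esub>)"
proof (induction w arbitrary: u)
 case Nil
 then show ?case by (simp add: conv_Nil sing_range image_subset_iff)
next
 case (Cons x w)
 show ?case
 proof (cases u)
  case Nil
  then show ?thesis using conv_sing_Nil[OF Cons.prems] by simp
 next
  case (Cons y u')
  then show ?thesis using Cons.IH[OF Cons.prems, of u'] Cons.prems
   by (cases "x = y") (auto simp: conv_Cons sing_range conv_zero_left image_subset_iff conv_cl)
 qed
qed

lemma conv_sing_Nil_right: "range f \<subseteq> carrier K ==> conv f (sing []) w = f w"
 by (induction w arbitrary: f) (simp_all add: conv_Nil conv_Cons sing_range conv_zero_left image_subset_iff)

lemma conv_sing_sing: "conv (sing u) (sing v) = sing (u @ v)"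
 by (rule ext, subst conv_sing[OF sing_range]) (auto, metis append_take_drop_id)

abbreviation "F X \<equiv> free_alg K X"

lemma free_carrier: "f \<in> carrier (F X) \<longleftrightarrow> range f \<subseteq> carrier K \<and> finite {w. f w \<noteq> \<zero>\<^bsub>K\<^esub>} \<and> {w. f w \<noteq> \<zero>\<^bsub>K\<^esub>} \<subseteq> lists X"
 by (simp add: free_alg_def)

lemma free_sel: "f \<cdot>[F X] g = conv f g" "f +[F X] g = (%w. f w +[K] g w)" "\<zero>\<^bsub>F X\<^esub> = (%w. \<zero>\<^bsub>K\<^esub>)"
 "\<one>\<^bsub>F X\<^esub> = sing []" "a *:[F X] f = (%w. a \<cdot>[K] f w)"
 by (simp_all add: free_alg_def conv_def)

lemma free_range: "f \<in> carrier (F X) ==> range f \<subseteq> carrier K"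
 by (simp add: free_carrier)

lemma free_val: "f \<in> carrier (F X) ==> f w \<in> carrier K"
 using free_range by blast

lemma free_supp: "f \<in> carrier (F X) ==> f w \<noteq> \<zero>\<^bsub>K\<^esub> ==> w \<in> lists X"
 by (auto simp: free_carrier)

lemma conv_supp: assumes "range f \<subseteq> carrier K" "range g \<subseteq> carrier K" "conv f g w \<noteq> \<zero>\<^bsub>K\<^esub>"
 shows "w \<in> (%(u, v). u @ v) ` ({w. f w \<noteq> \<zero>\<^bsub>K\<^esub>} \<times> {w. g w \<noteq> \<zero>\<^bsub>K\<^esub>})"
proof -
 have "\<exists>k. f (take k w) \<cdot>[K] g (drop k w) \<noteq> \<zero>\<^bsub>K\<^esub>"
 proof (rule ccontr)
  assume "\<not> ?thesis"
  then have "conv f g w = \<zero>\<^bsub>K\<^esub>" unfolding conv_def by (simp add: finsum_zero)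
  then show False using assms by simp
 qed
 then obtain k where "f (take k w) \<cdot>[K] g (drop k w) \<noteq> \<zero>\<^bsub>K\<^esub>" by blast
 then have "f (take k w) \<noteq> \<zero>\<^bsub>K\<^esub>" "g (drop k w) \<noteq> \<zero>\<^bsub>K\<^esub>"
  using assms by (auto simp: image_subset_iff)
 then show ?thesis by (intro image_eqI[of _ _ "(take k w, drop k w)"]) auto
qed

lemma conv_free: assumes "f \<in> carrier (F X)" "g \<in> carrier (F X)" shows "conv f g \<in> carrier (F X)"
proof -
 have r: "range f \<subseteq> carrier K" "range g \<subseteq> carrier K" using assms by (auto simp: free_carrier)
 have "{w. conv f g w \<noteq> \<zero>\<^bsub>K\<^esub>} \<subseteq> (%(u, v). u @ v) ` ({w. f w \<noteq> \<zero>\<^bsub>K\<^esub>} \<times> {w. g w \<noteq> \<zero>\<^bsub>K\<^esub>})"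
  using conv_supp[OF r] by blast
 moreover have "u @ v \<in> lists X" if "f u \<noteq> \<zero>\<^bsub>K\<^esub>" "g v \<noteq> \<zero>\<^bsub>K\<^esub>" for u v
  using free_supp[OF assms(1) that(1)] free_supp[OF assms(2) that(2)] by simp
 then have "(%(u, v). u @ v) ` ({w. f w \<noteq> \<zero>\<^bsub>K\<^esub>} \<times> {w. g w \<noteq> \<zero>\<^bsub>K\<^esub>}) \<subseteq> lists X"
  by (auto simp del: in_lists_conv_set append_in_lists_conv)
 moreover have "finite ((%(u, v). u @ v) ` ({w. f w \<noteq> \<zero>\<^bsub>K\<^esub>} \<times> {w. g w \<noteq> \<zero>\<^bsub>K\<^esub>}))"
  using assms by (auto simp: free_carrier)
 ultimately show ?thesis using conv_range[OF r] unfolding free_carrier by (meson finite_subset subset_trans)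
qed

lemma sing_free: "u \<in> lists X ==> sing u \<in> carrier (F X)"
proof -
 assume "u \<in> lists X"
 moreover have "{w. sing u w \<noteq> \<zero>\<^bsub>K\<^esub>} = {u}" by auto
 ultimately show ?thesis unfolding free_carrier using sing_range by simp
qed

lemma add_free: assumes "f \<in> carrier (F X)" "g \<in> carrier (F X)" shows "(%w. f w +[K] g w) \<in> carrier (F X)"
proof -
 have "{w. f w +[K] g w \<noteq> \<zero>\<^bsub>K\<^esub>} \<subseteq> {w. f w \<noteq> \<zero>\<^bsub>K\<^esub>} \<union> {w. g w \<noteq> \<zero>\<^bsub>K\<^esub>}" by auto
 moreover have "finite \<dots>" "\<dots> \<subseteq> lists X"
  using assms free_supp[OF assms(1)] free_supp[OF assms(2)] by (auto simp: free_carrier)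
 ultimately have "finite {w. f w +[K] g w \<noteq> \<zero>\<^bsub>K\<^esub>}" "{w. f w +[K] g w \<noteq> \<zero>\<^bsub>K\<^esub>} \<subseteq> lists X"
  using finite_subset by blast+
 then show ?thesis using free_val[OF assms(1)] free_val[OF assms(2)] by (auto simp: free_carrier)
qed

lemma smult_free: assumes "f \<in> carrier (F X)" "a \<in> carrier K" shows "(%w. a \<cdot>[K] f w) \<in> carrier (F X)"
proof -
 have "{w. a \<cdot>[K] f w \<noteq> \<zero>\<^bsub>K\<^esub>} \<subseteq> {w. f w \<noteq> \<zero>\<^bsub>K\<^esub>}" using assms by auto
 moreover have "finite \<dots>" "\<dots> \<subseteq> lists X"
  using assms by (auto simp: free_carrier)
 ultimately have "finite {w. a \<cdot>[K] f w \<noteq> \<zero>\<^bsub>K\<^esub>}" "{w. a \<cdot>[K] f w \<noteq> \<zero>\<^bsub>K\<^esub>} \<subseteq> lists X"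
  using finite_subset by blast+
 then show ?thesis using assms(2) free_val[OF assms(1)] by (auto simp: free_carrier)
qed

lemma free_module: "module K (F X)"
proof (rule moduleI)
 show "abelian_group (F X)"
 proof (rule abelian_groupI)
  fix f assume f: "f \<in> carrier (F X)"
  show "\<exists>g\<in>carrier (F X). g +[F X] f = \<zero>\<^bsub>F X\<^esub>"
   using smult_free[OF f, of "\<ominus>\<^bsub>K\<^esub> \<one>\<^bsub>K\<^esub>"] free_val[OF f]
   by (intro bexI[of _ "%w. \<ominus>\<^bsub>K\<^esub> \<one>\<^bsub>K\<^esub> \<cdot>[K] f w"]) (auto simp: free_sel l_minus l_neg)
 qed (auto simp: free_sel add_free free_val a_ac, simp add: free_carrier)
qed (auto simp: free_sel smult_free free_val is_cring m_assoc r_distr l_distr)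

lemma free_assoc_algebra [simp]: "assoc_algebra K (F X)"
proof -
 have "ring (F X)"
 proof (rule ringI)
  show "abelian_group (F X)" by (rule mod_abg[OF free_module])
  show "monoid (F X)" by (rule monoidI)
   (auto simp: free_sel conv_free sing_free conv_assoc free_range conv_sing_Nil conv_sing_Nil_right)
 qed (auto simp: free_sel conv_add_left conv_add_right free_range)
 then show ?thesis
  by (rule assoc_algebraI[OF free_module]) (auto simp: free_sel conv_smult_left conv_smult_right free_range)
qed

lemma free_span:
 assumes M: "submodule H K (F X)" "\<And>u. u \<in> lists X ==> sing u \<in> H" and "f \<in> carrier (F X)"
 shows "f \<in> H"
proof -
 \<comment> \<open>The induction runs over a finite set containing the support rather than the
   support itself, so that resetting one coefficient to zero stays within the hypothesis.\<close>
 have "finite S ==> S \<subseteq> lists X ==> range f \<subseteq> carrier K ==> {w. f w \<noteq> \<zero>\<^bsub>K\<^esub>} \<subseteq> S ==> f \<in> H" for S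
 proof (induction S arbitrary: f rule: finite_induct)
  case empty
  then have "f = \<zero>\<^bsub>F X\<^esub>" by (auto simp: free_sel)
  then show ?case using subm_zero[OF free_module M(1)] by simp
 next
  case (insert u S)
  let ?g = "%w. if w = u then \<zero>\<^bsub>K\<^esub> else f w"
  have "?g \<in> H" using insert by (intro insert.IH) auto
  moreover have "f u *:[F X] sing u \<in> H" using insert.prems M(2)
   by (intro subm_smult[OF free_module M(1)]) auto
  moreover have "?g +[F X] f u *:[F X] sing u = f"
   using insert.prems by (auto simp: free_sel image_subset_iff)
  ultimately show ?case using subm_add[OF free_module M(1), of ?g "f u *:[F X] sing u"] by simp
 qed
 then show ?thesis using assms(3) unfolding free_carrier by blast
qed

definition free_ext :: "('k, 'b, 'n) module_scheme \<Rightarrow> ('a list \<Rightarrow> 'b) \<Rightarrow> ('a list \<Rightarrow> 'k) \<Rightarrow> 'b"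
 where "free_ext M \<Phi> f = finsum M (%w. f w *:[M] \<Phi> w) {w. f w \<noteq> \<zero>\<^bsub>K\<^esub>}"

text \<open>Additivity compares sums over three different supports; this rewrites all of them as
  sums over one common finite set.\<close>

lemma free_ext_superset:
 assumes M: "module K M" and P: "\<Phi> \<in> lists X \<rightarrow> carrier M" and f: "f \<in> carrier (F X)"
  and S: "finite S" "S \<subseteq> lists X" "{w. f w \<noteq> \<zero>\<^bsub>K\<^esub>} \<subseteq> S"
 shows "free_ext M \<Phi> f = finsum M (%w. f w *:[M] \<Phi> w) S"
 unfolding free_ext_def finsum_def using assms free_val[OF f]
 by (intro comm_monoid.finprod_mono_neutral_cong_left[OF abelian_monoid.a_comm_monoid[OF mod_abm[OF M]]])
  (auto simp: Pi_def subset_iff)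

lemma free_ext_lin:
 assumes M: "module K M" and P: "\<Phi> \<in> lists X \<rightarrow> carrier M"
 shows "lin K (F X) M (free_ext M \<Phi>)"
proof (rule linI)
 fix f assume f: "f \<in> carrier (F X)"
 have f': "finite {w. f w \<noteq> \<zero>\<^bsub>K\<^esub>}" "{w. f w \<noteq> \<zero>\<^bsub>K\<^esub>} \<subseteq> lists X" using f by (auto simp: free_carrier)
 show "free_ext M \<Phi> f \<in> carrier M" unfolding free_ext_def using M P f' free_val[OF f]
  by (intro abelian_monoid.finsum_closed[OF mod_abm[OF M]]) (auto simp: Pi_def subset_iff)
 {
  fix g assume g: "g \<in> carrier (F X)"
  let ?S = "{w. f w \<noteq> \<zero>\<^bsub>K\<^esub>} \<union> {w. g w \<noteq> \<zero>\<^bsub>K\<^esub>}"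
  have S: "finite ?S" "?S \<subseteq> lists X" using f g by (auto simp: free_carrier)
  have c: "(%w. f w *:[M] \<Phi> w) \<in> ?S \<rightarrow> carrier M" "(%w. g w *:[M] \<Phi> w) \<in> ?S \<rightarrow> carrier M"
   using S P M free_val[OF f] free_val[OF g] by (auto simp: Pi_def subset_iff)
  have S': "{w. (f +[F X] g) w \<noteq> \<zero>\<^bsub>K\<^esub>} \<subseteq> ?S"
   by (auto simp: free_sel)
  have "free_ext M \<Phi> (f +[F X] g) = finsum M (%w. (f w +[K] g w) *:[M] \<Phi> w) ?S"
   using free_ext_superset[OF M P _ S S'] add_free[OF f g] by (simp add: free_sel)
  also have "\<dots> = finsum M (%w. f w *:[M] \<Phi> w +[M] g w *:[M] \<Phi> w) ?S"
   using S P M free_val[OF f] free_val[OF g]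
   by (intro abelian_monoid.finsum_cong'[OF mod_abm[OF M]]) (auto simp: Pi_def subset_iff add_smult)
  also have "\<dots> = free_ext M \<Phi> f +[M] free_ext M \<Phi> g"
   using abelian_monoid.finsum_addf[OF mod_abm[OF M] c]
    free_ext_superset[OF M P f S] free_ext_superset[OF M P g S] by simp
  finally show "free_ext M \<Phi> (f +[F X] g) = free_ext M \<Phi> f +[M] free_ext M \<Phi> g" .
 }
 fix a assume a: "a \<in> carrier K"
 let ?S = "{w. f w \<noteq> \<zero>\<^bsub>K\<^esub>}"
 have c: "(%w. f w *:[M] \<Phi> w) \<in> ?S \<rightarrow> carrier M"
  using f' P M free_val[OF f] by (auto simp: Pi_def subset_iff)
 have S': "{w. (a *:[F X] f) w \<noteq> \<zero>\<^bsub>K\<^esub>} \<subseteq> ?S"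
  using a by (auto simp: free_sel)
 have "free_ext M \<Phi> (a *:[F X] f) = finsum M (%w. (a \<cdot>[K] f w) *:[M] \<Phi> w) ?S"
  using free_ext_superset[OF M P _ f' S'] smult_free[OF f a] by (simp add: free_sel)
 also have "\<dots> = finsum M (%w. a *:[M] (f w *:[M] \<Phi> w)) ?S"
  using f' P M a free_val[OF f]
  by (intro abelian_monoid.finsum_cong'[OF mod_abm[OF M]]) (auto simp: Pi_def subset_iff smult_smult)
 also have "\<dots> = a *:[M] free_ext M \<Phi> f"
  unfolding free_ext_def using module.finsum_smult_ldistr[OF M f'(1) a c] by simp
 finally show "free_ext M \<Phi> (a *:[F X] f) = a *:[M] free_ext M \<Phi> f" .
qed

lemma free_ext_sing:
 assumes M: "module K M" and P: "\<Phi> \<in> lists X \<rightarrow> carrier M" and u: "u \<in> lists X"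
 shows "free_ext M \<Phi> (sing u) = \<Phi> u"
proof -
 have "free_ext M \<Phi> (sing u) = finsum M (%w. sing u w *:[M] \<Phi> w) {u}"
  using u by (intro free_ext_superset[OF M P sing_free[OF u]]) auto
 also have "\<dots> = \<Phi> u" using M P u
  by (subst abelian_monoid.finsum_insert[OF mod_abm[OF M]]) (auto simp: Pi_def abelian_monoid.finsum_empty[OF mod_abm[OF M]])
 finally show ?thesis .
qed

end

declare in_lists_conv_set [simp del] in_listsD [rule del] in_listsI [rule del]

context fld
begin

section \<open>The tensor algebra\<close>

abbreviation "T V \<equiv> tensor_alg K V"
abbreviation (input) tmult ("_ *[_] _" [70, 0, 71] 70) where "x *[V] y \<equiv> x \<otimes>\<^bsub>T V\<^esub> y"
abbreviation "pt V w \<equiv> pure_tensor K V w"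

lemma letter_sing: "letter K x = sing [x]"
 by (simp add: letter_def)

lemma letter_free [simp]: "x \<in> X ==> letter K x \<in> carrier (F X)"
 unfolding letter_sing by (rule sing_free) simp

definition tensor_rels :: "('k, 'a, 'm) module_scheme \<Rightarrow> ('a list \<Rightarrow> 'k) set" where
 "tensor_rels V = {letter K (x +[V] y) \<ominus>\<^bsub>F (carrier V)\<^esub> (letter K x +[F (carrier V)] letter K y) | x y. x \<in> carrier V \<and> y \<in> carrier V} \<union>
   {letter K (a *:[V] x) \<ominus>\<^bsub>F (carrier V)\<^esub> a *:[F (carrier V)] letter K x | a x. a \<in> carrier K \<and> x \<in> carrier V}"

lemma tensor_ideal_rels: "tensor_ideal K V = genideal (F (carrier V)) (tensor_rels V)"
 by (simp add: tensor_ideal_def tensor_rels_def Let_def)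

lemma tensor_rels_subset: "module K V ==> tensor_rels V \<subseteq> carrier (F (carrier V))"
 unfolding tensor_rels_def by auto

lemma tensor_ideal: "module K V ==> ideal (tensor_ideal K V) (F (carrier V))"
 unfolding tensor_ideal_rels by (rule gen_ideal) (auto dest: tensor_rels_subset)

lemma T_alg [simp]: "module K V ==> assoc_algebra K (T V)"
 unfolding tensor_alg_def by (rule quot_assoc_algebra) (auto simp: tensor_ideal)

definition tproj where "tproj V = quot_proj (F (carrier V)) (tensor_ideal K V)"

lemma tproj_hom: "module K V ==> alg_hom K (F (carrier V)) (T V) (tproj V)"
 unfolding tensor_alg_def tproj_def by (rule quot_proj_hom) (auto simp: tensor_ideal)

lemma tproj_surj: "module K V ==> carrier (T V) = tproj V ` carrier (F (carrier V))"
 unfolding tensor_alg_def tproj_def by (rule quot_sel) (auto simp: tensor_ideal)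

lemma iota_tproj: "\<iota> K V x = tproj V (letter K x)"
 by (simp add: \<iota>_def tproj_def)

lemma iota_lin: assumes V: "module K V" shows "lin K V (T V) (\<iota> K V)"
proof (rule linI)
 note q = alg_hom_lin[OF tproj_hom[OF V]]
 have rel: "tproj V x = tproj V y" if "x \<in> carrier (F (carrier V))" "y \<in> carrier (F (carrier V))"
  "x \<ominus>\<^bsub>F (carrier V)\<^esub> y \<in> tensor_rels V" for x y
  unfolding tproj_def using that gen_ideal_incl[OF free_assoc_algebra tensor_rels_subset[OF V]] tensor_ideal[OF V]
  by (subst quot_proj_eq_iff) (auto simp: tensor_ideal_rels)
 fix x assume x: "x \<in> carrier V"
 show "\<iota> K V x \<in> carrier (T V)" using lin_cl[OF q] x by (simp add: iota_tproj)
 {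
  fix y assume y: "y \<in> carrier V"
  have "tproj V (letter K (x +[V] y)) = tproj V (letter K x +[F (carrier V)] letter K y)"
   by (rule rel) (use V x y in \<open>auto simp: tensor_rels_def\<close>)
  then show "\<iota> K V (x +[V] y) = \<iota> K V x +[T V] \<iota> K V y" 
   using x y by (simp add: iota_tproj lin_add[OF q])
 }
 fix a assume a: "a \<in> carrier K"
 have "tproj V (letter K (a *:[V] x)) = tproj V (a *:[F (carrier V)] letter K x)"
  by (rule rel) (use V x a in \<open>auto simp: tensor_rels_def\<close>)
 then show "\<iota> K V (a *:[V] x) = a *:[T V] \<iota> K V x"
  using x a by (simp add: iota_tproj lin_smult[OF q])
qed

lemma iota_cl [simp]: "module K V ==> x \<in> carrier V ==> \<iota> K V x \<in> carrier (T V)"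
 by (rule lin_cl[OF iota_lin])

lemma pt_Nil [simp]: "pt V [] = \<one>\<^bsub>T V\<^esub>"
 by (simp add: pure_tensor_def)

lemma pt_Cons: "pt V (x # w) = \<iota> K V x *[V] pt V w"
 by (simp add: pure_tensor_def)

lemma pt_cl [simp]: "module K V ==> w \<in> lists (carrier V) ==> pt V w \<in> carrier (T V)"
 by (induction w) (auto simp: pt_Cons)

lemma pt_append: "module K V ==> u \<in> lists (carrier V) ==> v \<in> lists (carrier V) ==>
 pt V (u @ v) = pt V u *[V] pt V v"
 by (induction u) (auto simp: pt_Cons mult_assoc)

lemma pt_single [simp]: "module K V ==> x \<in> carrier V ==> pt V [x] = \<iota> K V x"
 by (simp add: pt_Cons)

lemma pt_tproj: "module K V ==> w \<in> lists (carrier V) ==> pt V w = tproj V (sing w)"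
proof (induction w)
 case Nil
 then show ?case using alg_hom_one[OF tproj_hom[OF Nil(1)]] by (simp only: free_sel pt_Nil)
next
 case (Cons x w)
 have "sing (x # w) = sing [x] \<cdot>[F (carrier V)] sing w"
  by (simp add: free_sel conv_sing_sing)
 then have "tproj V (sing (x # w)) = tproj V (sing [x]) *[V] tproj V (sing w)"
  using Cons sing_free by (simp only:, subst alg_hom_mult[OF tproj_hom]) auto
 then show ?case using Cons by (simp add: pt_Cons iota_tproj letter_sing)
qed

text \<open>The parameter covers three cases at once: \<open>{n}\<close> gives the homogeneous
  component, \<open>{n..}\<close> the part of degree at least \<open>n\<close>, and
  \<open>UNIV\<close> the whole algebra. Operator identities at a fixed position hold in all
  sufficiently high degrees, hence the abbreviation \<open>tge\<close>.\<close>

definition wsp :: "('k, 'a, 'm) module_scheme \<Rightarrow> nat set \<Rightarrow> ('a list \<Rightarrow> 'k) set" where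
 "wsp V N = lspan K (T V) (pt V ` {w \<in> lists (carrier V). length w \<in> N})"

abbreviation "tge V n \<equiv> wsp V {n..}"
abbreviation "tp V n \<equiv> tpow K V n"
abbreviation "tpm1 V n \<equiv> tpow_mod K V n"

lemma tpow_wsp: "tp V n = wsp V {n}"
 by (auto simp: tpow_def wsp_def intro!: arg_cong[where f = "lspan K (T V)"])

lemma wsp_gens: "module K V ==> pt V ` {w \<in> lists (carrier V). length w \<in> N} \<subseteq> carrier (T V)"
 by auto

lemma wsp_subm: "module K V ==> submodule (wsp V N) K (T V)"
 unfolding wsp_def by (rule lspan_subm) auto

lemma wsp_subset: "module K V ==> wsp V N \<subseteq> carrier (T V)"
 by (rule subm_subset[OF wsp_subm])

lemma wsp_cl: "module K V ==> t \<in> wsp V N ==> t \<in> carrier (T V)"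
 by (rule subsetD[OF wsp_subset])

lemma wsp_cl_tge [simp]: "module K V ==> t \<in> tge V n ==> t \<in> carrier (T V)"
 by (rule subsetD[OF wsp_subset])

lemma wsp_cl_tp: "module K V ==> t \<in> tp V n ==> t \<in> carrier (T V)"
 unfolding tpow_wsp by (rule subsetD[OF wsp_subset])

lemma wsp_mod [simp]: "module K V ==> module K ((T V)\<lparr>carrier := wsp V N\<rparr>)"
 by (simp add: subm_mod wsp_subm)

lemma tp_mod [simp]: "module K V ==> module K (tpm1 V n)"
 by (simp add: tpow_wsp)

lemma tp_subm: "module K V ==> submodule (tp V n) K (T V)"
 by (simp add: tpow_wsp wsp_subm)

lemma wsp_mono: "N \<subseteq> L ==> wsp V N \<subseteq> wsp V L"
 unfolding wsp_def by (rule lspan_mono) auto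

lemma tge_mono: "t \<in> tge V n ==> m \<le> n ==> t \<in> tge V m"
 using wsp_mono[of "{n..}" "{m..}" V] by auto

lemma tp_tge: "t \<in> tp V n ==> m \<le> n ==> t \<in> tge V m"
 using wsp_mono[of "{n}" "{m..}" V] by (auto simp: tpow_wsp)

lemma pt_wsp: "w \<in> lists (carrier V) ==> length w \<in> N ==> pt V w \<in> wsp V N"
 unfolding wsp_def by (rule subsetD[OF lspan_incl]) auto

lemma pt_tge: "w \<in> lists (carrier V) ==> n \<le> length w ==> pt V w \<in> tge V n"
 by (rule pt_wsp) auto

lemma pt_tp: "w \<in> lists (carrier V) ==> length w = n ==> pt V w \<in> tp V n"
 unfolding tpow_wsp by (rule pt_wsp) auto

lemma wsp_add: "module K V ==> s \<in> wsp V N ==> t \<in> wsp V N ==> s +[T V] t \<in> wsp V N"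
 by (rule subm_add[OF _ wsp_subm]) simp_all

lemma tp_add: "module K V ==> s \<in> tp V n ==> t \<in> tp V n ==> s +[T V] t \<in> tp V n"
 unfolding tpow_wsp by (rule wsp_add)

lemma wsp_all: assumes V: "module K V" shows "wsp V UNIV = carrier (T V)"
proof
 show "wsp V UNIV \<subseteq> carrier (T V)" using wsp_subset[OF V] .
 note q = alg_hom_lin[OF tproj_hom[OF V]]
 have sub: "submodule {f \<in> carrier (F (carrier V)). tproj V f \<in> wsp V UNIV} K (F (carrier V))"
  using V subm_zero[OF _ wsp_subm[OF V]] subm_add[OF _ wsp_subm[OF V]] subm_smult[OF _ wsp_subm[OF V]]
  by (intro submI) (auto simp: lin_zero[OF q] lin_add[OF q] lin_smult[OF q])
 have "f \<in> {f \<in> carrier (F (carrier V)). tproj V f \<in> wsp V UNIV}" if "f \<in> carrier (F (carrier V))" for f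
 proof (rule free_span[OF sub _ that])
  fix u assume u: "u \<in> lists (carrier V)"
  show "sing u \<in> {f \<in> carrier (F (carrier V)). tproj V f \<in> wsp V UNIV}"
   using sing_free[OF u] pt_wsp[OF u, of UNIV] pt_tproj[OF V u] by simp
 qed
 then show "carrier (T V) \<subseteq> wsp V UNIV" using tproj_surj[OF V] by auto
qed

lemma tge_0 [simp]: "module K V ==> tge V 0 = carrier (T V)"
 using wsp_all[of V] by (simp add: atLeast_0)

lemma wsp_lin_eq:
 assumes "t \<in> wsp V N" "module K V" "module K M" "lin K ((T V)\<lparr>carrier := wsp V N\<rparr>) M f"
  "lin K ((T V)\<lparr>carrier := wsp V N\<rparr>) M g"
  and "\<And>w. w \<in> lists (carrier V) ==> length w \<in> N ==> f (pt V w) = g (pt V w)"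
 shows "f t = g t"
 by (rule lin_eq_lspan[OF _ _ wsp_gens, folded wsp_def]) (use assms in auto)

lemma wsp_lin_eq':
 assumes "t \<in> wsp V N" "module K V" "module K M" "lin K (T V) M f" "lin K (T V) M g"
  and "\<And>w. w \<in> lists (carrier V) ==> length w \<in> N ==> f (pt V w) = g (pt V w)"
 shows "f t = g t"
 by (rule wsp_lin_eq) (use assms wsp_subset in \<open>auto intro!: lin_sub\<close>)

lemma T_lin_eq:
 assumes "t \<in> carrier (T V)" "module K V" "module K M" "lin K (T V) M f" "lin K (T V) M g"
  and "\<And>w. w \<in> lists (carrier V) ==> f (pt V w) = g (pt V w)"
 shows "f t = g t"
 by (rule wsp_lin_eq'[of t V UNIV]) (use assms wsp_all in auto)

lemma tp_lin_eq:
 assumes "t \<in> tp V n" "module K V" "module K M" "lin K (tpm1 V n) M f" "lin K (tpm1 V n) M g"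
  and "\<And>w. w \<in> lists (carrier V) ==> length w = n ==> f (pt V w) = g (pt V w)"
 shows "f t = g t"
 by (rule wsp_lin_eq[of t V "{n}"]) (use assms in \<open>auto simp: tpow_wsp\<close>)

lemma wsp_image:
 assumes "t \<in> wsp V N" "module K V" "module K M" "lin K (T V) M f" "submodule H K M"
  and "\<And>w. w \<in> lists (carrier V) ==> length w \<in> N ==> f (pt V w) \<in> H"
 shows "f t \<in> H"
 by (rule lin_image_lspan[OF assms(1)[unfolded wsp_def] assms(2)[THEN T_alg, THEN alg_mod] wsp_gens[OF assms(2)] assms(3-5)])
  (clarsimp simp: assms(6))

lemma wsp_mult:
 assumes "x \<in> wsp V N" "y \<in> wsp V L" "module K V" "\<And>n l. n \<in> N ==> l \<in> L ==> n + l \<in> S"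
 shows "x *[V] y \<in> wsp V S"
proof -
 note V = assms(3)
 have 1: "pt V u *[V] y \<in> wsp V S" if "u \<in> lists (carrier V)" "length u \<in> N" for u
  by (rule wsp_image[OF assms(2) V _ lin_mult_left wsp_subm])
   (use V that assms(4) in \<open>auto simp: pt_append[symmetric] intro!: pt_wsp\<close>)
 show ?thesis
  by (rule wsp_image[OF assms(1) V _ lin_mult_right[OF _ _ lin_id(2)] wsp_subm])
   (use V wsp_cl[OF V assms(2)] 1 in auto)
qed

lemma tp_mult: "module K V ==> x \<in> tp V m ==> y \<in> tp V n ==> m + n = k ==> x *[V] y \<in> tp V k"
 unfolding tpow_wsp by (rule wsp_mult) auto

lemma tge_mult: "module K V ==> x \<in> tge V m ==> y \<in> tge V n ==> k \<le> m + n ==> x *[V] y \<in> tge V k"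
 by (rule wsp_mult) auto

lemma iota_tp [simp]: "module K V ==> x \<in> carrier V ==> \<iota> K V x \<in> tp V 1" "module K V ==> x \<in> carrier V ==> \<iota> K V x \<in> tp V (Suc 0)"
 using pt_tp[of "[x]" V] by auto

lemma one_tp [simp]: "module K V ==> \<one>\<^bsub>T V\<^esub> \<in> tp V 0"
 using pt_tp[of "[]" V] by auto

lemma iota_mult_tp: "module K V ==> x \<in> carrier V ==> t \<in> tp V n ==> Suc n = m ==> \<iota> K V x *[V] t \<in> tp V m"
 using tp_mult[of V "\<iota> K V x" 1] by auto

lemma iota_mult_tge: "module K V ==> x \<in> carrier V ==> t \<in> tge V (n - 1) ==> \<iota> K V x *[V] t \<in> tge V n"
 by (rule tge_mult[where m = 1 and n = "n - 1", OF _ tp_tge[OF iota_tp(1)]]) auto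

lemma iotas_tp2 [simp]: "module K V ==> x \<in> carrier V ==> y \<in> carrier V ==> \<iota> K V x *[V] \<iota> K V y \<in> tp V 2"
 by (rule iota_mult_tp[where n = 1]) auto

text \<open>A family of multilinear maps, one for each word length, packed into one function on
  words.\<close>

definition mlin :: "('k, 'a, 'm) module_scheme \<Rightarrow> ('k, 'b, 'n) module_scheme \<Rightarrow> ('a list \<Rightarrow> 'b) \<Rightarrow> bool" where
 "mlin V M \<Phi> \<longleftrightarrow> (\<forall>w\<in>lists (carrier V). \<Phi> w \<in> carrier M) \<and>
  (\<forall>u\<in>lists (carrier V). \<forall>v\<in>lists (carrier V). lin K V M (%x. \<Phi> (u @ x # v)))"

lemma mlin_cl: "mlin V M \<Phi> ==> w \<in> lists (carrier V) ==> \<Phi> w \<in> carrier M"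
 by (simp add: mlin_def)

lemma mlin_lin: "mlin V M \<Phi> ==> u \<in> lists (carrier V) ==> v \<in> lists (carrier V) ==> lin K V M (%x. \<Phi> (u @ x # v))"
 by (simp add: mlin_def)

lemma mlinI: "(\<And>w. w \<in> lists (carrier V) ==> \<Phi> w \<in> carrier M) ==>
 (\<And>u v. u \<in> lists (carrier V) ==> v \<in> lists (carrier V) ==> lin K V M (%x. \<Phi> (u @ x # v))) ==> mlin V M \<Phi>"
 by (simp add: mlin_def)

lemma tensor_alg_ext:
 assumes V: "module K V" and M: "module K M" and P: "mlin V M \<Phi>"
 shows "\<exists>h. lin K (T V) M h \<and> (\<forall>w\<in>lists (carrier V). h (pt V w) = \<Phi> w)"
proof -
 let ?F = "F (carrier V)" and ?L = "lists (carrier V)" and ?h = "free_ext M \<Phi>"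
 have P': "\<Phi> \<in> ?L \<rightarrow> carrier M" using mlin_cl[OF P] by blast
 note h = free_ext_lin[OF M P']
 note sf = sing_free[of _ "carrier V"]
 \<comment> \<open>The kernel of \<open>?h\<close> is only a subspace. Requiring that an element be
   killed between any two words produces a two-sided ideal, and multilinearity puts the defining
   relations of the tensor algebra into it.\<close>
 define J where "J = {f \<in> carrier ?F. \<forall>u\<in>?L. \<forall>v\<in>?L. ?h (sing u \<cdot>[?F] f \<cdot>[?F] sing v) = \<zero>\<^bsub>M\<^esub>}"
 have lin2: "lin K ?F M (%f. ?h (sing u \<cdot>[?F] f \<cdot>[?F] sing v))" if "u \<in> ?L" "v \<in> ?L" for u v
  using that by (intro lin_comp'[OF _ h] lin_mult_right lin_mult_left lin_id) (auto simp: sf)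
 have "ideal J ?F"
 proof (rule idealI'[OF free_assoc_algebra])
  show "submodule J K ?F"
   unfolding J_def using M lin2
   by (intro submI) (auto simp: lin_zero[OF lin2] lin_add[OF lin2] lin_smult[OF lin2])
  fix a x assume a: "a \<in> J" and x: "x \<in> carrier ?F"
  have a': "a \<in> carrier ?F" using a by (simp add: J_def)
  \<comment> \<open>By linearity the multiplier may be taken to be a single word, and that word is
    absorbed into the surrounding context.\<close>
  have "x \<in> {x \<in> carrier ?F. \<forall>u\<in>?L. \<forall>v\<in>?L. ?h (sing u \<cdot>[?F] (x \<cdot>[?F] a) \<cdot>[?F] sing v) = \<zero>\<^bsub>M\<^esub>}"
  proof (rule free_span[OF _ _ x])
   have l: "lin K ?F M (%x. ?h (sing u \<cdot>[?F] (x \<cdot>[?F] a) \<cdot>[?F] sing v))" if "u \<in> ?L" "v \<in> ?L" for u v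
    using that a' by (intro lin_comp'[OF _ h] lin_mult_right lin_mult_left lin_id) (auto simp: sf)
   show "submodule {x \<in> carrier ?F. \<forall>u\<in>?L. \<forall>v\<in>?L. ?h (sing u \<cdot>[?F] (x \<cdot>[?F] a) \<cdot>[?F] sing v) = \<zero>\<^bsub>M\<^esub>} K ?F"
    using M by (intro submI) (auto simp: lin_zero[OF l] lin_add[OF l] lin_smult[OF l])
   fix t assume t: "t \<in> ?L"
   have "?h (sing u \<cdot>[?F] (sing t \<cdot>[?F] a) \<cdot>[?F] sing v) = \<zero>\<^bsub>M\<^esub>" if u: "u \<in> ?L" and v: "v \<in> ?L" for u v
   proof -
    have "sing u \<cdot>[?F] (sing t \<cdot>[?F] a) = sing (u @ t) \<cdot>[?F] a"
     using u t a' by (simp add: sf mult_assoc[symmetric] del: append_in_lists_conv)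
      (simp add: free_sel conv_sing_sing)
    then show ?thesis using a t u v unfolding J_def by simp
   qed
   then show "sing t \<in> {x \<in> carrier ?F. \<forall>u\<in>?L. \<forall>v\<in>?L. ?h (sing u \<cdot>[?F] (x \<cdot>[?F] a) \<cdot>[?F] sing v) = \<zero>\<^bsub>M\<^esub>}"
    using t sf by blast
  qed
  then show "x \<cdot>[?F] a \<in> J" unfolding J_def using a' x by auto
  have "x \<in> {x \<in> carrier ?F. \<forall>u\<in>?L. \<forall>v\<in>?L. ?h (sing u \<cdot>[?F] (a \<cdot>[?F] x) \<cdot>[?F] sing v) = \<zero>\<^bsub>M\<^esub>}"
  proof (rule free_span[OF _ _ x])
   have l: "lin K ?F M (%x. ?h (sing u \<cdot>[?F] (a \<cdot>[?F] x) \<cdot>[?F] sing v))" if "u \<in> ?L" "v \<in> ?L" for u v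
    using that a' by (intro lin_comp'[OF _ h] lin_mult_right lin_mult_left lin_id) (auto simp: sf)
   show "submodule {x \<in> carrier ?F. \<forall>u\<in>?L. \<forall>v\<in>?L. ?h (sing u \<cdot>[?F] (a \<cdot>[?F] x) \<cdot>[?F] sing v) = \<zero>\<^bsub>M\<^esub>} K ?F"
    using M by (intro submI) (auto simp: lin_zero[OF l] lin_add[OF l] lin_smult[OF l])
   fix t assume t: "t \<in> ?L"
   have "?h (sing u \<cdot>[?F] (a \<cdot>[?F] sing t) \<cdot>[?F] sing v) = \<zero>\<^bsub>M\<^esub>" if u: "u \<in> ?L" and v: "v \<in> ?L" for u v
   proof -
    have "sing u \<cdot>[?F] (a \<cdot>[?F] sing t) \<cdot>[?F] sing v = sing u \<cdot>[?F] a \<cdot>[?F] (sing t \<cdot>[?F] sing v)"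
     using u t v a' by (simp add: sf mult_assoc del: append_in_lists_conv)
    also have "sing t \<cdot>[?F] sing v = sing (t @ v)" by (simp add: free_sel conv_sing_sing)
    finally show ?thesis using a t u v unfolding J_def by simp
   qed
   then show "sing t \<in> {x \<in> carrier ?F. \<forall>u\<in>?L. \<forall>v\<in>?L. ?h (sing u \<cdot>[?F] (a \<cdot>[?F] x) \<cdot>[?F] sing v) = \<zero>\<^bsub>M\<^esub>}"
    using t sf by blast
  qed
  then show "a \<cdot>[?F] x \<in> J" unfolding J_def using a' x by auto
 qed
 moreover have hw: "?h (sing u \<cdot>[?F] letter K x \<cdot>[?F] sing v) = \<Phi> (u @ x # v)"
  if "u \<in> ?L" "v \<in> ?L" "x \<in> carrier V" for u v x
 proof -
  have "sing u \<cdot>[?F] letter K x \<cdot>[?F] sing v = sing (u @ x # v)"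
   by (simp add: free_sel conv_sing_sing letter_sing)
  then show ?thesis using that free_ext_sing[OF M P'] by simp
 qed
 have "tensor_rels V \<subseteq> J"
  unfolding tensor_rels_def J_def using V M
  by (auto simp: lin_minus[OF lin2] lin_add[OF lin2] lin_smult[OF lin2] hw
    lin_add[OF mlin_lin[OF P]] lin_smult[OF mlin_lin[OF P]] mlin_cl[OF P])
 ultimately have J: "tensor_ideal K V \<subseteq> J"
  unfolding tensor_ideal_rels by (simp add: gen_ideal_min)
 have h0: "?h i = \<zero>\<^bsub>M\<^esub>" if "i \<in> tensor_ideal K V" for i
 proof -
  have i: "i \<in> J" using that J by auto
  then have "?h (sing [] \<cdot>[?F] i \<cdot>[?F] sing []) = \<zero>\<^bsub>M\<^esub>" unfolding J_def by blast
  moreover have "sing [] \<cdot>[?F] i \<cdot>[?F] sing [] = i"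
   using i unfolding J_def free_sel(4)[of "carrier V",symmetric] by simp
  ultimately show ?thesis by simp
 qed
 \<comment> \<open>Elements of the quotient are representatives inside the free algebra, so the
   function \<open>?h\<close> itself is the induced map; it only has to be insensitive to the choice
   of representative.\<close>
 have hq: "?h (tproj V f) = ?h f" if f: "f \<in> carrier ?F" for f
 proof -
  obtain i where i: "i \<in> tensor_ideal K V" "tproj V f = i +[?F] f"
   using quot_proj_mem[OF free_assoc_algebra tensor_ideal[OF V] f] unfolding tproj_def by blast
  have "i \<in> carrier ?F" using i ideal_carrier[OF tensor_ideal[OF V]] by blast
  then show ?thesis using i h0 f lin_cl[OF h] M by (simp add: lin_add[OF h])
 qed
 note q = alg_hom_lin[OF tproj_hom[OF V]]
 have "lin K (T V) M ?h"
  by (rule linI) (use lin_cl[OF h] in \<open>auto simp: tproj_surj[OF V] hq lin_add[OF q, symmetric] lin_smult[OF q, symmetric]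
   lin_add[OF h] lin_smult[OF h]\<close>)
 moreover have "?h (pt V w) = \<Phi> w" if "w \<in> ?L" for w
  using that V by (simp only: pt_tproj hq sf free_ext_sing[OF M P'])
 ultimately show ?thesis by blast
qed

end

context fld
begin

lemma mlin_pt: "module K V ==> mlin V (T V) (pt V)"
proof (rule mlinI)
 fix u v assume "module K V" "u \<in> lists (carrier V)" "v \<in> lists (carrier V)"
 then have "lin K V (T V) (%x. pt V u *[V] (\<iota> K V x *[V] pt V v))"
  by (intro lin_mult_left lin_mult_right iota_lin) auto
 then show "lin K V (T V) (%x. pt V (u @ x # v))"
  using \<open>module K V\<close> \<open>u \<in> _\<close> \<open>v \<in> _\<close>
  by (subst lin_cong[of V _ "%x. pt V u *[V] (\<iota> K V x *[V] pt V v)"]) (auto simp: pt_append pt_Cons)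
qed auto

lemma mlin_comp: "mlin V M \<Phi> ==> lin K M N f ==> mlin V N (%w. f (\<Phi> w))"
 by (rule mlinI) (auto intro: lin_cl mlin_cl lin_comp'[OF mlin_lin])

lemma mlin_len: assumes "module K M" "mlin V M \<Phi>" shows "mlin V M (%w. if P (length w) then \<Phi> w else \<zero>\<^bsub>M\<^esub>)"
proof (rule mlinI)
 fix u v assume "u \<in> lists (carrier V)" "v \<in> lists (carrier V)"
 then show "lin K V M (%x. if P (length (u @ x # v)) then \<Phi> (u @ x # v) else \<zero>\<^bsub>M\<^esub>)"
  using assms mlin_lin by (cases "P (Suc (length u + length v))") (auto intro: lin_const_zero)
qed (use assms in \<open>auto intro: mlin_cl\<close>)

lemma lists_take_drop [simp]: "w \<in> lists X ==> take n w \<in> lists X" "w \<in> lists X ==> drop n w \<in> lists X"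
 by (auto simp: in_lists_conv_set dest: in_set_takeD in_set_dropD)

lemma mlin_split:
 assumes A: "assoc_algebra K A" and P: "mlin V A \<Phi>" and Q: "mlin V A \<Psi>"
 shows "mlin V A (%w. \<Phi> (take p w) \<cdot>[A] \<Psi> (drop p w))"
proof (rule mlinI)
 fix u v assume uv: "u \<in> lists (carrier V)" "v \<in> lists (carrier V)"
 show "lin K V A (%x. \<Phi> (take p (u @ x # v)) \<cdot>[A] \<Psi> (drop p (u @ x # v)))"
 proof (cases "p - length u")
  case 0
  then have "p \<le> length u" by simp
  then show ?thesis using 0 A uv by (simp, intro lin_mult_left mlin_lin[OF Q] mlin_cl[OF P]) auto
 next
  case (Suc j)
  then have "\<not> p \<le> length u" by simp
  then show ?thesis using Suc A uv by (simp, intro lin_mult_right mlin_lin[OF P] mlin_cl[OF Q]) auto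
 qed
qed (use A in \<open>auto intro!: mult_cl mlin_cl[OF P] mlin_cl[OF Q]\<close>)

definition bilin :: "('k, 'a, 'm) module_scheme \<Rightarrow> ('k, 'b, 'n) module_scheme \<Rightarrow> ('k, 'c, 'l) module_scheme \<Rightarrow> ('a \<Rightarrow> 'b \<Rightarrow> 'c) \<Rightarrow> bool"
 where "bilin V W M B \<longleftrightarrow> (\<forall>x\<in>carrier V. lin K W M (B x)) \<and> (\<forall>y\<in>carrier W. lin K V M (%x. B x y))"

lemma bilinI: "(\<And>x. x \<in> carrier V ==> lin K W M (B x)) ==> (\<And>y. y \<in> carrier W ==> lin K V M (%x. B x y)) ==> bilin V W M B"
 by (simp add: bilin_def)

lemma bilinD: "bilin V W M B ==> x \<in> carrier V ==> lin K W M (B x)" "bilin V W M B ==> y \<in> carrier W ==> lin K V M (%x. B x y)"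
 by (simp_all add: bilin_def)

lemma bilin_cl: "bilin V W M B ==> x \<in> carrier V ==> y \<in> carrier W ==> B x y \<in> carrier M"
 by (meson bilin_def lin_cl)

text \<open>Letting the letters of a word act one after the other is linear in each letter, so an
  operation of V on a module extends to all of T(V).\<close>

lemma mlin_foldr:
 assumes V: "module K V" and M: "module K M" and R: "bilin V M M R" and m: "m \<in> carrier M"
 shows "mlin V M (%w. foldr R w m)"
proof (rule mlinI)
 show cl: "foldr R w m \<in> carrier M" if "w \<in> lists (carrier V)" for w
  using that by (induction w) (auto simp: m bilin_cl[OF R])
 fix u v assume "u \<in> lists (carrier V)" "v \<in> lists (carrier V)"
 then show "lin K V M (%x. foldr R (u @ x # v) m)"
 proof (induction u)
  case Nil
  then show ?case using bilinD(2)[OF R cl] by simp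
 next
  case (Cons y u)
  then show ?case using lin_comp'[of V M "%x. foldr R (u @ x # v) m" M "R y"] bilinD(1)[OF R] by simp
 qed
qed

lemma mlin_rev: assumes "mlin V M \<Phi>" shows "mlin V M (%w. \<Phi> (rev w))"
 using assms mlin_lin[OF assms, of "rev _" "rev _"] by (intro mlinI) (auto intro!: mlin_cl simp: in_lists_conv_set)

lemma action_ext:
 assumes V: "module K V" and M: "module K M" and R: "bilin V M M R"
 shows "\<exists>act. bilin (T V) M M act \<and> (\<forall>w\<in>lists (carrier V). \<forall>m\<in>carrier M. act (pt V w) m = foldr R w m)"
proof -
 have "\<exists>h. lin K (T V) M h \<and> (\<forall>w\<in>lists (carrier V). h (pt V w) = foldr R w m)" if "m \<in> carrier M" for m
  using tensor_alg_ext[OF V M mlin_foldr[OF V M R that]] .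
 then obtain h where h: "\<And>m. m \<in> carrier M ==> lin K (T V) M (h m)"
  "\<And>m w. m \<in> carrier M ==> w \<in> lists (carrier V) ==> h m (pt V w) = foldr R w m"
  by metis
 have fl: "lin K M M (foldr R w)" if "w \<in> lists (carrier V)" for w
  using that
 proof (induction w)
  case (Cons a w)
  then show ?case using lin_comp[of M M "foldr R w" M "R a"] bilinD(1)[OF R] by (simp add: comp_def)
 qed (simp add: id_def)
 \<comment> \<open>The map \<open>h m\<close> was chosen separately for every \<open>m\<close>.
   Linearity in \<open>m\<close> is recovered from uniqueness: both sides are linear in
   \<open>a\<close> and agree on words.\<close>
 have hl: "lin K M M (%m. h m a)" if "a \<in> carrier (T V)" for a
 proof (rule linI)
  fix m assume m: "m \<in> carrier M"
  show "h m a \<in> carrier M" using lin_cl[OF h(1)[OF m] that] .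
  show "h (m +[M] m') a = h m a +[M] h m' a" if m': "m' \<in> carrier M" for m'
   by (rule T_lin_eq[OF \<open>a \<in> _\<close> V M h(1) lin_sum[OF M h(1)[OF m] h(1)[OF m']]])
    (use m m' M in \<open>simp_all add: h(2) lin_add[OF fl]\<close>)
  show "h (c *:[M] m) a = c *:[M] h m a" if c: "c \<in> carrier K" for c
   by (rule T_lin_eq[OF \<open>a \<in> _\<close> V M h(1) lin_scale[OF M c h(1)[OF m]]])
    (use m c M in \<open>simp_all add: h(2) lin_smult[OF fl]\<close>)
 qed
 have "bilin (T V) M M (%a m. h m a)" by (rule bilinI; fact h(1) hl)
 then show ?thesis using h(2) by blast
qed

lemma T_mult_lin_right:
 "module K V ==> y \<in> carrier (T V) ==> lin K (T V) (T V) (%x. x *[V] y)"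
 by (rule lin_mult_right) auto

lemma T_mult_lin_left:
 "module K V ==> y \<in> carrier (T V) ==> lin K (T V) (T V) (%x. y *[V] x)"
 by (rule lin_mult_left) auto

text \<open>T(V) is free, so an arbitrary bilinear operation of V makes the target a module over
  T(V). Algebra maps out of T(V) and both passes of the construction of its braiding come from such
  actions.\<close>

lemma left_action:
 assumes V: "module K V" and M: "module K M" and R: "bilin V M M R"
 obtains act where "bilin (T V) M M act" "\<And>m. m \<in> carrier M ==> act \<one>\<^bsub>T V\<^esub> m = m"
  "\<And>v m. v \<in> carrier V ==> m \<in> carrier M ==> act (\<iota> K V v) m = R v m"
  "\<And>a b m. a \<in> carrier (T V) ==> b \<in> carrier (T V) ==> m \<in> carrier M ==> act (a *[V] b) m = act a (act b m)"
proof -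
 obtain act where act: "bilin (T V) M M act"
  "\<And>w m. w \<in> lists (carrier V) ==> m \<in> carrier M ==> act (pt V w) m = foldr R w m"
  using action_ext[OF V M R] by blast
 have 1: "act (pt V w *[V] b) m = act (pt V w) (act b m)"
  if "w \<in> lists (carrier V)" "b \<in> carrier (T V)" "m \<in> carrier M" for w b m
 proof (rule T_lin_eq[OF that(2) V M])
  show "lin K (T V) M (%b. act (pt V w *[V] b) m)"
   by (rule lin_comp'[OF T_mult_lin_left[OF V pt_cl[OF V that(1)]] bilinD(2)[OF act(1) that(3)]])
  show "lin K (T V) M (%b. act (pt V w) (act b m))"
   by (rule lin_comp'[OF bilinD(2)[OF act(1) that(3)] bilinD(1)[OF act(1) pt_cl[OF V that(1)]]])
  show "act (pt V w *[V] pt V v) m = act (pt V w) (act (pt V v) m)" if "v \<in> lists (carrier V)" for v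
   using V that \<open>m \<in> _\<close> \<open>w \<in> _\<close> bilin_cl[OF act(1), of "pt V v" m] act(2)[of "w @ v" m]
   by (simp add: pt_append[symmetric] act(2))
 qed
 have 2: "act (a *[V] b) m = act a (act b m)"
  if "a \<in> carrier (T V)" "b \<in> carrier (T V)" "m \<in> carrier M" for a b m
  by (rule T_lin_eq[OF that(1) V M lin_comp'[OF T_mult_lin_right[OF V that(2)] bilinD(2)[OF act(1) that(3)]]
   bilinD(2)[OF act(1) bilin_cl[OF act(1) that(2,3)]]]) (rule 1[OF _ that(2,3)])
 show ?thesis
  by (rule that[OF act(1) _ _ 2]) (use act(2)[of "[]"] act(2)[of "[_]"] V in auto)
qed

text \<open>Reversing words is anti-multiplicative on T(V); composing it with a left action gives a
  right action.\<close>

lemma right_action: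
 assumes V: "module K V" and M: "module K M" and R: "bilin V M M R"
 obtains act where "bilin (T V) M M act" "\<And>m. m \<in> carrier M ==> act \<one>\<^bsub>T V\<^esub> m = m"
  "\<And>v m. v \<in> carrier V ==> m \<in> carrier M ==> act (\<iota> K V v) m = R v m"
  "\<And>a b m. a \<in> carrier (T V) ==> b \<in> carrier (T V) ==> m \<in> carrier M ==> act (a *[V] b) m = act b (act a m)"
proof -
 obtain h where h: "lin K (T V) (T V) h" "\<And>w. w \<in> lists (carrier V) ==> h (pt V w) = pt V (rev w)"
  using tensor_alg_ext[OF V _ mlin_rev[OF mlin_pt[OF V]]] V by auto
 have rl: "rev w \<in> lists (carrier V)" if "w \<in> lists (carrier V)" for w
  using that by (simp add: in_lists_conv_set)
 have h1: "h (a *[V] pt V w) = pt V (rev w) *[V] h a" if "a \<in> carrier (T V)" "w \<in> lists (carrier V)" for a w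
  by (rule T_lin_eq[OF that(1) V alg_mod[OF T_alg[OF V]] lin_comp'[OF T_mult_lin_right[OF V pt_cl[OF V that(2)]] h(1)]
   lin_comp'[OF h(1) T_mult_lin_left[OF V pt_cl[OF V rl[OF that(2)]]]]])
   (use V that(2) rl in \<open>auto simp: pt_append[symmetric] h\<close>)
 have h2: "h (a *[V] b) = h b *[V] h a" if "a \<in> carrier (T V)" "b \<in> carrier (T V)" for a b
  by (rule T_lin_eq[OF that(2) V alg_mod[OF T_alg[OF V]] lin_comp'[OF T_mult_lin_left[OF V that(1)] h(1)]
   lin_comp'[OF h(1) T_mult_lin_right[OF V lin_cl[OF h(1) that(1)]]]])
   (use that(1) in \<open>auto simp: h h1\<close>)
 obtain act where act: "bilin (T V) M M act" "\<And>m. m \<in> carrier M ==> act \<one>\<^bsub>T V\<^esub> m = m"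
  "\<And>v m. v \<in> carrier V ==> m \<in> carrier M ==> act (\<iota> K V v) m = R v m"
  "\<And>a b m. a \<in> carrier (T V) ==> b \<in> carrier (T V) ==> m \<in> carrier M ==> act (a *[V] b) m = act a (act b m)"
  using left_action[OF V M R] by blast
 have "bilin (T V) M M (%a. act (h a))"
  by (intro bilinI bilinD(1)[OF act(1)] lin_comp'[OF h(1) bilinD(2)[OF act(1)]] lin_cl[OF h(1)])
 then show ?thesis
  by (rule that) (use h(2)[of "[]"] h(2)[of "[_]"] V lin_cl[OF h(1)] in \<open>auto simp: act(2-4) h2\<close>)
qed

text \<open>V acts on \<open>A\<close> by left multiplication with \<open>f v\<close>. The resulting
  action of \<open>a\<close> is left multiplication by its value at the unit, which makes
  \<open>a\<close> \<mapsto> \<open>act a 1\<close> multiplicative.\<close>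

lemma alg_hom_ext:
 assumes V: "module K V" and A: "assoc_algebra K A" and f: "lin K V A f"
 shows "\<exists>h. alg_hom K (T V) A h \<and> (\<forall>v\<in>carrier V. h (\<iota> K V v) = f v)"
proof -
 have M: "module K A" using A by simp
 have R: "bilin V A A (%v x. f v \<cdot>[A] x)"
  using A lin_cl[OF f] by (intro bilinI lin_mult_left lin_mult_right f) auto
 obtain act where act: "bilin (T V) A A act" "\<And>m. m \<in> carrier A ==> act \<one>\<^bsub>T V\<^esub> m = m"
  "\<And>v m. v \<in> carrier V ==> m \<in> carrier A ==> act (\<iota> K V v) m = f v \<cdot>[A] m"
  "\<And>a b m. a \<in> carrier (T V) ==> b \<in> carrier (T V) ==> m \<in> carrier A ==> act (a *[V] b) m = act a (act b m)"
  using left_action[OF V M R] by blast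
 have "act (pt V w) m = act (pt V w) \<one>\<^bsub>A\<^esub> \<cdot>[A] m" if "w \<in> lists (carrier V)" "m \<in> carrier A" for w m
  using that(1)
 proof (induction w)
  case Nil
  then show ?case using A that act by simp
 next
  case (Cons v w)
  then show ?case using A V that lin_cl[OF f] bilin_cl[OF act(1), of "pt V w"]
   by (simp add: pt_Cons act mult_assoc[OF A])
 qed
 then have 1: "act a m = act a \<one>\<^bsub>A\<^esub> \<cdot>[A] m" if "a \<in> carrier (T V)" "m \<in> carrier A" for a m
  by (rule T_lin_eq[OF that(1) V M bilinD(2)[OF act(1) that(2)]
   lin_mult_right[OF A that(2) bilinD(2)[OF act(1) one_cl[OF A]]]]) (use that(2) in auto)
 have "alg_hom K (T V) A (%a. act a \<one>\<^bsub>A\<^esub>)"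
  using A V act 1[of _ "act _ \<one>\<^bsub>A\<^esub>"] bilin_cl[OF act(1)]
  by (intro alg_homI bilinD(2)[OF act(1)]) auto
 then show ?thesis using act A lin_cl[OF f] by (intro exI[of _ "%a. act a \<one>\<^bsub>A\<^esub>"]) auto
qed

lemma alg_hom_pt_eq:
 assumes V: "module K V" and A: "assoc_algebra K A" and f: "alg_hom K (T V) A f" "alg_hom K (T V) A g"
  and eq: "\<And>v. v \<in> carrier V ==> f (\<iota> K V v) = g (\<iota> K V v)" and t: "t \<in> carrier (T V)"
 shows "f t = g t"
proof (rule T_lin_eq[OF t V _ alg_hom_lin[OF f(1)] alg_hom_lin[OF f(2)]])
 fix w assume "w \<in> lists (carrier V)"
 then show "f (pt V w) = g (pt V w)"
  using V by (induction w) (auto simp: pt_Cons alg_hom_mult[OF f(1)] alg_hom_mult[OF f(2)] alg_hom_one[OF f(1)] alg_hom_one[OF f(2)] eq)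
qed (use A in auto)

lemma lin_ext:
 assumes V: "module K V" and M: "module K M" and f: "lin K V M f"
 shows "\<exists>h. lin K (T V) M h \<and> (\<forall>v\<in>carrier V. h (\<iota> K V v) = f v) \<and> (\<forall>w\<in>lists (carrier V). length w \<noteq> 1 \<longrightarrow> h (pt V w) = \<zero>\<^bsub>M\<^esub>)"
proof -
 have "mlin V M (%w. if length w = 1 then f (hd w) else \<zero>\<^bsub>M\<^esub>)"
 proof (rule mlinI)
  fix w assume w: "w \<in> lists (carrier V)"
  show "(if length w = 1 then f (hd w) else \<zero>\<^bsub>M\<^esub>) \<in> carrier M"
   using w M by (cases w) (auto intro: lin_cl[OF f])
 next
  fix u v assume "u \<in> lists (carrier V)" "v \<in> lists (carrier V)"
  then show "lin K V M (%x. if length (u @ x # v) = 1 then f (hd (u @ x # v)) else \<zero>\<^bsub>M\<^esub>)"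
   using f M by (cases "u = [] \<and> v = []") (auto intro: lin_const_zero)
 qed
 from tensor_alg_ext[OF V M this] obtain h where h: "lin K (T V) M h"
  "\<And>w. w \<in> lists (carrier V) ==> h (pt V w) = (if length w = 1 then f (hd w) else \<zero>\<^bsub>M\<^esub>)" by blast
 have "h (\<iota> K V v) = f v" if "v \<in> carrier V" for v using h(2)[of "[v]"] that V by simp
 then show ?thesis using h by auto
qed

lemma bilin_ext:
 assumes V: "module K V" and M: "module K M" and B: "bilin V V M B"
 shows "\<exists>h. lin K (T V) M h \<and> (\<forall>x\<in>carrier V. \<forall>y\<in>carrier V. h (\<iota> K V x *[V] \<iota> K V y) = B x y)"
proof -
 have "mlin V M (%w. if length w = 2 then B (w ! 0) (w ! 1) else \<zero>\<^bsub>M\<^esub>)"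
 proof (rule mlinI)
  fix w assume w: "w \<in> lists (carrier V)"
  show "(if length w = 2 then B (w ! 0) (w ! 1) else \<zero>\<^bsub>M\<^esub>) \<in> carrier M"
   using w M by (auto simp: in_lists_conv_set intro!: bilin_cl[OF B])
 next
  fix u v assume uv: "u \<in> lists (carrier V)" "v \<in> lists (carrier V)"
  consider y where "u = [y]" "v = []" | y where "u = []" "v = [y]" | "Suc (length u + length v) \<noteq> 2"
   by (cases u; cases v) (auto simp: length_Suc_conv)
  then show "lin K V M (%x. if length (u @ x # v) = 2 then B ((u @ x # v) ! 0) ((u @ x # v) ! 1) else \<zero>\<^bsub>M\<^esub>)"
   using uv M bilinD[OF B] by cases (auto intro: lin_const_zero)
 qed
 from tensor_alg_ext[OF V M this] obtain h where h: "lin K (T V) M h"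
  "\<And>w. w \<in> lists (carrier V) ==> h (pt V w) = (if length w = 2 then B (w ! 0) (w ! 1) else \<zero>\<^bsub>M\<^esub>)" by blast
 have "h (\<iota> K V x *[V] \<iota> K V y) = B x y" if "x \<in> carrier V" "y \<in> carrier V" for x y
  using h(2)[of "[x, y]"] that V by (simp add: pt_Cons)
 then show ?thesis using h(1) by blast
qed

lemma lists_len2: "w \<in> lists X ==> length w = 2 ==> \<exists>x y. w = [x, y] \<and> x \<in> X \<and> y \<in> X"
 by (auto simp: numeral_2_eq_2 length_Suc_conv)

lemma tp2_lin_eq:
 assumes "t \<in> tp V 2" "module K V" "module K M" "lin K (tpm1 V 2) M f" "lin K (tpm1 V 2) M g"
  and "\<And>x y. x \<in> carrier V ==> y \<in> carrier V ==> f (\<iota> K V x *[V] \<iota> K V y) = g (\<iota> K V x *[V] \<iota> K V y)"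
 shows "f t = g t"
proof (rule tp_lin_eq[OF assms(1-5)])
 fix w assume w: "w \<in> lists (carrier V)" "length w = 2"
 then show "f (pt V w) = g (pt V w)" using lists_len2[OF w] assms(2,6) by (auto simp: pt_Cons)
qed

lemma tp1_eq: assumes V: "module K V" shows "tp V 1 = \<iota> K V ` carrier V"
proof
 show "\<iota> K V ` carrier V \<subseteq> tp V 1" using iota_tp(1)[OF V] by auto
 note l = iota_lin[OF V]
 have "submodule (\<iota> K V ` carrier V) K (T V)"
 proof (rule submI)
  show "\<zero>\<^bsub>T V\<^esub> \<in> \<iota> K V ` carrier V" using V lin_zero[OF l V] by (intro image_eqI[of _ _ "\<zero>\<^bsub>V\<^esub>"]) auto
 next
  fix x y assume "x \<in> \<iota> K V ` carrier V" "y \<in> \<iota> K V ` carrier V"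
  then show "x +[T V] y \<in> \<iota> K V ` carrier V" using V by (auto simp: lin_add[OF l, symmetric])
 next
  fix a x assume "a \<in> carrier K" "x \<in> \<iota> K V ` carrier V"
  then show "a *:[T V] x \<in> \<iota> K V ` carrier V" using V by (auto simp: lin_smult[OF l, symmetric])
 qed (use V in auto)
 moreover have "pt V ` {w \<in> lists (carrier V). length w \<in> {1}} \<subseteq> \<iota> K V ` carrier V"
  using V by (auto simp: length_Suc_conv)
 ultimately show "tp V 1 \<subseteq> \<iota> K V ` carrier V" unfolding tpow_wsp wsp_def by (rule lspan_min)
qed

lemma tp1E: assumes "module K V" "t \<in> tp V 1" obtains x where "x \<in> carrier V" "t = \<iota> K V x"
 using assms tp1_eq by auto

lemma iota_inj: assumes V: "module K V" and xy: "x \<in> carrier V" "y \<in> carrier V" "\<iota> K V x = \<iota> K V y" shows "x = y"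
proof -
 obtain h where "lin K (T V) V h" "\<forall>v\<in>carrier V. h (\<iota> K V v) = v" using lin_ext[OF V V lin_id(2)] by blast
 then show ?thesis using xy by metis
qed

lemma tpow_ext:
 assumes V: "module K V" and M: "module K M" and f: "lin K (tpm1 V n) M f"
 shows "\<exists>h. lin K (T V) M h \<and> (\<forall>t\<in>tp V n. h t = f t) \<and> (\<forall>w\<in>lists (carrier V). length w \<noteq> n \<longrightarrow> h (pt V w) = \<zero>\<^bsub>M\<^esub>)"
proof -
 have "mlin V M (%w. if length w = n then f (pt V w) else \<zero>\<^bsub>M\<^esub>)"
 proof (rule mlinI)
  fix w assume w: "w \<in> lists (carrier V)"
  then show "(if length w = n then f (pt V w) else \<zero>\<^bsub>M\<^esub>) \<in> carrier M"
   using w M by (auto intro!: lin_cl[OF f] pt_tp)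
 next
  fix u v assume uv: "u \<in> lists (carrier V)" "v \<in> lists (carrier V)"
  show "lin K V M (%x. if length (u @ x # v) = n then f (pt V (u @ x # v)) else \<zero>\<^bsub>M\<^esub>)"
  \<comment> \<open>Only the length of the word matters here, so a dummy letter stands for the
    variable one.\<close>
  proof (cases "length (u @ undefined # v) = n")
   case True
   have "lin K V (tpm1 V n) (%x. pt V (u @ x # v))"
    using uv True by (intro lin_subI mlin_lin[OF mlin_pt[OF V]]) (auto intro!: pt_tp)
   from lin_comp'[OF this f] show ?thesis using True by simp
  qed (use M in \<open>auto intro: lin_const_zero\<close>)
 qed
 from tensor_alg_ext[OF V M this] obtain h where h: "lin K (T V) M h"
  "\<And>w. w \<in> lists (carrier V) ==> h (pt V w) = (if length w = n then f (pt V w) else \<zero>\<^bsub>M\<^esub>)" by blast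
 have "h t = f t" if "t \<in> tp V n" for t
  using h wsp_cl_tp[OF V] by (intro tp_lin_eq[OF that V M _ f] lin_sub) auto
 then show ?thesis using h by auto
qed

section \<open>Functoriality of the tensor algebra\<close>

text \<open>The functor T on linear maps. In degree n it is the n-th tensor power of
  \<open>f\<close>; in degree 2 it takes the place of \<open>tsquare\<close> in everything that
  follows.\<close>

definition Tm :: "('k, 'a, 'm) module_scheme \<Rightarrow> ('k, 'b, 'n) module_scheme \<Rightarrow> ('a \<Rightarrow> 'b) \<Rightarrow> ('a list \<Rightarrow> 'k) \<Rightarrow> ('b list \<Rightarrow> 'k)" where
 "Tm V W f = (SOME h. alg_hom K (T V) (T W) h \<and> (\<forall>v\<in>carrier V. h (\<iota> K V v) = \<iota> K W (f v)))"

context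
 fixes V :: "('k, 'a, 'm) module_scheme" and W :: "('k, 'b, 'n) module_scheme" and f
 assumes V: "module K V" and W: "module K W" and f: "lin K V W f"
begin

lemma Tm_spec: "alg_hom K (T V) (T W) (Tm V W f) \<and> (\<forall>v\<in>carrier V. Tm V W f (\<iota> K V v) = \<iota> K W (f v))"
 unfolding Tm_def
 by (rule someI_ex[OF alg_hom_ext[OF V T_alg[OF W] lin_comp'[OF f iota_lin[OF W]]]])

lemma Tm_hom: "alg_hom K (T V) (T W) (Tm V W f)"
 using Tm_spec by blast

lemma Tm_iota [simp]: "v \<in> carrier V ==> Tm V W f (\<iota> K V v) = \<iota> K W (f v)"
 using Tm_spec by blast

lemma Tm_lin: "lin K (T V) (T W) (Tm V W f)"
 using Tm_hom by (rule alg_hom_lin)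

lemma Tm_cl [simp]: "t \<in> carrier (T V) ==> Tm V W f t \<in> carrier (T W)"
 by (rule lin_cl[OF Tm_lin])

lemma Tm_mult: "s \<in> carrier (T V) ==> t \<in> carrier (T V) ==> Tm V W f (s *[V] t) = Tm V W f s *[W] Tm V W f t"
 by (rule alg_hom_mult[OF Tm_hom])

lemma Tm_one [simp]: "Tm V W f \<one>\<^bsub>T V\<^esub> = \<one>\<^bsub>T W\<^esub>"
 by (rule alg_hom_one[OF Tm_hom])

lemma map_lists: "w \<in> lists (carrier V) ==> map f w \<in> lists (carrier W)"
 using lin_cl[OF f] by (induction w) auto

lemma Tm_pt: "w \<in> lists (carrier V) ==> Tm V W f (pt V w) = pt W (map f w)"
 using V by (induction w) (auto simp: pt_Cons Tm_mult)

lemma Tm_wsp: "t \<in> wsp V N ==> Tm V W f t \<in> wsp W N"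
 by (rule wsp_image[OF _ V _ Tm_lin wsp_subm[OF W]]) (use W in \<open>auto simp: Tm_pt map_lists intro: pt_wsp\<close>)

lemma Tm_tp: "t \<in> tp V n ==> Tm V W f t \<in> tp W n"
 unfolding tpow_wsp by (rule Tm_wsp)

lemma Tm_tp_lin: "lin K (tpm1 V n) (tpm1 W n) (Tm V W f)"
 by (intro lin_subI lin_sub Tm_lin) (use wsp_cl_tp[OF V] Tm_tp in auto)

text \<open>This permits identities on the tensor powers of a quotient to be verified on images of
  tensors upstairs, in the same degrees.\<close>

lemma Tm_surj:
 assumes s: "f ` carrier V = carrier W" and t: "t \<in> wsp W N"
 obtains t' where "t' \<in> wsp V N" "t = Tm V W f t'"
proof -
 have "submodule (Tm V W f ` wsp V N) K (T W)"
 proof (rule submI)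
  show "Tm V W f ` wsp V N \<subseteq> carrier (T W)" using wsp_cl[OF V, of _ N] by auto
  show "\<zero>\<^bsub>T W\<^esub> \<in> Tm V W f ` wsp V N" using V W lin_zero[OF Tm_lin] subm_zero[OF _ wsp_subm[OF V]]
   by (intro image_eqI[of _ _ "\<zero>\<^bsub>T V\<^esub>"]) auto
 next
  fix x y assume "x \<in> Tm V W f ` wsp V N" "y \<in> Tm V W f ` wsp V N"
  then show "x +[T W] y \<in> Tm V W f ` wsp V N"
   using V wsp_cl[OF V, of _ N] subm_add[OF _ wsp_subm[OF V]] by (auto simp: lin_add[OF Tm_lin, symmetric])
 next
  fix a x assume "a \<in> carrier K" "x \<in> Tm V W f ` wsp V N"
  then show "a *:[T W] x \<in> Tm V W f ` wsp V N"
   using V wsp_cl[OF V, of _ N] subm_smult[OF _ wsp_subm[OF V]] by (auto simp: lin_smult[OF Tm_lin, symmetric])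
 qed (use W in auto)
 moreover have "pt W w \<in> Tm V W f ` wsp V N" if "w \<in> lists (carrier W)" "length w \<in> N" for w
 proof -
  have "\<exists>w'\<in>lists (carrier V). w = map f w'" using that(1)
  proof (induction w)
   case (Cons a w)
   then have "a \<in> f ` carrier V" using s by simp
   then obtain a' where "a' \<in> carrier V" "a = f a'" by blast
   moreover obtain w' where "w' \<in> lists (carrier V)" "w = map f w'" using Cons by blast
   ultimately show ?case by (intro bexI[of _ "a' # w'"]) auto
  qed simp
  then obtain w' where w': "w' \<in> lists (carrier V)" "w = map f w'" by blast
  then show ?thesis using that pt_wsp[of w' V N] by (auto simp: Tm_pt intro!: image_eqI[of _ _ "pt V w'"])
 qed
 ultimately have "wsp W N \<subseteq> Tm V W f ` wsp V N" unfolding wsp_def by (intro lspan_min) auto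
 then show thesis using t that by blast
qed

end

lemma Tm_cong: assumes "\<And>x. x \<in> carrier V ==> f x = g x" shows "Tm V W f = Tm V W g"
 unfolding Tm_def using assms by simp

lemma Tm_id [simp]: "module K V ==> t \<in> carrier (T V) ==> Tm V V (%x. x) t = t"
 by (rule alg_hom_pt_eq[of V "T V" _ "%x. x"]) (auto intro: Tm_hom alg_homI)

lemma Tm_Tm:
 assumes "module K V" "module K W" "module K X" and f: "lin K V W f" and g: "lin K W X g" and "t \<in> carrier (T V)"
 shows "Tm W X g (Tm V W f t) = Tm V X (%x. g (f x)) t"
proof -
 note gf = lin_comp'[OF f g]
 have "alg_hom K (T V) (T X) (%t. Tm W X g (Tm V W f t))"
  using alg_hom_comp[OF Tm_hom Tm_hom] assms by (simp add: comp_def)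
 from alg_hom_pt_eq[OF assms(1) T_alg[OF assms(3)] this Tm_hom[OF assms(1,3) gf]]
 show ?thesis using assms gf by (simp add: lin_cl[OF f])
qed

text \<open>A linear retraction of \<open>f\<close> gives, by functoriality, a retraction of all its
  tensor powers. Injectivity of the tensor square of an inclusion of subspaces is obtained in this
  way.\<close>

lemma Tm_inj:
 assumes "module K V" "module K W" "lin K V W f" "lin K W V g" "\<And>x. x \<in> carrier V ==> g (f x) = x"
  "s \<in> carrier (T V)" "t \<in> carrier (T V)" "Tm V W f s = Tm V W f t"
 shows "s = t"
proof -
 have "Tm W V g (Tm V W f r) = r" if "r \<in> carrier (T V)" for r
 proof -
  have "Tm W V g (Tm V W f r) = Tm V V (%x. g (f x)) r" by (rule Tm_Tm) (use assms that in auto)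
  also have "\<dots> = Tm V V (%x. x) r" using Tm_cong[of V "%x. g (f x)" "%x. x" V] assms by simp
  finally show ?thesis using assms that by simp
 qed
 then show ?thesis using assms by metis
qed

end

context fld
begin

section \<open>Operators on tensor powers\<close>

definition lop :: "('k, 'a, 'm) module_scheme \<Rightarrow> nat \<Rightarrow> nat \<Rightarrow> (('a list \<Rightarrow> 'k) \<Rightarrow> ('a list \<Rightarrow> 'k)) \<Rightarrow> bool"
 where "lop V p q f \<longleftrightarrow> lin K (tpm1 V p) (tpm1 V q) f"

text \<open>\<open>sh V i p f\<close> is \<open>V\<^sup>\<otimes>\<^sup>i \<otimes> f \<otimes> id\<close> for \<open>f\<close> defined on \<open>V\<^sup>\<otimes>\<^sup>p\<close>, on all tensor powers at once; it vanishes
 in degrees below \<open>i + p\<close>.\<close>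

definition sh :: "('k, 'a, 'm) module_scheme \<Rightarrow> nat \<Rightarrow> nat \<Rightarrow> (('a list \<Rightarrow> 'k) \<Rightarrow> ('a list \<Rightarrow> 'k)) \<Rightarrow> ('a list \<Rightarrow> 'k) \<Rightarrow> ('a list \<Rightarrow> 'k)"
 where "sh V i p f = (SOME h. lin K (T V) (T V) h \<and> (\<forall>w\<in>lists (carrier V). h (pt V w) =
  (if i + p \<le> length w then pt V (take i w) *[V] (f (pt V (take p (drop i w))) *[V] pt V (drop (i + p) w)) else \<zero>\<^bsub>T V\<^esub>)))"

lemma lop_cl: "lop V p q f ==> t \<in> tp V p ==> f t \<in> tp V q"
 unfolding lop_def by (auto dest: lin_cl)

lemma lop_lin: "module K V ==> lop V p q f ==> lin K (tpm1 V p) (T V) f"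
 unfolding lop_def by (erule lin_subD) (auto simp: wsp_cl_tp)

lemma lopI: "module K V ==> lin K (T V) (T V) f ==> (\<And>t. t \<in> tp V p ==> f t \<in> tp V q) ==> lop V p q f"
 unfolding lop_def by (rule lin_subI, rule lin_sub) (auto simp: wsp_cl_tp)

lemma lop_cl2: assumes "module K V" "lop V p q f" "t \<in> tp V p" shows "f t \<in> carrier (T V)"
 by (rule wsp_cl_tp[OF assms(1) lop_cl[OF assms(2,3)]])

lemma lop_id [simp]: "lop V p p id" "lop V p p (%t. t)"
 unfolding lop_def by simp_all

lemma sh_cong: 
 assumes "\<And>t. t \<in> tp V p ==> f t = g t" shows "sh V i p f = sh V i p g"
proof -
 have "f (pt V (take p (drop i w))) = g (pt V (take p (drop i w)))" if "w \<in> lists (carrier V)" "i + p \<le> length w" for w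
  using that by (intro assms pt_tp) auto
 then show ?thesis unfolding sh_def by (intro arg_cong[where f = Eps] ext) (auto split: if_splits)
qed

context
 fixes V :: "('k, 'a, 'm) module_scheme"
 assumes V: "module K V"
begin

lemma pt_split3: "w \<in> lists (carrier V) ==>
 pt V w = pt V (take i w) *[V] (pt V (take p (drop i w)) *[V] pt V (drop (i + p) w))"
 using V pt_append[of V "take i w" "take p (drop i w) @ drop (i + p) w"] pt_append[of V "take p (drop i w)" "drop (i + p) w"]
  append_take_drop_id[of p "drop i w"] by (simp add: add.commute)

lemma sh_spec: assumes f: "lop V p q f"
 shows "lin K (T V) (T V) (sh V i p f) \<and> (\<forall>w\<in>lists (carrier V). sh V i p f (pt V w) =
  (if i + p \<le> length w then pt V (take i w) *[V] (f (pt V (take p (drop i w))) *[V] pt V (drop (i + p) w)) else \<zero>\<^bsub>T V\<^esub>))"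
proof -
 have TV: "module K (T V)" using V by simp
 \<comment> \<open>\<open>f\<close> is linear only on the p-th tensor power; its extension by zero
   to T(V) makes the multilinear extension principle applicable, and the two agree on the block of
   \<open>p\<close> letters that is read.\<close>
 obtain f' where f': "lin K (T V) (T V) f'" "\<And>t. t \<in> tp V p ==> f' t = f t"
  using tpow_ext[OF V TV lop_lin[OF V f]] by blast
 note m1 = mlin_split[OF T_alg[OF V] mlin_comp[OF mlin_pt[OF V] f'(1)] mlin_pt[OF V], of p]
 note m2 = mlin_len[OF TV mlin_split[OF T_alg[OF V] mlin_pt[OF V] m1, of i], of "%n. i + p \<le> n"]
 obtain h where h: "lin K (T V) (T V) h" "\<forall>w\<in>lists (carrier V). h (pt V w) = (if i + p \<le> length w
    then pt V (take i w) *[V] (f' (pt V (take p (drop i w))) *[V] pt V (drop p (drop i w))) else \<zero>\<^bsub>T V\<^esub>)"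
  using tensor_alg_ext[OF V TV m2] by blast
 have "f' (pt V (take p (drop i w))) = f (pt V (take p (drop i w)))" if "w \<in> lists (carrier V)" "i + p \<le> length w" for w
  using that by (intro f'(2) pt_tp) auto
 then have "\<exists>h. lin K (T V) (T V) h \<and> (\<forall>w\<in>lists (carrier V). h (pt V w) =
  (if i + p \<le> length w then pt V (take i w) *[V] (f (pt V (take p (drop i w))) *[V] pt V (drop (i + p) w)) else \<zero>\<^bsub>T V\<^esub>))"
  using h by (intro exI[of _ h]) (auto simp: add.commute)
 then show ?thesis unfolding sh_def by (rule someI_ex)
qed

lemma sh_lin: "lop V p q f ==> lin K (T V) (T V) (sh V i p f)"
 using sh_spec by blast

lemma sh_pt: "lop V p q f ==> w \<in> lists (carrier V) ==> sh V i p f (pt V w) =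
  (if i + p \<le> length w then pt V (take i w) *[V] (f (pt V (take p (drop i w))) *[V] pt V (drop (i + p) w)) else \<zero>\<^bsub>T V\<^esub>)"
 using sh_spec by blast

lemma sh_cl: "lop V p q f ==> t \<in> carrier (T V) ==> sh V i p f t \<in> carrier (T V)"
 by (rule lin_cl[OF sh_lin])

lemma sh_wsp:
 assumes f: "lop V p q f" and t: "t \<in> wsp V N" and L: "\<And>n. n \<in> N ==> i + p \<le> n ==> n - p + q \<in> L"
 shows "sh V i p f t \<in> wsp V L"
proof (rule wsp_image[OF t V alg_mod[OF T_alg[OF V]] sh_lin[OF f] wsp_subm[OF V]])
 fix w assume w: "w \<in> lists (carrier V)" "length w \<in> N"
 show "sh V i p f (pt V w) \<in> wsp V L"
 proof (cases "i + p \<le> length w")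
  case True
  have 1: "pt V (take i w) \<in> wsp V {i}" "pt V (drop (i + p) w) \<in> wsp V {length w - (i + p)}"
   using w True by (auto intro!: pt_wsp)
  have 2: "f (pt V (take p (drop i w))) \<in> wsp V {q}"
   unfolding tpow_wsp[symmetric] using w True by (intro lop_cl[OF f] pt_tp) auto
  have "pt V (take i w) *[V] (f (pt V (take p (drop i w))) *[V] pt V (drop (i + p) w)) \<in> wsp V {length w - p + q}"
   by (rule wsp_mult[OF 1(1) wsp_mult[OF 2 1(2) V, of "{q + (length w - (i + p))}"] V]) (use True in auto)
  then show ?thesis using sh_pt[OF f w(1)] True wsp_mono[of "{length w - p + q}" L V] L w(2) by auto
 next
  case False
  then show ?thesis using sh_pt[OF f w(1)] V subm_zero[OF _ wsp_subm[OF V]] by simp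
 qed
qed

lemma sh_tge: "lop V p q f ==> t \<in> tge V n ==> m + p \<le> n + q ==> p \<le> n ==> sh V i p f t \<in> tge V m"
 by (rule sh_wsp) auto

lemma sh_tp: "lop V p q f ==> t \<in> tp V n ==> m + p = n + q ==> sh V i p f t \<in> tp V m"
 unfolding tpow_wsp by (rule sh_wsp) auto

lemma sh_left:
 assumes f: "lop V p q f" and x: "x \<in> tp V m" and t: "t \<in> carrier (T V)"
 shows "sh V (m + i) p f (x *[V] t) = x *[V] sh V i p f t"
proof -
 have 1: "sh V (m + i) p f (pt V u *[V] t) = pt V u *[V] sh V i p f t" if u: "u \<in> lists (carrier V)" "length u = m" for u
 proof (rule T_lin_eq[OF t V _ lin_comp'[OF T_mult_lin_left sh_lin[OF f]] lin_comp'[OF sh_lin[OF f] T_mult_lin_left]])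
  fix w assume w: "w \<in> lists (carrier V)"
  have "sh V (m + i) p f (pt V (u @ w)) = pt V u *[V] sh V i p f (pt V w)"
  proof (cases "i + p \<le> length w")
   case True
   have "f (pt V (take p (drop i w))) \<in> carrier (T V)"
    using w True by (intro lop_cl2[OF V f] pt_tp) auto
   then show ?thesis using u w V True sh_pt[OF f, of "u @ w"] sh_pt[OF f, of w] by (simp add: pt_append mult_assoc)
  next
   case False
   then show ?thesis using u w V sh_pt[OF f, of "u @ w"] sh_pt[OF f, of w] by simp
  qed
  then show "sh V (m + i) p f (pt V u *[V] pt V w) = pt V u *[V] sh V i p f (pt V w)"
   using u w V by (simp add: pt_append)
 qed (use V u in auto)
 show ?thesis
  by (rule wsp_lin_eq'[OF x[unfolded tpow_wsp] V _ lin_comp'[OF T_mult_lin_right sh_lin[OF f]] T_mult_lin_right])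
   (use V t 1 sh_cl[OF f t] in auto)
qed

text \<open>The lower bound on the degree of \<open>t\<close> ensures that every factor read by
  \<open>f\<close> comes from \<open>t\<close> and none from \<open>y\<close>.\<close>

lemma sh_right:
 assumes f: "lop V p q f" and t: "t \<in> tge V (i + p)" and y: "y \<in> carrier (T V)"
 shows "sh V i p f (t *[V] y) = sh V i p f t *[V] y"
proof -
 have 1: "sh V i p f (pt V u *[V] y) = sh V i p f (pt V u) *[V] y" if u: "u \<in> lists (carrier V)" "i + p \<le> length u" for u
 proof (rule T_lin_eq[OF y V _ lin_comp'[OF T_mult_lin_left sh_lin[OF f]] T_mult_lin_left])
  fix w assume w: "w \<in> lists (carrier V)"
  have "f (pt V (take p (drop i u))) \<in> carrier (T V)"
   using u by (intro lop_cl2[OF V f] pt_tp) auto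
  then have "sh V i p f (pt V (u @ w)) = sh V i p f (pt V u) *[V] pt V w"
   using u w V sh_pt[OF f, of "u @ w"] sh_pt[OF f, of u] by (simp add: pt_append mult_assoc)
  then show "sh V i p f (pt V u *[V] pt V w) = sh V i p f (pt V u) *[V] pt V w"
   using u w V by (simp add: pt_append)
 qed (use V u sh_cl[OF f] in auto)
 show ?thesis
  by (rule wsp_lin_eq'[OF t V _ lin_comp'[OF T_mult_lin_right sh_lin[OF f]] lin_comp'[OF sh_lin[OF f] T_mult_lin_right]])
   (use V y 1 in auto)
qed

lemma sh_base: assumes f: "lop V p q f" and t: "t \<in> tp V p" shows "sh V 0 p f t = f t"
proof (rule tp_lin_eq[OF t V _ lin_sub[OF sh_lin[OF f]] lop_lin[OF V f]])
 fix w assume w: "w \<in> lists (carrier V)" "length w = p"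
 have "f (pt V w) \<in> carrier (T V)" using w by (intro lop_cl2[OF V f] pt_tp) auto
 then show "sh V 0 p f (pt V w) = f (pt V w)" using sh_pt[OF f w(1), of 0] w V by simp
qed (use V wsp_cl_tp in auto)

lemma sh_base_left: assumes f: "lop V p q f" and x: "x \<in> tp V i" and t: "t \<in> tp V p" shows "sh V i p f (x *[V] t) = x *[V] f t"
 using sh_left[OF f x wsp_cl_tp[OF V t], of 0] sh_base[OF f t] by simp

lemma sh_mid:
 assumes f: "lop V p q f" and x: "x \<in> tp V i" and t: "t \<in> tp V p" and y: "y \<in> carrier (T V)"
 shows "sh V i p f (x *[V] (t *[V] y)) = x *[V] (f t *[V] y)"
proof -
 have "x \<in> carrier (T V)" "t \<in> carrier (T V)" "f t \<in> carrier (T V)"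
  using x t lop_cl[OF f t] wsp_cl_tp[OF V] by auto
 moreover have "x *[V] t \<in> tge V (i + p)"
  by (rule tp_tge[OF tp_mult[OF V x t refl]]) simp
 ultimately show ?thesis
  using sh_right[OF f _ y, of "x *[V] t" i] sh_base_left[OF f x t] V y by (simp add: mult_assoc)
qed

text \<open>Interchange law: the two operators read disjoint blocks separated by \<open>d\<close>
  factors. The position of the right one changes from \<open>i + p + d\<close> to
  \<open>i + q + d\<close> because \<open>f\<close> replaces \<open>p\<close> factors by
  \<open>q\<close>.\<close>

lemma sh_comm:
 assumes f: "lop V p q f" and g: "lop V r s g" and t: "t \<in> tge V (i + p + d + r)"
 shows "sh V i p f (sh V (i + p + d) r g t) = sh V (i + q + d) r g (sh V i p f t)"
proof (rule wsp_lin_eq'[OF t V _ lin_comp'[OF sh_lin[OF g] sh_lin[OF f]] lin_comp'[OF sh_lin[OF f] sh_lin[OF g]]])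
 fix w assume w: "w \<in> lists (carrier V)" "length w \<in> {i + p + d + r..}"
 define u a b c e where "u = pt V (take i w)" "a = pt V (take p (drop i w))" "b = pt V (take d (drop (i + p) w))"
  "c = pt V (take r (drop (i + p + d) w))" "e = pt V (drop (i + p + d + r) w)"
 note defs = this
 have tps: "u \<in> tp V i" "a \<in> tp V p" "b \<in> tp V d" "c \<in> tp V r" "e \<in> carrier (T V)"
  unfolding defs using w V by (auto intro!: pt_tp)
 have fg: "f a \<in> tp V q" "g c \<in> tp V s" using tps lop_cl[OF f] lop_cl[OF g] by auto
 have cl: "u \<in> carrier (T V)" "a \<in> carrier (T V)" "b \<in> carrier (T V)" "c \<in> carrier (T V)"
  "f a \<in> carrier (T V)" "g c \<in> carrier (T V)"
  using tps fg wsp_cl_tp[OF V] by auto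
 have d1: "drop (i + p) w \<in> lists (carrier V)" using w by simp
 have pw: "pt V w = u *[V] (a *[V] (b *[V] (c *[V] e)))"
  unfolding defs using pt_split3[OF w(1), of i p] pt_split3[OF d1, of d r] by (simp add: ac_simps)
 have uab: "u *[V] (a *[V] b) \<in> tp V (i + p + d)" "u *[V] (f a *[V] b) \<in> tp V (i + q + d)"
  using tp_mult[OF V tps(1) tp_mult[OF V tps(2,3) refl]] tp_mult[OF V tps(1) tp_mult[OF V fg(1) tps(3) refl]]
  by (auto simp: add.assoc)
 have A: "x *[V] (y *[V] (b *[V] z)) = (x *[V] (y *[V] b)) *[V] z"
  if "x \<in> carrier (T V)" "y \<in> carrier (T V)" "z \<in> carrier (T V)" for x y z
  using that cl V by (simp add: mult_assoc)
 have "sh V (i + p + d) r g (pt V w) = u *[V] (a *[V] (b *[V] (g c *[V] e)))"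
  unfolding pw using sh_mid[OF g uab(1) tps(4,5)] A cl tps(5) V by simp
 then have "sh V i p f (sh V (i + p + d) r g (pt V w)) = u *[V] (f a *[V] (b *[V] (g c *[V] e)))"
  using sh_mid[OF f tps(1,2)] cl tps(5) V by simp
 moreover have "sh V i p f (pt V w) = u *[V] (f a *[V] (b *[V] (c *[V] e)))"
  unfolding pw using sh_mid[OF f tps(1,2)] cl tps(5) V by simp
 then have "sh V (i + q + d) r g (sh V i p f (pt V w)) = u *[V] (f a *[V] (b *[V] (g c *[V] e)))"
  using sh_mid[OF g uab(2) tps(4,5)] A cl tps(5) V by simp
 ultimately show "sh V i p f (sh V (i + p + d) r g (pt V w)) = sh V (i + q + d) r g (sh V i p f (pt V w))" by simp
qed (use V in auto)

lemma lop_sh: "lop V r s f ==> j + r \<le> p ==> p' + r = p + s ==> lop V p p' (sh V j r f)"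
 by (rule lopI[OF V sh_lin sh_tp]) auto

lemma sh_sh:
 assumes f: "lop V r s f" and jr: "j + r \<le> p" and t: "t \<in> tge V (i + p)"
 shows "sh V i p (sh V j r f) t = sh V (i + j) r f t"
proof -
 have l: "lop V p (p - r + s) (sh V j r f)" using jr by (intro lop_sh[OF f]) auto
 show ?thesis
 proof (rule wsp_lin_eq'[OF t V _ sh_lin[OF l] sh_lin[OF f]])
  fix w assume w: "w \<in> lists (carrier V)" "length w \<in> {i + p..}"
  define u a e where "u = pt V (take i w)" "a = pt V (take p (drop i w))" "e = pt V (drop (i + p) w)"
  note defs = this
  have tps: "u \<in> tp V i" "a \<in> tp V p" "e \<in> carrier (T V)"
   unfolding defs using w V by (auto intro!: pt_tp)
  have cl: "u \<in> carrier (T V)" "a \<in> carrier (T V)" using tps wsp_cl_tp[OF V] by auto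
  have pw: "pt V w = u *[V] (a *[V] e)" unfolding defs by (rule pt_split3[OF w(1)])
  have "sh V (i + j) r f (u *[V] (a *[V] e)) = u *[V] sh V j r f (a *[V] e)"
   using cl tps(3) V by (intro sh_left[OF f tps(1)]) auto
  also have "sh V j r f (a *[V] e) = sh V j r f a *[V] e"
   by (rule sh_right[OF f tp_tge[OF tps(2) jr] tps(3)])
  finally show "sh V i p (sh V j r f) (pt V w) = sh V (i + j) r f (pt V w)"
   unfolding pw using sh_mid[OF l tps] by simp
 qed (use V in auto)
qed

lemma sh_id: assumes t: "t \<in> tge V (i + p)" shows "sh V i p (%t. t) t = t"
proof (rule wsp_lin_eq'[OF t V _ sh_lin[OF lop_id(2)] lin_id(2)])
 fix w assume w: "w \<in> lists (carrier V)" "length w \<in> {i + p..}"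
 then show "sh V i p (%t. t) (pt V w) = pt V w"
  using sh_pt[OF lop_id(2) w(1), of i p] pt_split3[OF w(1), of i p] by simp
qed (use V in auto)

lemma tsub_tp: "tsub K V (tp V p) (tp V r) = tp V (p + r)"
proof
 show "tsub K V (tp V p) (tp V r) \<subseteq> tp V (p + r)"
  unfolding tsub_def by (rule lspan_min[OF tp_subm[OF V]]) (use tp_mult[OF V] in auto)
 have "pt V ` {w \<in> lists (carrier V). length w \<in> {p + r}} \<subseteq> {x *[V] y |x y. x \<in> tp V p \<and> y \<in> tp V r}"
 proof clarsimp
  fix w assume w: "w \<in> lists (carrier V)" "length w = p + r"
  then have "pt V w = pt V (take p w) *[V] pt V (drop p w)" using V by (simp add: pt_append[symmetric])
  then show "\<exists>x y. pt V w = x *[V] y \<and> x \<in> tp V p \<and> y \<in> tp V r"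
   using w pt_tp[of "take p w" V p] pt_tp[of "drop p w" V r] by auto
 qed
 then show "tp V (p + r) \<subseteq> tsub K V (tp V p) (tp V r)"
  unfolding tpow_wsp wsp_def tsub_def by (rule lspan_mono)
qed

text \<open>\<open>tmap\<close> is an arbitrary solution of its specification. Solutions agree on
  the span of the pure tensors, so it can be computed with any convenient linear map that has the
  right values on them.\<close>

lemma tmap_eq:
 assumes W: "module K W" and XY: "X \<subseteq> carrier (T V)" "Y \<subseteq> carrier (T V)"
  and h: "lin K ((T V)\<lparr>carrier := tsub K V X Y\<rparr>) (T W) h"
  and eq: "\<And>x y. x \<in> X ==> y \<in> Y ==> h (x *[V] y) = f x *[W] g y" and t: "t \<in> tsub K V X Y"
 shows "tmap K V W X Y f g t = h t"
proof -
 let ?P = "%h. lin K ((T V)\<lparr>carrier := tsub K V X Y\<rparr>) (T W) h \<and> (\<forall>x\<in>X. \<forall>y\<in>Y. h (x *[V] y) = f x *[W] g y)"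
 have "?P (SOME h. ?P h)" by (rule someI[of ?P h]) (use h eq in blast)
 then have s: "?P (tmap K V W X Y f g)" unfolding tmap_def .
 show ?thesis
  unfolding tsub_def
  by (rule lin_eq_lspan[OF t[unfolded tsub_def] _ _ _ conjunct1[OF s, unfolded tsub_def] h[unfolded tsub_def]])
   (use V W XY s eq in \<open>auto simp: subset_iff\<close>)
qed

text \<open>The right factor is treated first: once \<open>f\<close> has been applied, the right
  factor starts at position \<open>q\<close> instead of \<open>p\<close>.\<close>

lemma tpm_eq:
 assumes f: "lop V p q f" and g: "lop V r s g" and t: "t \<in> tp V (p + r)"
 shows "tpm K V p f r g t = sh V 0 p f (sh V p r g t)"
proof (rule tmap_eq[OF V])
 show "tp V p \<subseteq> carrier (T V)" "tp V r \<subseteq> carrier (T V)" using wsp_cl_tp[OF V] by auto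
 show "t \<in> tsub K V (tp V p) (tp V r)" using t by (simp add: tsub_tp)
 show "lin K ((T V)\<lparr>carrier := tsub K V (tp V p) (tp V r)\<rparr>) (T V) (%t. sh V 0 p f (sh V p r g t))"
  unfolding tsub_tp by (rule lin_sub[OF lin_comp'[OF sh_lin[OF g] sh_lin[OF f]]]) (use wsp_cl_tp[OF V] in auto)
 fix x y assume x: "x \<in> tp V p" and y: "y \<in> tp V r"
 have "g y \<in> carrier (T V)" using lop_cl[OF g y] wsp_cl_tp[OF V] by blast
 then show "sh V 0 p f (sh V p r g (x *[V] y)) = f x *[V] g y"
  using sh_base_left[OF g x y] sh_right[OF f, of x 0] sh_base[OF f x] tp_tge[OF x] by simp
qed

lemma tpm_left: "lop V p q f ==> t \<in> tp V (p + r) ==> tpm K V p f r id t = sh V 0 p f t"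
 using tpm_eq[OF _ lop_id(1), of p q f t r] sh_id[of t p r] tp_tge[of t V "p + r" "p + r"] by (simp add: id_def)

lemma tpm_right: assumes g: "lop V r s g" and t: "t \<in> tp V (p + r)" shows "tpm K V p id r g t = sh V p r g t"
proof -
 have "sh V p r g t \<in> tge V p" by (rule tp_tge[OF sh_tp[OF g t, of "p + s"]]) auto
 then show ?thesis using tpm_eq[OF lop_id(1) g t] sh_id[of "sh V p r g t" 0 p] by (simp add: id_def)
qed

end

text \<open>Naturality in one degree propagates to every position, because T(h) is multiplicative
  and preserves word length. Axioms are transported along maps by this rule.\<close>

lemma Tm_sh:
 assumes V: "module K V" and W: "module K W" and h: "lin K V W h" and f: "lop V p q f" and g: "lop W p q g"
  and fg: "\<And>t. t \<in> tp V p ==> Tm V W h (f t) = g (Tm V W h t)" and t: "t \<in> carrier (T V)"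
 shows "Tm V W h (sh V i p f t) = sh W i p g (Tm V W h t)"
proof (rule T_lin_eq[OF t V _ lin_comp'[OF sh_lin[OF V f] Tm_lin[OF V W h]] lin_comp'[OF Tm_lin[OF V W h] sh_lin[OF W g]]])
 note Tms = Tm_pt[OF V W h] Tm_mult[OF V W h] map_lists[OF V W h]
 fix w assume w: "w \<in> lists (carrier V)"
 show "Tm V W h (sh V i p f (pt V w)) = sh W i p g (Tm V W h (pt V w))"
 proof (cases "i + p \<le> length w")
  case True
  then have a: "pt V (take p (drop i w)) \<in> tp V p" using w by (auto intro!: pt_tp)
  have "f (pt V (take p (drop i w))) \<in> carrier (T V)" using wsp_cl_tp[OF V lop_cl[OF f a]] .
  then show ?thesis using True w V W sh_pt[OF V f w, of i] sh_pt[OF W g Tms(3)[OF w], of i] fg[OF a]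
   by (simp add: Tms take_map drop_map)
 next
  case False
  then show ?thesis using w V W sh_pt[OF V f w, of i] sh_pt[OF W g Tms(3)[OF w], of i] lin_zero[OF Tm_lin[OF V W h]]
   by (simp add: Tms)
 qed
qed (use W in auto)

lemma deg1_iota: assumes "module K V" "x \<in> carrier V" shows "deg1 K V W f (\<iota> K V x) = \<iota> K W (f x)"
proof -
 have "inj_on (\<iota> K V) (carrier V)" by (rule inj_onI) (rule iota_inj[OF assms(1)])
 then show ?thesis using assms by (simp add: deg1_def induced_def)
qed

lemma deg1_Tm: assumes "module K V" "module K W" "lin K V W f" "t \<in> tp V 1" shows "deg1 K V W f t = Tm V W f t"
proof -
 obtain x where "x \<in> carrier V" "t = \<iota> K V x" using tp1E[OF assms(1,4)] .
 then show ?thesis using assms deg1_iota[OF assms(1)] by simp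
qed

lemma deg1_lop: assumes V: "module K V" and f: "lin K V V f" shows "lop V 1 1 (deg1 K V V f)"
proof -
 have "lop V 1 1 (Tm V V f)" by (rule lopI[OF V Tm_lin[OF V V f] Tm_tp[OF V V f]])
 then show ?thesis unfolding lop_def
  using lin_cong[of "tpm1 V 1" "deg1 K V V f" "Tm V V f" "tpm1 V 1"] deg1_Tm[OF V V f] V by simp
qed

lemma tsquare_Tm:
 assumes V: "module K V" and W: "module K W" and f: "lin K V W f" and t: "t \<in> tp V 2"
 shows "tsquare K V W f t = Tm V W f t"
 unfolding tsquare_def
proof (rule tmap_eq[OF V W])
 show "tp V 1 \<subseteq> carrier (T V)" "tp V 1 \<subseteq> carrier (T V)" using wsp_cl_tp[OF V] by auto
 show "t \<in> tsub K V (tp V 1) (tp V 1)" using t by (simp add: tsub_tp[OF V] numeral_2_eq_2)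
 show "lin K ((T V)\<lparr>carrier := tsub K V (tp V 1) (tp V 1)\<rparr>) (T W) (Tm V W f)"
  by (rule lin_sub[OF Tm_lin[OF V W f]]) (use wsp_cl_tp[OF V] in \<open>auto simp: tsub_tp[OF V]\<close>)
 fix x y assume xy: "x \<in> tp V 1" "y \<in> tp V 1"
 show "Tm V W f (x *[V] y) = deg1 K V W f x *[W] deg1 K V W f y"
  using xy deg1_Tm[OF V W f] wsp_cl_tp[OF V] by (simp add: Tm_mult[OF V W f])
qed

end

context fld
begin

text \<open>The simplifier turns indices into iterated successors; these rules fold them back so
  that facts about degrees 2, 3 and 4 keep matching.\<close>

lemma wsp_two [simp]: "tge V (Suc (Suc 0)) = tge V 2" "tp V (Suc (Suc 0)) = tp V 2"
 "tge V (Suc (Suc (Suc 0))) = tge V 3" "tp V (Suc (Suc (Suc 0))) = tp V 3"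
 "tge V (Suc (Suc (Suc (Suc 0)))) = tge V 4" "tp V (Suc (Suc (Suc (Suc 0)))) = tp V 4"
 by (simp_all add: numeral_eq_Suc)

declare wsp_all [simp]

text \<open>An identity at position \<open>i\<close> is reduced to tensors x \<otimes> a \<otimes> y
  with \<open>a\<close> of exact degree \<open>p\<close>, where x and y are mere spectators.\<close>

lemma op_eq:
 assumes V: "module K V" and F: "lin K (T V) (T V) f" and G: "lin K (T V) (T V) g" and t: "t \<in> tge V (i + p)"
  and eq: "\<And>x a y. x \<in> tp V i ==> a \<in> tp V p ==> y \<in> carrier (T V) ==>
   f (x *[V] (a *[V] y)) = g (x *[V] (a *[V] y))"
 shows "f t = g t"
proof (rule wsp_lin_eq'[OF t V _ F G])
 fix w assume w: "w \<in> lists (carrier V)" "length w \<in> {i + p..}"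
 show "f (pt V w) = g (pt V w)"
  unfolding pt_split3[OF V w(1), of i p] by (rule eq) (use w V in \<open>auto intro!: pt_tp\<close>)
qed (use V in auto)

lemma lop_cong: "module K V ==> (\<And>t. t \<in> tp V p ==> f t = g t) ==> lop V p q f = lop V p q g"
 unfolding lop_def by (rule lin_cong) auto

lemma mulT_spec:
 assumes A: "assoc_algebra K A"
 shows "lop A 2 1 (mulT K A)" "x \<in> carrier A ==> y \<in> carrier A ==> mulT K A (\<iota> K A x *[A] \<iota> K A y) = \<iota> K A (x \<cdot>[A] y)"
proof -
 have V: "module K A" using A by simp
 have "bilin A A (tpm1 A 1) (%x y. \<iota> K A (x \<cdot>[A] y))"
  using A by (intro bilinI lin_comp'[OF lin_mult_left[OF A _ lin_id(2)] lin_subI[OF iota_lin[OF V]]]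
    lin_comp'[OF lin_mult_right[OF A _ lin_id(2)] lin_subI[OF iota_lin[OF V]]]) auto
 from bilin_ext[OF V tp_mod[OF V] this] obtain h where h: "lin K (T A) (tpm1 A 1) h"
  "\<forall>x\<in>carrier A. \<forall>y\<in>carrier A. h (\<iota> K A x *[A] \<iota> K A y) = \<iota> K A (x \<cdot>[A] y)" by blast
 have "lin K (tpm1 A 2) (tpm1 A 1) h" using lin_sub[OF h(1), of "tp A 2"] wsp_cl_tp[OF V] by auto
 then have "\<exists>h. lin K (tpm1 A 2) (tpm1 A 1) h \<and> (\<forall>x\<in>carrier A. \<forall>y\<in>carrier A. h (\<iota> K A x *[A] \<iota> K A y) = \<iota> K A (x \<cdot>[A] y))"
  using h(2) by blast
 from someI_ex[OF this] show "lop A 2 1 (mulT K A)"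
  "x \<in> carrier A ==> y \<in> carrier A ==> mulT K A (\<iota> K A x *[A] \<iota> K A y) = \<iota> K A (x \<cdot>[A] y)"
  unfolding mulT_def lop_def by blast+
qed

lemma induced_iota: "module K V ==> x \<in> carrier V ==> induced (carrier V) (\<iota> K V) f (\<iota> K V x) = f x"
 by (simp add: induced_def inv_into_f_f[OF inj_onI[OF iota_inj]])

lemma induced_iota_lin:
 assumes V: "module K V" and M: "module K M" and f: "lin K V M f"
 shows "lin K (tpm1 V 1) M (induced (carrier V) (\<iota> K V) f)"
proof -
 obtain h where h: "lin K (T V) M h" "\<forall>v\<in>carrier V. h (\<iota> K V v) = f v" using lin_ext[OF V M f] by blast
 have "lin K (tpm1 V 1) M h" by (rule lin_sub[OF h(1)]) (use wsp_cl_tp[OF V] in auto)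
 moreover have "induced (carrier V) (\<iota> K V) f t = h t" if "t \<in> tp V 1" for t
  using tp1E[OF V that] h induced_iota[OF V] by metis
 ultimately show ?thesis using lin_cong[of "tpm1 V 1" "induced (carrier V) (\<iota> K V) f" h M] V by simp
qed

end

section \<open>Multiplication and unit as operators at a position\<close>

locale alg_op = fld K for K :: "('k, 'z) ring_scheme" +
 fixes A :: "('k, 'a, 'm) module_scheme"
 assumes alg [simp]: "assoc_algebra K A"
begin

abbreviation "TA \<equiv> tensor_alg K A"
abbreviation "M i \<equiv> sh A i 2 (mulT K A)"
abbreviation "j \<equiv> \<iota> K A"
abbreviation "e \<equiv> j \<one>\<^bsub>A\<^esub>"
text \<open>Insertion of the unit at position \<open>i\<close>, regarded as an operator that reads
  zero factors and produces one.\<close>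

abbreviation "U i \<equiv> sh A i 0 (%t. t \<cdot>[TA] e)"
abbreviation mult_TA (infixr "*" 75) where "x * y \<equiv> x \<cdot>[TA] y"

lemma modA [simp]: "module K A" by simp

lemma lopM: "lop A 2 1 (mulT K A)" by (rule mulT_spec) simp

lemma lopU: "lop A 0 1 (%t. t * e)"
 by (rule lopI[OF modA T_mult_lin_right]) (auto intro: tp_mult[OF modA _ iota_tp(1)])

lemma Tassoc: "x \<in> carrier TA ==> y \<in> carrier TA ==> z \<in> carrier TA ==> (x * y) * z = x * (y * z)"
 by (simp add: mult_assoc)

lemmas M_lin = sh_lin[OF modA lopM] and U_lin = sh_lin[OF modA lopU]
lemmas M_cl [simp] = sh_cl[OF modA lopM] and U_cl [simp] = sh_cl[OF modA lopU]

lemma M_tge [simp]: "t \<in> tge A (Suc n) ==> 1 \<le> n ==> M i t \<in> tge A n"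
 by (rule sh_tge[OF modA lopM]) auto

lemma U_tge [simp]: "t \<in> tge A (n - 1) ==> 1 \<le> n ==> U i t \<in> tge A n"
 by (rule sh_tge[OF modA lopU]) auto

lemma M_tp: "t \<in> tp A (Suc n) ==> M i t \<in> tp A n"
 by (rule sh_tp[OF modA lopM]) auto

lemma M_mult: "x \<in> carrier A ==> y \<in> carrier A ==> t \<in> carrier TA ==> M 0 (j x * (j y * t)) = j (x \<cdot>[A] y) * t"
 using sh_mid[OF modA lopM, of "\<one>\<^bsub>TA\<^esub>" 0 "j x * j y" t] mulT_spec(2)[OF alg, of x y] by (simp add: Tassoc)

lemma M_mult': "x \<in> carrier A ==> y \<in> carrier A ==> M 0 (j x * j y) = j (x \<cdot>[A] y)"
 using M_mult[of x y "\<one>\<^bsub>TA\<^esub>"] by simp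

lemma U_0: "t \<in> carrier TA ==> U 0 t = e * t"
 using sh_mid[OF modA lopU, of "\<one>\<^bsub>TA\<^esub>" 0 "\<one>\<^bsub>TA\<^esub>" t] by simp

lemma sh_Suc: "lop A p q f ==> x \<in> carrier A ==> t \<in> carrier TA ==> sh A (Suc i) p f (j x * t) = j x * sh A i p f t"
 using sh_left[OF modA _ iota_tp(1), of p q f x t i] by simp

lemma sh_at1: "lop A p q f ==> x \<in> carrier A ==> t \<in> carrier TA ==> sh A 1 p f (j x * t) = j x * sh A 0 p f t"
 using sh_Suc[of p q f x t 0] by simp

lemma sh_at2: "lop A p q f ==> x \<in> carrier A ==> t \<in> carrier TA ==> sh A 2 p f (j x * t) = j x * sh A 1 p f t"
 using sh_Suc[of p q f x t 1] by (simp add: numeral_2_eq_2)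

lemma sh_at3: "lop A p q f ==> x \<in> carrier A ==> t \<in> carrier TA ==> sh A 3 p f (j x * t) = j x * sh A 2 p f t"
 using sh_Suc[of p q f x t 2] by (simp add: numeral_3_eq_3)

lemmas at_rules = sh_at1 sh_at2 sh_at3 sh_Suc

lemma U_1: "x \<in> carrier A ==> t \<in> carrier TA ==> U (Suc 0) (j x * t) = j x * (e * t)"
 "x \<in> carrier A ==> U (Suc 0) (j x) = j x * e"
 using sh_at1[OF lopU, of x t] sh_at1[OF lopU, of x "\<one>\<^bsub>TA\<^esub>"] by (auto simp: U_0)

lemma tp2_eqI:
 assumes "t \<in> tp A 2" "lin K TA TA f" "lin K TA TA g"
  and "\<And>x y. x \<in> carrier A ==> y \<in> carrier A ==> f (j x * j y) = g (j x * j y)"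
 shows "f t = g t"
 by (rule tp2_lin_eq[OF assms(1)]) (use assms wsp_cl_tp[OF modA] in \<open>auto intro!: lin_sub\<close>)

lemma tge1_eqI:
 assumes t: "t \<in> tge A 1" and f: "lin K TA TA f" and g: "lin K TA TA g"
  and eq: "\<And>x s. x \<in> carrier A ==> s \<in> carrier TA ==> f (j x * s) = g (j x * s)"
 shows "f t = g t"
proof (rule wsp_lin_eq'[OF t modA _ f g])
 fix w assume w: "w \<in> lists (carrier A)" "length w \<in> {1..}"
 then obtain x v where "w = x # v" by (cases w) auto
 then show "f (pt A w) = g (pt A w)" using w eq by (simp add: pt_Cons)
qed simp

lemma tge_Suc_eqI:
 assumes t: "t \<in> tge A (Suc n)" and f: "lin K TA TA f" and g: "lin K TA TA g"
  and eq: "\<And>x s. x \<in> carrier A ==> s \<in> tge A n ==> f (j x * s) = g (j x * s)"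
 shows "f t = g t"
proof (rule wsp_lin_eq'[OF t modA _ f g])
 fix w assume w: "w \<in> lists (carrier A)" "length w \<in> {Suc n..}"
 then obtain x v where "w = x # v" by (cases w) auto
 then show "f (pt A w) = g (pt A w)" using w eq by (auto simp: pt_Cons intro: pt_tge)
qed simp

lemmas lifts = sh_left[OF modA] sh_right[OF modA]

lemma sh_left0: "lop A p q f ==> x \<in> tp A i ==> t \<in> carrier TA ==> sh A i p f (x * t) = x * sh A 0 p f t"
 using sh_left[OF modA, of p q f x i t 0] by simp

lemma sh_left1: "lop A p q f ==> x \<in> tp A i ==> t \<in> carrier TA ==> sh A (Suc i) p f (x * t) = x * sh A 1 p f t"
 using sh_left[OF modA, of p q f x i t 1] by simp

lemma sh_left2: "lop A p q f ==> x \<in> tp A i ==> t \<in> carrier TA ==> sh A (i + 2) p f (x * t) = x * sh A 2 p f t"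
 "lop A p q f ==> x \<in> tp A i ==> t \<in> carrier TA ==> sh A (Suc (Suc i)) p f (x * t) = x * sh A 2 p f t"
 using sh_left[OF modA, of p q f x i t 2] by simp_all

lemmas sh_lefts = sh_left0 sh_left1 sh_left2

lemma MM: assumes "t \<in> tge A (i + 3)" shows "M i (M i t) = M i (M (Suc i) t)"
proof (rule op_eq[OF modA lin_comp'[OF M_lin M_lin] lin_comp'[OF M_lin M_lin] assms])
 fix x a y assume x: "x \<in> tp A i" and a: "a \<in> tp A 3" and y: "y \<in> carrier TA"
 have 1: "M 0 (M 0 a) = M 0 (M 1 a)"
 proof (rule tge_Suc_eqI[OF tp_tge[OF a, of "Suc 2"]])
  fix u s assume u: "u \<in> carrier A" and s: "s \<in> tge A 2"
  show "M 0 (M 0 (j u * s)) = M 0 (M 1 (j u * s))"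
  proof (rule tge_Suc_eqI[OF s[folded wsp_two], where f = "%s. M 0 (M 0 (j u * s))" and g = "%s. M 0 (M 1 (j u * s))"])
   fix v r assume v: "v \<in> carrier A" and r: "r \<in> tge A (Suc 0)"
   show "M 0 (M 0 (j u * (j v * r))) = M 0 (M 1 (j u * (j v * r)))"
   proof (rule tge_Suc_eqI[OF r, where f = "%r. M 0 (M 0 (j u * (j v * r)))" and g = "%r. M 0 (M 1 (j u * (j v * r)))"])
    fix w q assume "w \<in> carrier A" "q \<in> tge A 0"
    then show "M 0 (M 0 (j u * (j v * (j w * q)))) = M 0 (M 1 (j u * (j v * (j w * q))))"
     using u v by (simp add: M_mult sh_Suc[OF lopM] mult_assoc[OF alg])
   qed (use u v in \<open>auto intro!: lin_comp'[OF lin_comp'[OF T_mult_lin_left] M_lin] lin_comp'[OF _ M_lin] lin_comp'[OF _ T_mult_lin_left] T_mult_lin_left\<close>)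
  qed (use u in \<open>auto intro!: lin_comp'[OF _ M_lin] lin_comp'[OF _ T_mult_lin_left] T_mult_lin_left\<close>)
 qed (auto intro!: lin_comp'[OF M_lin M_lin])
 have c: "a \<in> tge A 3" "a \<in> tge A 2" "a \<in> carrier TA" "x \<in> carrier TA"
  using tp_tge[OF a] wsp_cl_tp[OF modA a] wsp_cl_tp[OF modA x] by auto
 show "M i (M i (x * (a * y))) = M i (M (Suc i) (x * (a * y)))"
  using x y c 1 by (simp add: sh_lefts[OF lopM] sh_right[OF modA lopM])
qed

lemma MU: assumes "t \<in> tge A (i + 1)" shows "M i (U i t) = t" "M i (U (Suc i) t) = t"
proof -
 have "M i (U i (x * (a * y))) = x * (a * y) \<and> M i (U (Suc i) (x * (a * y))) = x * (a * y)"
  if x: "x \<in> tp A i" and a: "a \<in> tp A 1" and y: "y \<in> carrier TA" for x a y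
 proof -
  obtain u where u: "u \<in> carrier A" "a = j u" using tp1E[OF modA a] .
  have c: "x \<in> carrier TA" using wsp_cl_tp[OF modA x] .
  have "U (Suc 0) (j u * y) = j u * (e * y)" "U 0 (j u * y) = e * (j u * y)" using u y by (simp_all add: U_1 U_0)
  then show ?thesis using x y c u M_mult[of "\<one>\<^bsub>A\<^esub>" u y] M_mult[of u "\<one>\<^bsub>A\<^esub>" y]
   by (simp add: sh_lefts[OF lopM] sh_lefts[OF lopU])
 qed
 then show "M i (U i t) = t" "M i (U (Suc i) t) = t"
  by (auto intro!: op_eq[OF modA lin_comp'[OF U_lin M_lin] lin_id(2) assms])
qed

text \<open>The interchange law with the shifted position given by an equation between sums, which
  avoids truncated subtraction.\<close>

lemma far:
 assumes f: "lop A p q f" and g: "lop A r s g" and "i + p \<le> l" "l + q = l' + p" "t \<in> tge A (l + r)"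
 shows "sh A i p f (sh A l r g t) = sh A l' r g (sh A i p f t)"
proof -
 obtain d where d: "l = i + p + d" using assms(3) le_Suc_ex by blast
 then have "l' = i + q + d" using assms(4) by simp
 then show ?thesis using sh_comm[OF modA f g, of t i d] assms(5) d by simp
qed

end

context fld begin

lemma sh_pos [simp]: "sh V (Suc (Suc 0)) = sh V 2" "sh V (Suc (Suc (Suc 0))) = sh V 3" "sh V (Suc (Suc (Suc (Suc 0)))) = sh V 4"
 by (simp_all add: numeral_eq_Suc)

lemma tpm_ops:
 assumes V: "module K V" and f: "lop V p q f"
 shows "t \<in> tp V 3 ==> p = 2 ==> tpm K V 2 f 1 id t = sh V 0 p f t"
  "t \<in> tp V 3 ==> p = 2 ==> tpm K V 1 id 2 f t = sh V 1 p f t"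
  "t \<in> tp V 2 ==> p = 1 ==> tpm K V 1 f 1 id t = sh V 0 p f t"
  "t \<in> tp V 2 ==> p = 1 ==> tpm K V 1 id 1 f t = sh V 1 p f t"
 using tpm_left[OF V f, of t 1] tpm_right[OF V f, of t 1] by simp_all

lemma tp_ops:
 assumes V: "module K V" and f: "lop V p q f"
 shows "t \<in> tp V 3 ==> p = 2 ==> q = 2 ==> sh V i p f t \<in> tp V 3"
  "t \<in> tp V 3 ==> p = 2 ==> q = 1 ==> sh V i p f t \<in> tp V 2"
  "t \<in> tp V 2 ==> p = 2 ==> q = 2 ==> sh V i p f t \<in> tp V 2"
  "t \<in> tp V 2 ==> p = 1 ==> q = 2 ==> sh V i p f t \<in> tp V 3"
  "t \<in> tp V 2 ==> p = 2 ==> q = 1 ==> sh V i p f t \<in> tp V 1"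
 by (rule sh_tp[OF V f]; simp)+

lemma braided_vs_iff: "braided_vs K V c \<longleftrightarrow> module K V \<and> lop V 2 2 c \<and>
  (\<forall>t\<in>tp V 3. sh V 0 2 c (sh V 1 2 c (sh V 0 2 c t)) = sh V 1 2 c (sh V 0 2 c (sh V 1 2 c t)))"
proof -
 {
  assume V: "module K V" and c: "lop V 2 2 c"
  fix t assume t: "t \<in> tp V 3"
  have "tpm K V 2 c 1 id (tpm K V 1 id 2 c (tpm K V 2 c 1 id t)) = sh V 0 2 c (sh V 1 2 c (sh V 0 2 c t))"
   "tpm K V 1 id 2 c (tpm K V 2 c 1 id (tpm K V 1 id 2 c t)) = sh V 1 2 c (sh V 0 2 c (sh V 1 2 c t))"
   using tpm_ops(1,2)[OF V c] tp_ops(1)[OF V c] t by simp_all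
 }
 then show ?thesis unfolding braided_vs_def lop_def[symmetric] by metis
qed

lemma braided_mor_iff: "module K V ==> module K W ==> lop V 2 2 cV ==> braided_mor K V cV W cW f \<longleftrightarrow> lin K V W f \<and>
 (\<forall>t\<in>tp V 2. cW (Tm V W f t) = Tm V W f (cV t))"
 unfolding braided_mor_def using tsquare_Tm[of V W f] lop_cl[of V 2 2 cV] by auto

end

section \<open>Braided algebras in terms of operators\<close>

locale pre_br = alg_op K A for K :: "('k, 'z) ring_scheme" and A :: "('k, 'a, 'm) module_scheme" +
 fixes c
 assumes lopC: "lop A 2 2 c"
begin

abbreviation "C i \<equiv> sh A i 2 c"

lemmas C_lin = sh_lin[OF modA lopC]
lemmas C_cl [simp] = sh_cl[OF modA lopC]

lemma C_tge [simp]: "t \<in> tge A n ==> 2 \<le> n ==> C i t \<in> tge A n"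
 by (rule sh_tge[OF modA lopC]) auto

lemma C_tge1 [simp]: "t \<in> tge A 2 ==> C i t \<in> tge A (Suc 0)"
 using C_tge[of t 2 i] tge_mono[of "C i t" A 2 1] by simp

lemma C_tp: "t \<in> tp A n ==> C i t \<in> tp A n"
 by (rule sh_tp[OF modA lopC]) auto

lemma C_base: "t \<in> tp A 2 ==> C 0 t = c t"
 by (rule sh_base[OF modA lopC])

lemmas rights = sh_right[OF modA lopC] sh_right[OF modA lopM] sh_right[OF modA lopU]
lemmas lefts = sh_lefts[OF lopC] sh_lefts[OF lopM] sh_lefts[OF lopU]
lemmas ats = at_rules[OF lopC] at_rules[OF lopM] at_rules[OF lopU]

lemmas op_lins = M_lin C_lin U_lin lin_comp'[OF _ M_lin] lin_comp'[OF _ C_lin] lin_comp'[OF _ U_lin]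

lemma C_far: "lop A r s g ==> i + 2 \<le> l ==> t \<in> tge A (l + r) ==> C i (sh A l r g t) = sh A l r g (C i t)"
 by (rule far[OF lopC]) auto

lemma M_far: "lop A r s g ==> i + 2 \<le> l ==> t \<in> tge A (l + r) ==> M i (sh A l r g t) = sh A (l - 1) r g (M i t)"
 by (rule far[OF lopM]) auto

lemma U_far: "lop A r s g ==> i \<le> l ==> t \<in> tge A (l + r) ==> U i (sh A l r g t) = sh A (l + 1) r g (U i t)"
 by (rule far[OF lopU]) auto

lemmas fars = C_far[OF lopC] C_far[OF lopM] M_far[OF lopC] M_far[OF lopM]

lemma op3_lift:
 assumes x: "x \<in> tp A i" and a: "a \<in> tp A 3" and y: "y \<in> carrier TA"
 shows "C 0 (C 1 (C 0 a)) = C 1 (C 0 (C 1 a)) ==>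
   C i (C (Suc i) (C i (x * (a * y)))) = C (Suc i) (C i (C (Suc i) (x * (a * y))))"
  "C 0 (M 0 a) = M 1 (C 0 (C 1 a)) ==> C i (M i (x * (a * y))) = M (Suc i) (C i (C (Suc i) (x * (a * y))))"
  "C 0 (M 1 a) = M 0 (C 1 (C 0 a)) ==> C i (M (Suc i) (x * (a * y))) = M i (C (Suc i) (C i (x * (a * y))))"
proof -
 have c: "a \<in> tge A 3" "a \<in> tge A 2" "a \<in> carrier TA" "x \<in> carrier TA"
  using tp_tge[OF a] wsp_cl_tp[OF modA a] wsp_cl_tp[OF modA x] by auto
 show "C 0 (C 1 (C 0 a)) = C 1 (C 0 (C 1 a)) ==>
   C i (C (Suc i) (C i (x * (a * y)))) = C (Suc i) (C i (C (Suc i) (x * (a * y))))"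
  "C 0 (M 0 a) = M 1 (C 0 (C 1 a)) ==> C i (M i (x * (a * y))) = M (Suc i) (C i (C (Suc i) (x * (a * y))))"
  "C 0 (M 1 a) = M 0 (C 1 (C 0 a)) ==> C i (M (Suc i) (x * (a * y))) = M i (C (Suc i) (C i (x * (a * y))))"
  using x y c by (simp_all add: lefts rights)
qed

text \<open>Each axiom is lifted from the leftmost position to all positions separately, because in
  the construction of the braiding on T(V) the axioms become available one after another.\<close>

lemma braid_lift: assumes "\<And>t. t \<in> tp A 3 ==> C 0 (C 1 (C 0 t)) = C 1 (C 0 (C 1 t))" and t: "t \<in> tge A (i + 3)"
 shows "C i (C (Suc i) (C i t)) = C (Suc i) (C i (C (Suc i) t))"
 by (rule op_eq[OF modA _ _ t], (intro op_lins)+, rule op3_lift(1)) (use assms(1) in auto)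

lemma CM_lift1: assumes "\<And>t. t \<in> tp A 3 ==> C 0 (M 0 t) = M 1 (C 0 (C 1 t))" and t: "t \<in> tge A (i + 3)"
 shows "C i (M i t) = M (Suc i) (C i (C (Suc i) t))"
 by (rule op_eq[OF modA _ _ t], (intro op_lins)+, rule op3_lift(2)) (use assms(1) in auto)

lemma CM_lift2: assumes "\<And>t. t \<in> tp A 3 ==> C 0 (M 1 t) = M 0 (C 1 (C 0 t))" and t: "t \<in> tge A (i + 3)"
 shows "C i (M (Suc i) t) = M i (C (Suc i) (C i t))"
 by (rule op_eq[OF modA _ _ t], (intro op_lins)+, rule op3_lift(3)) (use assms(1) in auto)

lemma CU_aux: assumes x: "x \<in> tp A i" and u: "u \<in> carrier A" and y: "y \<in> carrier TA"
 shows "C i (U i (x * (j u * y))) = x * (c (e * j u) * y)" "C i (U (Suc i) (x * (j u * y))) = x * (c (j u * e) * y)"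
  "U i (x * (j u * y)) = x * (e * (j u * y))" "U (Suc i) (x * (j u * y)) = x * (j u * (e * y))"
proof -
 have c: "x \<in> carrier TA" using wsp_cl_tp[OF modA x] .
 have *: "C 0 ((j u * e) * y) = c (j u * e) * y" "C 0 ((e * j u) * y) = c (e * j u) * y"
  using y tp_tge[OF iotas_tp2[OF modA u one_cl[OF alg]], of 2] tp_tge[OF iotas_tp2[OF modA one_cl[OF alg] u], of 2]
   C_base[OF iotas_tp2[OF modA u one_cl[OF alg]]] C_base[OF iotas_tp2[OF modA one_cl[OF alg] u]]
  by (simp_all add: rights)
 show 1: "U i (x * (j u * y)) = x * (e * (j u * y))" "U (Suc i) (x * (j u * y)) = x * (j u * (e * y))"
  using x y c u by (simp_all add: lefts U_0 U_1)
 show "C i (U i (x * (j u * y))) = x * (c (e * j u) * y)" "C i (U (Suc i) (x * (j u * y))) = x * (c (j u * e) * y)"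
  unfolding 1 using x y c u * by (simp_all add: lefts Tassoc)
qed

lemma CU_lift1: assumes "\<And>x. x \<in> carrier A ==> c (e * j x) = j x * e" and t: "t \<in> tge A (i + 1)"
 shows "C i (U i t) = U (Suc i) t"
proof (rule op_eq[OF modA _ _ t])
 fix x a y assume x: "x \<in> tp A i" and a: "a \<in> tp A 1" and y: "y \<in> carrier TA"
 obtain u where "u \<in> carrier A" "a = j u" using tp1E[OF modA a] .
 then show "C i (U i (x * (a * y))) = U (Suc i) (x * (a * y))" using CU_aux[OF x _ y] y assms(1) by (simp add: Tassoc)
qed (intro op_lins)+

lemma CU_lift2: assumes "\<And>x. x \<in> carrier A ==> c (j x * e) = e * j x" and t: "t \<in> tge A (i + 1)"
 shows "C i (U (Suc i) t) = U i t"
proof (rule op_eq[OF modA _ _ t])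
 fix x a y assume x: "x \<in> tp A i" and a: "a \<in> tp A 1" and y: "y \<in> carrier TA"
 obtain u where "u \<in> carrier A" "a = j u" using tp1E[OF modA a] .
 then show "C i (U (Suc i) (x * (a * y))) = U i (x * (a * y))" using CU_aux[OF x _ y] y assms(1) by (simp add: Tassoc)
qed (intro op_lins)+

end

locale br_alg = pre_br K A c for K :: "('k, 'z) ring_scheme" and A :: "('k, 'a, 'm) module_scheme" and c +
 assumes braid0: "t \<in> tp A 3 ==> C 0 (C 1 (C 0 t)) = C 1 (C 0 (C 1 t))"
  and CM0: "t \<in> tp A 3 ==> C 0 (M 0 t) = M 1 (C 0 (C 1 t))"
  and CM1: "t \<in> tp A 3 ==> C 0 (M 1 t) = M 0 (C 1 (C 0 t))"
  and CU0: "x \<in> carrier A ==> c (e * j x) = j x * e"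
  and CU1: "x \<in> carrier A ==> c (j x * e) = e * j x"
begin

lemmas braid = braid_lift[OF braid0]
lemmas CM = CM_lift1[OF CM0] CM_lift2[OF CM1]
lemmas CU = CU_lift1[OF CU0] CU_lift2[OF CU1]

lemma braided_vsA: "braided_vs K A c"
 unfolding braided_vs_iff using lopC braid0 by simp

end

context fld begin

lemma br_alg_iff: "braided_algebra K A c \<longleftrightarrow> br_alg K A c"
proof -
 {
  assume a: "assoc_algebra K A" and c: "lop A 2 2 c"
  have V: "module K A" using a by simp
  note m = mulT_spec(1)[OF a]
  fix t assume t: "t \<in> tp A 3"
  have "c (tpm K A 2 (mulT K A) 1 id t) = sh A 0 2 c (sh A 0 2 (mulT K A) t)"
   "tpm K A 1 id 2 (mulT K A) (tpm K A 2 c 1 id (tpm K A 1 id 2 c t)) = sh A 1 2 (mulT K A) (sh A 0 2 c (sh A 1 2 c t))"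
   "c (tpm K A 1 id 2 (mulT K A) t) = sh A 0 2 c (sh A 1 2 (mulT K A) t)"
   "tpm K A 2 (mulT K A) 1 id (tpm K A 1 id 2 c (tpm K A 2 c 1 id t)) = sh A 0 2 (mulT K A) (sh A 1 2 c (sh A 0 2 c t))"
   using tpm_ops(1,2)[OF V c] tp_ops(1)[OF V c] tpm_ops(1,2)[OF V m] tp_ops(2)[OF V m] t sh_base[OF V c] by simp_all
 }
 note * = this
 show ?thesis
  unfolding braided_algebra_def braided_vs_iff br_alg_def br_alg_axioms_def pre_br_def pre_br_axioms_def alg_op_def alg_op_axioms_def
  using * fld_axioms alg_mod by (auto simp: One_nat_def[symmetric] simp del: One_nat_def alg_mod)
qed

end

context br_alg begin

abbreviation "A2 \<equiv> braided_tensor_square K A c"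

lemma A2_sel: "carrier A2 = tp A 2" "\<one>\<^bsub>A2\<^esub> = e * e" "\<zero>\<^bsub>A2\<^esub> = \<zero>\<^bsub>TA\<^esub>" "x +[A2] y = x +[TA] y" "a *:[A2] x = a *:[TA] x"
 by (simp_all add: braided_tensor_square_def)

lemma A2_mult: assumes "s \<in> tp A 2" "t \<in> tp A 2" shows "s \<cdot>[A2] t = M 0 (M 2 (C 1 (s * t)))"
proof -
 have st: "s * t \<in> tp A 4" by (rule tp_mult[OF modA assms]) simp
 have l3: "lop A 3 3 (sh A 0 2 c)" by (rule lop_sh[OF modA lopC]) simp_all
 have eq: "tpm K A 2 c 1 id t = sh A 0 2 c t" if "t \<in> tp A 3" for t
  using tpm_ops(1)[OF modA lopC that] by simp
 have l3': "lop A 3 3 (tpm K A 2 c 1 id)"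
  by (rule iffD2[OF lop_cong[OF modA eq] l3])
 have "tpm K A 1 id 3 (tpm K A 2 c 1 id) (s * t) = sh A 1 3 (tpm K A 2 c 1 id) (s * t)"
  by (rule tpm_right[OF modA l3']) (use st in simp)
 also have "\<dots> = sh A 1 3 (sh A 0 2 c) (s * t)" using sh_cong[of A 3 "tpm K A 2 c 1 id" "sh A 0 2 c" 1] eq by simp
 also have "\<dots> = C 1 (s * t)" using sh_sh[OF modA lopC, of 0 3 "s * t" 1] tp_tge[OF st] by simp
 finally have 1: "tpm K A 1 id 3 (tpm K A 2 c 1 id) (s * t) = C 1 (s * t)" .
 have "tpm K A 2 (mulT K A) 2 (mulT K A) (C 1 (s * t)) = M 0 (M 2 (C 1 (s * t)))"
  by (rule tpm_eq[OF modA lopM lopM]) (use C_tp[OF st] in simp)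
 then show ?thesis using 1 by (simp add: braided_tensor_square_def)
qed

text \<open>Both bracketings of a triple product amount to braiding the six factors into the order \<open>1 3 5 2 4 6\<close>.\<close>

lemma A2_assoc: assumes r: "r \<in> tp A 2" and s: "s \<in> tp A 2" and t: "t \<in> tp A 2"
 shows "M 0 (M 2 (C 1 (M 0 (M 2 (C 1 (r * s))) * t))) = M 0 (M 2 (C 1 (r * M 0 (M 2 (C 1 (s * t))))))"
proof -
 have cl: "r \<in> carrier TA" "s \<in> carrier TA" "t \<in> carrier TA" using r s t wsp_cl_tp[OF modA] by auto
 have st: "s * t \<in> tp A 4" "r * s \<in> tp A 4" using tp_mult[OF modA s t] tp_mult[OF modA r s] by auto
 have w: "r * (s * t) \<in> tp A 6" using tp_mult[OF modA r st(1)] by simp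
 define q where "q = r * (s * t)"
 have q [simp]: "q \<in> tge A n" if "n \<le> 6" for n using w that unfolding q_def by (rule tp_tge)
 have qc [simp]: "q \<in> carrier TA" unfolding q_def using cl by simp
 have rs [simp]: "r * s \<in> tge A n" if "n \<le> 4" for n using st(2) that by (rule tp_tge)
 have L: "M 0 (M 2 (C 1 (r * s))) * t = M 0 (M 2 (C 1 q))"
  unfolding q_def using cl by (simp add: Tassoc[symmetric] rights)
 have "r * M 0 (M 2 (C 1 (s * t))) = M 2 (r * M 2 (C 1 (s * t)))"
  using sh_left[OF modA lopM r, of "M 2 (C 1 (s * t))" 0] cl by simp
 also have "\<dots> = M 2 (M 4 (r * C 1 (s * t)))"
  using sh_left[OF modA lopM r, of "C 1 (s * t)" 2] cl by simp
 also have "\<dots> = M 2 (M 4 (C 3 q))"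
  unfolding q_def using sh_left[OF modA lopC r, of "s * t" 1] cl by simp
 finally have R: "r * M 0 (M 2 (C 1 (s * t))) = M 2 (M 4 (C 3 q))" .
 have "C 1 (M 0 (M 2 (C 1 q))) = M 0 (C 2 (M 2 (C 1 q)))"
  using far[OF lopM lopC, of 0 2 1 "M 2 (C 1 q)"] by simp
 also have "\<dots> = M 0 (M 3 (C 2 (C 3 (C 1 q))))"
  using CM(1)[of "C 1 q" 2] by simp
 finally have "M 0 (M 2 (C 1 (M 0 (M 2 (C 1 q))))) = M 0 (M 2 (M 0 (M 3 (C 2 (C 3 (C 1 q))))))" by simp
 also have "\<dots> = M 0 (M 0 (M 3 (M 3 (C 2 (C 3 (C 1 q))))))"
  using far[OF lopM lopM, of 0 3 2 "M 3 (C 2 (C 3 (C 1 q)))"] by simp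
 finally have L': "M 0 (M 2 (C 1 (M 0 (M 2 (C 1 q))))) = M 0 (M 0 (M 3 (M 3 (C 2 (C 3 (C 1 q))))))" .
 have "C 1 (M 2 (M 4 (C 3 q))) = M 1 (C 2 (C 1 (M 4 (C 3 q))))"
  using CM(2)[of "M 4 (C 3 q)" 1] by (simp add: numeral_2_eq_2[symmetric])
 also have "\<dots> = M 1 (M 4 (C 2 (C 1 (C 3 q))))"
  by (simp add: fars)
 finally have "M 0 (M 2 (C 1 (M 2 (M 4 (C 3 q))))) = M 0 (M 2 (M 1 (M 4 (C 2 (C 1 (C 3 q))))))" by simp
 also have "\<dots> = M 0 (M 1 (M 3 (M 4 (C 2 (C 1 (C 3 q))))))"
  using far[OF lopM lopM, of 1 3 2 "M 4 (C 2 (C 1 (C 3 q)))"] by simp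
 also have "\<dots> = M 0 (M 0 (M 3 (M 3 (C 2 (C 1 (C 3 q))))))"
  using MM[of "M 3 (M 3 (C 2 (C 1 (C 3 q))))" 0] MM[of "C 2 (C 1 (C 3 q))" 3] by simp
 also have "C 1 (C 3 q) = C 3 (C 1 q)" using C_far[OF lopC, of 1 3 q] by simp
 finally show ?thesis unfolding L R L' ..
qed

lemma A2_alg: "assoc_algebra K A2"
proof (rule assoc_algebraI)
 have closed: "s \<cdot>[A2] t \<in> tp A 2" if "s \<in> tp A 2" "t \<in> tp A 2" for s t
 proof -
  have "s * t \<in> tp A 4" by (rule tp_mult[OF modA that]) simp
  then show ?thesis unfolding A2_mult[OF that] by (intro M_tp C_tp) simp
 qed
 have ml: "lin K (tpm1 A 2) TA (%s. s \<cdot>[A2] t)" if t: "t \<in> tp A 2" for t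
 proof -
  have "lin K (tpm1 A 2) TA (%s. M 0 (M 2 (C 1 (s * t))))"
   by (rule lin_sub[OF lin_comp'[OF T_mult_lin_right op_lins(4)[OF op_lins(4)[OF C_lin]]]])
    (use wsp_cl_tp[OF modA] t in auto)
  then show ?thesis using lin_cong[of "tpm1 A 2" "%s. s \<cdot>[A2] t" "%s. M 0 (M 2 (C 1 (s * t)))" TA] A2_mult[OF _ t] by simp
 qed
 have mr: "lin K (tpm1 A 2) TA (%t. s \<cdot>[A2] t)" if s: "s \<in> tp A 2" for s
 proof -
  have "lin K (tpm1 A 2) TA (%t. M 0 (M 2 (C 1 (s * t))))"
   by (rule lin_sub[OF lin_comp'[OF T_mult_lin_left op_lins(4)[OF op_lins(4)[OF C_lin]]]])
    (use wsp_cl_tp[OF modA] s in auto)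
  then show ?thesis using lin_cong[of "tpm1 A 2" "%t. s \<cdot>[A2] t" "%t. M 0 (M 2 (C 1 (s * t)))" TA] A2_mult[OF s] by simp
 qed
 have M2: "module K (tpm1 A 2)" by simp
 have m: "module K A2"
 proof (rule moduleI)
  show "abelian_group A2"
   by (rule abelian_groupI; use mod_abg[OF M2] in \<open>(drule_tac abelian_groupE(1-6); simp add: A2_sel)?\<close>)
    (use add_ac[OF M2] zero_cl[OF M2] add_cl[OF M2] add_zero[OF M2] abelian_groupE(6)[OF mod_abg[OF M2]] in \<open>auto simp: A2_sel\<close>)
 qed (use is_cring smult_cl[OF M2] smult_add[OF M2] add_smult[OF M2] smult_smult[OF M2] smult_one[OF M2] in \<open>auto simp: A2_sel\<close>)
 show "module K A2" by (rule m)
 have one: "e * e \<in> tp A 2" by simp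
 have unit: "(e * e) \<cdot>[A2] t = t" "t \<cdot>[A2] (e * e) = t" if t: "t \<in> tp A 2" for t
 proof -
  have tc [simp]: "t \<in> carrier TA" "\<And>n. n \<le> 2 ==> t \<in> tge A n" using t wsp_cl_tp[OF modA] tp_tge[OF t] by auto
  have "(e * e) * t = U 0 (U 0 t)" by (simp add: U_0 Tassoc)
  \<comment> \<open>Of the two inserted units the one to be braided is reindexed to position 1,
    where \<open>C 1\<close> carries it past the first factor of \<open>t\<close>; both units are
    then absorbed by the multiplications.\<close>
  also have "\<dots> = U 1 (U 0 t)" using far[OF lopU lopU, of 0 0 1 t] by simp
  finally have "C 1 ((e * e) * t) = U 2 (U 0 t)" using CU(1)[of "U 0 t" 1] by simp
  then have "M 2 (C 1 ((e * e) * t)) = U 0 t" using MU(1)[of "U 0 t" 2] tge_mono by simp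
  then show "(e * e) \<cdot>[A2] t = t" using A2_mult[OF one t] MU(1)[of t 0] by simp
  have "t * (e * e) = U 2 (U 2 t)"
   using sh_base_left[OF modA lopU t one_tp[OF modA]] sh_right[OF modA lopU, of t 2 e] by (simp add: Tassoc)
  also have "\<dots> = U 3 (U 2 t)" using far[OF lopU lopU, of 2 2 3 t] by simp
  also have "\<dots> = U 2 (U 2 t)" using far[OF lopU lopU, of 2 2 3 t] by simp
  finally have "C 1 (t * (e * e)) = U 1 (U 2 t)" using CU(2)[of "U 2 t" 1] by simp
  also have "\<dots> = U 3 (U 1 t)" using far[OF lopU lopU, of 1 2 3 t] by simp
  finally have "M 2 (C 1 (t * (e * e))) = U 1 t" using MU(2)[of "U 1 t" 2] by simp
  then show "t \<cdot>[A2] (e * e) = t" using A2_mult[OF t one] MU(2)[of t 0] by simp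
 qed
 show "ring A2"
 proof (rule ringI)
  show "abelian_group A2" by (rule mod_abg[OF m])
  show "monoid A2"
  proof (rule monoidI)
   fix x y z assume "x \<in> carrier A2" "y \<in> carrier A2" "z \<in> carrier A2"
   then have xyz: "x \<in> tp A 2" "y \<in> tp A 2" "z \<in> tp A 2" by (simp_all add: A2_sel)
   then show "x \<cdot>[A2] y \<cdot>[A2] z = x \<cdot>[A2] (y \<cdot>[A2] z)"
    using A2_mult[OF closed[OF xyz(1,2)] xyz(3)] A2_mult[OF xyz(1) closed[OF xyz(2,3)]] A2_assoc[OF xyz]
    by (simp add: A2_mult)
  qed (use closed unit one in \<open>simp_all add: A2_sel\<close>)
 qed (use lin_add[OF ml] lin_add[OF mr] in \<open>auto simp: A2_sel\<close>)
 show "a *:[A2] x \<cdot>[A2] y = a *:[A2] (x \<cdot>[A2] y)" "x \<cdot>[A2] (a *:[A2] y) = a *:[A2] (x \<cdot>[A2] y)"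
  if "a \<in> carrier K" "x \<in> carrier A2" "y \<in> carrier A2" for a x y
  using that lin_smult[OF ml] lin_smult[OF mr] by (auto simp: A2_sel)
qed

end

section \<open>Braided bialgebras in terms of operators\<close>

locale bialg_op = alg_op K B for K :: "('k, 'z) ring_scheme" and B :: "('k, 'a) bialg" +
 assumes comult_lin: "lin K B (tpow_mod K B 2) (comult B)" and counit_lin: "lin K B (ground K) (counit B)"
begin

abbreviation mult_TB (infixr "*" 75) where "x * y \<equiv> x \<cdot>[TA] y"
abbreviation "D i \<equiv> sh B i (Suc 0) (comultT K B)"
abbreviation "E i \<equiv> sh B i (Suc 0) (counitT K B)"

lemma comult_tp: "x \<in> carrier B ==> comult B x \<in> tp B 2"
 using lin_cl[OF comult_lin] by simp

lemma comult_cl [simp]: "x \<in> carrier B ==> comult B x \<in> carrier TA"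
 by (rule wsp_cl_tp[OF modA comult_tp])

lemma counit_cl [simp]: "x \<in> carrier B ==> counit B x \<in> carrier K"
 using lin_cl[OF counit_lin] by (simp add: ground_def)

lemma comultT: "x \<in> carrier B ==> comultT K B (j x) = comult B x"
 unfolding comultT_def by (rule induced_iota[OF modA])

lemma counitT: "x \<in> carrier B ==> counitT K B (j x) = counit B x *:[TA] \<one>\<^bsub>TA\<^esub>"
 unfolding counitT_def by (rule induced_iota[OF modA])

lemma lopD: "lop B (Suc 0) 2 (comultT K B)"
 unfolding lop_def comultT_def by (rule induced_iota_lin[OF modA tp_mod[OF modA] comult_lin, unfolded One_nat_def])

lemma counit_tp0: "lin K B (tpow_mod K B 0) (%x. counit B x *:[TA] \<one>\<^bsub>TA\<^esub>)"
proof (rule linI)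
 fix x assume x: "x \<in> carrier B"
 show "counit B x *:[TA] \<one>\<^bsub>TA\<^esub> \<in> carrier (tpm1 B 0)"
  using subm_smult[OF _ tp_subm[OF modA]] x by simp
qed (use lin_add[OF counit_lin] lin_smult[OF counit_lin] in \<open>auto simp: ground_def add_smult smult_smult\<close>)

lemma lopE: "lop B (Suc 0) 0 (counitT K B)"
 unfolding lop_def counitT_def by (rule induced_iota_lin[OF modA tp_mod[OF modA] counit_tp0, unfolded One_nat_def])

lemmas D_lin = sh_lin[OF modA lopD] and E_lin = sh_lin[OF modA lopE]
lemmas D_cl [simp] = sh_cl[OF modA lopD] and E_cl [simp] = sh_cl[OF modA lopE]

lemma D_tge [simp]: "t \<in> tge B (n - 1) ==> 2 \<le> n ==> D i t \<in> tge B n"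
 by (rule sh_tge[OF modA lopD]) auto

lemma D_tge1 [simp]: "t \<in> tge B (Suc 0) ==> D i t \<in> tge B (Suc 0)"
 using D_tge[of t 2 i] tge_mono[of "D i t" B 2 1] by simp

lemma E_tge [simp]: "t \<in> tge B (Suc n) ==> E i t \<in> tge B n"
 by (rule sh_tge[OF modA lopE]) auto

lemma D_mult: "x \<in> carrier B ==> t \<in> carrier TA ==> D 0 (j x * t) = comult B x * t"
 using sh_mid[OF modA lopD, of "\<one>\<^bsub>TA\<^esub>" 0 "j x" t] comult_cl[of x] by (simp add: comultT)

lemma D_j: "x \<in> carrier B ==> D 0 (j x) = comult B x"
 using D_mult[of x "\<one>\<^bsub>TA\<^esub>"] by simp

lemma E_mult: "x \<in> carrier B ==> t \<in> carrier TA ==> E 0 (j x * t) = counit B x *:[TA] t"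
 using sh_mid[OF modA lopE, of "\<one>\<^bsub>TA\<^esub>" 0 "j x" t] by (simp add: counitT mult_smult)

lemma E_j: "x \<in> carrier B ==> E 0 (j x) = counit B x *:[TA] \<one>\<^bsub>TA\<^esub>"
 using E_mult[of x "\<one>\<^bsub>TA\<^esub>"] by simp

lemma D_far: "lop B r s g ==> i + 1 \<le> l ==> t \<in> tge B (l + r) ==> D i (sh B l r g t) = sh B (l + 1) r g (D i t)"
 by (rule far[OF lopD]) auto

lemma E_far: "lop B r s g ==> i + 1 \<le> l ==> t \<in> tge B (l + r) ==> E i (sh B l r g t) = sh B (l - 1) r g (E i t)"
 by (rule far[OF lopE]) auto

end

text \<open>A braided algebra whose comultiplication and counit are algebra maps, still without
  coassociativity, the counit laws and the compatibility of both maps with the braiding. These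
  remaining laws will follow from generation by primitive elements.\<close>

locale pre_bialg = bialg_op K B + br_alg K B "braiding B" for K :: "('k, 'z) ring_scheme" and B :: "('k, 'a) bialg" +
 assumes comult_mult: "x \<in> carrier B ==> y \<in> carrier B ==>
   comult B (x \<cdot>[B] y) = M 0 (M 2 (C 1 (comult B x * comult B y)))"
  and comult_one: "comult B \<one>\<^bsub>B\<^esub> = e * e"
  and counit_mult: "x \<in> carrier B ==> y \<in> carrier B ==> counit B (x \<cdot>[B] y) = counit B x \<cdot>[K] counit B y"
  and counit_one: "counit B \<one>\<^bsub>B\<^esub> = \<one>\<^bsub>K\<^esub>"
begin

lemmas blefts = lefts sh_lefts[OF lopD] sh_lefts[OF lopE]
lemmas brights = rights sh_right[OF modA lopD] sh_right[OF modA lopE]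
lemmas bop_lins = op_lins D_lin E_lin lin_comp'[OF _ D_lin] lin_comp'[OF _ E_lin]

lemma DC_lift: assumes x: "x \<in> tp B i" and a: "a \<in> tp B 2" and y: "y \<in> carrier TA"
 shows "D 0 (C 0 a) = C 1 (C 0 (D 1 a)) ==> D i (C i (x * (a * y))) = C (Suc i) (C i (D (Suc i) (x * (a * y))))"
  "D 1 (C 0 a) = C 0 (C 1 (D 0 a)) ==> D (Suc i) (C i (x * (a * y))) = C i (C (Suc i) (D i (x * (a * y))))"
  "E 0 (C 0 a) = E 1 a ==> E i (C i (x * (a * y))) = E (Suc i) (x * (a * y))"
  "E 1 (C 0 a) = E 0 a ==> E (Suc i) (C i (x * (a * y))) = E i (x * (a * y))"
proof -
 have c: "a \<in> tge B 2" "a \<in> tge B 1" "a \<in> carrier TA" "x \<in> carrier TA"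
  using tp_tge[OF a] wsp_cl_tp[OF modA a] wsp_cl_tp[OF modA x] by auto
 show "D 0 (C 0 a) = C 1 (C 0 (D 1 a)) ==> D i (C i (x * (a * y))) = C (Suc i) (C i (D (Suc i) (x * (a * y))))"
  "D 1 (C 0 a) = C 0 (C 1 (D 0 a)) ==> D (Suc i) (C i (x * (a * y))) = C i (C (Suc i) (D i (x * (a * y))))"
  "E 0 (C 0 a) = E 1 a ==> E i (C i (x * (a * y))) = E (Suc i) (x * (a * y))"
  "E 1 (C 0 a) = E 0 a ==> E (Suc i) (C i (x * (a * y))) = E i (x * (a * y))"
  using x y c by (simp_all add: blefts brights)
qed

lemma DC_lifts:
 assumes "t \<in> tge B (i + 2)"
 shows "(\<And>t. t \<in> tp B 2 ==> D 0 (C 0 t) = C 1 (C 0 (D 1 t))) ==> D i (C i t) = C (Suc i) (C i (D (Suc i) t))"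
  "(\<And>t. t \<in> tp B 2 ==> D 1 (C 0 t) = C 0 (C 1 (D 0 t))) ==> D (Suc i) (C i t) = C i (C (Suc i) (D i t))"
  "(\<And>t. t \<in> tp B 2 ==> E 0 (C 0 t) = E 1 t) ==> E i (C i t) = E (Suc i) t"
  "(\<And>t. t \<in> tp B 2 ==> E 1 (C 0 t) = E 0 t) ==> E (Suc i) (C i t) = E i t"
   apply (rule op_eq[OF modA _ _ assms], (intro bop_lins)+, rule DC_lift(1), assumption, assumption, assumption, simp)
  apply (rule op_eq[OF modA _ _ assms], (intro bop_lins)+, rule DC_lift(2), assumption, assumption, assumption, simp)
  apply (rule op_eq[OF modA _ _ assms], (intro bop_lins)+, rule DC_lift(3), assumption, assumption, assumption, simp)
 apply (rule op_eq[OF modA _ _ assms], (intro bop_lins)+, rule DC_lift(4), assumption, assumption, assumption, simp)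
 done

lemma DM0: assumes "t \<in> tp B 2" shows "D 0 (M 0 t) = M 0 (M 2 (C 1 (D 0 (D 1 t))))" "E 0 (M 0 t) = E 0 (E 0 t)"
proof -
 {
  fix x y assume x: "x \<in> carrier B" and y: "y \<in> carrier B"
  have "D 0 (D 1 (j x * j y)) = comult B x * comult B y"
   using x y by (simp add: sh_Suc[OF lopD] D_mult D_j)
  then have "D 0 (M 0 (j x * j y)) = M 0 (M 2 (C 1 (D 0 (D 1 (j x * j y)))))"
   using x y by (simp add: M_mult' D_j comult_mult)
  moreover have "E 0 (M 0 (j x * j y)) = E 0 (E 0 (j x * j y))"
   using x y lin_smult[OF E_lin, of "counit B x" "j y" 0] by (simp add: M_mult' E_j E_mult counit_mult smult_smult)
  ultimately have "D 0 (M 0 (j x * j y)) = M 0 (M 2 (C 1 (D 0 (D 1 (j x * j y)))))"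
   "E 0 (M 0 (j x * j y)) = E 0 (E 0 (j x * j y))" by blast+
 }
 note * = this
 show "D 0 (M 0 t) = M 0 (M 2 (C 1 (D 0 (D 1 t))))"
  by (rule tp2_eqI[OF assms], (intro bop_lins)+, rule *(1))
 show "E 0 (M 0 t) = E 0 (E 0 t)"
  by (rule tp2_eqI[OF assms], (intro bop_lins)+, rule *(2))
qed

lemma DM: assumes "t \<in> tge B (i + 2)"
 shows "D i (M i t) = M i (M (i + 2) (C (Suc i) (D i (D (Suc i) t))))" "E i (M i t) = E i (E i t)"
proof -
 {
  fix x a y assume x: "x \<in> tp B i" and a: "a \<in> tp B 2" and y: "y \<in> carrier TA"
  have c: "a \<in> tge B 2" "a \<in> tge B 1" "a \<in> carrier TA" "x \<in> carrier TA"
   using tp_tge[OF a] wsp_cl_tp[OF modA a] wsp_cl_tp[OF modA x] by auto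
  have "D i (M i (x * (a * y))) = M i (M (i + 2) (C (Suc i) (D i (D (Suc i) (x * (a * y))))))"
   "E i (M i (x * (a * y))) = E i (E i (x * (a * y)))"
   using x y c DM0[OF a] by (simp_all add: blefts brights )
 }
 note * = this
 show "D i (M i t) = M i (M (i + 2) (C (Suc i) (D i (D (Suc i) t))))"
  by (rule op_eq[OF modA _ _ assms], (intro bop_lins)+, rule *(1))
 show "E i (M i t) = E i (E i t)"
  by (rule op_eq[OF modA _ _ assms], (intro bop_lins)+, rule *(2))
qed

end

locale br_bialg = pre_bialg K B for K :: "('k, 'z) ring_scheme" and B :: "('k, 'a) bialg" +
 assumes DD0: "x \<in> carrier B ==> D 0 (comult B x) = D 1 (comult B x)"
  and ED0: "x \<in> carrier B ==> E 0 (comult B x) = j x"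
  and ED1: "x \<in> carrier B ==> E 1 (comult B x) = j x"
  and DC0: "t \<in> tp B 2 ==> D 0 (C 0 t) = C 1 (C 0 (D 1 t))"
  and DC1: "t \<in> tp B 2 ==> D 1 (C 0 t) = C 0 (C 1 (D 0 t))"
  and EC0: "t \<in> tp B 2 ==> E 0 (C 0 t) = E 1 t"
  and EC1: "t \<in> tp B 2 ==> E 1 (C 0 t) = E 0 t"
begin

end

context fld begin

lemma tpm_coalg:
 assumes V: "module K V" and c: "lop V 2 2 c" and d: "lop V (Suc 0) 2 d" and \<epsilon>: "lop V (Suc 0) 0 \<epsilon>" and t: "t \<in> tp V 2"
 shows "tpm K V 1 d 1 id t = sh V 0 (Suc 0) d t" "tpm K V 1 id 1 d t = sh V 1 (Suc 0) d t"
  "tpm K V 1 \<epsilon> 1 id t = sh V 0 (Suc 0) \<epsilon> t" "tpm K V 1 id 1 \<epsilon> t = sh V 1 (Suc 0) \<epsilon> t"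
  "tpm K V 1 id 2 c (tpm K V 2 c 1 id (tpm K V 1 id 1 d t)) = sh V 1 2 c (sh V 0 2 c (sh V 1 (Suc 0) d t))"
  "tpm K V 2 c 1 id (tpm K V 1 id 2 c (tpm K V 1 d 1 id t)) = sh V 0 2 c (sh V 1 2 c (sh V 0 (Suc 0) d t))"
proof -
 have d': "sh V i (Suc 0) d t \<in> tp V 3" for i using tp_ops(4)[OF V d] t by simp
 show *: "tpm K V 1 d 1 id t = sh V 0 (Suc 0) d t" "tpm K V 1 id 1 d t = sh V 1 (Suc 0) d t"
  "tpm K V 1 \<epsilon> 1 id t = sh V 0 (Suc 0) \<epsilon> t" "tpm K V 1 id 1 \<epsilon> t = sh V 1 (Suc 0) \<epsilon> t"
  using tpm_ops(3,4)[OF V d t] tpm_ops(3,4)[OF V \<epsilon> t] by simp_all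
 show "tpm K V 1 id 2 c (tpm K V 2 c 1 id (tpm K V 1 id 1 d t)) = sh V 1 2 c (sh V 0 2 c (sh V 1 (Suc 0) d t))"
  "tpm K V 2 c 1 id (tpm K V 1 id 2 c (tpm K V 1 d 1 id t)) = sh V 0 2 c (sh V 1 2 c (sh V 0 (Suc 0) d t))"
  unfolding * using tpm_ops(1,2)[OF V c] tp_ops(1)[OF V c] d' by simp_all
qed

lemma alg_hom_iff: "alg_hom K A B f \<longleftrightarrow> lin K A B f \<and> (\<forall>x\<in>carrier A. \<forall>y\<in>carrier A. f (x \<cdot>[A] y) = f x \<cdot>[B] f y) \<and> f \<one>\<^bsub>A\<^esub> = \<one>\<^bsub>B\<^esub>"
 by (auto simp: alg_hom_def ring_hom_def lin_def)

lemma br_bialg_iff: "braided_bialgebra K B \<longleftrightarrow> br_bialg K B"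
proof (cases "br_alg K B (braiding B) \<and> lin K B (tpm1 B 2) (comult B) \<and> lin K B (ground K) (counit B)")
 case True
 interpret br_alg K B "braiding B" using True by simp
 interpret bialg_op K B using True by unfold_locales simp_all
 note ops = tpm_coalg[OF modA lopC lopD lopE]
 have lin2: "lin K B A2 (comult B) \<longleftrightarrow> lin K B (tpm1 B 2) (comult B)"
  unfolding lin_def by (simp add: A2_sel)
 have 1: "comult B (x \<cdot>[B] y) = comult B x \<cdot>[A2] comult B y \<longleftrightarrow> comult B (x \<cdot>[B] y) = M 0 (M 2 (C 1 (comult B x * comult B y)))"
  if "x \<in> carrier B" "y \<in> carrier B" for x y using A2_mult[OF comult_tp[OF that(1)] comult_tp[OF that(2)]] by simp
 have 2: "(\<forall>t\<in>tp B 2. 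
   tpm K B 1 (comultT K B) 1 id (braiding B t) =
    tpm K B 1 id 2 (braiding B) (tpm K B 2 (braiding B) 1 id (tpm K B 1 id 1 (comultT K B) t)) \<and>
   tpm K B 1 id 1 (comultT K B) (braiding B t) =
    tpm K B 2 (braiding B) 1 id (tpm K B 1 id 2 (braiding B) (tpm K B 1 (comultT K B) 1 id t)) \<and>
   tpm K B 1 (counitT K B) 1 id (braiding B t) = tpm K B 1 id 1 (counitT K B) t \<and>
   tpm K B 1 id 1 (counitT K B) (braiding B t) = tpm K B 1 (counitT K B) 1 id t) \<longleftrightarrow>
  (\<forall>t\<in>tp B 2. D 0 (C 0 t) = C 1 (C 0 (D 1 t)) \<and> D 1 (C 0 t) = C 0 (C 1 (D 0 t)) \<and> E 0 (C 0 t) = E 1 t \<and> E 1 (C 0 t) = E 0 t)"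
 proof (rule ball_cong[OF refl])
  fix t assume t: "t \<in> tp B 2"
  have ct: "braiding B t \<in> tp B 2" by (rule lop_cl[OF lopC t])
  show "(tpm K B 1 (comultT K B) 1 id (braiding B t) =
    tpm K B 1 id 2 (braiding B) (tpm K B 2 (braiding B) 1 id (tpm K B 1 id 1 (comultT K B) t)) \<and>
   tpm K B 1 id 1 (comultT K B) (braiding B t) =
    tpm K B 2 (braiding B) 1 id (tpm K B 1 id 2 (braiding B) (tpm K B 1 (comultT K B) 1 id t)) \<and>
   tpm K B 1 (counitT K B) 1 id (braiding B t) = tpm K B 1 id 1 (counitT K B) t \<and>
   tpm K B 1 id 1 (counitT K B) (braiding B t) = tpm K B 1 (counitT K B) 1 id t) \<longleftrightarrow>
  (D 0 (C 0 t) = C 1 (C 0 (D 1 t)) \<and> D 1 (C 0 t) = C 0 (C 1 (D 0 t)) \<and> E 0 (C 0 t) = E 1 t \<and> E 1 (C 0 t) = E 0 t)"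
   unfolding ops(5,6)[OF t] unfolding ops(1-4)[OF t] ops(1-4)[OF ct] C_base[OF t] ..
 qed
 show ?thesis
  unfolding braided_bialgebra_def braided_coalgebra_def br_alg_iff alg_hom_iff lin2 2 br_bialg_def br_bialg_axioms_def pre_bialg_def pre_bialg_axioms_def
  using True braided_vsA 1 ops(1-4)[OF comult_tp] bialg_op_axioms
  by (auto simp: A2_sel(2) ground_def)
next
 case False
 then show ?thesis
  unfolding braided_bialgebra_def braided_coalgebra_def br_alg_iff br_bialg_def pre_bialg_def bialg_op_def bialg_op_axioms_def
  by blast
qed

end

context fld begin

lemma tge_split_eqI:
 assumes t: "t \<in> tge V p" and V: "module K V" and f: "lin K (T V) (T V) f" and g: "lin K (T V) (T V) g"
  and eq: "\<And>a y. a \<in> tp V p ==> y \<in> carrier (T V) ==> f (a *[V] y) = g (a *[V] y)"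
 shows "f t = g t"
proof (rule op_eq[OF V f g, of t 0 p])
 show "t \<in> tge V (0 + p)" using t by simp
 fix x a y assume x: "x \<in> tp V 0" and a: "a \<in> tp V p" and y: "y \<in> carrier (T V)"
 have "x *[V] a \<in> tp V p" by (rule tp_mult[OF V x a]) simp
 moreover have "x *[V] (a *[V] y) = (x *[V] a) *[V] y"
  using wsp_cl_tp[OF V x] wsp_cl_tp[OF V a] y V by (simp add: mult_assoc)
 ultimately show "f (x *[V] (a *[V] y)) = g (x *[V] (a *[V] y))" using eq y by simp
qed

lemma T_gen_induct [consumes 2, case_names one gen mult add smult]:
 assumes a: "a \<in> carrier (T V)" and V: "module K V"
  and one: "Q \<one>\<^bsub>T V\<^esub>" and gen: "\<And>v. v \<in> carrier V ==> Q (\<iota> K V v)"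
  and mult: "\<And>v a. v \<in> carrier V ==> a \<in> carrier (T V) ==> Q (\<iota> K V v) ==> Q a ==> Q (\<iota> K V v *[V] a)"
  and add: "\<And>a b. a \<in> carrier (T V) ==> b \<in> carrier (T V) ==> Q a ==> Q b ==> Q (a +[T V] b)"
  and smult: "\<And>k a. k \<in> carrier K ==> a \<in> carrier (T V) ==> Q a ==> Q (k *:[T V] a)"
 shows "Q a"
proof -
 have w: "Q (pt V w)" if "w \<in> lists (carrier V)" for w
  using that V by (induction w) (auto simp: pt_Cons one gen mult)
 have "a \<in> lspan K (T V) (pt V ` {w \<in> lists (carrier V). length w \<in> UNIV})"
  using a wsp_all[OF V] unfolding wsp_def by simp
 then show ?thesis
 proof (rule lspan_induct)
  show "Q \<zero>\<^bsub>T V\<^esub>" using smult[OF zero_closed, of "\<one>\<^bsub>T V\<^esub>"] V one by simp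
 qed (use V w add smult in auto)
qed

end

section \<open>Existence of the braiding on the tensor algebra\<close>

locale tens = fld K for K :: "('k, 'z) ring_scheme" +
 fixes V :: "('k, 'a, 'm) module_scheme" and cV
 assumes bvs: "braided_vs K V cV"

sublocale tens \<subseteq> alg_op K "tensor_alg K V"
 by unfold_locales (use bvs in \<open>auto simp: braided_vs_def\<close>)

context tens begin

abbreviation "A \<equiv> tensor_alg K V"
abbreviation mult_TT (infixr "*" 75) where "x * y \<equiv> x \<cdot>[TA] y"
abbreviation "iv \<equiv> \<iota> K V"
abbreviation "Ti \<equiv> Tm V A iv"

lemma modV [simp]: "module K V" and lopc: "lop V 2 2 cV"
 and braidV: "t \<in> tp V 3 ==> sh V 0 2 cV (sh V 1 2 cV (sh V 0 2 cV t)) = sh V 1 2 cV (sh V 0 2 cV (sh V 1 2 cV t))"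
 using bvs unfolding braided_vs_iff by auto

lemmas iv_lin = iota_lin[OF modV]
lemmas Ti_lin = Tm_lin[OF modV modA iv_lin]

definition pr :: "('a list \<Rightarrow> 'k) \<Rightarrow> 'a" where
 "pr = (SOME h. lin K A V h \<and> (\<forall>v\<in>carrier V. h (iv v) = v))"

lemma pr: "lin K A V pr" "v \<in> carrier V ==> pr (iv v) = v"
proof -
 have "\<exists>h. lin K A V h \<and> (\<forall>v\<in>carrier V. h (iv v) = v)"
  using lin_ext[OF modV modV lin_id(2)] by blast
 from someI_ex[OF this] show "lin K A V pr" "v \<in> carrier V ==> pr (iv v) = v" unfolding pr_def by blast+
qed

lemma pr_cl [simp]: "a \<in> carrier A ==> pr a \<in> carrier V"
 by (rule lin_cl[OF pr(1)])

lemma ind_lop: assumes "lin K A (tpm1 A n) f" shows "lop A 1 n (induced (carrier A) j f)"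
 unfolding lop_def by (rule induced_iota_lin[OF modA tp_mod[OF modA] assms])

lemma ind_sh:
 assumes f: "lin K A (tpm1 A n) f" and a: "a \<in> carrier A"
 shows "t \<in> carrier TA ==> sh A 0 1 (induced (carrier A) j f) (j a * t) = f a * t"
  "sh A 0 1 (induced (carrier A) j f) (j a) = f a"
proof -
 have fa: "f a \<in> carrier TA" using lin_cl[OF f a] wsp_cl_tp[OF modA] by simp
 show "sh A 0 1 (induced (carrier A) j f) (j a * t) = f a * t" if t: "t \<in> carrier TA"
  using sh_mid[OF modA ind_lop[OF f] one_tp[OF modA] iota_tp(1)[OF modA a] t] induced_iota[OF modA a, of f] a t fa by simp
 show "sh A 0 1 (induced (carrier A) j f) (j a) = f a"
  using sh_base[OF modA ind_lop[OF f] iota_tp(1)[OF modA a]] induced_iota[OF modA a, of f] by simp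
qed

text \<open>The braiding c(v \<otimes> u) of two elements of V, viewed in T(V) \<otimes> T(V). Its
  first argument is extended to all of T(V) through the retraction \<open>pr\<close>, since
  operators act on full tensor powers of T(V).\<close>

definition G :: "'a \<Rightarrow> ('a list \<Rightarrow> 'k) \<Rightarrow> ('a list \<Rightarrow> 'k) list \<Rightarrow> 'k" where
 "G u b = Ti (cV (iv (pr b) \<cdot>[A] iv u))"

lemma G_bilin: "bilin V A (tpm1 A 2) G"
proof (rule bilinI)
 have c': "lin K (tpm1 V 2) (tpm1 A 2) (%s. Ti (cV s))"
  using lin_comp'[OF _ Tm_tp_lin[OF modV modA iv_lin]] lopc unfolding lop_def by blast
 fix u assume u: "u \<in> carrier V"
 have "lin K A (tpm1 V 2) (%b. iv (pr b) \<cdot>[A] iv u)"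
  by (rule lin_subI[OF lin_mult_right[OF T_alg[OF modV] _ lin_comp'[OF pr(1) iv_lin]]]) (use u in auto)
 from lin_comp'[OF this c'] show "lin K A (tpm1 A 2) (G u)" unfolding G_def .
next
 have c': "lin K (tpm1 V 2) (tpm1 A 2) (%s. Ti (cV s))"
  using lin_comp'[OF _ Tm_tp_lin[OF modV modA iv_lin]] lopc unfolding lop_def by blast
 fix b assume b: "b \<in> carrier A"
 have "lin K V (tpm1 V 2) (%u. iv (pr b) \<cdot>[A] iv u)"
  by (rule lin_subI[OF lin_mult_left[OF T_alg[OF modV] _ iv_lin]]) (use b in auto)
 from lin_comp'[OF this c'] show "lin K V (tpm1 A 2) (%u. G u b)" unfolding G_def .
qed

text \<open>\<open>S u\<close> is right multiplication by \<open>u \<in> V\<close> in the twisted bimodule \<open>T(V) \<otimes> V\<close>: \<open>(a \<otimes> v) u = a c(v \<otimes> u)\<close>.\<close>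

definition S :: "'a \<Rightarrow> (('a list \<Rightarrow> 'k) list \<Rightarrow> 'k) \<Rightarrow> ('a list \<Rightarrow> 'k) list \<Rightarrow> 'k" where
 "S u t = M 0 (sh A 1 1 (induced (carrier A) j (G u)) t)"

lemma S_eq: assumes "u \<in> carrier V" "x \<in> carrier A" "y \<in> carrier A"
 shows "S u (j x * j y) = M 0 (j x * G u y)"
 unfolding S_def using assms sh_at1[OF ind_lop[OF bilinD(1)[OF G_bilin]], of u x "j y"] ind_sh(2)[OF bilinD(1)[OF G_bilin], of u y] by simp

lemma S_lin: "u \<in> carrier V ==> lin K TA TA (S u)"
 unfolding S_def by (rule lin_comp'[OF sh_lin[OF modA ind_lop[OF bilinD(1)[OF G_bilin]]] M_lin])

lemma G_cl [simp]: "u \<in> carrier V ==> y \<in> carrier A ==> G u y \<in> carrier TA"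
 and G_tp: "u \<in> carrier V ==> y \<in> carrier A ==> G u y \<in> tp A 2"
 using bilin_cl[OF G_bilin] wsp_cl_tp[OF modA] by auto

lemma S_tp: "u \<in> carrier V ==> t \<in> tp A 2 ==> S u t \<in> tp A 2"
 unfolding S_def by (rule M_tp, rule sh_tp[OF modA ind_lop[OF bilinD(1)[OF G_bilin]]]) auto

lemma S_bilin: "bilin V (tpm1 A 2) (tpm1 A 2) S"
proof (rule bilinI)
 fix u assume u: "u \<in> carrier V"
 show "lin K (tpm1 A 2) (tpm1 A 2) (S u)"
  by (rule lin_subI[OF lin_sub[OF S_lin[OF u]]]) (use wsp_cl_tp[OF modA] S_tp u in auto)
next
 fix t assume t: "t \<in> carrier (tpm1 A 2)"
 then have t: "t \<in> tp A 2" by simp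
 have Gl: "lin K V TA (%u. G u y)" if "y \<in> carrier A" for y
  using lin_subD[OF bilinD(2)[OF G_bilin that]] wsp_cl_tp[OF modA] by blast
 show "lin K V (tpm1 A 2) (%u. S u t)"
 proof (rule linI)
  fix u v assume u: "u \<in> carrier V" and v: "v \<in> carrier V"
  show "S u t \<in> carrier (tpm1 A 2)" using S_tp[OF u t] by simp
  have "S (u +[V] v) t = S u t +[TA] S v t"
   by (rule tp2_eqI[OF t S_lin lin_sum[OF _ S_lin S_lin]])
    (use u v lin_cl[OF Gl] in \<open>auto simp: S_eq lin_add[OF Gl] mult_add lin_add[OF M_lin]\<close>)
  then show "S (u +[V] v) t = S u t +[tpm1 A 2] S v t" by simp
 next
  fix k u assume k: "k \<in> carrier K" and u: "u \<in> carrier V"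
  have "S (k *:[V] u) t = k *:[TA] S u t"
   by (rule tp2_eqI[OF t S_lin lin_scale[OF _ k S_lin]])
    (use u k lin_cl[OF Gl] in \<open>auto simp: S_eq lin_smult[OF Gl] mult_smult lin_smult[OF M_lin]\<close>)
  then show "S (k *:[V] u) t = k *:[tpm1 A 2] S u t" by simp
 qed
qed

text \<open>The subspace T(V) \<otimes> V is described as the set of tensors fixed by
  \<open>pv\<close> at position 1.\<close>

abbreviation "pv \<equiv> deg1 K A A (%a. iv (pr a))"

lemma lop_pv: "lop A 1 1 pv"
 by (rule deg1_lop[OF modA lin_comp'[OF pr(1) iv_lin]])

lemma pv_0: "x \<in> carrier A ==> t \<in> carrier TA ==> sh A 0 1 pv (j x * t) = j (iv (pr x)) * t"
 "x \<in> carrier A ==> sh A 0 1 pv (j x) = j (iv (pr x))"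
 using sh_mid[OF modA lop_pv one_tp[OF modA], of "j x" t] sh_base[OF modA lop_pv, of "j x"]
 by (simp_all add: deg1_iota)

lemma pv_1: "x \<in> carrier A ==> y \<in> carrier A ==> sh A 1 1 pv (j x * j y) = j x * j (iv (pr y))"
 using sh_at1[OF lop_pv, of x "j y"] pv_0(2)[of y] by simp

lemma pv_G: assumes u: "u \<in> carrier V" and y: "y \<in> carrier A" shows "sh A 1 1 pv (G u y) = G u y"
proof -
 have *: "sh A 1 1 pv (Ti s) = Ti s" if s: "s \<in> tp V 2" for s
 proof (rule tp2_lin_eq[OF s])
  show "lin K (tpm1 V 2) TA (%s. sh A 1 1 pv (Ti s))" "lin K (tpm1 V 2) TA Ti"
   by (rule lin_sub[OF lin_comp'[OF Ti_lin sh_lin[OF modA lop_pv]]], use wsp_cl_tp[OF modV] in auto,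
     rule lin_sub[OF Ti_lin], use wsp_cl_tp[OF modV] in auto)
  fix x z assume "x \<in> carrier V" "z \<in> carrier V"
  then show "sh A 1 1 pv (Ti (iv x \<cdot>[A] iv z)) = Ti (iv x \<cdot>[A] iv z)"
   using pv_1[of "iv x" "iv z"] by (simp add: Tm_mult[OF modV modA iv_lin] Tm_iota[OF modV modA iv_lin] pr)
 qed auto
 show ?thesis unfolding G_def by (rule *) (rule lop_cl[OF lopc], use u y in simp)
qed

text \<open>First pass: \<open>c' v a\<close> is the future c(v \<otimes> a) for v in V. It is
  obtained by letting T(V) act from the right on T(V) \<otimes> V, starting from 1 \<otimes> v. The
  product rule in \<open>a\<close> braids elements of V past \<open>b\<close>, and the full braiding
  does not exist yet; it is therefore stated for every operator \<open>h\<close> that agrees with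
  \<open>c'\<close> there.\<close>

lemma exists_half:
 "\<exists>c'. bilin V A (tpm1 A 2) c' \<and> (\<forall>v\<in>carrier V. c' v \<one>\<^bsub>A\<^esub> = e * j (iv v)) \<and>
  (\<forall>v\<in>carrier V. \<forall>u\<in>carrier V. c' v (iv u) = Ti (cV (iv v \<cdot>[A] iv u))) \<and>
  (\<forall>v\<in>carrier V. \<forall>a\<in>carrier A. \<forall>b\<in>carrier A. \<forall>h. lop A 2 2 h \<longrightarrow>
   (\<forall>u\<in>carrier V. h (j (iv u) * j b) = c' u b) \<longrightarrow> c' v (a \<cdot>[A] b) = M 0 (sh A 1 2 h (c' v a * j b)))"
proof -
 have M2: "module K (tpm1 A 2)" by simp
 obtain R where R: "bilin A (tpm1 A 2) (tpm1 A 2) R" "\<And>m. m \<in> tp A 2 ==> R \<one>\<^bsub>A\<^esub> m = m"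
  "\<And>v m. v \<in> carrier V ==> m \<in> tp A 2 ==> R (iv v) m = S v m"
  "\<And>a b m. a \<in> carrier A ==> b \<in> carrier A ==> m \<in> tp A 2 ==> R (a \<cdot>[A] b) m = R b (R a m)"
  using right_action[OF modV M2 S_bilin] by auto
 have R_tp: "R a t \<in> tp A 2" if "a \<in> carrier A" "t \<in> tp A 2" for a t using bilin_cl[OF R(1)] that by simp
 have R_cl [simp]: "R a t \<in> carrier TA" if "a \<in> carrier A" "t \<in> tp A 2" for a t by (rule wsp_cl_tp[OF modA R_tp[OF that]])
 have Rl: "lin K (tpm1 A 2) TA (R a)" if "a \<in> carrier A" for a
  using lin_subD[OF bilinD(1)[OF R(1) that]] wsp_cl_tp[OF modA] by blast
 have Rl2: "lin K A TA (%a. R a t)" if "t \<in> tp A 2" for t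
  using lin_subD[OF bilinD(2)[OF R(1), of t]] wsp_cl_tp[OF modA] that by auto
 have Mt: "M 0 (j x * t) \<in> tp A 2" if "x \<in> carrier A" "t \<in> tp A 2" for x t
  by (rule M_tp, rule iota_mult_tp[OF modA]) (use that in auto)
 have Mjlin: "lin K (tpm1 A 2) (tpm1 A 2) (%t. M 0 (j x * t))" if "x \<in> carrier A" for x
  by (rule lin_subI[OF lin_sub[OF lin_comp'[OF T_mult_lin_left[OF modA] M_lin]]]) (use Mt that wsp_cl_tp[OF modA] in auto)
 \<comment> \<open>Left multiplication on the first factor commutes with the right action by
   associativity of the product, first for generators and then, by \<open>RM\<close>, for all of
   T(V).\<close>
 have SM: "M 0 (j x * S u t) = S u (M 0 (j x * t))" if "x \<in> carrier A" "u \<in> carrier V" "t \<in> tp A 2" for x u t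
 proof -
  let ?g = "induced (carrier A) j (G u)"
  note lg = ind_lop[OF bilinD(1)[OF G_bilin that(2)]]
  have tc: "t \<in> carrier TA" using wsp_cl_tp[OF modA that(3)] .
  have xt: "j x * t \<in> tge A 3" using that(1) tp_tge[OF that(3)] by (intro iota_mult_tge) auto
  have xt': "sh A 2 1 ?g (j x * t) \<in> tge A (0 + 3)" using sh_tge[OF modA lg xt, of 3] by simp
  have "j x * M 0 (sh A 1 1 ?g t) = M 1 (sh A 2 1 ?g (j x * t))"
   using that tc sh_cl[OF modA lg] sh_at2[OF lg that(1) tc] by (simp add: sh_Suc[OF lopM])
  then have "M 0 (j x * S u t) = M 0 (M 1 (sh A 2 1 ?g (j x * t)))" unfolding S_def by simp
  also have "\<dots> = M 0 (M 0 (sh A 2 1 ?g (j x * t)))" using MM[OF xt'] by simp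
  also have "\<dots> = M 0 (sh A 1 1 ?g (M 0 (j x * t)))"
   using far[OF lopM lg, of 0 2 1 "j x * t"] xt by simp
  finally show ?thesis unfolding S_def .
 qed
 have RM: "M 0 (j x * R a t) = R a (M 0 (j x * t))" if a: "a \<in> carrier A" and x: "x \<in> carrier A" and t: "t \<in> tp A 2" for a x t
 proof -
  have "\<forall>t\<in>tp A 2. M 0 (j x * R a t) = R a (M 0 (j x * t))"
   using a modV
  proof (induction rule: T_gen_induct)
   case one
   then show ?case using R(2) Mt[OF x] by simp
  next
   case (gen v)
   then show ?case using R(3) SM x Mt[OF x] by simp
  next
   case (mult v a)
   then show ?case using R(4) R(3) S_tp SM Mt[OF x] x by simp
  next
   case (add a b)
   then show ?case using R_cl lin_add[OF Rl2] Mt[OF x] x by (simp add: mult_add lin_add[OF M_lin])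
  next
   case (smult k a)
   then show ?case using R_cl lin_smult[OF Rl2] Mt[OF x] x by (simp add: mult_smult lin_smult[OF M_lin])
  qed
  then show ?thesis using t by blast
 qed
 have Rp: "sh A 1 1 pv (R a t) = R a t" if a: "a \<in> carrier A" and t: "t \<in> tp A 2" "sh A 1 1 pv t = t" for a t
 proof -
  have Sp: "sh A 1 1 pv (S u t) = S u t" if u: "u \<in> carrier V" and t: "t \<in> tp A 2" for u t
  proof (rule tp2_eqI[OF t lin_comp'[OF S_lin[OF u] sh_lin[OF modA lop_pv]] S_lin[OF u]])
   fix x y assume xy: "x \<in> carrier A" "y \<in> carrier A"
   have xG: "j x * G u y \<in> tge A (2 + 1)" using iota_mult_tge[OF modA xy(1) tp_tge[OF G_tp[OF u xy(2)]], of 3] by simp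
   have "sh A 1 1 pv (M 0 (j x * G u y)) = M 0 (sh A 2 1 pv (j x * G u y))"
    using far[OF lopM lop_pv, of 0 2 1, OF _ _ xG] by simp
   also have "sh A 2 1 pv (j x * G u y) = j x * G u y"
    using sh_at2[OF lop_pv, of x "G u y"] pv_G[OF u xy(2)] xy u by simp
   finally show "sh A 1 1 pv (S u (j x * j y)) = S u (j x * j y)" using S_eq u xy by simp
  qed
  have "\<forall>t\<in>tp A 2. sh A 1 1 pv t = t \<longrightarrow> sh A 1 1 pv (R a t) = R a t"
   using a modV
  proof (induction rule: T_gen_induct)
   case one
   then show ?case using R(2) by simp
  next
   case (gen v)
   then show ?case using R(3) Sp by simp
  next
   case (mult v a)
   then show ?case using R(4) R(3) S_tp Sp by simp
  next
   case (add a b)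
   then show ?case using R_cl lin_add[OF Rl2] by (simp add: lin_add[OF sh_lin[OF modA lop_pv, unfolded One_nat_def]])
  next
   case (smult k a)
   then show ?case using R_cl lin_smult[OF Rl2] by (simp add: lin_smult[OF sh_lin[OF modA lop_pv, unfolded One_nat_def]])
  qed
  then show ?thesis using t by blast
 qed
 \<comment> \<open>In the twisted bimodule, c(v \<otimes> a) is the product of 1 \<otimes> v with
   \<open>a\<close> from the right.\<close>
 define c' where "c' v a = R a (e * j (iv v))" for v a
 have c'b: "bilin V A (tpm1 A 2) c'"
 proof (rule bilinI)
  show "lin K A (tpm1 A 2) (c' v)" if "v \<in> carrier V" for v
   unfolding c'_def using bilinD(2)[OF R(1)] that by simp
  show "lin K V (tpm1 A 2) (%v. c' v a)" if a: "a \<in> carrier A" for a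
  proof -
   have "lin K V (tpm1 A 2) (%v. e * j (iv v))"
    by (rule lin_subI[OF lin_mult_left[OF _ _ lin_comp'[OF iv_lin iota_lin[OF modA]]]]) auto
   from lin_comp'[OF this bilinD(1)[OF R(1) a]] show ?thesis unfolding c'_def .
  qed
 qed
 have c'_tp: "c' v a \<in> tp A 2" if "v \<in> carrier V" "a \<in> carrier A" for v a
  using bilin_cl[OF c'b] that by simp
 have "c' v (iv u) = Ti (cV (iv v \<cdot>[A] iv u))" if v: "v \<in> carrier V" and u: "u \<in> carrier V" for u v
 proof -
  have "c' v (iv u) = M 0 (e * G u (iv v))" unfolding c'_def using R(3) S_eq u v by simp
  also have "\<dots> = M 0 (U 0 (G u (iv v)))" using u v by (simp add: U_0)
  also have "\<dots> = G u (iv v)" by (rule MU(1)) (use tp_tge[OF G_tp[OF u]] v in auto)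
  finally show ?thesis unfolding G_def using v by (simp add: pr)
 qed
 moreover have "c' v (a \<cdot>[A] b) = M 0 (sh A 1 2 h (c' v a * j b))"
  if v: "v \<in> carrier V" and a: "a \<in> carrier A" and b: "b \<in> carrier A" and h: "lop A 2 2 h"
   "\<forall>u\<in>carrier V. h (j (iv u) * j b) = c' u b" for v a b h
 proof -
  \<comment> \<open>On T(V) \<otimes> V the right action is determined by its values on 1 \<otimes>
    v, since x \<otimes> v is x times 1 \<otimes> v and left multiplication commutes with the
    action. Applying \<open>pv\<close> at position 1 puts an arbitrary tensor into this
    subspace.\<close>
  have main: "R b (sh A 1 1 pv t) = M 0 (sh A 1 2 h (sh A 1 1 pv t * j b))" if t: "t \<in> tp A 2" for t
  proof (rule tp2_lin_eq[OF t modA])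
   show "lin K (tpm1 A 2) TA (%t. R b (sh A 1 1 pv t))"
    by (rule lin_comp'[OF lin_subI[OF lin_sub[OF sh_lin[OF modA lop_pv]]] Rl[OF b]])
     (use wsp_cl_tp[OF modA] sh_tp[OF modA lop_pv] in auto)
   show "lin K (tpm1 A 2) TA (%t. M 0 (sh A 1 2 h (sh A 1 1 pv t * j b)))"
    by (rule lin_sub[OF lin_comp'[OF sh_lin[OF modA lop_pv] lin_comp'[OF lin_comp'[OF T_mult_lin_right[OF modA] sh_lin[OF modA h(1)]] M_lin]]])
     (use b wsp_cl_tp[OF modA] in auto)
   fix x y assume x: "x \<in> carrier A" and y: "y \<in> carrier A"
   have 1: "M 0 (j x * (e * j (iv (pr y)))) = j x * j (iv (pr y))"
    using M_mult[of x "\<one>\<^bsub>A\<^esub>" "j (iv (pr y))"] x y by simp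
   have "R b (sh A 1 1 pv (j x * j y)) = R b (M 0 (j x * (e * j (iv (pr y)))))"
    unfolding 1 using pv_1 x y by simp
   also have "\<dots> = M 0 (j x * c' (pr y) b)"
    unfolding c'_def using RM[OF b x] y by simp
   also have "j x * c' (pr y) b = sh A 1 2 h (j x * (j (iv (pr y)) * j b))"
    using sh_at1[OF h(1), of x "j (iv (pr y)) * j b"] sh_base[OF modA h(1), of "j (iv (pr y)) * j b"] h(2) x y b by simp
   finally show "R b (sh A 1 1 pv (j x * j y)) = M 0 (sh A 1 2 h (sh A 1 1 pv (j x * j y) * j b))"
    using x y b pv_1[OF x y] by (simp add: Tassoc)
  qed simp
  have "sh A 1 1 pv (c' v a) = c' v a" unfolding c'_def
   by (rule Rp[OF a]) (use v pv_1 in \<open>auto simp: pr\<close>)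
  then show ?thesis using main[OF c'_tp[OF v a]] R(4)[OF a b, of "e * j (iv v)"] v unfolding c'_def by simp
 qed
 moreover have "c' v \<one>\<^bsub>A\<^esub> = e * j (iv v)" if "v \<in> carrier V" for v
  unfolding c'_def using R(2) that by simp
 ultimately show ?thesis using c'b by blast
qed

end


context tens begin

text \<open>Second pass: \<open>L v\<close> braids v past the first factor with \<open>c'\<close>
  and multiplies the result into the second factor. This extends to a left action of T(V), and c(a
  \<otimes> b) is the action of \<open>a\<close> on b \<otimes> 1. The product rule in the left
  argument holds because this is an action; the one in the right argument is so far known only when
  the left argument lies in V.\<close>

lemma exists_full:
 "\<exists>cT. lop A 2 2 cT \<and> (\<forall>b\<in>carrier A. cT (e * j b) = j b * e) \<and>
  (\<forall>v\<in>carrier V. cT (j (iv v) * e) = e * j (iv v)) \<and>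
  (\<forall>v\<in>carrier V. \<forall>u\<in>carrier V. cT (j (iv v) * j (iv u)) = Ti (cV (iv v \<cdot>[A] iv u))) \<and>
  (\<forall>t\<in>tp A 3. sh A 0 2 cT (M 0 t) = M 1 (sh A 0 2 cT (sh A 1 2 cT t))) \<and>
  (\<forall>v\<in>carrier V. \<forall>a\<in>carrier A. \<forall>b\<in>carrier A.
   cT (j (iv v) * j (a \<cdot>[A] b)) = M 0 (sh A 1 2 cT (cT (j (iv v) * j a) * j b)))"
proof -
 obtain c' where c': "bilin V A (tpm1 A 2) c'" "\<And>v. v \<in> carrier V ==> c' v \<one>\<^bsub>A\<^esub> = e * j (iv v)"
  "\<And>v u. v \<in> carrier V ==> u \<in> carrier V ==> c' v (iv u) = Ti (cV (iv v \<cdot>[A] iv u))"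
  "\<And>v a b h. v \<in> carrier V ==> a \<in> carrier A ==> b \<in> carrier A ==> lop A 2 2 h ==>
   (\<And>u. u \<in> carrier V ==> h (j (iv u) * j b) = c' u b) ==> c' v (a \<cdot>[A] b) = M 0 (sh A 1 2 h (c' v a * j b))"
  using exists_half by metis
 have c'_tp: "c' v a \<in> tp A 2" if "v \<in> carrier V" "a \<in> carrier A" for v a
  using bilin_cl[OF c'(1)] that by simp
 have c'_cl [simp]: "c' v a \<in> carrier TA" if "v \<in> carrier V" "a \<in> carrier A" for v a
  using wsp_cl_tp[OF modA c'_tp[OF that]] .
 have c'_lin: "lin K V TA (%v. c' v a)" if "a \<in> carrier A" for a
  using lin_subD[OF bilinD(2)[OF c'(1) that]] wsp_cl_tp[OF modA] by blast
 define H where "H v = induced (carrier A) j (c' v)" for v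
 have lH: "lop A 1 2 (H v)" if "v \<in> carrier V" for v unfolding H_def by (rule ind_lop[OF bilinD(1)[OF c'(1) that]])
 have H_0: "sh A 0 1 (H v) (j a * t) = c' v a * t" if "v \<in> carrier V" "a \<in> carrier A" "t \<in> carrier TA" for v a t
  unfolding H_def using ind_sh(1)[OF bilinD(1)[OF c'(1) that(1)] that(2,3)] .
 define L where "L v t = M 1 (sh A 0 1 (H v) t)" for v t
 have L_eq: "L v (j a * t) = M 1 (c' v a * t)" if "v \<in> carrier V" "a \<in> carrier A" "t \<in> carrier TA" for v a t
  unfolding L_def using H_0[OF that] by simp
 have L_lin: "lin K TA TA (L v)" if "v \<in> carrier V" for v
  unfolding L_def by (rule lin_comp'[OF sh_lin[OF modA lH[OF that]] M_lin])
 have L_tp: "L v t \<in> tp A 2" if "v \<in> carrier V" "t \<in> tp A 2" for v t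
  unfolding L_def by (rule M_tp, rule sh_tp[OF modA lH[OF that(1)] that(2)]) simp
 have L_bilin: "bilin V (tpm1 A 2) (tpm1 A 2) L"
 proof (rule bilinI)
  fix u assume u: "u \<in> carrier V"
  show "lin K (tpm1 A 2) (tpm1 A 2) (L u)"
   by (rule lin_subI[OF lin_sub[OF L_lin[OF u]]]) (use wsp_cl_tp[OF modA] L_tp u in auto)
 next
  fix t assume t: "t \<in> carrier (tpm1 A 2)"
  then have t: "t \<in> tp A 2" by simp
  show "lin K V (tpm1 A 2) (%u. L u t)"
  proof (rule linI)
   fix u v assume u: "u \<in> carrier V" and v: "v \<in> carrier V"
   show "L u t \<in> carrier (tpm1 A 2)" using L_tp[OF u t] by simp
   have "L (u +[V] v) t = L u t +[TA] L v t"
    by (rule tp2_eqI[OF t L_lin lin_sum[OF _ L_lin L_lin]])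
     (use u v in \<open>auto simp: L_eq lin_add[OF c'_lin] add_mult lin_add[OF M_lin]\<close>)
   then show "L (u +[V] v) t = L u t +[tpm1 A 2] L v t" by simp
  next
   fix k u assume k: "k \<in> carrier K" and u: "u \<in> carrier V"
   have "L (k *:[V] u) t = k *:[TA] L u t"
    by (rule tp2_eqI[OF t L_lin lin_scale[OF _ k L_lin]])
     (use u k in \<open>auto simp: L_eq lin_smult[OF c'_lin] mult_smult lin_smult[OF M_lin]\<close>)
   then show "L (k *:[V] u) t = k *:[tpm1 A 2] L u t" by simp
  qed
 qed
 have M2: "module K (tpm1 A 2)" by simp
 obtain R where R: "bilin A (tpm1 A 2) (tpm1 A 2) R" "\<And>m. m \<in> tp A 2 ==> R \<one>\<^bsub>A\<^esub> m = m"
  "\<And>v m. v \<in> carrier V ==> m \<in> tp A 2 ==> R (iv v) m = L v m"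
  "\<And>a b m. a \<in> carrier A ==> b \<in> carrier A ==> m \<in> tp A 2 ==> R (a \<cdot>[A] b) m = R a (R b m)"
  using left_action[OF modV M2 L_bilin] by auto
 have R_tp: "R a t \<in> tp A 2" if "a \<in> carrier A" "t \<in> tp A 2" for a t using bilin_cl[OF R(1)] that by simp
 have R_cl [simp]: "R a t \<in> carrier TA" if "a \<in> carrier A" "t \<in> tp A 2" for a t by (rule wsp_cl_tp[OF modA R_tp[OF that]])
 have Rl: "lin K (tpm1 A 2) TA (R a)" if "a \<in> carrier A" for a
  using lin_subD[OF bilinD(1)[OF R(1) that]] wsp_cl_tp[OF modA] by blast
 have Rl2: "lin K A TA (%a. R a t)" if "t \<in> tp A 2" for t
  using lin_subD[OF bilinD(2)[OF R(1), of t]] wsp_cl_tp[OF modA] that by auto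
 have "bilin A A TA (%a b. R a (j b * e))"
 proof (rule bilinI)
  fix a assume a: "a \<in> carrier A"
  have "lin K A (tpm1 A 2) (%b. j b * e)"
   by (rule lin_subI[OF lin_mult_right[OF _ _ iota_lin[OF modA]]]) auto
  from lin_comp'[OF this Rl[OF a]] show "lin K A TA (%b. R a (j b * e))" .
 qed (use Rl2 in auto)
 from bilin_ext[OF modA _ this] obtain cT where cT: "lin K TA TA cT"
  "\<And>a b. a \<in> carrier A ==> b \<in> carrier A ==> cT (j a * j b) = R a (j b * e)" by auto
 have "cT t \<in> tp A 2" if "t \<in> tp A 2" for t
  using that unfolding tpow_wsp
  by (rule wsp_image[OF _ modA _ cT(1) wsp_subm[OF modA]])
   (auto dest!: lists_len2 simp: pt_Cons cT(2) tpow_wsp[symmetric] R_tp)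
 then have lc: "lop A 2 2 cT" by (rule lopI[OF modA cT(1)])
 interpret pre_br K A cT by unfold_locales (rule lc)
 \<comment> \<open>Right multiplication on the second factor commutes with the left action; this is
   the mirror image of the first pass.\<close>
 have LM: "M 1 (L v t * j y) = L v (M 1 (t * j y))" if v: "v \<in> carrier V" and t: "t \<in> tp A 2" and y: "y \<in> carrier A" for v t y
 proof -
  have tc: "t \<in> carrier TA" by (rule wsp_cl_tp[OF modA t])
  have ty: "t * j y \<in> tge A 3" by (rule tp_tge[OF tp_mult[OF modA t iota_tp(1)[OF modA y] refl]]) simp
  have Ht: "sh A 0 1 (H v) t \<in> tge A 3" by (rule tp_tge[OF sh_tp[OF modA lH[OF v] t, of 3]]) simp_all
  have Hty: "sh A 0 1 (H v) (t * j y) = sh A 0 1 (H v) t * j y"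
   by (rule sh_right[OF modA lH[OF v]]) (use tp_tge[OF t] y in simp_all)
  have Hty': "sh A 0 1 (H v) (t * j y) \<in> tge A 4" using sh_tge[OF modA lH[OF v] ty, of 4] by simp
  have "M 1 (L v t * j y) = M 1 (M 1 (sh A 0 1 (H v) (t * j y)))"
   unfolding L_def Hty using sh_right[OF modA lopM, of "sh A 0 1 (H v) t" 1 "j y"] Ht y by simp
  also have "\<dots> = M 1 (M 2 (sh A 0 1 (H v) (t * j y)))"
   using MM[of "sh A 0 1 (H v) (t * j y)" 1] Hty' by simp
  also have "M 2 (sh A 0 1 (H v) (t * j y)) = sh A 0 1 (H v) (M 1 (t * j y))"
   using far[OF lH[OF v] lopM, of 0 1 2 "t * j y"] ty by simp
  finally show ?thesis unfolding L_def .
 qed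
 have M1_tp: "M 1 (t * j y) \<in> tp A 2" if "t \<in> tp A 2" "y \<in> carrier A" for t y
  by (rule M_tp, rule tp_mult[OF modA that(1) iota_tp(1)[OF modA that(2)]]) simp
 have RM: "M 1 (R a t * j y) = R a (M 1 (t * j y))" if a: "a \<in> carrier A" and t: "t \<in> tp A 2" and y: "y \<in> carrier A" for a t y
 proof -
  note M1 = M1_tp[OF _ y, simplified]
  have "\<forall>t\<in>tp A 2. M 1 (R a t * j y) = R a (M 1 (t * j y))"
   using a modV
  proof (induction rule: T_gen_induct)
   case one
   then show ?case using R(2) M1 by simp
  next
   case (gen v)
   then show ?case using R(3) LM y M1 by simp
  next
   case (mult v a)
   then show ?case using R(4) R(3) L_tp LM M1 y R_tp by simp
  next
   case (add a b)
   then show ?case using R_cl lin_add[OF Rl2] M1 y by (simp add: add_mult lin_add[OF M_lin])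
  next
   case (smult k a)
   then show ?case using R_cl lin_smult[OF Rl2] M1 y by (simp add: mult_smult lin_smult[OF M_lin])
  qed
  then show ?thesis using t by blast
 qed
 have M1e: "M 1 ((j x * e) * j y) = j x * j y" if "x \<in> carrier A" "y \<in> carrier A" for x y
  using M_mult'[of "\<one>\<^bsub>A\<^esub>" y] that by (simp add: Tassoc sh_Suc[OF lopM])
 \<comment> \<open>Any x \<otimes> y is x \<otimes> 1 multiplied by y on the right, so the action on
   arbitrary tensors is expressed by the braiding with x followed by a multiplication.\<close>
 have RC: "R a t = M 1 (C 0 (j a * t))" if a: "a \<in> carrier A" and t: "t \<in> tp A 2" for a t
 proof (rule tp2_lin_eq[OF t modA _ Rl[OF a]])
  show "lin K (tpm1 A 2) TA (%t. M 1 (C 0 (j a * t)))"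
   by (rule lin_sub[OF lin_comp'[OF lin_comp'[OF T_mult_lin_left[OF modA] C_lin] M_lin]]) (use a wsp_cl_tp[OF modA] in auto)
  fix x y assume x: "x \<in> carrier A" and y: "y \<in> carrier A"
  have ax: "j a * j x \<in> tp A 2" using a x by simp
  have "R a (j x * j y) = M 1 (R a (j x * e) * j y)" using RM[OF a _ y, of "j x * e"] M1e[OF x y] x by simp
  also have "R a (j x * e) = C 0 (j a * j x)" using C_base[OF ax] cT(2)[OF a x] by simp
  also have "C 0 (j a * j x) * j y = C 0 (j a * (j x * j y))"
   using sh_right[OF modA lopC, of "j a * j x" 0 "j y"] tp_tge[OF ax, of 2] a x y by (simp add: Tassoc)
  finally show "R a (j x * j y) = M 1 (C 0 (j a * (j x * j y)))" .
 qed simp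
 have g: "C 0 (M 0 t) = M 1 (C 0 (C 1 t))" if t: "t \<in> tp A 3" for t
 proof (rule tp_lin_eq[OF t modA])
  show "lin K (tpm1 A 3) TA (%t. C 0 (M 0 t))" "lin K (tpm1 A 3) TA (%t. M 1 (C 0 (C 1 t)))"
   by (rule lin_sub[OF lin_comp'[OF M_lin C_lin]], use wsp_cl_tp[OF modA] in auto,
     rule lin_sub[OF lin_comp'[OF lin_comp'[OF C_lin C_lin] M_lin]], use wsp_cl_tp[OF modA] in auto)
  fix w assume w: "w \<in> lists (carrier A)" "length w = 3"
  then obtain a a' b where w: "w = [a, a', b]" and a: "a \<in> carrier A" "a' \<in> carrier A" "b \<in> carrier A"
   by (auto simp: length_Suc_conv numeral_3_eq_3)
  have be: "j b * e \<in> tp A 2" using a by simp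
  have a'b: "j a' * j b \<in> tp A 2" using a by simp
  have aab: "j (a \<cdot>[A] a') * j b \<in> tp A 2" using a by simp
  have "C 0 (M 0 (j a * (j a' * j b))) = cT (j (a \<cdot>[A] a') * j b)"
   using a C_base[OF aab] by (simp add: M_mult)
  also have "\<dots> = R a (R a' (j b * e))" using cT(2) R(4)[OF a(1,2) be] a by simp
  also have "R a' (j b * e) = C 0 (j a' * j b)" using C_base[OF a'b] cT(2) a by simp
  also have "R a (C 0 (j a' * j b)) = M 1 (C 0 (j a * C 0 (j a' * j b)))"
   by (rule RC[OF a(1) C_tp[OF a'b]])
  also have "j a * C 0 (j a' * j b) = C 1 (j a * (j a' * j b))" using a by (simp add: sh_Suc[OF lopC])
  finally show "C 0 (M 0 (pt A w)) = M 1 (C 0 (C 1 (pt A w)))" unfolding w using a by (simp add: pt_Cons)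
 qed simp
 have h: "cT (j (iv v) * j b) = c' v b" if v: "v \<in> carrier V" and b: "b \<in> carrier A" for v b
 proof -
  have "cT (j (iv v) * j b) = L v (j b * e)" using cT(2) R(3) v b by simp
  also have "\<dots> = M 1 (c' v b * e)" using L_eq v b by simp
  also have "c' v b * e = U 2 (c' v b)"
   using sh_base_left[OF modA lopU c'_tp[OF v b] one_tp[OF modA]] v b by simp
  also have "M 1 (U 2 (c' v b)) = c' v b"
   using MU(2)[of "c' v b" 1] tp_tge[OF c'_tp[OF v b], of 2] by simp
  finally show ?thesis .
 qed
 have "cT (j (iv v) * j (a \<cdot>[A] b)) = M 0 (C 1 (cT (j (iv v) * j a) * j b))"
  if v: "v \<in> carrier V" and a: "a \<in> carrier A" and b: "b \<in> carrier A" for v a b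
 proof -
  have "c' v (a \<cdot>[A] b) = M 0 (C 1 (c' v a * j b))"
   by (rule c'(4)[OF v a b lc]) (use h b in auto)
  then show ?thesis using h v a b by simp
 qed
 moreover have "cT (e * j b) = j b * e" if "b \<in> carrier A" for b
  using cT(2) R(2) that by simp
 ultimately show ?thesis using lc g h c'(2,3) modA one_cl[OF alg] by (intro exI[of _ cT]) auto
qed

end

context tens begin

lemma Ti_cl [simp]: "t \<in> carrier A ==> Ti t \<in> carrier TA"
 by (rule Tm_cl[OF modV modA iv_lin])

lemma Ti_tp: "t \<in> tp V n ==> Ti t \<in> tp A n"
 by (rule Tm_tp[OF modV modA iv_lin])

lemma Ti_cons: "v \<in> carrier V ==> t \<in> carrier A ==> Ti (iv v \<cdot>[A] t) = j (iv v) * Ti t"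
 by (simp add: Tm_mult[OF modV modA iv_lin] Tm_iota[OF modV modA iv_lin])

lemma tp_Suc_induct_eq:
 assumes t: "t \<in> tp V (Suc n)" and f: "lin K A TA f" and g: "lin K A TA g"
  and eq: "\<And>v s. v \<in> carrier V ==> s \<in> tp V n ==> f (iv v \<cdot>[A] s) = g (iv v \<cdot>[A] s)"
 shows "f t = g t"
proof (rule tp_lin_eq[OF t modV])
 show "lin K (tpm1 V (Suc n)) TA f" "lin K (tpm1 V (Suc n)) TA g"
  using wsp_cl_tp[OF modV] f g by (auto intro: lin_sub)
 fix w assume "w \<in> lists (carrier V)" "length w = Suc n"
 then obtain v u where "w = v # u" "v \<in> carrier V" "u \<in> lists (carrier V)" "length u = n" by (auto simp: length_Suc_conv)
 then show "f (pt V w) = g (pt V w)" using eq[of v "pt V u"] by (simp add: pt_Cons pt_tp)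
qed simp

text \<open>What is missing after the two passes is proved by induction on words: the product rule
  in the right argument for arbitrary left arguments, the right unit law, and the braid relation.
  For the latter the factors are released from V into T(V) one at a time, in the order third,
  second, first (\<open>Z\<close>, \<open>Y\<close>, \<open>X\<close>), because each product step
  needs the relation for the factors already released.\<close>

lemma tensor_braiding_exists:
 "\<exists>c'. braided_algebra K A c' \<and> (\<forall>t\<in>tp V 2. c' (tsquare K V A iv t) = tsquare K V A iv (cV t))"
proof -
 obtain cT where lc: "lop A 2 2 cT" and eone: "\<And>b. b \<in> carrier A ==> cT (e * j b) = j b * e"
  and vone: "\<And>v. v \<in> carrier V ==> cT (j (iv v) * e) = e * j (iv v)"
  and vu: "\<And>v u. v \<in> carrier V ==> u \<in> carrier V ==> cT (j (iv v) * j (iv u)) = Ti (cV (iv v \<cdot>[A] iv u))"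
  and CM0: "\<And>t. t \<in> tp A 3 ==> sh A 0 2 cT (M 0 t) = M 1 (sh A 0 2 cT (sh A 1 2 cT t))"
  and half: "\<And>v a b. v \<in> carrier V ==> a \<in> carrier A ==> b \<in> carrier A ==>
   cT (j (iv v) * j (a \<cdot>[A] b)) = M 0 (sh A 1 2 cT (cT (j (iv v) * j a) * j b))"
  using exists_full by blast
 interpret pre_br K A cT by unfold_locales (rule lc)
 note CMl = CM_lift1[OF CM0]
 note CUl = CU_lift1[OF eone]
 have jlin: "lin K A TA (%x. j x * s)" if "s \<in> carrier TA" for s
  by (rule lin_mult_right[OF T_alg[OF modA] that iota_lin[OF modA]])
 have jmul: "j (x \<cdot>[A] y) * s = M 0 (j x * (j y * s))" if "x \<in> carrier A" "y \<in> carrier A" "s \<in> carrier TA" for x y s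
  using M_mult[OF that] by simp
 have jmul1: "j x * (j (y \<cdot>[A] z) * s) = M 1 (j x * (j y * (j z * s)))"
  if "x \<in> carrier A" "y \<in> carrier A" "z \<in> carrier A" "s \<in> carrier TA" for x y z s
  using that by (simp add: sh_Suc[OF lopM] M_mult)
 \<comment> \<open>Induction on the left factor. For a product the left product rule splits it,
   after which the hypothesis for the inner part and then the one for the generator apply.\<close>
 have Q: "C 0 (M 1 (j a * s)) = M 0 (C 1 (C 0 (j a * s)))" if a: "a \<in> carrier A" and s: "s \<in> tge A 2" for a s
 proof -
  have "\<forall>s\<in>tge A 2. C 0 (M 1 (j a * s)) = M 0 (C 1 (C 0 (j a * s)))"
   using a modV
  proof (induction rule: T_gen_induct)
   case one
   show ?case
   proof
    fix s assume s: "s \<in> tge A 2"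
    have s1: "s \<in> tge A 1" "s \<in> carrier TA" using tge_mono[OF s, of 1] s by simp_all
    have "M 1 (e * s) = e * M 0 s" using s1 by (simp add: sh_Suc[OF lopM])
    also have "\<dots> = U 0 (M 0 s)" using s1 by (simp add: U_0)
    finally have "C 0 (M 1 (e * s)) = U 1 (M 0 s)" using CUl[of "M 0 s" 0] s s1 by simp
    also have "\<dots> = M 0 (U 2 s)" using far[OF lopM lopU, of 0 2 1 s] s by simp
    also have "U 2 s = C 1 (U 1 s)" using CUl[of s 1] s by simp
    also have "U 1 s = C 0 (e * s)" using CUl[of s 0] s1 by (simp add: U_0)
    finally show "C 0 (M 1 (e * s)) = M 0 (C 1 (C 0 (e * s)))" .
   qed
  next
   case (gen v)
   show ?case
   proof
    fix s assume s: "s \<in> tge A 2"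
    show "C 0 (M 1 (j (iv v) * s)) = M 0 (C 1 (C 0 (j (iv v) * s)))"
    proof (rule tge_split_eqI[OF s modA])
     show "lin K TA TA (%s. C 0 (M 1 (j (iv v) * s)))" "lin K TA TA (%s. M 0 (C 1 (C 0 (j (iv v) * s))))"
      using gen by (auto intro!: lin_comp'[OF _ M_lin] lin_comp'[OF _ C_lin] T_mult_lin_left)
     fix t y assume t: "t \<in> tp A 2" and y: "y \<in> carrier TA"
     have "C 0 (M 1 (j (iv v) * t)) = M 0 (C 1 (C 0 (j (iv v) * t)))"
     proof (rule tp2_eqI[OF t])
      show "lin K TA TA (%s. C 0 (M 1 (j (iv v) * s)))" "lin K TA TA (%s. M 0 (C 1 (C 0 (j (iv v) * s))))"
       using gen by (auto intro!: lin_comp'[OF _ M_lin] lin_comp'[OF _ C_lin] T_mult_lin_left)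
      fix a b assume a: "a \<in> carrier A" and b: "b \<in> carrier A"
      have v: "iv v \<in> carrier A" using gen by simp
      have va: "j (iv v) * j a \<in> tp A 2" "j (iv v) * j (a \<cdot>[A] b) \<in> tp A 2" using v a b by simp_all
      have "C 0 (M 1 (j (iv v) * (j a * j b))) = C 0 (j (iv v) * j (a \<cdot>[A] b))"
       using v a b by (simp add: sh_Suc[OF lopM] M_mult')
      also have "\<dots> = M 0 (C 1 (C 0 (j (iv v) * j a) * j b))"
       using half[OF gen a b] C_base[OF va(1)] C_base[OF va(2)] by simp
      also have "C 0 (j (iv v) * j a) * j b = C 0 (j (iv v) * (j a * j b))"
       using sh_right[OF modA lopC, of "j (iv v) * j a" 0 "j b"] tp_tge[OF va(1), of 2] v a b by (simp add: Tassoc)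
      finally show "C 0 (M 1 (j (iv v) * (j a * j b))) = M 0 (C 1 (C 0 (j (iv v) * (j a * j b))))" .
     qed
     moreover have "j (iv v) * t \<in> tge A 3" using gen tp_tge[OF t] by (intro iota_mult_tge) auto
     moreover then have "j (iv v) * t \<in> tge A 2" using tge_mono by fastforce
     ultimately show "C 0 (M 1 (j (iv v) * (t * y))) = M 0 (C 1 (C 0 (j (iv v) * (t * y))))"
      using gen y wsp_cl_tp[OF modA t] by (simp add: Tassoc[symmetric] rights)
    qed
   qed
  next
   case (mult v a)
   show ?case
   proof
    fix s assume s: "s \<in> tge A 2"
    let ?v = "iv v"
    define q where "q = j ?v * (j a * s)"
    have cl: "?v \<in> carrier A" "a \<in> carrier A" "s \<in> carrier TA" using mult s by simp_all
    have q [simp]: "q \<in> tge A n" if "n \<le> 4" for n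
     by (rule tge_mono[OF _ that]) (use cl s in \<open>simp add: q_def iota_mult_tge\<close>)
    have qc [simp]: "q \<in> carrier TA" using cl unfolding q_def by simp
    define s' where "s' = C 1 (C 0 (j a * s))"
    have as: "j a * s \<in> tge A 3" using cl s by (simp add: iota_mult_tge)
    have s': "s' \<in> tge A 2" "s' \<in> carrier TA" unfolding s'_def using as tge_mono[OF as, of 2] cl by simp_all
    have q1: "C 2 (C 1 q) = j ?v * s'" unfolding q_def s'_def using cl by (simp add: ats)
    have "C 0 (M 1 (j (?v \<cdot>[A] a) * s)) = C 0 (M 1 (M 0 q))" unfolding q_def using cl by (simp add: jmul)
    also have "M 1 (M 0 q) = M 0 (M 2 q)" using far[OF lopM lopM, of 0 2 1 q] by simp
    also have "C 0 (M 0 (M 2 q)) = M 1 (C 0 (C 1 (M 2 q)))" using CMl[of "M 2 q" 0] by simp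
    also have "C 1 (M 2 q) = j ?v * C 0 (M 1 (j a * s))" unfolding q_def using cl by (simp add: ats)
    also have "\<dots> = j ?v * M 0 s'" unfolding s'_def using mult.IH(2) s by simp
    also have "\<dots> = M 1 (j ?v * s')" using cl s' by (simp add: sh_Suc[OF lopM])
    also have "C 0 (M 1 (j ?v * s')) = M 0 (C 1 (C 0 (C 2 (C 1 q))))"
     unfolding q1 using mult.IH(1) s'(1) by blast
    also have "C 0 (C 2 (C 1 q)) = C 2 (C 0 (C 1 q))" using C_far[OF lopC, of 0 2 "C 1 q"] by simp
    also have "M 1 (M 0 (C 1 (C 2 (C 0 (C 1 q))))) = M 0 (M 2 (C 1 (C 2 (C 0 (C 1 q)))))"
     using far[OF lopM lopM, of 0 2 1 "C 1 (C 2 (C 0 (C 1 q)))"] by simp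
    also have "M 2 (C 1 (C 2 (C 0 (C 1 q)))) = C 1 (M 1 (C 0 (C 1 q)))" using CMl[of "C 0 (C 1 q)" 1] by (simp add: numeral_2_eq_2[symmetric])
    also have "M 1 (C 0 (C 1 q)) = C 0 (M 0 q)" using CMl[of q 0] by simp
    also have "M 0 q = j (?v \<cdot>[A] a) * s" unfolding q_def using cl by (simp add: jmul)
    finally show "C 0 (M 1 (j (?v \<cdot>[A] a) * s)) = M 0 (C 1 (C 0 (j (?v \<cdot>[A] a) * s)))" .
   qed
  next
   case (add a b)
   then show ?case using lin_add[OF jlin] by (simp add: lin_add[OF M_lin] lin_add[OF C_lin])
  next
   case (smult k a)
   then show ?case using lin_smult[OF jlin] by (simp add: lin_smult[OF M_lin] lin_smult[OF C_lin])
  qed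
  then show ?thesis using s by blast
 qed
 have CM1: "C 0 (M 1 t) = M 0 (C 1 (C 0 t))" if t: "t \<in> tp A 3" for t
  by (rule tge_Suc_eqI[OF tp_tge[OF t, of "Suc 2"]], simp, (intro op_lins)+, rule Q)
 note CMr = CM_lift2[OF CM1]
 have aone: "cT (j a * e) = e * j a" if a: "a \<in> carrier A" for a
  using a modV
 proof (induction rule: T_gen_induct)
  case one
  show ?case by (rule eone) simp
 next
  case (gen v)
  then show ?case by (rule vone)
 next
  case (mult v a)
  have tp: "j (iv v) * (j a * e) \<in> tp A 3" "j (iv v) * j a \<in> tp A 2" "j a * e \<in> tp A 2" "j (iv v) * e \<in> tp A 2" "j (iv v \<cdot>[A] a) * e \<in> tp A 2"
   using mult iota_mult_tp[OF modA, of "iv v" "j a * e" 2 3] by simp_all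
  have "cT (j (iv v \<cdot>[A] a) * e) = C 0 (M 0 (j (iv v) * (j a * e)))"
   using C_base[OF tp(5)] mult by (simp add: M_mult)
  also have "\<dots> = M 1 (C 0 (j (iv v) * C 0 (j a * e)))" using CM0[OF tp(1)] mult by (simp add: ats)
  also have "C 0 (j a * e) = e * j a" using C_base[OF tp(3)] mult by simp
  also have "C 0 (j (iv v) * (e * j a)) = C 0 (j (iv v) * e) * j a"
   using sh_right[OF modA lopC, of "j (iv v) * e" 0 "j a"] tp_tge[OF tp(4), of 2] mult by (simp add: Tassoc)
  also have "C 0 (j (iv v) * e) = e * j (iv v)" using C_base[OF tp(4)] mult by simp
  finally show ?case using mult by (simp add: Tassoc sh_Suc[OF lopM] M_mult')
 next
  case (add a b)
  have tp: "j a * e \<in> tp A 2" "j b * e \<in> tp A 2" using add by simp_all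
  then show ?case using add lin_add[OF jlin, of e a b] lin_add[OF lc[unfolded lop_def], of "j a * e" "j b * e"]
   by (simp add: lin_add[OF iota_lin[OF modA]] mult_add)
 next
  case (smult k a)
  have tp: "j a * e \<in> tp A 2" using smult by simp_all
  then show ?case using smult lin_smult[OF jlin, of e k a] lin_smult[OF lc[unfolded lop_def], of k "j a * e"]
   by (simp add: lin_smult[OF iota_lin[OF modA]] mult_smult)
 qed
 note CUr = CU_lift2[OF aone]
 have CTi: "C i (Ti t) = Ti (sh V i 2 cV t)" if "t \<in> carrier A" for i t
 proof -
  have "Ti (cV s) = cT (Ti s)" if s: "s \<in> tp V 2" for s
  proof (rule tp2_lin_eq[OF s modV])
   show "lin K (tpm1 V 2) TA (%s. Ti (cV s))"
    using lin_comp'[OF lopc[unfolded lop_def] lin_sub[OF Ti_lin]] wsp_cl_tp[OF modV] by blast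
   show "lin K (tpm1 V 2) TA (%s. cT (Ti s))"
    by (rule lin_comp'[OF Tm_tp_lin[OF modV modA iv_lin] lop_lin[OF modA lc]])
   fix v u assume v: "v \<in> carrier V" "u \<in> carrier V"
   then show "Ti (cV (iv v \<cdot>[A] iv u)) = cT (Ti (iv v \<cdot>[A] iv u))"
    using vu[OF v] Ti_cons[OF v(1), of "iv u"] Tm_iota[OF modV modA iv_lin v(2)] by simp
  qed simp
  from Tm_sh[OF modV modA iv_lin lopc lc this \<open>t \<in> carrier A\<close>] show ?thesis by simp
 qed
 define Br where "Br t \<longleftrightarrow> C 0 (C 1 (C 0 t)) = C 1 (C 0 (C 1 t))" for t
 \<comment> \<open>The third factor is released. Splitting it as a generator times a word gives four
   strands; the relation on the first three is that of V, and the relation on the last three is the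
   induction hypothesis next to a spectator.\<close>
 have Z: "Br (Ti s * j z)" if s: "s \<in> tp V 2" and z: "z \<in> carrier A" for s z
 proof -
  have "\<forall>s\<in>tp V 2. Br (Ti s * j z)"
   using z modV
  proof (induction rule: T_gen_induct)
   case one
   show ?case unfolding Br_def
   proof
    fix s assume s: "s \<in> tp V 2"
    define r where "r = Ti s"
    have r: "r \<in> tp A 2" "r \<in> carrier TA" unfolding r_def using Ti_tp[OF s] wsp_cl_tp[OF modV s] by auto
    have [simp]: "r \<in> tge A n" if "n \<le> 2" for n using tp_tge[OF r(1) that] .
    have re: "r * e = U 2 r" using sh_base_left[OF modA lopU r(1) one_tp[OF modA]] r(2) by simp
    have "C 0 (C 1 (C 0 (U 2 r))) = C 0 (C 1 (U 2 (C 0 r)))" using far[OF lopC lopU, of 0 2 2 r] by simp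
    also have "\<dots> = U 0 (C 0 r)" using CUr[of "C 0 r" 1] CUr[of "C 0 r" 0] by simp
    also have "\<dots> = C 1 (C 0 (C 1 (U 2 r)))"
     using CUr[of r 1] CUr[of r 0] far[OF lopU lopC, of 0 0 1 r] by simp
    finally show "C 0 (C 1 (C 0 (Ti s * e))) = C 1 (C 0 (C 1 (Ti s * e)))" unfolding r_def[symmetric] re .
   qed
  next
   case (gen v)
   show ?case unfolding Br_def
   proof
    fix s assume s: "s \<in> tp V 2"
    have sv: "s \<cdot>[A] iv v \<in> tp V 3" by (rule tp_mult[OF modV s iota_tp(1)[OF modV gen]]) simp
    have "Ti s * j (iv v) = Ti (s \<cdot>[A] iv v)"
     using wsp_cl_tp[OF modV s] gen by (simp add: Tm_mult[OF modV modA iv_lin] Tm_iota[OF modV modA iv_lin])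
    then show "C 0 (C 1 (C 0 (Ti s * j (iv v)))) = C 1 (C 0 (C 1 (Ti s * j (iv v))))"
     using braidV[OF sv] wsp_cl_tp[OF modV sv] sh_cl[OF modV lopc] by (simp add: CTi)
   qed
  next
   case (mult v z)
   show ?case unfolding Br_def
   proof
    fix s assume s: "s \<in> tp V 2"
    have cl: "Ti s \<in> carrier TA" "iv v \<in> carrier A" "z \<in> carrier A" "s \<in> carrier A"
     using mult Ti_tp[OF s] wsp_cl_tp[OF modA] wsp_cl_tp[OF modV s] by auto
    define r where "r = s \<cdot>[A] iv v"
    have r: "r \<in> tp V 3" unfolding r_def by (rule tp_mult[OF modV s iota_tp(1)[OF modV mult(1)]]) simp
    have rc [simp]: "r \<in> carrier A" by (rule wsp_cl_tp[OF modV r])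
    have Tr: "Ti r = Ti s * j (iv v)" unfolding r_def
     using cl mult by (simp add: Tm_mult[OF modV modA iv_lin] Tm_iota[OF modV modA iv_lin])
    define q where "q = Ti r * j z"
    have qtp: "q \<in> tp A 4" unfolding q_def by (rule tp_mult[OF modA Ti_tp[OF r] iota_tp(1)[OF modA cl(3)]]) simp
    have [simp]: "q \<in> tge A n" if "n \<le> 4" for n using tp_tge[OF qtp that] .
    have [simp]: "q \<in> carrier TA" by (rule wsp_cl_tp[OF modA qtp])
    have Tr3 [simp]: "Ti r \<in> tge A n" if "n \<le> 3" for n using tp_tge[OF Ti_tp[OF r] that] .
    have shq: "C 0 q = Ti (sh V 0 2 cV r) * j z" "C 1 q = Ti (sh V 1 2 cV r) * j z"
     unfolding q_def using cl by (simp_all add: rights CTi[symmetric])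
    have sr: "sh V i 2 cV r \<in> tp V 3" for i by (rule sh_tp[OF modV lopc r]) simp
    have srr: "sh V i 2 cV (sh V k 2 cV r) \<in> tp V 3" for i k by (rule sh_tp[OF modV lopc sr]) simp
    have [simp]: "Ti (sh V i 2 cV r) \<in> tge A n" "Ti (sh V i 2 cV (sh V k 2 cV r)) \<in> tge A n" if "n \<le> 3" for i k n
     using tp_tge[OF Ti_tp[OF sr] that] tp_tge[OF Ti_tp[OF srr] that] by auto
    have big: "C 0 (C 1 (C 0 q)) = C 1 (C 0 (C 1 q))"
     unfolding q_def using braidV[OF r] cl sh_cl[OF modV lopc] by (simp add: rights CTi)
    have C01: "C 0 (C 1 q) = Ti (sh V 0 2 cV (sh V 1 2 cV r)) * j z"
     unfolding shq(2) using sh_cl[OF modV lopc] cl tp_tge[OF Ti_tp[OF sr], of 2] by (simp add: rights CTi[symmetric])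
    \<comment> \<open>The first letter of \<open>p\<close> is a spectator for operators at positions
      1 and 2; removing it leaves the induction hypothesis.\<close>
    have sub: "C 1 (C 2 (C 1 (Ti p * j z))) = C 2 (C 1 (C 2 (Ti p * j z)))" if p: "p \<in> tp V 3" for p
    proof (rule tp_Suc_induct_eq[OF p[unfolded numeral_3_eq_3], folded numeral_2_eq_2])
     show "lin K A TA (%p. C 1 (C 2 (C 1 (Ti p * j z))))" "lin K A TA (%p. C 2 (C 1 (C 2 (Ti p * j z))))"
      using cl by (auto intro!: lin_comp'[OF _ C_lin] lin_comp'[OF Ti_lin T_mult_lin_right])
     fix u p assume u: "u \<in> carrier V" and p: "p \<in> tp V 2"
     have "Br (Ti p * j z)" using mult.IH(2) p by blast
     then show "C 1 (C 2 (C 1 (Ti (iv u \<cdot>[A] p) * j z))) = C 2 (C 1 (C 2 (Ti (iv u \<cdot>[A] p) * j z)))"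
      unfolding Br_def using u cl wsp_cl_tp[OF modV p] by (simp add: Ti_cons Tassoc ats)
    qed
    have "C 1 (M 2 q) = M 1 (C 2 (C 1 q))" using CMr[of q 1] by (simp add: numeral_2_eq_2[symmetric])
    have M2: "Ti s * j (iv v \<cdot>[A] z) = M 2 q"
     unfolding q_def Tr using sh_left[OF modA lopM Ti_tp[OF s], of "j (iv v) * j z" 0] cl by (simp add: Tassoc M_mult')
    have "C 0 (C 1 (C 0 (M 2 q))) = C 0 (C 1 (M 2 (C 0 q)))" using far[OF lopC lopM, of 0 2 2 q] by simp
    also have "\<dots> = C 0 (M 1 (C 2 (C 1 (C 0 q))))" using CMr[of "C 0 q" 1] by (simp add: numeral_2_eq_2[symmetric])
    also have "\<dots> = M 0 (C 1 (C 0 (C 2 (C 1 (C 0 q)))))" using CMr[of "C 2 (C 1 (C 0 q))" 0] by simp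
    also have "C 0 (C 2 (C 1 (C 0 q))) = C 2 (C 0 (C 1 (C 0 q)))" using C_far[OF lopC, of 0 2 "C 1 (C 0 q)"] by simp
    also have "C 1 (C 2 (C 0 (C 1 (C 0 q)))) = C 1 (C 2 (C 1 (C 0 (C 1 q))))" unfolding big ..
    also have "\<dots> = C 2 (C 1 (C 2 (C 0 (C 1 q))))" unfolding C01 by (rule sub[OF srr])
    also have "C 2 (C 0 (C 1 q)) = C 0 (C 2 (C 1 q))" using C_far[OF lopC, of 0 2 "C 1 q"] by simp
    also have "M 0 (C 2 (C 1 (C 0 (C 2 (C 1 q))))) = C 1 (M 0 (C 1 (C 0 (C 2 (C 1 q)))))"
     using far[OF lopM lopC, of 0 2 1 "C 1 (C 0 (C 2 (C 1 q)))"] by simp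
    also have "M 0 (C 1 (C 0 (C 2 (C 1 q)))) = C 0 (M 1 (C 2 (C 1 q)))" using CMr[of "C 2 (C 1 q)" 0] by simp
    also have "M 1 (C 2 (C 1 q)) = C 1 (M 2 q)" using CMr[of q 1] by (simp add: numeral_2_eq_2[symmetric])
    finally show "C 0 (C 1 (C 0 (Ti s * j (iv v \<cdot>[A] z)))) = C 1 (C 0 (C 1 (Ti s * j (iv v \<cdot>[A] z))))"
     unfolding M2 .
   qed
  next
   case (add a b)
   show ?case unfolding Br_def
   proof
    fix s assume s: "s \<in> tp V 2"
    have "lin K A TA (%z. Ti s * j z)" by (rule lin_mult_left[OF _ _ iota_lin[OF modA]]) (use wsp_cl_tp[OF modV s] in auto)
    from lin_add[OF this] show "C 0 (C 1 (C 0 (Ti s * j (a +[A] b)))) = C 1 (C 0 (C 1 (Ti s * j (a +[A] b))))"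
     using add s wsp_cl_tp[OF modV s] unfolding Br_def by (simp add: lin_add[OF C_lin])
   qed
  next
   case (smult k a)
   show ?case unfolding Br_def
   proof
    fix s assume s: "s \<in> tp V 2"
    have "lin K A TA (%z. Ti s * j z)" by (rule lin_mult_left[OF _ _ iota_lin[OF modA]]) (use wsp_cl_tp[OF modV s] in auto)
    from lin_smult[OF this] show "C 0 (C 1 (C 0 (Ti s * j (k *:[A] a)))) = C 1 (C 0 (C 1 (Ti s * j (k *:[A] a))))"
     using smult s wsp_cl_tp[OF modV s] unfolding Br_def by (simp add: lin_smult[OF C_lin])
   qed
  qed
  then show ?thesis using s by blast
 qed
 have Br_right: "Br (t * y)" if "Br t" "t \<in> tge A 3" "y \<in> carrier TA" for t y
  using that tge_mono[OF that(2), of 2] unfolding Br_def by (simp add: rights)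
 have Br_cons: "C 1 (C 2 (C 1 (j x * t))) = C 2 (C 1 (C 2 (j x * t)))" if "Br t" "x \<in> carrier A" "t \<in> carrier TA" for x t
  using that unfolding Br_def by (simp add: ats)
 have BrU0: "Br (e * s)" if s: "s \<in> tge A 2" for s
 proof -
  have s1: "s \<in> tge A 1" "s \<in> carrier TA" using tge_mono[OF s, of 1] s by auto
  have es: "e * s = U 0 s" using s1 by (simp add: U_0)
  have "C 0 (C 1 (C 0 (U 0 s))) = C 0 (U 2 s)" using CUl[of s 0] CUl[of s 1] s s1 by simp
  also have "\<dots> = U 2 (C 0 s)" using far[OF lopC lopU, of 0 2 2 s] s by simp
  also have "\<dots> = C 1 (C 0 (U 0 (C 0 s)))" using CUl[of "C 0 s" 0] CUl[of "C 0 s" 1] s s1 by simp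
  also have "U 0 (C 0 s) = C 1 (U 0 s)" using far[OF lopU lopC, of 0 0 1 s] s by simp
  finally show ?thesis unfolding Br_def es .
 qed
 \<comment> \<open>The second factor is released. When it is a single generator, the first two
   factors lie in V and \<open>Z\<close> applies to the next factor of \<open>s\<close>; this is why
   \<open>s\<close> must have degree at least one.\<close>
 have Y: "Br (j (iv v) * (j y * s))" if v: "v \<in> carrier V" and y: "y \<in> carrier A" and s: "s \<in> tge A 1" for v y s
 proof -
  have "\<forall>v\<in>carrier V. \<forall>s\<in>tge A 1. Br (j (iv v) * (j y * s))"
   using y modV
  proof (induction rule: T_gen_induct)
   case one
   show ?case unfolding Br_def
   proof (intro ballI)
    fix v s assume v: "v \<in> carrier V" and s: "s \<in> tge A 1"
    define q where "q = j (iv v) * s"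
    have sc: "s \<in> carrier TA" using s by simp
    have [simp]: "q \<in> tge A n" if "n \<le> 2" for n
     by (rule tge_mono[OF _ that]) (use v s in \<open>simp add: q_def iota_mult_tge\<close>)
    have [simp]: "q \<in> carrier TA" unfolding q_def using v sc by simp
    have e: "j (iv v) * (e * s) = U 1 q" unfolding q_def using v sc by (simp add: U_1)
    have "C 0 (C 1 (C 0 (U 1 q))) = C 0 (C 1 (U 0 q))" using CUr[of q 0] by simp
    also have "C 1 (U 0 q) = U 0 (C 0 q)" using far[OF lopU lopC, of 0 0 1 q] by simp
    also have "C 0 (U 0 (C 0 q)) = U 1 (C 0 q)" using CUl[of "C 0 q" 0] by simp
    also have "U 1 (C 0 q) = C 1 (U 2 (C 0 q))" using CUr[of "C 0 q" 1] by simp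
    also have "U 2 (C 0 q) = C 0 (U 2 q)" using far[OF lopC lopU, of 0 2 2 q] by simp
    also have "U 2 q = C 1 (U 1 q)" using CUl[of q 1] by simp
    finally show "C 0 (C 1 (C 0 (j (iv v) * (e * s)))) = C 1 (C 0 (C 1 (j (iv v) * (e * s))))" unfolding e .
   qed
  next
   case (gen u)
   show ?case
   proof (intro ballI)
    fix v s assume v: "v \<in> carrier V" and s: "s \<in> tge A 1"
    have vu: "iv v \<cdot>[A] iv u \<in> tp V 2" using v gen by simp
    have Tvu: "Ti (iv v \<cdot>[A] iv u) = j (iv v) * j (iv u)" using v gen by (simp add: Ti_cons Tm_iota[OF modV modA iv_lin])
    show "Br (j (iv v) * (j (iv u) * s))"
     unfolding Br_def
    proof (rule tge1_eqI[OF s])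
     show "lin K TA TA (%s. C 0 (C 1 (C 0 (j (iv v) * (j (iv u) * s)))))" "lin K TA TA (%s. C 1 (C 0 (C 1 (j (iv v) * (j (iv u) * s)))))"
      using v gen by (auto intro!: lin_comp'[OF _ C_lin] lin_comp'[OF T_mult_lin_left T_mult_lin_left])
     fix x r assume x: "x \<in> carrier A" and r: "r \<in> carrier TA"
     have 3: "(j (iv v) * j (iv u)) * j x \<in> tge A 3"
      by (rule tp_tge[OF tp_mult[OF modA _ iota_tp(1)[OF modA x], of _ 2 3]]) (use v gen in simp_all)
     have "Br (((j (iv v) * j (iv u)) * j x) * r)"
      by (rule Br_right[OF Z[OF vu x, unfolded Tvu] 3 r])
     then show "C 0 (C 1 (C 0 (j (iv v) * (j (iv u) * (j x * r))))) = C 1 (C 0 (C 1 (j (iv v) * (j (iv u) * (j x * r)))))"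
      unfolding Br_def using v gen x r by (simp add: Tassoc)
    qed
   qed
  next
   case (mult u y)
   show ?case unfolding Br_def
   proof (intro ballI)
    fix v s assume v: "v \<in> carrier V" and s: "s \<in> tge A 1"
    have cl: "iv v \<in> carrier A" "iv u \<in> carrier A" "y \<in> carrier A" "s \<in> carrier TA" using v mult s by auto
    define q where "q = j (iv v) * (j (iv u) * (j y * s))"
    have [simp]: "q \<in> tge A n" if "n \<le> 4" for n
     by (rule tge_mono[OF _ that]) (use cl s in \<open>simp add: q_def iota_mult_tge\<close>)
    have [simp]: "q \<in> carrier TA" unfolding q_def using cl by simp
    have M1: "j (iv v) * (j (iv u \<cdot>[A] y) * s) = M 1 q" unfolding q_def using cl by (simp add: jmul1)
    define r where "r = cV (iv v \<cdot>[A] iv u)"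
    have r: "r \<in> tp V 2" unfolding r_def by (rule lop_cl[OF lopc]) (use v mult in simp)
    have jj: "j (iv v) * j (iv u) \<in> tp A 2" using cl by simp
    have C0q: "C 0 q = Ti r * (j y * s)"
     unfolding q_def r_def using vu[OF v mult(1)] C_base[OF jj] tp_tge[OF jj, of 2] cl
      sh_right[OF modA lopC, of "j (iv v) * j (iv u)" 0 "j y * s"] by (simp add: Tassoc)
    have sub: "C 1 (C 2 (C 1 (Ti p * (j y * s)))) = C 2 (C 1 (C 2 (Ti p * (j y * s))))" if p: "p \<in> tp V 2" for p
    proof (rule tp_Suc_induct_eq[OF p[unfolded numeral_2_eq_2]])
     show "lin K A TA (%p. C 1 (C 2 (C 1 (Ti p * (j y * s)))))" "lin K A TA (%p. C 2 (C 1 (C 2 (Ti p * (j y * s)))))"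
      using cl by (auto intro!: lin_comp'[OF _ C_lin] lin_comp'[OF Ti_lin T_mult_lin_right])
     fix a p assume a: "a \<in> carrier V" and "p \<in> tp V (Suc 0)"
     then obtain b where b: "b \<in> carrier V" "p = iv b" using tp1E[OF modV, of p] by auto
     have "Br (j (iv b) * (j y * s))" using mult.IH(2) b s by blast
     from Br_cons[OF this, of "iv a"] show "C 1 (C 2 (C 1 (Ti (iv a \<cdot>[A] p) * (j y * s)))) = C 2 (C 1 (C 2 (Ti (iv a \<cdot>[A] p) * (j y * s))))"
      using a b cl by (simp add: Ti_cons Tm_iota[OF modV modA iv_lin] Tassoc)
    qed
    define s' where "s' = C 0 (j y * s)"
    have ys: "j y * s \<in> tge A 2" using cl s by (simp add: iota_mult_tge)
    have s': "s' \<in> tge A 1" unfolding s'_def using ys by simp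
    have C2q: "C 2 q = j (iv v) * (j (iv u) * s')" unfolding q_def s'_def using cl by (simp add: ats)
    have BrC2: "C 0 (C 1 (C 0 (C 2 q))) = C 1 (C 0 (C 1 (C 2 q)))"
     unfolding C2q using mult.IH(1) v s' unfolding Br_def by blast
    have "C 0 (C 1 (C 0 (M 1 q))) = C 0 (C 1 (M 0 (C 1 (C 0 q))))" using CMr[of q 0] by simp
    also have "C 1 (M 0 (C 1 (C 0 q))) = M 0 (C 2 (C 1 (C 0 q)))" using far[OF lopM lopC, of 0 2 1 "C 1 (C 0 q)"] by simp
    also have "C 0 (M 0 (C 2 (C 1 (C 0 q)))) = M 1 (C 0 (C 1 (C 2 (C 1 (C 0 q)))))" using CMl[of "C 2 (C 1 (C 0 q))" 0] by simp
    also have "C 1 (C 2 (C 1 (C 0 q))) = C 2 (C 1 (C 2 (C 0 q)))" unfolding C0q by (rule sub[OF r])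
    also have "C 2 (C 0 q) = C 0 (C 2 q)" using C_far[OF lopC, of 0 2 q] by simp
    also have "C 0 (C 2 (C 1 (C 0 (C 2 q)))) = C 2 (C 0 (C 1 (C 0 (C 2 q))))" using C_far[OF lopC, of 0 2 "C 1 (C 0 (C 2 q))"] by simp
    also have "C 0 (C 1 (C 0 (C 2 q))) = C 1 (C 0 (C 1 (C 2 q)))" by (rule BrC2)
    also have "M 1 (C 2 (C 1 (C 0 (C 1 (C 2 q))))) = C 1 (M 2 (C 0 (C 1 (C 2 q))))"
     using CMr[of "C 0 (C 1 (C 2 q))" 1] by (simp add: numeral_2_eq_2[symmetric])
    also have "M 2 (C 0 (C 1 (C 2 q))) = C 0 (M 2 (C 1 (C 2 q)))" using far[OF lopC lopM, of 0 2 2 "C 1 (C 2 q)"] by simp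
    also have "M 2 (C 1 (C 2 q)) = C 1 (M 1 q)" using CMl[of q 1] by (simp add: numeral_2_eq_2[symmetric])
    finally show "C 0 (C 1 (C 0 (j (iv v) * (j (iv u \<cdot>[A] y) * s)))) = C 1 (C 0 (C 1 (j (iv v) * (j (iv u \<cdot>[A] y) * s))))"
     unfolding M1 .
   qed
  next
   case (add a b)
   then show ?case unfolding Br_def using lin_add[OF jlin] by (simp add: lin_add[OF C_lin] mult_add)
  next
   case (smult k a)
   then show ?case unfolding Br_def using lin_smult[OF jlin] by (simp add: lin_smult[OF C_lin] mult_smult)
  qed
  then show ?thesis using v s by blast
 qed
 \<comment> \<open>Finally the first factor is released; the generator case is \<open>Y\<close>, and
   products are split by the left product rule.\<close>
 have X: "Br (j x * s)" if x: "x \<in> carrier A" and s: "s \<in> tge A 2" for x s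
 proof -
  have "\<forall>s\<in>tge A 2. Br (j x * s)"
   using x modV
  proof (induction rule: T_gen_induct)
   case one
   then show ?case using BrU0 by blast
  next
   case (gen v)
   show ?case unfolding Br_def
   proof
    fix s assume s: "s \<in> tge A 2"
    show "C 0 (C 1 (C 0 (j (iv v) * s))) = C 1 (C 0 (C 1 (j (iv v) * s)))"
    proof (rule tge_Suc_eqI[OF s[unfolded numeral_2_eq_2]])
     show "lin K TA TA (%s. C 0 (C 1 (C 0 (j (iv v) * s))))" "lin K TA TA (%s. C 1 (C 0 (C 1 (j (iv v) * s))))"
      using gen by (auto intro!: lin_comp'[OF _ C_lin] T_mult_lin_left)
     fix y r assume "y \<in> carrier A" "r \<in> tge A (Suc 0)"
     then show "C 0 (C 1 (C 0 (j (iv v) * (j y * r)))) = C 1 (C 0 (C 1 (j (iv v) * (j y * r))))"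
      using Y[OF gen, of y r] unfolding Br_def by simp
    qed
   qed
  next
   case (mult v x)
   show ?case unfolding Br_def
   proof
    fix s assume s: "s \<in> tge A 2"
    have cl: "iv v \<in> carrier A" "x \<in> carrier A" "s \<in> carrier TA" using mult s by auto
    define q where "q = j (iv v) * (j x * s)"
    have [simp]: "q \<in> tge A n" if "n \<le> 4" for n
     by (rule tge_mono[OF _ that]) (use cl s in \<open>simp add: q_def iota_mult_tge\<close>)
    have [simp]: "q \<in> carrier TA" unfolding q_def using cl by simp
    have M0: "j (iv v \<cdot>[A] x) * s = M 0 q" unfolding q_def using cl by (simp add: jmul)
    have xs: "j x * s \<in> tge A 3" using cl s by (simp add: iota_mult_tge)
    define s' where "s' = C 1 (C 0 (j x * s))"
    have s': "s' \<in> tge A 2" unfolding s'_def using tge_mono[OF xs, of 2] by simp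
    have C21: "C 2 (C 1 q) = j (iv v) * s'" unfolding q_def s'_def using cl by (simp add: ats)
    have e1: "C 0 (C 1 (C 0 (C 2 (C 1 q)))) = C 1 (C 0 (C 1 (C 2 (C 1 q))))"
     unfolding C21 using mult.IH(1) s' unfolding Br_def by blast
    have e2: "C 1 (C 2 (C 1 q)) = C 2 (C 1 (C 2 q))"
     unfolding q_def by (rule Br_cons) (use mult.IH(2) s cl in auto)
    have "C 0 (C 1 (C 0 (M 0 q))) = C 0 (C 1 (M 1 (C 0 (C 1 q))))" using CMl[of q 0] by simp
    also have "C 1 (M 1 (C 0 (C 1 q))) = M 2 (C 1 (C 2 (C 0 (C 1 q))))" using CMl[of "C 0 (C 1 q)" 1] by (simp add: numeral_2_eq_2[symmetric])
    also have "C 0 (M 2 (C 1 (C 2 (C 0 (C 1 q))))) = M 2 (C 0 (C 1 (C 2 (C 0 (C 1 q)))))"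
     using far[OF lopC lopM, of 0 2 2 "C 1 (C 2 (C 0 (C 1 q)))"] by simp
    also have "C 2 (C 0 (C 1 q)) = C 0 (C 2 (C 1 q))" using C_far[OF lopC, of 0 2 "C 1 q"] by simp
    also have "C 0 (C 1 (C 0 (C 2 (C 1 q)))) = C 1 (C 0 (C 2 (C 1 (C 2 q))))" unfolding e1 e2 ..
    also have "C 0 (C 2 (C 1 (C 2 q))) = C 2 (C 0 (C 1 (C 2 q)))" using C_far[OF lopC, of 0 2 "C 1 (C 2 q)"] by simp
    also have "M 2 (C 1 (C 2 (C 0 (C 1 (C 2 q))))) = C 1 (M 1 (C 0 (C 1 (C 2 q))))"
     using CMl[of "C 0 (C 1 (C 2 q))" 1] by (simp add: numeral_2_eq_2[symmetric])
    also have "M 1 (C 0 (C 1 (C 2 q))) = C 0 (M 0 (C 2 q))" using CMl[of "C 2 q" 0] by simp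
    also have "M 0 (C 2 q) = C 1 (M 0 q)" using far[OF lopM lopC, of 0 2 1 q] by simp
    finally show "C 0 (C 1 (C 0 (j (iv v \<cdot>[A] x) * s))) = C 1 (C 0 (C 1 (j (iv v \<cdot>[A] x) * s)))"
     unfolding M0 .
   qed
  next
   case (add a b)
   then show ?case unfolding Br_def using lin_add[OF jlin] by (simp add: lin_add[OF C_lin])
  next
   case (smult k a)
   then show ?case unfolding Br_def using lin_smult[OF jlin] by (simp add: lin_smult[OF C_lin])
  qed
  then show ?thesis using s by blast
 qed
 have braid: "C 0 (C 1 (C 0 t)) = C 1 (C 0 (C 1 t))" if t: "t \<in> tp A 3" for t
 proof (rule tge_Suc_eqI[OF tp_tge[OF t, of "Suc 2"]])
  show "lin K TA TA (%t. C 0 (C 1 (C 0 t)))" "lin K TA TA (%t. C 1 (C 0 (C 1 t)))" by (intro op_lins)+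
 qed (use X in \<open>auto simp: Br_def\<close>)
 have "br_alg K A cT"
  by unfold_locales (use braid CM0 CM1 eone aone in auto)
 moreover have "cT (tsquare K V A iv t) = tsquare K V A iv (cV t)" if t: "t \<in> tp V 2" for t
  using tsquare_Tm[OF modV modA iv_lin t] tsquare_Tm[OF modV modA iv_lin lop_cl[OF lopc t]]
   CTi[OF wsp_cl_tp[OF modV t], of 0] C_base[OF Ti_tp[OF t]] sh_base[OF modV lopc t] by simp
 ultimately show ?thesis unfolding br_alg_iff by blast
qed

end

section \<open>Bialgebras generated by primitive elements\<close>

text \<open>A braided bialgebra structure is determined, and its axioms can be checked, on a braided subspace of
 primitive generators, here given as the image of a linear projection \<open>p\<close>.\<close>

locale prim_gen = pre_bialg K B for K :: "('k, 'z) ring_scheme" and B :: "('k, 'a) bialg" +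
 fixes p
 assumes p_lin: "lin K B B p"
  and p_prim: "x \<in> carrier B ==> comult B (p x) = (j (p x) * e) +[TA] (e * j (p x))"
  and p_eps: "x \<in> carrier B ==> counit B (p x) = \<zero>\<^bsub>K\<^esub>"
  and p_idem: "x \<in> carrier B ==> p (p x) = p x"
  and p_braid: "x \<in> carrier B ==> y \<in> carrier B ==>
    sh B 0 (Suc 0) (deg1 K B B p) (C 0 (j (p x) * j (p y))) = C 0 (j (p x) * j (p y))"
   "x \<in> carrier B ==> y \<in> carrier B ==>
    sh B (Suc 0) (Suc 0) (deg1 K B B p) (C 0 (j (p x) * j (p y))) = C 0 (j (p x) * j (p y))"
  and p_gen: "submodule H K B ==> \<one>\<^bsub>B\<^esub> \<in> H ==> (\<And>x. x \<in> carrier B ==> p x \<in> H) ==>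
    (\<And>x a. x \<in> carrier B ==> a \<in> H ==> p x \<cdot>[B] a \<in> H) ==> carrier B \<subseteq> H"
begin

abbreviation "P i \<equiv> sh B i (Suc 0) (deg1 K B B p)"

lemma p_cl [simp]: "x \<in> carrier B ==> p x \<in> carrier B"
 by (rule lin_cl[OF p_lin])

lemma lopP: "lop B (Suc 0) (Suc 0) (deg1 K B B p)"
 using deg1_lop[OF modA p_lin] by simp

lemmas P_lin = sh_lin[OF modA lopP]
lemmas P_cl [simp] = sh_cl[OF modA lopP]

lemma P_tge [simp]: "t \<in> tge B n ==> 1 \<le> n ==> P i t \<in> tge B n"
 by (rule sh_tge[OF modA lopP]) auto

lemma P_0: "x \<in> carrier B ==> t \<in> carrier TA ==> P 0 (j x * t) = j (p x) * t"
 "x \<in> carrier B ==> P 0 (j x) = j (p x)"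
 using sh_mid[OF modA lopP one_tp[OF modA], of "j x" t] sh_base[OF modA lopP, of "j x"]
 by (simp_all add: deg1_iota)

text \<open>Induction on products of generators with a parameter \<open>y\<close>. The hypothesis is
  available for all parameters, since braiding a generator past the other factor changes that
  factor.\<close>

lemma gen_eq:
 assumes f: "\<And>y. y \<in> Y ==> lin K B TA (f y)" and g: "\<And>y. y \<in> Y ==> lin K B TA (g y)"
  and one: "\<And>y. y \<in> Y ==> f y \<one>\<^bsub>B\<^esub> = g y \<one>\<^bsub>B\<^esub>"
  and gen: "\<And>x y. x \<in> carrier B ==> y \<in> Y ==> f y (p x) = g y (p x)"
  and mult: "\<And>x a y. x \<in> carrier B ==> a \<in> carrier B ==> (\<And>y. y \<in> Y ==> f y a = g y a) ==> y \<in> Y ==>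
   f y (p x \<cdot>[B] a) = g y (p x \<cdot>[B] a)"
  and "a \<in> carrier B" "y \<in> Y"
 shows "f y a = g y a"
proof -
 have "submodule {x \<in> carrier B. \<forall>y\<in>Y. f y x = g y x} K B"
  using lin_zero[OF f] lin_zero[OF g] lin_add[OF f] lin_add[OF g] lin_smult[OF f] lin_smult[OF g]
  by (intro submI) auto
 from p_gen[OF this] have "carrier B \<subseteq> {x \<in> carrier B. \<forall>y\<in>Y. f y x = g y x}"
  using one gen mult by auto
 then show ?thesis using assms(6,7) by blast
qed

lemma jl: "s \<in> carrier TA ==> lin K B TA (%a. j a * s)" "s \<in> carrier TA ==> lin K B TA (%a. s * j a)"
 "s \<in> carrier TA ==> t \<in> carrier TA ==> lin K B TA (%a. s * (j a * t))"
 by (auto intro!: lin_mult_left lin_mult_right iota_lin)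

lemmas ops_comp = lin_comp'[OF _ M_lin] lin_comp'[OF _ C_lin] lin_comp'[OF _ U_lin] lin_comp'[OF _ D_lin] lin_comp'[OF _ E_lin]
 lin_comp'[OF _ P_lin]

lemmas all_rights = brights sh_right[OF modA lopP]
lemmas all_ats = ats at_rules[OF lopD] at_rules[OF lopE] at_rules[OF lopP]

lemma jj_tge [simp]: "x \<in> carrier B ==> y \<in> carrier B ==> n \<le> 2 ==> j x * j y \<in> tge B n"
 by (rule tp_tge[OF iotas_tp2]) auto

lemma tp2_tge [simp]: "t \<in> tp B 2 ==> n \<le> 2 ==> C i t \<in> tge B n"
 by (rule tp_tge[OF C_tp])

text \<open>The braiding maps B \<otimes> p(B) into p(B) \<otimes> B: a product in the first
  argument is braided past one generator at a time, and each single step is covered by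
  \<open>p_braid\<close>.\<close>

lemma CP1_gen: assumes a: "a \<in> carrier B" and y: "y \<in> carrier B"
 shows "P 0 (C 0 (j a * j (p y))) = C 0 (j a * j (p y))"
proof (rule gen_eq[where Y = "carrier B" and f = "%y a. P 0 (C 0 (j a * j (p y)))" and g = "%y a. C 0 (j a * j (p y))"])
 fix y assume y: "y \<in> carrier B"
 have "C 0 (e * j (p y)) = j (p y) * e" using C_base[of "e * j (p y)"] CU0 y by simp
 then show "P 0 (C 0 (e * j (p y))) = C 0 (e * j (p y))" using y by (simp add: P_0 p_idem)
next
 fix x a y assume x: "x \<in> carrier B" and a: "a \<in> carrier B" and y: "y \<in> carrier B"
  and IH: "\<And>y. y \<in> carrier B ==> P 0 (C 0 (j a * j (p y))) = C 0 (j a * j (p y))"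
 have sub: "P 0 (C 0 (j (p x) * P 0 t)) = C 0 (j (p x) * P 0 t)" if t: "t \<in> tp B 2" for t
 proof (rule tp2_eqI[OF t, where f = "%t. P 0 (C 0 (j (p x) * P 0 t))" and g = "%t. C 0 (j (p x) * P 0 t)"])
  show "lin K TA TA (%t. P 0 (C 0 (j (p x) * P 0 t)))" "lin K TA TA (%t. C 0 (j (p x) * P 0 t))"
   using x by (auto intro!: ops_comp lin_mult_left P_lin)
  fix b d assume bd: "b \<in> carrier B" "d \<in> carrier B"
  have "C 0 (j (p x) * (j (p b) * j d)) = C 0 (j (p x) * j (p b)) * j d"
   using x bd all_rights(1)[of "j (p x) * j (p b)" 0 "j d"] by (simp add: Tassoc)
  then show "P 0 (C 0 (j (p x) * P 0 (j b * j d))) = C 0 (j (p x) * P 0 (j b * j d))"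
   using x bd p_braid(1)[OF x bd(1)] by (simp add: P_0 all_rights)
 qed
 have q: "j (p x) * (j a * j (p y)) \<in> tp B 3" by (rule iota_mult_tp[where n = 2]) (use x a y in simp_all)
 define r where "r = C 0 (j a * j (p y))"
 have r: "r \<in> tp B 2" "r = P 0 r" "r \<in> carrier TA" unfolding r_def using IH[OF y] a y by (simp_all add: C_tp)
 have "C 0 (j (p x \<cdot>[B] a) * j (p y)) = C 0 (M 0 (j (p x) * (j a * j (p y))))" using x a y by (simp add: M_mult)
 also have "\<dots> = M 1 (C 0 (j (p x) * r))" unfolding r_def using CM0[OF q] x a y by (simp add: all_ats)
 finally have eq: "C 0 (j (p x \<cdot>[B] a) * j (p y)) = M 1 (C 0 (j (p x) * r))" .
 have t3: "C 0 (j (p x) * r) \<in> tge B 3" using tp_tge[OF r(1), of 2] x by (simp add: iota_mult_tge)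
 have "P 0 (M 1 (C 0 (j (p x) * r))) = M 1 (P 0 (C 0 (j (p x) * r)))"
  using far[OF lopP lopM, of 0 1 1 "C 0 (j (p x) * r)"] t3 by simp
 also have "P 0 (C 0 (j (p x) * r)) = C 0 (j (p x) * r)" using sub[OF r(1)] r(2) by simp
 finally show "P 0 (C 0 (j (p x \<cdot>[B] a) * j (p y))) = C 0 (j (p x \<cdot>[B] a) * j (p y))" unfolding eq .
qed (use a y p_braid in \<open>auto intro!: ops_comp jl\<close>)

lemma CP0_gen: assumes b: "b \<in> carrier B" and x: "x \<in> carrier B"
 shows "P 1 (C 0 (j (p x) * j b)) = C 0 (j (p x) * j b)"
proof (rule gen_eq[where Y = "carrier B" and f = "%x b. P 1 (C 0 (j (p x) * j b))" and g = "%x b. C 0 (j (p x) * j b)"])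
 fix x assume x: "x \<in> carrier B"
 have "C 0 (j (p x) * e) = e * j (p x)" using C_base[of "j (p x) * e"] CU1 x by simp
 then show "P 1 (C 0 (j (p x) * e)) = C 0 (j (p x) * e)" using x by (simp add: all_ats P_0 p_idem)
next
 fix y b x assume y: "y \<in> carrier B" and b: "b \<in> carrier B" and x: "x \<in> carrier B"
  and IH: "\<And>x. x \<in> carrier B ==> P 1 (C 0 (j (p x) * j b)) = C 0 (j (p x) * j b)"
 have sub: "P 2 (C 1 (P 1 t * j b)) = C 1 (P 1 t * j b)" if t: "t \<in> tp B 2" for t
 proof (rule tp2_eqI[OF t, where f = "%t. P 2 (C 1 (P 1 t * j b))" and g = "%t. C 1 (P 1 t * j b)"])
  show "lin K TA TA (%t. P 2 (C 1 (P 1 t * j b)))" "lin K TA TA (%t. C 1 (P 1 t * j b))"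
   using b by (auto intro!: ops_comp lin_mult_right P_lin)
  fix d f assume df: "d \<in> carrier B" "f \<in> carrier B"
  then show "P 2 (C 1 (P 1 (j d * j f) * j b)) = C 1 (P 1 (j d * j f) * j b)"
   using b IH[OF df(2)] by (simp add: all_ats P_0 Tassoc)
 qed
 have q: "j (p x) * (j (p y) * j b) \<in> tp B 3" by (rule iota_mult_tp[where n = 2]) (use x b y in simp_all)
 define r where "r = C 0 (j (p x) * j (p y))"
 have r: "r \<in> tp B 2" "r = P 1 r" "r \<in> carrier TA" unfolding r_def using p_braid(2)[OF x y] x y by (simp_all add: C_tp)
 have "C 0 (j (p x) * j (p y \<cdot>[B] b)) = C 0 (M 1 (j (p x) * (j (p y) * j b)))" using x b y by (simp add: all_ats M_mult')
 also have "\<dots> = M 0 (C 1 (C 0 (j (p x) * (j (p y) * j b))))" by (rule CM1[OF q])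
 also have "C 0 (j (p x) * (j (p y) * j b)) = r * j b" unfolding r_def
  using x b y all_rights(1)[of "j (p x) * j (p y)" 0 "j b"] by (simp add: Tassoc)
 finally have eq: "C 0 (j (p x) * j (p y \<cdot>[B] b)) = M 0 (C 1 (r * j b))" .
 have t3: "C 1 (r * j b) \<in> tge B 3"
  using tp_tge[OF C_tp[OF tp_mult[OF modA r(1) iota_tp(1)[OF modA b] refl]], of 3 1] by simp
 have "P 1 (M 0 (C 1 (r * j b))) = M 0 (P 2 (C 1 (r * j b)))"
  using far[OF lopM lopP, of 0 2 1 "C 1 (r * j b)"] t3 by simp
 also have "P 2 (C 1 (r * j b)) = C 1 (r * j b)" using sub[OF r(1)] r(2) by simp
 finally show "P 1 (C 0 (j (p x) * j (p y \<cdot>[B] b))) = C 0 (j (p x) * j (p y \<cdot>[B] b))" unfolding eq .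
qed (use b x p_braid in \<open>auto intro!: ops_comp jl\<close>)

text \<open>On a factor in the image of \<open>p\<close>, comultiplication is a sum of two unit
  insertions. Its compatibility with the braiding therefore reduces on generators to the unit axioms
  of a braided algebra.\<close>

lemma D_P: assumes "t \<in> tge B 1" shows "D 0 (P 0 t) = U 1 (P 0 t) +[TA] U 0 (P 0 t)"
 by (rule tge1_eqI[OF assms], intro ops_comp P_lin, intro lin_sum ops_comp P_lin)
  (simp_all add: P_0 D_mult p_prim U_0 U_1 add_mult Tassoc)

lemma E_P: assumes "t \<in> tge B 1" shows "E 0 (P 0 t) = \<zero>\<^bsub>TA\<^esub>"
 by (rule tge1_eqI[OF assms], intro ops_comp P_lin, rule lin_const_zero) (simp_all add: P_0 E_mult p_eps)

lemma DC0_gen: assumes y: "y \<in> carrier B" and a: "a \<in> carrier B"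
 shows "D 0 (C 0 (j a * j (p y))) = C 1 (C 0 (D 1 (j a * j (p y))))"
proof -
 define t where "t = j a * j (p y)"
 have t: "t \<in> tp B 2" "t \<in> carrier TA" unfolding t_def using a y by simp_all
 have [simp]: "t \<in> tge B n" if "n \<le> 2" for n using tp_tge[OF t(1) that] .
 have Pt: "P 0 (C 0 t) = C 0 t" unfolding t_def by (rule CP1_gen[OF a y])
 have "D 1 t = (j a * (j (p y) * e)) +[TA] (j a * (e * j (p y)))"
  unfolding t_def using a y by (simp add: all_ats D_j p_prim mult_add)
 also have "j a * (j (p y) * e) = U 2 t" unfolding t_def using sh_at2[OF lopU, of a "j (p y)"] a y by (simp add: U_1)
 also have "j a * (e * j (p y)) = U 1 t" unfolding t_def using a y by (simp add: U_1)
 finally have "C 1 (C 0 (D 1 t)) = C 1 (C 0 (U 2 t)) +[TA] C 1 (C 0 (U 1 t))" using t by (simp add: lin_add[OF C_lin])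
 also have "C 0 (U 2 t) = U 2 (C 0 t)" using far[OF lopC lopU, of 0 2 2 t] by simp
 also have "C 1 (U 2 (C 0 t)) = U 1 (C 0 t)" using CU(2)[of "C 0 t" 1] t by simp
 also have "C 0 (U 1 t) = U 0 t" using CU(2)[of t 0] by simp
 also have "C 1 (U 0 t) = U 0 (C 0 t)" using far[OF lopU lopC, of 0 0 1 t] by simp
 also have "U 1 (C 0 t) +[TA] U 0 (C 0 t) = D 0 (C 0 t)" using D_P[of "C 0 t"] Pt t by simp
 finally show ?thesis unfolding t_def ..
qed

lemma j_tge [simp]: "a \<in> carrier B ==> n \<le> 1 ==> j a \<in> tge B n"
 by (rule tp_tge[OF iota_tp(1)]) auto

text \<open>Induction on the second factor. In the product step \<open>DM\<close> expands the
  comultiplication of a product, and both sides become the same permutation of five factors, the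
  difference being one braid relation and some interchanges.\<close>

lemma DC0': assumes "y \<in> carrier B" and "a \<in> carrier B"
 shows "D 0 (C 0 (j a * j y)) = C 1 (C 0 (D 1 (j a * j y)))"
proof (rule gen_eq[where Y = "carrier B" and f = "%a y. D 0 (C 0 (j a * j y))" and g = "%a y. C 1 (C 0 (D 1 (j a * j y)))"])
 fix a assume a: "a \<in> carrier B"
 have 1: "C 0 (j a * e) = e * j a" using C_base[of "j a * e"] CU1 a by simp
 have "D 1 (j a * e) = j a * (e * e)" using a by (simp add: all_ats D_j comult_one)
 also have "\<dots> = U 1 (U 1 (j a))" using a by (simp add: U_1)
 finally have 2: "D 1 (j a * e) = U 1 (U 1 (j a))" .
 have "C 1 (C 0 (U 1 (U 1 (j a)))) = C 1 (U 0 (U 1 (j a)))" using CU(2)[of "U 1 (j a)" 0] a by simp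
 also have "\<dots> = U 0 (C 0 (U 1 (j a)))" using far[OF lopU lopC, of 0 0 1 "U 1 (j a)"] a by simp
 also have "\<dots> = U 0 (U 0 (j a))" using CU(2)[of "j a" 0] a by simp
 finally show "D 0 (C 0 (j a * e)) = C 1 (C 0 (D 1 (j a * e)))"
  unfolding 1 2 using a by (simp add: D_mult comult_one U_0 Tassoc)
next
 fix x y a assume x: "x \<in> carrier B" and y: "y \<in> carrier B" and a: "a \<in> carrier B"
  and IH: "\<And>a. a \<in> carrier B ==> D 0 (C 0 (j a * j y)) = C 1 (C 0 (D 1 (j a * j y)))"
 define q where "q = j a * (j (p x) * j y)"
 have qt: "q \<in> tp B 3" unfolding q_def by (rule iota_mult_tp[where n = 2]) (use x a y in simp_all)
 have [simp]: "q \<in> tge B n" if "n \<le> 3" for n using tp_tge[OF qt that] .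
 have [simp]: "q \<in> carrier TA" using wsp_cl_tp[OF modA qt] .
 have q': "q = (j a * j (p x)) * j y" unfolding q_def using a x y by (simp add: Tassoc)
 have eq: "j a * j (p x \<cdot>[B] y) = M 1 q" unfolding q_def using x a y by (simp add: all_ats M_mult')
 have C0q: "C 0 q = C 0 (j a * j (p x)) * j y" unfolding q' using a x y by (simp add: all_rights)
 have sub: "D 1 (C 1 (r * j y)) = C 2 (C 1 (D 2 (r * j y)))" if r: "r \<in> tp B 2" for r
 proof (rule tp2_eqI[OF r, where f = "%r. D 1 (C 1 (r * j y))" and g = "%r. C 2 (C 1 (D 2 (r * j y)))"])
  show "lin K TA TA (%r. D 1 (C 1 (r * j y)))" "lin K TA TA (%r. C 2 (C 1 (D 2 (r * j y))))"
   using y by (auto intro!: ops_comp lin_mult_right)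
  fix b d assume "b \<in> carrier B" "d \<in> carrier B"
  then show "D 1 (C 1 ((j b * j d) * j y)) = C 2 (C 1 (D 2 ((j b * j d) * j y)))"
   using y IH[of d] by (simp add: Tassoc all_ats)
 qed
 have base: "D 0 (C 0 q) = C 1 (C 0 (D 1 q))"
  unfolding q' using DC0_gen[OF x a] a x y by (simp add: all_rights)
 have "D 0 (C 0 (M 1 q)) = D 0 (M 0 (C 1 (C 0 q)))" using CM(2)[of q 0] by simp
 also have "\<dots> = M 0 (M 2 (C 1 (D 0 (D 1 (C 1 (C 0 q))))))" using DM(1)[of "C 1 (C 0 q)" 0] by (simp add: numeral_2_eq_2[symmetric])
 also have "D 1 (C 1 (C 0 q)) = C 2 (C 1 (D 2 (C 0 q)))" unfolding C0q by (rule sub) (use a x in \<open>simp add: C_tp\<close>)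
 also have "D 0 (C 2 (C 1 (D 2 (C 0 q)))) = C 3 (D 0 (C 1 (D 2 (C 0 q))))" using D_far[OF lopC, of 0 2 "C 1 (D 2 (C 0 q))"] by simp
 also have "D 0 (C 1 (D 2 (C 0 q))) = C 2 (D 0 (D 2 (C 0 q)))" using D_far[OF lopC, of 0 1 "D 2 (C 0 q)"] by simp
 also have "D 0 (D 2 (C 0 q)) = D 3 (D 0 (C 0 q))" using D_far[OF lopD, of 0 2 "C 0 q"] by simp
 also have "D 0 (C 0 q) = C 1 (C 0 (D 1 q))" by (rule base)
 also have "D 3 (C 1 (C 0 (D 1 q))) = C 1 (D 3 (C 0 (D 1 q)))" using C_far[OF lopD, of 1 3 "C 0 (D 1 q)"] by simp
 also have "D 3 (C 0 (D 1 q)) = C 0 (D 3 (D 1 q))" using C_far[OF lopD, of 0 3 "D 1 q"] by simp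
 also have "D 3 (D 1 q) = D 1 (D 2 q)" using D_far[OF lopD, of 1 2 q] by simp
 finally have L: "D 0 (C 0 (M 1 q)) = M 0 (M 2 (C 1 (C 3 (C 2 (C 1 (C 0 (D 1 (D 2 q))))))))" .
 define w where "w = D 1 (D 2 q)"
 have w [simp]: "w \<in> tge B n" if "n \<le> 5" for n
  unfolding w_def by (rule tge_mono[OF _ that]) simp
 have wc [simp]: "w \<in> carrier TA" unfolding w_def by simp
 have "D 1 (M 1 q) = M 1 (M 3 (C 2 w))" unfolding w_def using DM(1)[of q 1] by simp
 then have "C 1 (C 0 (D 1 (M 1 q))) = C 1 (C 0 (M 1 (M 3 (C 2 w))))" by simp
 also have "C 0 (M 1 (M 3 (C 2 w))) = M 0 (C 1 (C 0 (M 3 (C 2 w))))" using CM(2)[of "M 3 (C 2 w)" 0] by simp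
 also have "C 0 (M 3 (C 2 w)) = M 3 (C 0 (C 2 w))" using C_far[OF lopM, of 0 3 "C 2 w"] by simp
 also have "C 1 (M 3 (C 0 (C 2 w))) = M 3 (C 1 (C 0 (C 2 w)))" using C_far[OF lopM, of 1 3 "C 0 (C 2 w)"] by simp
 also have "C 1 (M 0 (M 3 (C 1 (C 0 (C 2 w))))) = M 0 (C 2 (M 3 (C 1 (C 0 (C 2 w)))))"
  using far[OF lopM lopC, of 0 2 1 "M 3 (C 1 (C 0 (C 2 w)))"] by simp
 also have "C 2 (M 3 (C 1 (C 0 (C 2 w)))) = M 2 (C 3 (C 2 (C 1 (C 0 (C 2 w)))))" using CM(2)[of "C 1 (C 0 (C 2 w))" 2] by simp
 also have "C 0 (C 2 w) = C 2 (C 0 w)" using C_far[OF lopC, of 0 2 w] by simp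
 also have "C 2 (C 1 (C 2 (C 0 w))) = C 1 (C 2 (C 1 (C 0 w)))" using braid[of "C 0 w" 1] by (simp add: numeral_2_eq_2[symmetric])
 also have "C 3 (C 1 (C 2 (C 1 (C 0 w)))) = C 1 (C 3 (C 2 (C 1 (C 0 w))))" using C_far[OF lopC, of 1 3 "C 2 (C 1 (C 0 w))"] by simp
 finally show "D 0 (C 0 (j a * j (p x \<cdot>[B] y))) = C 1 (C 0 (D 1 (j a * j (p x \<cdot>[B] y))))"
  unfolding eq L w_def by simp
qed (use assms DC0_gen in \<open>auto intro!: ops_comp jl\<close>)

lemma DC1_gen: assumes x: "x \<in> carrier B" and b: "b \<in> carrier B"
 shows "D 1 (C 0 (j (p x) * j b)) = C 0 (C 1 (D 0 (j (p x) * j b)))"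
proof -
 define t where "t = j (p x) * j b"
 have t: "t \<in> tp B 2" "t \<in> carrier TA" unfolding t_def using b x by simp_all
 have [simp]: "t \<in> tge B n" if "n \<le> 2" for n using tp_tge[OF t(1) that] .
 have Pt: "P 1 (C 0 t) = C 0 t" unfolding t_def by (rule CP0_gen[OF b x])
 have D1P: "D 1 (P 1 s) = U 2 (P 1 s) +[TA] U 1 (P 1 s)" if s: "s \<in> tp B 2" for s
  by (rule tp2_eqI[OF s], intro ops_comp P_lin, intro lin_sum ops_comp P_lin)
   (auto simp: all_ats P_0 D_j p_prim U_0 U_1 mult_add)
 have "D 0 t = U 1 t +[TA] U 0 t"
  unfolding t_def using b x by (simp add: D_mult p_prim add_mult U_0 U_1 Tassoc)
 then have "C 0 (C 1 (D 0 t)) = C 0 (C 1 (U 1 t)) +[TA] C 0 (C 1 (U 0 t))" using t by (simp add: lin_add[OF C_lin])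
 also have "C 1 (U 1 t) = U 2 t" using CU(1)[of t 1] by simp
 also have "C 0 (U 2 t) = U 2 (C 0 t)" using far[OF lopC lopU, of 0 2 2 t] by simp
 also have "C 1 (U 0 t) = U 0 (C 0 t)" using far[OF lopU lopC, of 0 0 1 t] by simp
 also have "C 0 (U 0 (C 0 t)) = U 1 (C 0 t)" using CU(1)[of "C 0 t" 0] t by simp
 also have "U 2 (C 0 t) +[TA] U 1 (C 0 t) = D 1 (C 0 t)" using D1P[of "C 0 t"] Pt t by (simp add: C_tp)
 finally show ?thesis unfolding t_def ..
qed

text \<open>The mirror image, by induction on the first factor. The generator case is applied with a
  longer tensor behind the generator, which stays untouched.\<close>

lemma DC1': assumes "x \<in> carrier B" and "b \<in> carrier B"
 shows "D 1 (C 0 (j x * j b)) = C 0 (C 1 (D 0 (j x * j b)))"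
proof (rule gen_eq[where Y = "carrier B" and f = "%b x. D 1 (C 0 (j x * j b))" and g = "%b x. C 0 (C 1 (D 0 (j x * j b)))"])
 fix b assume b: "b \<in> carrier B"
 have 1: "C 0 (e * j b) = j b * e" using C_base[of "e * j b"] CU0 b by simp
 have "D 0 (e * j b) = U 0 (U 0 (j b))" using b by (simp add: D_mult comult_one U_0 Tassoc)
 then have "C 0 (C 1 (D 0 (e * j b))) = C 0 (C 1 (U 0 (U 0 (j b))))" by simp
 also have "\<dots> = C 0 (U 0 (C 0 (U 0 (j b))))" using far[OF lopU lopC, of 0 0 1 "U 0 (j b)"] b by simp
 also have "\<dots> = U 1 (U 1 (j b))" using CU(1)[of "U 1 (j b)" 0] CU(1)[of "j b" 0] b by simp
 also have "\<dots> = D 1 (j b * e)" using b by (simp add: U_0 U_1 all_ats D_j comult_one)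
 finally show "D 1 (C 0 (e * j b)) = C 0 (C 1 (D 0 (e * j b)))" unfolding 1 by simp
next
 fix x y b assume x: "x \<in> carrier B" and y: "y \<in> carrier B" and b: "b \<in> carrier B"
  and IH: "\<And>b. b \<in> carrier B ==> D 1 (C 0 (j y * j b)) = C 0 (C 1 (D 0 (j y * j b)))"
 define q where "q = j (p x) * (j y * j b)"
 have qt: "q \<in> tp B 3" unfolding q_def by (rule iota_mult_tp[where n = 2]) (use x b y in simp_all)
 have [simp]: "q \<in> tge B n" if "n \<le> 3" for n using tp_tge[OF qt that] .
 have [simp]: "q \<in> carrier TA" using wsp_cl_tp[OF modA qt] .
 have eq: "j (p x \<cdot>[B] y) * j b = M 0 q" unfolding q_def using x b y by (simp add: M_mult)
 have base: "D 1 (C 0 (j (p x) * s)) = C 0 (C 1 (D 0 (j (p x) * s)))" if s: "s \<in> tge B 1" for s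
 proof (rule tge1_eqI[OF s, where f = "%s. D 1 (C 0 (j (p x) * s))" and g = "%s. C 0 (C 1 (D 0 (j (p x) * s)))"])
  show "lin K TA TA (%s. D 1 (C 0 (j (p x) * s)))" "lin K TA TA (%s. C 0 (C 1 (D 0 (j (p x) * s))))"
   using x by (auto intro!: ops_comp lin_mult_left)
  fix d r assume d: "d \<in> carrier B" and r: "r \<in> carrier TA"
  define t where "t = j (p x) * j d"
  have [simp]: "t \<in> tge B n" if "n \<le> 2" for n unfolding t_def using x d that by simp
  have "D 1 (C 0 (t * r)) = C 0 (C 1 (D 0 (t * r)))"
   using DC1_gen[OF x d, folded t_def] r by (simp add: all_rights)
  then have "D 1 (C 0 ((j (p x) * j d) * r)) = C 0 (C 1 (D 0 ((j (p x) * j d) * r)))" unfolding t_def .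
  then show "D 1 (C 0 (j (p x) * (j d * r))) = C 0 (C 1 (D 0 (j (p x) * (j d * r))))" using x d r by (simp add: Tassoc)
 qed
 have sub: "D 2 (C 1 q) = C 1 (C 2 (D 1 q))" unfolding q_def using IH[OF b] x y b by (simp add: all_ats)
 define w where "w = D 0 (D 1 q)"
 have w [simp]: "w \<in> tge B n" if "n \<le> 5" for n
  unfolding w_def by (rule tge_mono[OF _ that]) simp
 have wc [simp]: "w \<in> carrier TA" unfolding w_def by simp
 have D1q: "C 1 (C 2 (D 1 q)) = j (p x) * C 0 (C 1 (D 0 (j y * j b)))"
  unfolding q_def using x y b by (simp add: all_ats)
 have yb: "D 0 (j y * j b) \<in> tge B 3" using y b by simp
 have "D 1 (C 0 (M 0 q)) = D 1 (M 1 (C 0 (C 1 q)))" using CM(1)[of q 0] by simp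
 also have "\<dots> = M 1 (M 3 (C 2 (D 1 (D 2 (C 0 (C 1 q))))))" using DM(1)[of "C 0 (C 1 q)" 1] by simp
 also have "D 2 (C 0 (C 1 q)) = C 0 (D 2 (C 1 q))" using C_far[OF lopD, of 0 2 "C 1 q"] by simp
 also have "\<dots> = C 0 (C 1 (C 2 (D 1 q)))" unfolding sub ..
 also have "D 1 (C 0 (C 1 (C 2 (D 1 q)))) = C 0 (C 1 (D 0 (C 1 (C 2 (D 1 q)))))"
  unfolding D1q by (rule base) (use yb tge_mono[OF yb, of 2] in simp)
 also have "D 0 (C 1 (C 2 (D 1 q))) = C 2 (D 0 (C 2 (D 1 q)))" using D_far[OF lopC, of 0 1 "C 2 (D 1 q)"] by simp
 also have "D 0 (C 2 (D 1 q)) = C 3 w" unfolding w_def using D_far[OF lopC, of 0 2 "D 1 q"] by simp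
 finally have L: "D 1 (C 0 (M 0 q)) = M 1 (M 3 (C 2 (C 0 (C 1 (C 2 (C 3 w))))))" .
 have "D 0 (M 0 q) = M 0 (M 2 (C 1 w))" unfolding w_def using DM(1)[of q 0] by (simp add: numeral_2_eq_2[symmetric])
 then have "C 0 (C 1 (D 0 (M 0 q))) = C 0 (C 1 (M 0 (M 2 (C 1 w))))" by simp
 also have "C 1 (M 0 (M 2 (C 1 w))) = M 0 (C 2 (M 2 (C 1 w)))" using far[OF lopM lopC, of 0 2 1 "M 2 (C 1 w)"] by simp
 also have "C 2 (M 2 (C 1 w)) = M 3 (C 2 (C 3 (C 1 w)))" using CM(1)[of "C 1 w" 2] by simp
 also have "C 0 (M 0 (M 3 (C 2 (C 3 (C 1 w))))) = M 1 (C 0 (C 1 (M 3 (C 2 (C 3 (C 1 w))))))"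
  using CM(1)[of "M 3 (C 2 (C 3 (C 1 w)))" 0] by simp
 also have "C 1 (M 3 (C 2 (C 3 (C 1 w)))) = M 3 (C 1 (C 2 (C 3 (C 1 w))))" using C_far[OF lopM, of 1 3 "C 2 (C 3 (C 1 w))"] by simp
 also have "C 0 (M 3 (C 1 (C 2 (C 3 (C 1 w))))) = M 3 (C 0 (C 1 (C 2 (C 3 (C 1 w)))))" using C_far[OF lopM, of 0 3 "C 1 (C 2 (C 3 (C 1 w)))"] by simp
 also have "C 3 (C 1 w) = C 1 (C 3 w)" using C_far[OF lopC, of 1 3 w] by simp
 also have "C 1 (C 2 (C 1 (C 3 w))) = C 2 (C 1 (C 2 (C 3 w)))" using braid[of "C 3 w" 1] by (simp add: numeral_2_eq_2[symmetric])
 also have "C 0 (C 2 (C 1 (C 2 (C 3 w)))) = C 2 (C 0 (C 1 (C 2 (C 3 w))))" using C_far[OF lopC, of 0 2 "C 1 (C 2 (C 3 w))"] by simp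
 finally show "D 1 (C 0 (j (p x \<cdot>[B] y) * j b)) = C 0 (C 1 (D 0 (j (p x \<cdot>[B] y) * j b)))"
  unfolding eq L by simp
qed (use assms DC1_gen in \<open>auto intro!: ops_comp jl\<close>)

lemma EC0_gen: assumes y: "y \<in> carrier B" and a: "a \<in> carrier B"
 shows "E 0 (C 0 (j a * j (p y))) = E 1 (j a * j (p y))"
proof -
 have "E 0 (C 0 (j a * j (p y))) = \<zero>\<^bsub>TA\<^esub>"
  using E_P[of "C 0 (j a * j (p y))"] CP1_gen[OF a y] a y by simp
 then show ?thesis using a y by (simp add: all_ats E_j p_eps)
qed

lemma EC1_gen: assumes x: "x \<in> carrier B" and b: "b \<in> carrier B"
 shows "E 1 (C 0 (j (p x) * j b)) = E 0 (j (p x) * j b)"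
proof -
 have 1: "E 1 (P 1 s) = \<zero>\<^bsub>TA\<^esub>" if s: "s \<in> tp B 2" for s
  by (rule tp2_eqI[OF s], intro ops_comp P_lin, rule lin_const_zero) (auto simp: all_ats P_0 E_j p_eps)
 have "E 1 (C 0 (j (p x) * j b)) = \<zero>\<^bsub>TA\<^esub>"
  using 1[of "C 0 (j (p x) * j b)"] CP0_gen[OF b x] b x by (simp add: C_tp)
 then show ?thesis using b x by (simp add: E_mult p_eps)
qed

lemma EC0': assumes "y \<in> carrier B" and "a \<in> carrier B"
 shows "E 0 (C 0 (j a * j y)) = E 1 (j a * j y)"
proof (rule gen_eq[where Y = "carrier B" and f = "%a y. E 0 (C 0 (j a * j y))" and g = "%a y. E 1 (j a * j y)"])
 fix a assume a: "a \<in> carrier B"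
 have 1: "C 0 (j a * e) = e * j a" using C_base[of "j a * e"] CU1 a by simp
 show "E 0 (C 0 (j a * e)) = E 1 (j a * e)" unfolding 1 using a by (simp add: all_ats E_mult E_j counit_one)
next
 fix x y a assume x: "x \<in> carrier B" and y: "y \<in> carrier B" and a: "a \<in> carrier B"
  and IH: "\<And>a. a \<in> carrier B ==> E 0 (C 0 (j a * j y)) = E 1 (j a * j y)"
 define q where "q = j a * (j (p x) * j y)"
 have qt: "q \<in> tp B 3" unfolding q_def by (rule iota_mult_tp[where n = 2]) (use x a y in simp_all)
 have [simp]: "q \<in> tge B n" if "n \<le> 3" for n using tp_tge[OF qt that] .
 have [simp]: "q \<in> carrier TA" using wsp_cl_tp[OF modA qt] .
 have q': "q = (j a * j (p x)) * j y" unfolding q_def using a x y by (simp add: Tassoc)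
 have eq: "j a * j (p x \<cdot>[B] y) = M 1 q" unfolding q_def using x a y by (simp add: all_ats M_mult')
 have C0q: "C 0 q = C 0 (j a * j (p x)) * j y" unfolding q' using a x y by (simp add: all_rights)
 have sub: "E 1 (C 1 (r * j y)) = E 2 (r * j y)" if r: "r \<in> tp B 2" for r
 proof (rule tp2_eqI[OF r, where f = "%r. E 1 (C 1 (r * j y))" and g = "%r. E 2 (r * j y)"])
  show "lin K TA TA (%r. E 1 (C 1 (r * j y)))" "lin K TA TA (%r. E 2 (r * j y))"
   using y by (auto intro!: ops_comp lin_mult_right)
  fix b d assume "b \<in> carrier B" "d \<in> carrier B"
  then show "E 1 (C 1 ((j b * j d) * j y)) = E 2 ((j b * j d) * j y)"
   using y IH[of d] by (simp add: Tassoc all_ats)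
 qed
 have base: "E 0 (C 0 q) = E 1 q"
  unfolding q' using EC0_gen[OF x a] a x y by (simp add: all_rights)
 have "E 0 (C 0 (M 1 q)) = E 0 (M 0 (C 1 (C 0 q)))" using CM(2)[of q 0] by simp
 also have "\<dots> = E 0 (E 0 (C 1 (C 0 q)))" using DM(2)[of "C 1 (C 0 q)" 0] by simp
 also have "\<dots> = E 0 (E 1 (C 1 (C 0 q)))" using E_far[OF lopE, of 0 1 "C 1 (C 0 q)"] by simp
 also have "E 1 (C 1 (C 0 q)) = E 2 (C 0 q)" unfolding C0q by (rule sub) (use a x in \<open>simp add: C_tp\<close>)
 also have "E 0 (E 2 (C 0 q)) = E 1 (E 0 (C 0 q))" using E_far[OF lopE, of 0 2 "C 0 q"] by simp
 also have "\<dots> = E 1 (E 1 q)" unfolding base ..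
 also have "\<dots> = E 1 (M 1 q)" using DM(2)[of q 1] by simp
 finally show "E 0 (C 0 (j a * j (p x \<cdot>[B] y))) = E 1 (j a * j (p x \<cdot>[B] y))" unfolding eq .
qed (use assms EC0_gen in \<open>auto intro!: ops_comp jl\<close>)

lemma EC1': assumes "x \<in> carrier B" and "b \<in> carrier B"
 shows "E 1 (C 0 (j x * j b)) = E 0 (j x * j b)"
proof (rule gen_eq[where Y = "carrier B" and f = "%b x. E 1 (C 0 (j x * j b))" and g = "%b x. E 0 (j x * j b)"])
 fix b assume b: "b \<in> carrier B"
 have 1: "C 0 (e * j b) = j b * e" using C_base[of "e * j b"] CU0 b by simp
 show "E 1 (C 0 (e * j b)) = E 0 (e * j b)" unfolding 1 using b by (simp add: all_ats E_mult E_j counit_one)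
next
 fix x y b assume x: "x \<in> carrier B" and y: "y \<in> carrier B" and b: "b \<in> carrier B"
  and IH: "\<And>b. b \<in> carrier B ==> E 1 (C 0 (j y * j b)) = E 0 (j y * j b)"
 define q where "q = j (p x) * (j y * j b)"
 have qt: "q \<in> tp B 3" unfolding q_def by (rule iota_mult_tp[where n = 2]) (use x b y in simp_all)
 have [simp]: "q \<in> tge B n" if "n \<le> 3" for n using tp_tge[OF qt that] .
 have [simp]: "q \<in> carrier TA" using wsp_cl_tp[OF modA qt] .
 have eq: "j (p x \<cdot>[B] y) * j b = M 0 q" unfolding q_def using x b y by (simp add: M_mult)
 have base: "E 1 (C 0 (j (p x) * s)) = E 0 (j (p x) * s)" if s: "s \<in> tge B 1" for s
 proof (rule tge1_eqI[OF s, where f = "%s. E 1 (C 0 (j (p x) * s))" and g = "%s. E 0 (j (p x) * s)"])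
  show "lin K TA TA (%s. E 1 (C 0 (j (p x) * s)))" "lin K TA TA (%s. E 0 (j (p x) * s))"
   using x by (auto intro!: ops_comp lin_mult_left)
  fix d r assume d: "d \<in> carrier B" and r: "r \<in> carrier TA"
  define t where "t = j (p x) * j d"
  have [simp]: "t \<in> tge B n" if "n \<le> 2" for n unfolding t_def using x d that by simp
  have "E 1 (C 0 (t * r)) = E 0 (t * r)"
   using EC1_gen[OF x d, folded t_def] r by (simp add: all_rights)
  then have "E 1 (C 0 ((j (p x) * j d) * r)) = E 0 ((j (p x) * j d) * r)" unfolding t_def .
  then show "E 1 (C 0 (j (p x) * (j d * r))) = E 0 (j (p x) * (j d * r))" using x d r by (simp add: Tassoc)
 qed
 have sub: "E 2 (C 1 q) = E 1 q" unfolding q_def using IH[OF b] x y b by (simp add: all_ats)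
 have E1q: "E 1 q = j (p x) * E 0 (j y * j b)" unfolding q_def using x y b by (simp add: all_ats)
 have "E 1 (C 0 (M 0 q)) = E 1 (M 1 (C 0 (C 1 q)))" using CM(1)[of q 0] by simp
 also have "\<dots> = E 1 (E 1 (C 0 (C 1 q)))" using DM(2)[of "C 0 (C 1 q)" 1] by simp
 also have "\<dots> = E 1 (E 2 (C 0 (C 1 q)))" using E_far[OF lopE, of 1 2 "C 0 (C 1 q)"] by simp
 also have "E 2 (C 0 (C 1 q)) = C 0 (E 2 (C 1 q))" using C_far[OF lopE, of 0 2 "C 1 q"] by simp
 also have "\<dots> = C 0 (E 1 q)" unfolding sub ..
 also have "E 1 (C 0 (E 1 q)) = E 0 (E 1 q)" unfolding E1q by (rule base) (use y b in simp)
 also have "\<dots> = E 0 (E 0 q)" using E_far[OF lopE, of 0 1 q] by simp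
 also have "\<dots> = E 0 (M 0 q)" using DM(2)[of q 0] by simp
 finally show "E 1 (C 0 (j (p x \<cdot>[B] y) * j b)) = E 0 (j (p x \<cdot>[B] y) * j b)" unfolding eq .
qed (use assms EC1_gen in \<open>auto intro!: ops_comp jl\<close>)

lemma DC_tp2:
 assumes t: "t \<in> tp B 2"
 shows "D 0 (C 0 t) = C 1 (C 0 (D 1 t))" "D 1 (C 0 t) = C 0 (C 1 (D 0 t))" "E 0 (C 0 t) = E 1 t" "E 1 (C 0 t) = E 0 t"
   apply (rule tp2_eqI[OF t], (intro bop_lins)+, rule DC0', assumption+)
  apply (rule tp2_eqI[OF t], (intro bop_lins)+, rule DC1', assumption+)
  apply (rule tp2_eqI[OF t], (intro bop_lins)+, rule EC0', assumption+)
 apply (rule tp2_eqI[OF t], (intro bop_lins)+, rule EC1', assumption+)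
 done

lemmas DCl = DC_lifts(1)[OF _ DC_tp2(1)] DC_lifts(2)[OF _ DC_tp2(2)] DC_lifts(3)[OF _ DC_tp2(3)] DC_lifts(4)[OF _ DC_tp2(4)]

text \<open>The elements satisfying the three laws contain the unit and the generators and are
  closed under left multiplication by generators. Closure needs the iterated comultiplications to be
  multiplicative, which rests on the compatibility of comultiplication and counit with the braiding;
  so those had to come first.\<close>

lemma coalg: assumes "a \<in> carrier B"
 shows "D 0 (comult B a) = D 1 (comult B a)" "E 0 (comult B a) = j a" "E 1 (comult B a) = j a"
proof -
 have cl: "lin K B TA (comult B)"
  using lin_subD[OF comult_lin] wsp_cl_tp[OF modA] by blast
 note cl_ops = lin_comp'[OF cl D_lin] lin_comp'[OF cl E_lin]
 have one: "D 0 (e * e) = D 1 (e * e)" "E 0 (e * e) = e" "E 1 (e * e) = e"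
  by (simp_all add: D_mult D_j all_ats comult_one E_mult E_j counit_one Tassoc)
 have gen: "D 0 (comult B (p x)) = D 1 (comult B (p x))" "E 0 (comult B (p x)) = j (p x)" "E 1 (comult B (p x)) = j (p x)"
  if x: "x \<in> carrier B" for x
  using x by (simp_all add: p_prim lin_add[OF D_lin] lin_add[OF E_lin] D_mult D_j all_ats comult_one E_mult E_j counit_one p_eps
    add_mult mult_add Tassoc add_ac)
 have mult: "D 0 (comult B (p x \<cdot>[B] y)) = D 1 (comult B (p x \<cdot>[B] y)) \<and>
   E 0 (comult B (p x \<cdot>[B] y)) = j (p x \<cdot>[B] y) \<and> E 1 (comult B (p x \<cdot>[B] y)) = j (p x \<cdot>[B] y)"
  if x: "x \<in> carrier B" and y: "y \<in> carrier B"
   and IH: "D 0 (comult B y) = D 1 (comult B y) \<and> E 0 (comult B y) = j y \<and> E 1 (comult B y) = j y" for x y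
 proof -
  let ?x = "comult B (p x)" and ?y = "comult B y"
  define s where "s = ?x * ?y"
  have xt: "?x \<in> tp B 2" "?y \<in> tp B 2" using comult_tp x y by auto
  have xc [simp]: "?x \<in> carrier TA" "?y \<in> carrier TA" "?x \<in> tge B 2" "?x \<in> tge B (Suc 0)"
   using x y tp_tge[OF xt(1), of 2] tp_tge[OF xt(1), of 1] by auto
  have st: "s \<in> tp B 4" unfolding s_def by (rule tp_mult[OF modA xt]) simp
  have [simp]: "s \<in> tge B n" if "n \<le> 4" for n using tp_tge[OF st that] .
  have [simp]: "s \<in> carrier TA" using wsp_cl_tp[OF modA st] .
  have eq: "comult B (p x \<cdot>[B] y) = M 0 (M 2 (C 1 s))" unfolding s_def using comult_mult[of "p x" y] x y by simp
  have at: "sh B (2 + i) r f s = ?x * sh B i r f ?y" if "lop B r q f" for i r q f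
   unfolding s_def by (rule sh_left[OF modA that xt(1)]) simp
  have "D 0 (D 2 s) = D 0 ?x * D 0 ?y" using at[OF lopD, of 0] unfolding s_def by (simp add: all_rights)
  also have "\<dots> = D 1 ?x * D 1 ?y" using gen(1)[OF x] IH by simp
  also have "\<dots> = D 1 (D 3 s)" using at[OF lopD, of 1] by (simp add: all_rights)
  finally have DDs: "D 0 (D 2 s) = D 1 (D 3 s)" .
  have "D 0 (M 0 (M 2 (C 1 s))) = M 0 (M 2 (C 1 (D 0 (D 1 (M 2 (C 1 s))))))"
   using DM(1)[of "M 2 (C 1 s)" 0] by (simp add: numeral_2_eq_2[symmetric])
  also have "D 1 (M 2 (C 1 s)) = M 3 (D 1 (C 1 s))" using D_far[OF lopM, of 1 2 "C 1 s"] by simp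
  also have "D 0 (M 3 (D 1 (C 1 s))) = M 4 (D 0 (D 1 (C 1 s)))" using D_far[OF lopM, of 0 3 "D 1 (C 1 s)"] by simp
  also have "D 1 (C 1 s) = C 2 (C 1 (D 2 s))" using DCl(1)[of s 1] by (simp add: numeral_2_eq_2[symmetric])
  also have "D 0 (C 2 (C 1 (D 2 s))) = C 3 (D 0 (C 1 (D 2 s)))" using D_far[OF lopC, of 0 2 "C 1 (D 2 s)"] by simp
  also have "D 0 (C 1 (D 2 s)) = C 2 (D 0 (D 2 s))" using D_far[OF lopC, of 0 1 "D 2 s"] by simp
  also have "D 0 (D 2 s) = D 1 (D 3 s)" by (rule DDs)
  finally have L: "D 0 (M 0 (M 2 (C 1 s))) = M 0 (M 2 (C 1 (M 4 (C 3 (C 2 (D 1 (D 3 s)))))))" .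
  have "D 1 (M 0 (M 2 (C 1 s))) = M 0 (D 2 (M 2 (C 1 s)))" using far[OF lopM lopD, of 0 2 1 "M 2 (C 1 s)"] by simp
  also have "D 2 (M 2 (C 1 s)) = M 2 (M 4 (C 3 (D 2 (D 3 (C 1 s)))))" using DM(1)[of "C 1 s" 2] by simp
  also have "D 3 (C 1 s) = C 1 (D 3 s)" using C_far[OF lopD, of 1 3 s] by simp
  also have "D 2 (C 1 (D 3 s)) = C 1 (C 2 (D 1 (D 3 s)))" using DCl(2)[of "D 3 s" 1] by (simp add: numeral_2_eq_2[symmetric])
  also have "C 3 (C 1 (C 2 (D 1 (D 3 s)))) = C 1 (C 3 (C 2 (D 1 (D 3 s))))" using C_far[OF lopC, of 1 3 "C 2 (D 1 (D 3 s))"] by simp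
  also have "M 4 (C 1 (C 3 (C 2 (D 1 (D 3 s))))) = C 1 (M 4 (C 3 (C 2 (D 1 (D 3 s)))))"
   using C_far[OF lopM, of 1 4 "C 3 (C 2 (D 1 (D 3 s)))"] by simp
  finally have 1: "D 0 (M 0 (M 2 (C 1 s))) = D 1 (M 0 (M 2 (C 1 s)))" unfolding L ..
  have "E 0 (M 0 (M 2 (C 1 s))) = E 0 (E 0 (M 2 (C 1 s)))" using DM(2)[of "M 2 (C 1 s)" 0] by simp
  also have "E 0 (M 2 (C 1 s)) = M 1 (E 0 (C 1 s))" using E_far[OF lopM, of 0 2 "C 1 s"] by simp
  also have "E 0 (M 1 (E 0 (C 1 s))) = M 0 (E 0 (E 0 (C 1 s)))" using E_far[OF lopM, of 0 1 "E 0 (C 1 s)"] by simp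
  also have "E 0 (E 0 (C 1 s)) = E 0 (E 1 (C 1 s))" using E_far[OF lopE, of 0 1 "C 1 s"] by simp
  also have "E 1 (C 1 s) = E 2 s" using DCl(3)[of s 1] by (simp add: numeral_2_eq_2[symmetric])
  also have "E 2 s = ?x * j y" using at[OF lopE, of 0] IH by simp
  also have "E 0 (?x * j y) = j (p x) * j y" using gen(2)[OF x] y by (simp add: all_rights)
  finally have 2: "E 0 (M 0 (M 2 (C 1 s))) = j (p x \<cdot>[B] y)" using x y by (simp add: M_mult')
  have "E 1 (M 0 (M 2 (C 1 s))) = M 0 (E 2 (M 2 (C 1 s)))" using far[OF lopM lopE, of 0 2 1 "M 2 (C 1 s)"] by simp
  also have "E 2 (M 2 (C 1 s)) = E 2 (E 2 (C 1 s))" using DM(2)[of "C 1 s" 2] by simp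
  also have "\<dots> = E 2 (E 3 (C 1 s))" using E_far[OF lopE, of 2 3 "C 1 s"] by simp
  also have "E 3 (C 1 s) = C 1 (E 3 s)" using C_far[OF lopE, of 1 3 s] by simp
  also have "E 2 (C 1 (E 3 s)) = E 1 (E 3 s)" using DCl(4)[of "E 3 s" 1] by (simp add: numeral_2_eq_2[symmetric])
  also have "E 3 s = ?x * j y" using at[OF lopE, of 1] IH by simp
  also have "E 1 (?x * j y) = j (p x) * j y" using gen(3)[OF x] y by (simp add: all_rights)
  finally have 3: "E 1 (M 0 (M 2 (C 1 s))) = j (p x \<cdot>[B] y)" using x y by (simp add: M_mult')
  show ?thesis unfolding eq using 1 2 3 by blast
 qed
 let ?H = "{a \<in> carrier B. D 0 (comult B a) = D 1 (comult B a) \<and> E 0 (comult B a) = j a \<and> E 1 (comult B a) = j a}"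
 note js = iota_lin[OF modA]
 have "submodule ?H K B"
  using lin_zero[OF cl] lin_zero[OF js] lin_zero[OF D_lin] lin_zero[OF E_lin]
  by (intro submI) (auto simp: lin_add[OF cl] lin_add[OF D_lin] lin_add[OF E_lin] lin_add[OF js]
   lin_smult[OF cl] lin_smult[OF D_lin] lin_smult[OF E_lin] lin_smult[OF js])
 from p_gen[OF this] have "carrier B \<subseteq> ?H" using one gen mult comult_one by auto
 then show "D 0 (comult B a) = D 1 (comult B a)" "E 0 (comult B a) = j a" "E 1 (comult B a) = j a"
  using assms by auto
qed

lemma br_bialgI: "br_bialg K B"
 by unfold_locales (use coalg DC_tp2 in auto)

end

section \<open>Records with the same underlying module\<close>

context fld begin

text \<open>The bialgebras in play are records obtained by adding coalgebra fields to an algebra.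
  All tensor constructions look only at carrier, addition and scalar multiplication, hence coincide
  for the record and for its extension.\<close>

lemma same_tensor:
 assumes "carrier W = carrier V" "ring.add W = ring.add V" "smult W = smult V"
 shows "tensor_alg K W = tensor_alg K V" "\<iota> K W = \<iota> K V" "pure_tensor K W = pure_tensor K V" "tpow K W = tpow K V"
  "sh W = sh V" "lop W = lop V" "wsp W = wsp V"
proof -
 show 1: "tensor_alg K W = tensor_alg K V" by (simp add: tensor_alg_def tensor_ideal_def assms)
 show 2: "\<iota> K W = \<iota> K V" by (rule ext) (simp add: \<iota>_def tensor_ideal_def assms)
 show 3: "pure_tensor K W = pure_tensor K V" by (rule ext) (simp add: pure_tensor_def 1 2)
 show 4: "tpow K W = tpow K V" by (rule ext) (simp add: tpow_def 1 3 assms)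
 show 5: "sh W = sh V" by (intro ext) (simp add: sh_def 1 3 assms)
 show 6: "lop W = lop V" by (intro ext) (simp add: lop_def 1 4)
 show 7: "wsp W = wsp V" by (rule ext) (simp add: wsp_def 1 3 assms)
qed

lemma same_mulT:
 assumes "carrier W = carrier V" "ring.add W = ring.add V" "smult W = smult V" "monoid.mult W = monoid.mult V"
 shows "mulT K W = mulT K V"
 by (simp add: mulT_def same_tensor[OF assms(1-3)] assms)

lemma same_module:
 assumes "carrier W = carrier V" "ring.add W = ring.add V" "smult W = smult V" "ring.zero W = ring.zero V" and V: "module K V"
 shows "module K W"
proof (rule moduleI)
 show "abelian_group W"
 proof (rule abelian_groupI)
  fix x assume "x \<in> carrier W"
  then show "\<exists>y\<in>carrier W. y +[W] x = \<zero>\<^bsub>W\<^esub>"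
   using V by (intro bexI[of _ "\<ominus>\<^bsub>V\<^esub> x"]) (simp_all add: assms(1-4))
 qed (use V in \<open>auto simp: assms(1-4) add_ac\<close>)
qed (use V is_cring in \<open>auto simp: assms(1-4) smult_add add_smult smult_smult\<close>)

lemma same_alg:
 assumes "carrier W = carrier V" "ring.add W = ring.add V" "smult W = smult V" "ring.zero W = ring.zero V"
  "monoid.mult W = monoid.mult V" "one W = one V" and V: "assoc_algebra K V"
 shows "assoc_algebra K W"
proof (rule assoc_algebraI)
 show m: "module K W" by (rule same_module[OF assms(1-4)]) (use V in simp)
 show "ring W"
 proof (rule ringI)
  show "abelian_group W" by (rule mod_abg[OF m])
  show "monoid W" by (rule monoidI) (use V in \<open>auto simp: assms(1-6) mult_assoc\<close>)
 qed (use V in \<open>auto simp: assms(1-6) mult_add add_mult\<close>)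
qed (use V in \<open>auto simp: assms(1-6) mult_smult\<close>)

lemma Tm_M:
 assumes A: "assoc_algebra K A" and B: "assoc_algebra K B" and h: "alg_hom K A B h" and t: "t \<in> carrier (T A)"
 shows "Tm A B h (sh A i 2 (mulT K A) t) = sh B i 2 (mulT K B) (Tm A B h t)"
proof (rule Tm_sh[OF alg_mod[OF A] alg_mod[OF B] alg_hom_lin[OF h] mulT_spec(1)[OF A] mulT_spec(1)[OF B] _ t])
 note Th = Tm_lin[OF alg_mod[OF A] alg_mod[OF B] alg_hom_lin[OF h]]
 note hl = alg_hom_lin[OF h]
 have mA: "module K A" "module K B" using A B by auto
 fix s assume s: "s \<in> tp A 2"
 show "Tm A B h (mulT K A s) = mulT K B (Tm A B h s)"
 proof (rule tp2_lin_eq[OF s])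
  show "lin K (tpm1 A 2) (T B) (%s. Tm A B h (mulT K A s))"
   by (rule lin_comp'[OF lop_lin[OF mA(1) mulT_spec(1)[OF A]] Th])
  show "lin K (tpm1 A 2) (T B) (%s. mulT K B (Tm A B h s))"
   by (rule lin_comp'[OF Tm_tp_lin[OF mA hl] lop_lin[OF mA(2) mulT_spec(1)[OF B]]])
  fix x y assume "x \<in> carrier A" "y \<in> carrier A"
  then show "Tm A B h (mulT K A (\<iota> K A x *[A] \<iota> K A y)) = mulT K B (Tm A B h (\<iota> K A x *[A] \<iota> K A y))"
   using mA lin_cl[OF hl] A B by (simp add: mulT_spec(2) Tm_mult[OF mA hl] Tm_iota[OF mA hl] alg_hom_mult[OF h])
 qed (use mA in auto)
qed

lemma Tm_C:
 assumes A: "module K A" and B: "module K B" and h: "lin K A B h" and c: "lop A 2 2 cA" "lop B 2 2 cB"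
  and eq: "\<And>x y. x \<in> carrier A ==> y \<in> carrier A ==> Tm A B h (cA (\<iota> K A x *[A] \<iota> K A y)) = cB (\<iota> K B (h x) *[B] \<iota> K B (h y))"
  and t: "t \<in> carrier (T A)"
 shows "Tm A B h (sh A i 2 cA t) = sh B i 2 cB (Tm A B h t)"
proof (rule Tm_sh[OF A B h c _ t])
 fix s assume s: "s \<in> tp A 2"
 show "Tm A B h (cA s) = cB (Tm A B h s)"
 proof (rule tp2_lin_eq[OF s A])
  show "lin K (tpm1 A 2) (T B) (%s. Tm A B h (cA s))"
   by (rule lin_comp'[OF lop_lin[OF A c(1)] Tm_lin[OF A B h]])
  show "lin K (tpm1 A 2) (T B) (%s. cB (Tm A B h s))"
   by (rule lin_comp'[OF Tm_tp_lin[OF A B h] lop_lin[OF B c(2)]])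
 qed (use A B eq in \<open>auto simp: Tm_mult[OF A B h] Tm_iota[OF A B h]\<close>)
qed

end

section \<open>The braided bialgebra T(V,c) and its universal property\<close>

context tens begin

abbreviation "cT \<equiv> tensor_braiding K V cV"

lemma cT: "br_alg K A cT" "t \<in> tp V 2 ==> cT (Ti t) = Ti (cV t)"
proof -
 from someI_ex[OF tensor_braiding_exists]
 have *: "braided_algebra K A cT \<and> (\<forall>t\<in>tp V 2. cT (tsquare K V A iv t) = tsquare K V A iv (cV t))"
  unfolding tensor_braiding_def .
 then show "br_alg K A cT" unfolding br_alg_iff by blast
 show "cT (Ti t) = Ti (cV t)" if t: "t \<in> tp V 2"
 proof -
  have "cT (tsquare K V A iv t) = tsquare K V A iv (cV t)" using * t by blast
  then show ?thesis unfolding tsquare_Tm[OF modV modA iv_lin t] tsquare_Tm[OF modV modA iv_lin lop_cl[OF lopc t]] .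
 qed
qed

end

sublocale tens \<subseteq> br_alg K "tensor_alg K V" "tensor_braiding K V cV"
 by (rule cT(1))

context tens begin

abbreviation "BT \<equiv> tensor_bialg K V cV"

lemma BT_sel [simp]: "carrier BT = carrier A" "ring.add BT = ring.add A" "smult BT = smult A" "ring.zero BT = ring.zero A"
  "monoid.mult BT = monoid.mult A" "one BT = one A" "comult BT = tensor_comult K V cV" "counit BT = tensor_counit K V"
  "braiding BT = cT"
 by (simp_all add: tensor_bialg_def module.defs bialg.defs)

lemmas same_BT [simp] = same_tensor[OF BT_sel(1-3)] same_mulT[OF BT_sel(1-3,5)]

lemma BT_alg: "assoc_algebra K BT"
 by (rule same_alg[OF BT_sel(1-6)]) simp

lemma BT_br_alg: "br_alg K BT cT"
 by unfold_locales (use BT_alg lopC braid0 CM0 CM1 CU0 CU1 in auto)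

lemma tensor_comult: "alg_hom K A A2 (tensor_comult K V cV)"
  "v \<in> carrier V ==> tensor_comult K V cV (iv v) = (j (iv v) * e) +[TA] (e * j (iv v))"
proof -
 have "lin K V TA (%v. (j (iv v) * e) +[TA] (e * j (iv v)))"
  by (intro lin_sum lin_mult_left lin_mult_right lin_comp'[OF iv_lin iota_lin[OF modA]]) auto
 then have "lin K V A2 (%v. (j (iv v) * e) +[TA] (e * j (iv v)))"
  unfolding lin_def by (auto simp: A2_sel intro!: tp_add)
 from someI_ex[OF alg_hom_ext[OF modV A2_alg this]]
 show "alg_hom K A A2 (tensor_comult K V cV)"
  "v \<in> carrier V ==> tensor_comult K V cV (iv v) = (j (iv v) * e) +[TA] (e * j (iv v))"
  unfolding tensor_comult_def Let_def by blast+
qed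

lemma tensor_counit: "alg_hom K A (ground K) (tensor_counit K V)" "v \<in> carrier V ==> tensor_counit K V (iv v) = \<zero>\<^bsub>K\<^esub>"
proof -
 have "lin K V (ground K) (%v. \<zero>\<^bsub>K\<^esub>)" by (rule linI) (auto simp: ground_def)
 from someI_ex[OF alg_hom_ext[OF modV alg_ground this]]
 show "alg_hom K A (ground K) (tensor_counit K V)" "v \<in> carrier V ==> tensor_counit K V (iv v) = \<zero>\<^bsub>K\<^esub>"
  unfolding tensor_counit_def by blast+
qed

lemma lin_BT: "lin K BT N f = lin K A N f"
 by (simp add: lin_def)

lemma pre_bialg_BT: "pre_bialg K BT"
proof -
 have l: "lin K A (tpm1 A 2) (tensor_comult K V cV)"
  using alg_hom_lin[OF tensor_comult(1)] unfolding lin_def by (simp add: A2_sel)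
 interpret BO: bialg_op K BT
  by unfold_locales (use BT_alg l alg_hom_lin[OF tensor_counit(1)] in \<open>simp_all add: lin_BT\<close>)
 interpret B: br_alg K BT "braiding BT" using BT_br_alg by simp
 show ?thesis
 proof
  fix x y assume xy: "x \<in> carrier BT" "y \<in> carrier BT"
  then have "tensor_comult K V cV x \<in> tp A 2" "tensor_comult K V cV y \<in> tp A 2" using lin_cl[OF l] by auto
  then show "comult BT (x \<cdot>[BT] y) = sh BT 0 2 (mulT K BT) (sh BT 2 2 (mulT K BT) (sh BT 1 2 (braiding BT) (comult BT x *[BT] comult BT y)))"
   using alg_hom_mult[OF tensor_comult(1), of x y] xy by (simp add: A2_mult)
  show "counit BT (x \<cdot>[BT] y) = counit BT x \<cdot>[K] counit BT y"
   using alg_hom_mult[OF tensor_counit(1), of x y] xy by (simp add: ground_def)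
 next
  show "comult BT \<one>\<^bsub>BT\<^esub> = \<iota> K BT \<one>\<^bsub>BT\<^esub> *[BT] \<iota> K BT \<one>\<^bsub>BT\<^esub>" using alg_hom_one[OF tensor_comult(1)] by (simp add: A2_sel)
  show "counit BT \<one>\<^bsub>BT\<^esub> = \<one>\<^bsub>K\<^esub>" using alg_hom_one[OF tensor_counit(1)] by (simp add: ground_def)
 qed
qed

lemma pv_Ti: assumes s: "s \<in> tp V 2" shows "sh A 0 1 pv (Ti s) = Ti s" "sh A 1 1 pv (Ti s) = Ti s"
proof -
 have l: "lin K (tpm1 V 2) TA (%s. sh A i 1 pv (Ti s))" for i
  by (rule lin_sub[OF lin_comp'[OF Ti_lin sh_lin[OF modA lop_pv]]]) (use wsp_cl_tp[OF modV] in auto)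
 have l': "lin K (tpm1 V 2) TA Ti" by (rule lin_sub[OF Ti_lin]) (use wsp_cl_tp[OF modV] in auto)
 {
  fix x z assume "x \<in> carrier V" "z \<in> carrier V"
  then have "sh A 0 1 pv (Ti (iv x \<cdot>[A] iv z)) = Ti (iv x \<cdot>[A] iv z) \<and> sh A 1 1 pv (Ti (iv x \<cdot>[A] iv z)) = Ti (iv x \<cdot>[A] iv z)"
   using pv_1[of "iv x" "iv z"] pv_0(1)[of "iv x" "j (iv z)"] by (simp add: Ti_cons Tm_iota[OF modV modA iv_lin] pr)
 }
 note * = this
 show "sh A 0 1 pv (Ti s) = Ti s" by (rule tp2_lin_eq[OF s modV _ l l']) (use * in auto)
 show "sh A 1 1 pv (Ti s) = Ti s" by (rule tp2_lin_eq[OF s modV _ l l']) (use * in auto)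
qed

lemma C_gen: assumes "v \<in> carrier V" "u \<in> carrier V"
 shows "C 0 (j (iv v) * j (iv u)) = Ti (cV (iv v \<cdot>[A] iv u))"
 using cT(2)[of "iv v \<cdot>[A] iv u"] assms C_base[of "j (iv v) * j (iv u)"] by (simp add: Ti_cons Tm_iota[OF modV modA iv_lin])

text \<open>The criterion for bialgebras generated by primitive elements is applied with the
  projection of T(V) onto V given by \<open>iv\<close> after \<open>pr\<close>; the braiding
  preserves V \<otimes> V because it extends the one of V.\<close>

lemma br_bialg_BT: "br_bialg K BT"
proof -
 interpret B: pre_bialg K BT by (rule pre_bialg_BT)
 have d: "deg1 K BT BT = deg1 K A A" by (intro ext) (simp add: deg1_def)
 have cV: "cV (iv v \<cdot>[A] iv u) \<in> tp V 2" if "v \<in> carrier V" "u \<in> carrier V" for u v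
  by (rule lop_cl[OF lopc]) (use that in simp)
 interpret G: prim_gen K BT "%a. iv (pr a)"
 proof
  show "lin K BT BT (%a. iv (pr a))" using lin_comp'[OF pr(1) iv_lin] unfolding lin_def by simp
  fix x assume "x \<in> carrier BT"
  then have v: "pr x \<in> carrier V" by simp
  show "comult BT (iv (pr x)) = (\<iota> K BT (iv (pr x)) *[BT] \<iota> K BT \<one>\<^bsub>BT\<^esub>) +[T BT] (\<iota> K BT \<one>\<^bsub>BT\<^esub> *[BT] \<iota> K BT (iv (pr x)))"
   using tensor_comult(2)[OF v] by simp
  show "counit BT (iv (pr x)) = \<zero>\<^bsub>K\<^esub>" using tensor_counit(2)[OF v] by simp
  show "iv (pr (iv (pr x))) = iv (pr x)" using pr(2)[OF v] by simp
  fix y assume "y \<in> carrier BT"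
  then have u: "pr y \<in> carrier V" by simp
  show "sh BT 0 (Suc 0) (deg1 K BT BT (%a. iv (pr a))) (sh BT 0 2 (braiding BT) (\<iota> K BT (iv (pr x)) *[BT] \<iota> K BT (iv (pr y)))) =
    sh BT 0 2 (braiding BT) (\<iota> K BT (iv (pr x)) *[BT] \<iota> K BT (iv (pr y)))"
   "sh BT (Suc 0) (Suc 0) (deg1 K BT BT (%a. iv (pr a))) (sh BT 0 2 (braiding BT) (\<iota> K BT (iv (pr x)) *[BT] \<iota> K BT (iv (pr y)))) =
    sh BT 0 2 (braiding BT) (\<iota> K BT (iv (pr x)) *[BT] \<iota> K BT (iv (pr y)))"
   using C_gen[OF v u] pv_Ti[OF cV[OF v u]] by (simp_all add: d)
 next
  fix H assume H: "submodule H K BT" "\<one>\<^bsub>BT\<^esub> \<in> H"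
   and gen: "\<And>x. x \<in> carrier BT ==> iv (pr x) \<in> H" "\<And>x a. x \<in> carrier BT ==> a \<in> H ==> iv (pr x) \<cdot>[BT] a \<in> H"
  have sH: "submodule H K A"
  proof (rule submI)
   show "H \<subseteq> carrier A" using subm_subset[OF H(1)] by simp
   show "\<zero>\<^bsub>A\<^esub> \<in> H" using subm_zero[OF _ H(1)] BT_alg by simp
   show "x +[A] y \<in> H" if "x \<in> H" "y \<in> H" for x y using subm_add[OF _ H(1) that] BT_alg by simp
   show "a *:[A] x \<in> H" if "a \<in> carrier K" "x \<in> H" for a x using subm_smult[OF _ H(1) that] BT_alg by simp
  qed simp
  have "pt V w \<in> H" if "w \<in> lists (carrier V)" for w
   using that
  proof (induction w)
   case (Cons v w)
   then show ?case using gen(2)[of "iv v" "pt V w"] by (simp add: pt_Cons pr(2))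
  qed (use H in simp)
  then have "wsp V UNIV \<subseteq> H" unfolding wsp_def by (intro lspan_min[OF sH]) auto
  then show "carrier BT \<subseteq> H" by simp
 qed
 show ?thesis by (rule G.br_bialgI)
qed

text \<open>The braiding of T(V) is determined by its values on generators through the product
  rules, and these hold in the target too. So an algebra map that is braided on V is braided: first
  with the left factor in V and induction on the right one, then by induction on the left
  factor.\<close>

lemma universal_braided:
 assumes B: "br_alg K B cB" and f: "lin K V B f" and fc: "\<And>t. t \<in> tp V 2 ==> cB (Tm V B f t) = Tm V B f (cV t)"
  and h: "alg_hom K A B h" and hf: "\<And>v. v \<in> carrier V ==> h (iv v) = f v" and t: "t \<in> carrier TA"
 shows "Tm A B h (C i t) = sh B i 2 cB (Tm A B h t)"
proof -
 interpret B: br_alg K B cB by (rule B)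
 note hl = alg_hom_lin[OF h]
 let ?H = "Tm A B h"
 note H_lin = Tm_lin[OF modA B.modA hl] and H_mult = Tm_mult[OF modA B.modA hl]
  and H_j = Tm_iota[OF modA B.modA hl] and H_cl [simp] = Tm_cl[OF modA B.modA hl]
 note HM = Tm_M[OF alg B.alg h]
 have h_cl [simp]: "h x \<in> carrier B" if "x \<in> carrier A" for x using lin_cl[OF hl that] .
 have h1: "h \<one>\<^bsub>A\<^esub> = \<one>\<^bsub>B\<^esub>" by (rule alg_hom_one[OF h])
 have HTi: "?H (Ti t) = Tm V B f t" if "t \<in> carrier A" for t
  using Tm_Tm[OF modV modA B.modA iv_lin hl that] Tm_cong[of V "%x. h (iv x)" f B] hf by simp
 have j1: "\<And>s. s \<in> carrier TA ==> lin K A TA (%a. j a * s)" and j2: "\<And>s. s \<in> carrier TA ==> lin K A TA (%a. s * j a)"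
  by (auto intro!: lin_mult_left lin_mult_right iota_lin)
 note HC_lin = lin_comp'[OF lin_comp'[OF _ C_lin] H_lin] and CH_lin = lin_comp'[OF lin_comp'[OF _ H_lin] B.C_lin]
 have first: "?H (C 0 (j (iv v) * j b)) = B.C 0 (?H (j (iv v) * j b))" if v: "v \<in> carrier V" and b: "b \<in> carrier A" for v b
 proof -
  have "\<forall>v\<in>carrier V. ?H (C 0 (j (iv v) * j b)) = B.C 0 (?H (j (iv v) * j b))"
   using b modV
  proof (induction rule: T_gen_induct)
   case one
   show ?case
   proof
    fix v assume v: "v \<in> carrier V"
    have "C 0 (j (iv v) * e) = e * j (iv v)" using C_base[of "j (iv v) * e"] CU1[of "iv v"] v by simp
    moreover have "B.C 0 (B.j (h (iv v)) *[B] B.e) = B.e *[B] B.j (h (iv v))"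
     using B.C_base[of "B.j (h (iv v)) *[B] B.e"] B.CU1[of "h (iv v)"] v by simp
    ultimately show "?H (C 0 (j (iv v) * e)) = B.C 0 (?H (j (iv v) * e))"
     using v by (simp add: H_mult H_j h1)
   qed
  next
   case (gen u)
   show ?case
   proof
    fix v assume v: "v \<in> carrier V"
    have vu: "iv v \<cdot>[A] iv u \<in> tp V 2" using v gen by simp
    have "?H (C 0 (j (iv v) * j (iv u))) = Tm V B f (cV (iv v \<cdot>[A] iv u))"
     using C_gen[OF v gen] HTi[OF lop_cl2[OF modV lopc vu]] by simp
    also have "\<dots> = cB (Tm V B f (iv v \<cdot>[A] iv u))" using fc[OF vu] by simp
    also have "\<dots> = B.C 0 (Tm V B f (iv v \<cdot>[A] iv u))" using B.C_base[OF Tm_tp[OF modV B.modA f vu]] by simp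
    also have "Tm V B f (iv v \<cdot>[A] iv u) = ?H (j (iv v) * j (iv u))"
     using HTi[of "iv v \<cdot>[A] iv u"] v gen by (simp add: Ti_cons Tm_iota[OF modV modA iv_lin])
    finally show "?H (C 0 (j (iv v) * j (iv u))) = B.C 0 (?H (j (iv v) * j (iv u)))" .
   qed
  next
   case (mult u b)
   show ?case
   proof
    fix v assume v: "v \<in> carrier V"
    have cl: "iv v \<in> carrier A" "iv u \<in> carrier A" "b \<in> carrier A" using v mult by auto
    define q where "q = j (iv v) * (j (iv u) * j b)"
    have qt: "q \<in> tp A 3" unfolding q_def by (rule iota_mult_tp[where n = 2]) (use cl in simp_all)
    have qc [simp]: "q \<in> carrier TA" by (rule wsp_cl_tp[OF modA qt])
    have Hq: "?H q \<in> tp B 3" by (rule Tm_tp[OF modA B.modA hl qt])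
    define r where "r = cV (iv v \<cdot>[A] iv u)"
    have r: "r \<in> tp V 2" unfolding r_def by (rule lop_cl[OF lopc]) (use v mult in simp)
    have jj: "j (iv v) * j (iv u) \<in> tp A 2" using cl by simp
    have C0q: "C 0 q = Ti r * j b"
     unfolding q_def r_def using C_gen[OF v mult(1)] tp_tge[OF jj, of 2] cl
      sh_right[OF modA lopC, of "j (iv v) * j (iv u)" 0 "j b"] by (simp add: Tassoc)
    have "?H (C 0 q) = ?H (C 0 (j (iv v) * j (iv u))) *[B] ?H (j b)"
     unfolding C0q r_def C_gen[OF v mult(1)] using lop_cl2[OF modV lopc] v cl mult(1) by (intro H_mult) auto
    also have "\<dots> = B.C 0 (?H (j (iv v) * j (iv u))) *[B] ?H (j b)" using mult.IH(1) v by simp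
    also have "\<dots> = B.C 0 (?H (j (iv v) * j (iv u)) *[B] ?H (j b))"
     using sh_right[OF B.modA B.lopC, of "?H (j (iv v) * j (iv u))" 0 "?H (j b)"] tp_tge[OF Tm_tp[OF modA B.modA hl jj], of 2] cl by simp
    also have "?H (j (iv v) * j (iv u)) *[B] ?H (j b) = ?H q" unfolding q_def using cl by (simp add: H_mult mult_assoc)
    finally have H0: "?H (C 0 q) = B.C 0 (?H q)" .
    \<comment> \<open>After the first braiding the tensor has two generators in front of
      \<open>b\<close>. The leading one is a spectator, and the hypothesis applies to the second
      together with \<open>b\<close>; hence the hypothesis must hold for all generators.\<close>
    have sub: "?H (C 1 (Ti p * j b)) = B.C 1 (?H (Ti p * j b))" if p: "p \<in> tp V 2" for p
    proof (rule tp2_lin_eq[OF p modV])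
     have Tr: "lin K (tpm1 V 2) TA (%p. Ti p * j b)"
      by (rule lin_sub[OF lin_comp'[OF Ti_lin T_mult_lin_right]]) (use cl wsp_cl_tp[OF modV] in auto)
     show "lin K (tpm1 V 2) (T B) (%p. ?H (C 1 (Ti p * j b)))" "lin K (tpm1 V 2) (T B) (%p. B.C 1 (?H (Ti p * j b)))"
      by (rule HC_lin[OF Tr], rule CH_lin[OF Tr])
     fix x y assume xy: "x \<in> carrier V" "y \<in> carrier V"
     have "?H (C 0 (j (iv y) * j b)) = B.C 0 (?H (j (iv y) * j b))" using mult.IH(2) xy by blast
     then show "?H (C 1 (Ti (iv x \<cdot>[A] iv y) * j b)) = B.C 1 (?H (Ti (iv x \<cdot>[A] iv y) * j b))"
      using xy cl by (simp add: Ti_cons Tm_iota[OF modV modA iv_lin] Tassoc ats B.ats H_mult H_j B.Tassoc)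
    qed simp
    have eq: "j (iv v) * j (iv u \<cdot>[A] b) = M 1 q" unfolding q_def using cl by (simp add: ats M_mult')
    have "?H (C 0 (M 1 q)) = ?H (M 0 (C 1 (C 0 q)))" using CM1[OF qt] by simp
    also have "\<dots> = B.M 0 (?H (C 1 (C 0 q)))" by (rule HM) simp
    also have "?H (C 1 (C 0 q)) = B.C 1 (?H (C 0 q))" unfolding C0q by (rule sub[OF r])
    also have "B.M 0 (B.C 1 (?H (C 0 q))) = B.C 0 (B.M 1 (?H q))" unfolding H0 using B.CM1[OF Hq] by simp
    also have "B.M 1 (?H q) = ?H (M 1 q)" using HM[OF qc, of 1] by simp
    finally show "?H (C 0 (j (iv v) * j (iv u \<cdot>[A] b))) = B.C 0 (?H (j (iv v) * j (iv u \<cdot>[A] b)))" unfolding eq .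
   qed
  next
   case (add a b)
   show ?case
   proof
    fix v assume v: "v \<in> carrier V"
    then have s: "j (iv v) \<in> carrier TA" by simp
    show "?H (C 0 (j (iv v) * j (a +[A] b))) = B.C 0 (?H (j (iv v) * j (a +[A] b)))"
     using lin_add[OF HC_lin[OF j2[OF s]], of a b 0] lin_add[OF CH_lin[OF j2[OF s]], of a b 0] add v by simp
   qed
  next
   case (smult k a)
   show ?case
   proof
    fix v assume v: "v \<in> carrier V"
    then have s: "j (iv v) \<in> carrier TA" by simp
    show "?H (C 0 (j (iv v) * j (k *:[A] a))) = B.C 0 (?H (j (iv v) * j (k *:[A] a)))"
     using lin_smult[OF HC_lin[OF j2[OF s]], of k a 0] lin_smult[OF CH_lin[OF j2[OF s]], of k a 0] smult v by simp
   qed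
  qed
  then show ?thesis using v by blast
 qed
 have first2: "?H (C 0 (j (iv v) * t)) = B.C 0 (?H (j (iv v) * t))" if v: "v \<in> carrier V" and t: "t \<in> tge A 1" for v t
 proof (rule wsp_lin_eq'[OF t modA _ HC_lin[OF T_mult_lin_left] CH_lin[OF T_mult_lin_left]])
  fix w assume w: "w \<in> lists (carrier A)" "length w \<in> {1..}"
  then obtain b u where bu: "w = b # u" by (cases w) auto
  have b: "b \<in> carrier A" "pt A u \<in> carrier TA" using w bu by auto
  have jj: "j (iv v) * j b \<in> tp A 2" using v b by simp
  have "?H (C 0 ((j (iv v) * j b) * pt A u)) = ?H (C 0 (j (iv v) * j b)) *[B] ?H (pt A u)"
   using sh_right[OF modA lopC, of "j (iv v) * j b" 0 "pt A u"] tp_tge[OF jj, of 2] v b by (simp add: H_mult)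
  also have "\<dots> = B.C 0 (?H (j (iv v) * j b) *[B] ?H (pt A u))"
   using sh_right[OF B.modA B.lopC, of "?H (j (iv v) * j b)" 0 "?H (pt A u)"] tp_tge[OF Tm_tp[OF modA B.modA hl jj], of 2] v b first[OF v b(1)] by simp
  finally show "?H (C 0 (j (iv v) * pt A w)) = B.C 0 (?H (j (iv v) * pt A w))"
   unfolding bu using v b by (simp add: pt_Cons Tassoc H_mult B.Tassoc)
 qed (use v in auto)
 have second: "?H (C 0 (j a * j b)) = B.C 0 (?H (j a * j b))" if a: "a \<in> carrier A" and b: "b \<in> carrier A" for a b
 proof -
  have "\<forall>b\<in>carrier A. ?H (C 0 (j a * j b)) = B.C 0 (?H (j a * j b))"
   using a modV
  proof (induction rule: T_gen_induct)
   case one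
   show ?case
   proof
    fix b assume b: "b \<in> carrier A"
    have "C 0 (e * j b) = j b * e" using C_base[of "e * j b"] CU0[of b] b by simp
    moreover have "B.C 0 (B.e *[B] B.j (h b)) = B.j (h b) *[B] B.e"
     using B.C_base[of "B.e *[B] B.j (h b)"] B.CU0[of "h b"] b by simp
    ultimately show "?H (C 0 (e * j b)) = B.C 0 (?H (e * j b))"
     using b by (simp add: H_mult H_j h1)
   qed
  next
   case (gen v)
   then show ?case using first by blast
  next
   case (mult v a)
   show ?case
   proof
    fix b assume b: "b \<in> carrier A"
    have cl: "iv v \<in> carrier A" "a \<in> carrier A" "b \<in> carrier A" using b mult by auto
    define q where "q = j (iv v) * (j a * j b)"
    have qt: "q \<in> tp A 3" unfolding q_def by (rule iota_mult_tp[where n = 2]) (use cl in simp_all)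
    have qc [simp]: "q \<in> carrier TA" by (rule wsp_cl_tp[OF modA qt])
    have Hq: "?H q \<in> tp B 3" by (rule Tm_tp[OF modA B.modA hl qt])
    have jj: "j a * j b \<in> tp A 2" using cl by simp
    have C1q: "C 1 q = j (iv v) * C 0 (j a * j b)" unfolding q_def using cl by (simp add: ats)
    have r: "C 0 (j a * j b) \<in> tge A 1" by (rule tp_tge[OF C_tp[OF jj]]) simp
    have H1: "?H (C 1 q) = B.C 1 (?H q)"
     unfolding C1q using mult.IH(2) b cl by (simp add: q_def H_mult H_j B.ats)
    have eq: "j (iv v \<cdot>[A] a) * j b = M 0 q" unfolding q_def using cl by (simp add: M_mult)
    have "?H (C 0 (M 0 q)) = ?H (M 1 (C 0 (C 1 q)))" using CM0[OF qt] by simp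
    also have "\<dots> = B.M 1 (?H (C 0 (C 1 q)))" by (rule HM) simp
    also have "?H (C 0 (C 1 q)) = B.C 0 (?H (C 1 q))" unfolding C1q by (rule first2[OF mult(1) r])
    also have "B.M 1 (B.C 0 (?H (C 1 q))) = B.C 0 (B.M 0 (?H q))" unfolding H1 using B.CM0[OF Hq] by simp
    also have "B.M 0 (?H q) = ?H (M 0 q)" using HM[OF qc, of 0] by simp
    finally show "?H (C 0 (j (iv v \<cdot>[A] a) * j b)) = B.C 0 (?H (j (iv v \<cdot>[A] a) * j b))" unfolding eq .
   qed
  next
   case (add a a')
   show ?case
   proof
    fix b assume b: "b \<in> carrier A"
    then have s: "j b \<in> carrier TA" by simp
    show "?H (C 0 (j (a +[A] a') * j b)) = B.C 0 (?H (j (a +[A] a') * j b))"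
     using lin_add[OF HC_lin[OF j1[OF s]], of a a' 0] lin_add[OF CH_lin[OF j1[OF s]], of a a' 0] add b by simp
   qed
  next
   case (smult k a)
   show ?case
   proof
    fix b assume b: "b \<in> carrier A"
    then have s: "j b \<in> carrier TA" by simp
    show "?H (C 0 (j (k *:[A] a) * j b)) = B.C 0 (?H (j (k *:[A] a) * j b))"
     using lin_smult[OF HC_lin[OF j1[OF s]], of k a 0] lin_smult[OF CH_lin[OF j1[OF s]], of k a 0] smult b by simp
   qed
  qed
  then show ?thesis using b by blast
 qed
 show ?thesis
 proof (rule Tm_C[OF modA B.modA hl lopC B.lopC _ t])
  fix x y assume xy: "x \<in> carrier A" "y \<in> carrier A"
  have jj: "j x * j y \<in> tp A 2" using xy by simp
  show "?H (cT (j x * j y)) = cB (B.j (h x) *[B] B.j (h y))"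
   using second[OF xy] C_base[OF jj] B.C_base[OF Tm_tp[OF modA B.modA hl jj]] xy by (simp add: H_mult H_j)
 qed
qed

text \<open>By the preceding result h \<otimes> h is an algebra map between the braided tensor
  squares. Hence both composites to be compared are algebra maps out of T(V), and they agree on
  primitive generators.\<close>

lemma universal_bialg:
 assumes B: "br_bialg K B" and f: "lin K V B f" and fc: "\<And>t. t \<in> tp V 2 ==> braiding B (Tm V B f t) = Tm V B f (cV t)"
  and h: "alg_hom K A B h" and hf: "\<And>v. v \<in> carrier V ==> h (iv v) = f v"
  and fp: "\<And>v. v \<in> carrier V ==> f v \<in> prims K B" and fe: "\<And>v. v \<in> carrier V ==> counit B (f v) = \<zero>\<^bsub>K\<^esub>"
  and a: "a \<in> carrier A"
 shows "comult B (h a) = Tm A B h (comult BT a)" "counit B (h a) = counit BT a"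
proof -
 interpret B: br_bialg K B by (rule B)
 note hl = alg_hom_lin[OF h]
 let ?H = "Tm A B h"
 note H_lin = Tm_lin[OF modA B.modA hl] and H_mult = Tm_mult[OF modA B.modA hl]
  and H_j = Tm_iota[OF modA B.modA hl] and H_cl [simp] = Tm_cl[OF modA B.modA hl]
 note HM = Tm_M[OF alg B.alg h]
 note HC = universal_braided[OF B.br_alg_axioms f fc h hf]
 have h1: "h \<one>\<^bsub>A\<^esub> = \<one>\<^bsub>B\<^esub>" by (rule alg_hom_one[OF h])
 have h_cl [simp]: "h x \<in> carrier B" if "x \<in> carrier A" for x using lin_cl[OF hl that] .
 have dl: "lin K B B.A2 (comult B)" using B.comult_lin unfolding lin_def by (simp add: B.A2_sel)
 have d: "alg_hom K B B.A2 (comult B)"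
  by (rule alg_homI[OF dl])
   (auto simp: B.A2_sel B.comult_one B.comult_mult B.A2_mult[OF B.comult_tp B.comult_tp])
 have "lin K A2 B.A2 ?H"
  using Tm_tp_lin[OF modA B.modA hl, of 2] unfolding lin_def by (simp add: A2_sel B.A2_sel)
 then have Hd: "alg_hom K A2 B.A2 ?H"
  by (rule alg_homI)
   (auto simp: A2_sel B.A2_sel A2_mult B.A2_mult Tm_tp[OF modA B.modA hl] wsp_cl_tp[OF modA] HM HC H_mult H_j h1)
 have "(comult B \<circ> h) a = (?H \<circ> tensor_comult K V cV) a"
 proof (rule alg_hom_pt_eq[OF modV B.A2_alg alg_hom_comp[OF h d] alg_hom_comp[OF tensor_comult(1) Hd] _ a])
  fix v assume v: "v \<in> carrier V"
  then show "(comult B \<circ> h) (iv v) = (?H \<circ> tensor_comult K V cV) (iv v)"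
   using fp[OF v] hf[OF v] by (simp add: tensor_comult(2) lin_add[OF H_lin] H_mult H_j h1 prims_def)
 qed
 then show "comult B (h a) = ?H (comult BT a)" by simp
 have "lin K B (ground K) (counit B)" by (rule B.counit_lin)
 then have "alg_hom K B (ground K) (counit B)"
  by (rule alg_homI) (auto simp: ground_def B.counit_mult B.counit_one)
 from alg_hom_pt_eq[OF modV alg_ground alg_hom_comp[OF h this] tensor_counit(1) _ a]
 have "(counit B \<circ> h) a = tensor_counit K V a"
  using hf fe tensor_counit(2) by simp
 then show "counit B (h a) = counit BT a" by simp
qed

end

context fld begin

section \<open>Complements of subspaces\<close>

text \<open>A complement of \<open>H\<close> is a maximal subspace meeting \<open>H\<close>
  trivially, supplied by Zorn's lemma; the projection is along it. Kernels and images of tensor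
  products of maps are later handled entirely through such projections.\<close>

lemma subspace_projection:
 assumes M: "module K M" and H: "submodule H K M"
 shows "\<exists>q. lin K M M q \<and> (\<forall>x\<in>carrier M. q x \<in> H) \<and> (\<forall>x\<in>H. q x = x)"
proof -
 define AA where "AA = {N. submodule N K M \<and> N \<inter> H = {\<zero>\<^bsub>M\<^esub>}}"
 have Hc: "h \<in> carrier M" if "h \<in> H" for h using subm_subset[OF H] that by blast
 have z0: "\<zero>\<^bsub>M\<^esub> \<in> H" by (rule subm_zero[OF M H])
 have "submodule {\<zero>\<^bsub>M\<^esub>} K M" by (rule submI) (use M in auto)
 then have zAA: "{\<zero>\<^bsub>M\<^esub>} \<in> AA" using z0 by (auto simp: AA_def)
 have "\<exists>U\<in>AA. \<forall>X\<in>Ch. X \<subseteq> U" if ch: "subset.chain AA Ch" for Ch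
 proof (cases "Ch = {}")
  case True
  then show ?thesis using zAA by blast
 next
  case False
  have sub: "submodule X K M" "X \<inter> H = {\<zero>\<^bsub>M\<^esub>}" if "X \<in> Ch" for X
   using ch that unfolding subset.chain_def AA_def by auto
  have lin: "X \<subseteq> Y \<or> Y \<subseteq> X" if "X \<in> Ch" "Y \<in> Ch" for X Y
   using ch that unfolding subset.chain_def by blast
  have "submodule (\<Union>Ch) K M"
  proof (rule submI[OF M])
   show "\<Union>Ch \<subseteq> carrier M" using sub(1) subm_subset by blast
   show "\<zero>\<^bsub>M\<^esub> \<in> \<Union>Ch" using False sub(2) by blast
  next
   fix x y assume "x \<in> \<Union>Ch" "y \<in> \<Union>Ch"
   then obtain X where "X \<in> Ch" "x \<in> X" "y \<in> X" using lin by blast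
   then show "x +[M] y \<in> \<Union>Ch" using subm_add[OF M sub(1)] by blast
  next
   fix a x assume "a \<in> carrier K" "x \<in> \<Union>Ch"
   then show "a *:[M] x \<in> \<Union>Ch" using subm_smult[OF M sub(1)] by blast
  qed
  moreover have "\<Union>Ch \<inter> H = {\<zero>\<^bsub>M\<^esub>}" using sub(2) False by blast
  ultimately show ?thesis unfolding AA_def by blast
 qed
 from subset_Zorn[OF this] obtain N where N: "N \<in> AA" and max: "\<And>X. X \<in> AA ==> N \<subseteq> X ==> X = N" by blast
 have sN: "submodule N K M" and NH: "N \<inter> H = {\<zero>\<^bsub>M\<^esub>}" using N by (auto simp: AA_def)
 have Nc: "n \<in> carrier M" if "n \<in> N" for n using subm_subset[OF sN] that by blast
 have dec: "\<exists>h\<in>H. \<exists>n\<in>N. x = h +[M] n" if x: "x \<in> carrier M" for x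
 proof (rule ccontr)
  assume no: "\<not> ?thesis"
  \<comment> \<open>If \<open>x\<close> had no decomposition, adjoining the line through
    \<open>x\<close> to \<open>N\<close> would give a larger subspace that still meets
    \<open>H\<close> trivially.\<close>
  define N' where "N' = {n +[M] a *:[M] x |n a. n \<in> N \<and> a \<in> carrier K}"
  have "submodule N' K M"
  proof (rule submI[OF M])
   show "N' \<subseteq> carrier M" unfolding N'_def using M x Nc by auto
   have "\<zero>\<^bsub>M\<^esub> = \<zero>\<^bsub>M\<^esub> +[M] \<zero>\<^bsub>K\<^esub> *:[M] x" using M x by simp
   then show "\<zero>\<^bsub>M\<^esub> \<in> N'" unfolding N'_def using subm_zero[OF M sN] by blast
  next
   fix y z assume "y \<in> N'" "z \<in> N'"
   then obtain n a n' a' where *: "y = n +[M] a *:[M] x" "z = n' +[M] a' *:[M] x" "n \<in> N" "n' \<in> N" "a \<in> carrier K" "a' \<in> carrier K"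
    unfolding N'_def by blast
   have "y +[M] z = (n +[M] n') +[M] (a +[K] a') *:[M] x"
    using * M x Nc by (simp add: add_smult add_ac)
   then show "y +[M] z \<in> N'" unfolding N'_def using * subm_add[OF M sN] by blast
  next
   fix k y assume k: "k \<in> carrier K" and "y \<in> N'"
   then obtain n a where *: "y = n +[M] a *:[M] x" "n \<in> N" "a \<in> carrier K" unfolding N'_def by blast
   have "k *:[M] y = k *:[M] n +[M] (k \<cdot>[K] a) *:[M] x" using * M x Nc k by (simp add: smult_add smult_smult)
   then show "k *:[M] y \<in> N'" unfolding N'_def using * k subm_smult[OF M sN] by blast
  qed
  moreover have "N' \<inter> H \<subseteq> {\<zero>\<^bsub>M\<^esub>}"
  proof
   fix y assume "y \<in> N' \<inter> H"
   then obtain n a where *: "y = n +[M] a *:[M] x" "n \<in> N" "a \<in> carrier K" "y \<in> H" unfolding N'_def by blast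
   \<comment> \<open>A nonzero coefficient could be inverted, which would express \<open>x\<close>
     as a sum of elements of \<open>H\<close> and \<open>N\<close>. Division in \<open>K\<close>
     enters here.\<close>
   have a0: "a = \<zero>\<^bsub>K\<^esub>"
   proof (rule ccontr)
    assume "a \<noteq> \<zero>\<^bsub>K\<^esub>"
    then have i: "inv\<^bsub>K\<^esub> a \<in> carrier K" "inv\<^bsub>K\<^esub> a \<cdot>[K] a = \<one>\<^bsub>K\<^esub>" using *(3) field_Units by (auto simp: Units_inv_closed Units_l_inv)
    have "inv\<^bsub>K\<^esub> a *:[M] y = inv\<^bsub>K\<^esub> a *:[M] n +[M] x" using * M x Nc i by (simp add: smult_add smult_smult)
    then have "x = inv\<^bsub>K\<^esub> a *:[M] y +[M] \<ominus>\<^bsub>M\<^esub> (inv\<^bsub>K\<^esub> a *:[M] n)"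
     using M x Nc * i by (simp add: add_ac)
    moreover have "inv\<^bsub>K\<^esub> a *:[M] y \<in> H" "\<ominus>\<^bsub>M\<^esub> (inv\<^bsub>K\<^esub> a *:[M] n) \<in> N"
     using * i subm_smult[OF M H] subm_smult[OF M sN] subm_neg[OF M sN] by auto
    ultimately show False using no by blast
   qed
   then have "y = n" using * M x Nc by simp
   then show "y \<in> {\<zero>\<^bsub>M\<^esub>}" using * NH by blast
  qed
  moreover have "N \<subseteq> N'"
  proof
   fix n assume n: "n \<in> N"
   then have "n = n +[M] \<zero>\<^bsub>K\<^esub> *:[M] x" using M x Nc by simp
   then show "n \<in> N'" unfolding N'_def using n by blast
  qed
  ultimately have "N' = N" using max[of N'] z0 subm_zero[OF M] unfolding AA_def by blast
  moreover have "x \<in> N'"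
  proof -
   have "x = \<zero>\<^bsub>M\<^esub> +[M] \<one>\<^bsub>K\<^esub> *:[M] x" using M x by simp
   then show ?thesis unfolding N'_def using subm_zero[OF M sN] by blast
  qed
  moreover have "x = \<zero>\<^bsub>M\<^esub> +[M] x" using M x by simp
  ultimately show False using no z0 by blast
 qed
 have uniq: "h = h'" if "h \<in> H" "h' \<in> H" "n \<in> N" "n' \<in> N" "h +[M] n = h' +[M] n'" for h h' n n'
 proof -
  have c: "h \<in> carrier M" "h' \<in> carrier M" "n \<in> carrier M" "n' \<in> carrier M" using that Hc Nc by auto
  have "\<ominus>\<^bsub>M\<^esub> h' +[M] ((h +[M] n) +[M] \<ominus>\<^bsub>M\<^esub> n) = \<ominus>\<^bsub>M\<^esub> h' +[M] ((h' +[M] n') +[M] \<ominus>\<^bsub>M\<^esub> n)" using that(5) by simp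
  also have "\<ominus>\<^bsub>M\<^esub> h' +[M] ((h +[M] n) +[M] \<ominus>\<^bsub>M\<^esub> n) = \<ominus>\<^bsub>M\<^esub> h' +[M] h" using M c by (simp add: add_assoc)
  also have "\<ominus>\<^bsub>M\<^esub> h' +[M] ((h' +[M] n') +[M] \<ominus>\<^bsub>M\<^esub> n) = n' +[M] \<ominus>\<^bsub>M\<^esub> n" using M c by (simp add: add_assoc[symmetric])
  finally have "\<ominus>\<^bsub>M\<^esub> h' +[M] h \<in> N \<inter> H"
   using subm_add[OF M sN that(4) subm_neg[OF M sN that(3)]] subm_add[OF M H subm_neg[OF M H that(2)] that(1)] by simp
  then have "h \<ominus>\<^bsub>M\<^esub> h' = \<zero>\<^bsub>M\<^esub>" using NH M c by (simp add: a_minus_def add_comm)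
  then show ?thesis using minus_eq_zero_iff[OF M] c by simp
 qed
 define q where "q x = (SOME h. h \<in> H \<and> (\<exists>n\<in>N. x = h +[M] n))" for x
 have q: "q x \<in> H \<and> (\<exists>n\<in>N. x = q x +[M] n)" if x: "x \<in> carrier M" for x
 proof -
  have "\<exists>h. h \<in> H \<and> (\<exists>n\<in>N. x = h +[M] n)" using dec[OF x] by blast
  from someI_ex[OF this] show ?thesis unfolding q_def .
 qed
 have qeq: "q (h +[M] n) = h" if "h \<in> H" "n \<in> N" for h n
 proof -
  have "h +[M] n \<in> carrier M" using that Hc Nc M by simp
  from q[OF this] obtain n' where "q (h +[M] n) \<in> H" "n' \<in> N" "h +[M] n = q (h +[M] n) +[M] n'" by blast
  then show ?thesis using uniq[of "q (h +[M] n)" h n' n] that by simp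
 qed
 have "lin K M M q"
 proof (rule linI)
  fix x assume x: "x \<in> carrier M"
  then show "q x \<in> carrier M" using q Hc by blast
  obtain n where n: "n \<in> N" "x = q x +[M] n" using q x by blast
  have xc: "q x \<in> carrier M" "q x \<in> H" using q x Hc by blast+
  {
   fix y assume y: "y \<in> carrier M"
   obtain m where m: "m \<in> N" "y = q y +[M] m" using q y by blast
   have yc: "q y \<in> carrier M" "q y \<in> H" using q y Hc by blast+
   have "x +[M] y = (q x +[M] n) +[M] (q y +[M] m)" using n(2) m(2) by simp
   also have "\<dots> = (q x +[M] q y) +[M] (n +[M] m)" using xc yc n(1) m(1) Nc M by (simp add: add_ac)
   finally show "q (x +[M] y) = q x +[M] q y"
    by (simp only: qeq[OF subm_add[OF M H xc(2) yc(2)] subm_add[OF M sN n(1) m(1)]])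
  }
  fix a assume a: "a \<in> carrier K"
  have "a *:[M] x = a *:[M] (q x +[M] n)" using n(2) by simp
  also have "\<dots> = a *:[M] q x +[M] a *:[M] n" using xc n(1) Nc M a by (simp add: smult_add)
  finally show "q (a *:[M] x) = a *:[M] q x"
   by (simp only: qeq[OF subm_smult[OF M H a xc(2)] subm_smult[OF M sN a n(1)]])
 qed
 moreover have "q x = x" if "x \<in> H" for x using qeq[OF that subm_zero[OF M sN]] that Hc M by simp
 ultimately show ?thesis using q by blast
qed

text \<open>\<open>induced\<close> evaluates \<open>f\<close> at an arbitrary preimage, so
  independence of the preimage is exactly what is required.\<close>

lemma induced_eq: assumes "x \<in> S" "\<And>y. y \<in> S ==> p y = p x ==> f y = f x" shows "induced S p f (p x) = f x"
proof -
 have "p x \<in> p ` S" using assms(1) by blast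
 then have "inv_into S p (p x) \<in> S" "p (inv_into S p (p x)) = p x" by (rule inv_into_into, rule f_inv_into_f)
 from assms(2)[OF this] show ?thesis unfolding induced_def comp_def .
qed

lemma lin_surj:
 assumes M: "module K M" and p: "lin K M N p" "p ` carrier M = carrier N" and f: "lin K M L f" and g: "\<And>x. x \<in> carrier M ==> g (p x) = f x"
 shows "lin K N L g"
proof (rule linI)
 fix x assume "x \<in> carrier N"
 then obtain x' where x: "x' \<in> carrier M" "x = p x'" using p(2) by blast
 show "g x \<in> carrier L" using x g lin_cl[OF f] by simp
 show "g (x +[N] y) = g x +[L] g y" if "y \<in> carrier N" for y
 proof -
  obtain y' where y: "y' \<in> carrier M" "y = p y'" using p(2) \<open>y \<in> _\<close> by blast
  then show ?thesis using x M lin_add[OF p(1), of x' y', symmetric] lin_add[OF f, of x' y'] g by simp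
 qed
 show "g (a *:[N] x) = a *:[L] g x" if "a \<in> carrier K" for a
  using x M that lin_smult[OF p(1), of a x', symmetric] lin_smult[OF f, of a x'] g by simp
qed

section \<open>Quotients of braided bialgebras\<close>

lemma same_Tm:
 assumes "carrier W = carrier V" "ring.add W = ring.add V" "smult W = smult V"
 shows "Tm U W f = Tm U V f"
 unfolding Tm_def by (simp add: same_tensor[OF assms])

text \<open>The axioms are identities between operators, T(p) intertwines the operators on both
  sides and is surjective in every degree, so each axiom descends.\<close>

lemma br_alg_surj:
 assumes B: "br_alg K B c" and Q: "assoc_algebra K Q" and p: "alg_hom K B Q p" "p ` carrier B = carrier Q"
  and c': "lop Q 2 2 c'" and cc: "\<And>t. t \<in> tp B 2 ==> Tm B Q p (c t) = c' (Tm B Q p t)"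
 shows "br_alg K Q c'"
proof -
 interpret B: br_alg K B c by (rule B)
 interpret Q: pre_br K Q c' by unfold_locales (use Q c' in auto)
 note pl = alg_hom_lin[OF p(1)]
 let ?T = "Tm B Q p"
 note Tl = Tm_cl[OF B.modA Q.modA pl] and Tj = Tm_iota[OF B.modA Q.modA pl] and Tmu = Tm_mult[OF B.modA Q.modA pl]
 have TC: "?T (B.C i t) = Q.C i (?T t)" if "t \<in> carrier (T B)" for i t
  by (rule Tm_sh[OF B.modA Q.modA pl B.lopC c' cc that])
 note TM = Tm_M[OF B.alg Q p(1)]
 have surj: "\<exists>t'\<in>tp B n. t = ?T t'" if "t \<in> tp Q n" for n t
  using Tm_surj[OF B.modA Q.modA pl p(2), of t "{n}"] that unfolding tpow_wsp by blast
 have p1: "p \<one>\<^bsub>B\<^esub> = \<one>\<^bsub>Q\<^esub>" by (rule alg_hom_one[OF p(1)])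
 show ?thesis
 proof
  fix t assume "t \<in> tp Q 3"
  then obtain s where s: "s \<in> tp B 3" "t = ?T s" using surj by blast
  have sc: "s \<in> carrier (T B)" by (rule wsp_cl_tp[OF B.modA s(1)])
  show "Q.C 0 (Q.C 1 (Q.C 0 t)) = Q.C 1 (Q.C 0 (Q.C 1 t))"
   using B.braid0[OF s(1)] sc unfolding s(2) by (simp add: TC[symmetric])
  show "Q.C 0 (Q.M 0 t) = Q.M 1 (Q.C 0 (Q.C 1 t))"
   using B.CM0[OF s(1)] sc unfolding s(2) by (simp add: TC[symmetric] TM[symmetric])
  show "Q.C 0 (Q.M 1 t) = Q.M 0 (Q.C 1 (Q.C 0 t))"
   using B.CM1[OF s(1)] sc unfolding s(2) by (simp add: TC[symmetric] TM[symmetric])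
 next
  fix x assume "x \<in> carrier Q"
  then obtain y where y: "y \<in> carrier B" "x = p y" using p(2) by blast
  show "c' (Q.e *[Q] Q.j x) = Q.j x *[Q] Q.e" "c' (Q.j x *[Q] Q.e) = Q.e *[Q] Q.j x"
   using cc[of "B.e *[B] B.j y"] cc[of "B.j y *[B] B.e"] B.CU0[OF y(1)] B.CU1[OF y(1)] y by (simp_all add: Tmu Tj p1)
 qed
qed

lemma br_bialg_surj:
 assumes B: "br_bialg K B" and Q: "br_alg K Q (braiding Q)" and p: "alg_hom K B Q p" "p ` carrier B = carrier Q"
  and cc: "\<And>t. t \<in> tp B 2 ==> Tm B Q p (braiding B t) = braiding Q (Tm B Q p t)"
  and dd: "\<And>x. x \<in> carrier B ==> comult Q (p x) = Tm B Q p (comult B x)"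
  and ee: "\<And>x. x \<in> carrier B ==> counit Q (p x) = counit B x"
 shows "br_bialg K Q"
proof -
 interpret B: br_bialg K B by (rule B)
 interpret Q: br_alg K Q "braiding Q" by (rule Q)
 note pl = alg_hom_lin[OF p(1)]
 let ?T = "Tm B Q p"
 note Tl = Tm_cl[OF B.modA Q.modA pl] and Tj = Tm_iota[OF B.modA Q.modA pl] and Tmu = Tm_mult[OF B.modA Q.modA pl]
 have TC: "?T (B.C i t) = Q.C i (?T t)" if "t \<in> carrier (T B)" for i t
  by (rule Tm_sh[OF B.modA Q.modA pl B.lopC Q.lopC cc that])
 note TM = Tm_M[OF B.alg Q.alg p(1)]
 have surj: "\<exists>t'\<in>tp B n. t = ?T t'" if "t \<in> tp Q n" for n t
  using Tm_surj[OF B.modA Q.modA pl p(2), of t "{n}"] that unfolding tpow_wsp by blast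
 have p1: "p \<one>\<^bsub>B\<^esub> = \<one>\<^bsub>Q\<^esub>" by (rule alg_hom_one[OF p(1)])
 have dl: "lin K Q (tpm1 Q 2) (comult Q)"
  by (rule lin_surj[OF B.modA pl p(2) lin_comp'[OF B.comult_lin Tm_tp_lin[OF B.modA Q.modA pl]] dd])
 have el: "lin K Q (ground K) (counit Q)"
  by (rule lin_surj[OF B.modA pl p(2) B.counit_lin ee])
 interpret Qo: bialg_op K Q by unfold_locales (use dl el in auto)
 have TD: "?T (B.D i t) = Qo.D i (?T t)" if "t \<in> carrier (T B)" for i t
 proof (rule Tm_sh[OF B.modA Q.modA pl B.lopD Qo.lopD _ that])
  fix t assume "t \<in> tp B (Suc 0)"
  then obtain x where "x \<in> carrier B" "t = B.j x" using tp1E[OF B.modA, of t] by auto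
  then show "?T (comultT K B t) = comultT K Q (?T t)" using dd lin_cl[OF pl] by (simp add: B.comultT Qo.comultT Tj)
 qed
 have TE: "?T (B.E i t) = Qo.E i (?T t)" if "t \<in> carrier (T B)" for i t
 proof (rule Tm_sh[OF B.modA Q.modA pl B.lopE Qo.lopE _ that])
  fix t assume "t \<in> tp B (Suc 0)"
  then obtain x where "x \<in> carrier B" "t = B.j x" using tp1E[OF B.modA, of t] by auto
  then show "?T (counitT K B t) = counitT K Q (?T t)"
   using ee lin_cl[OF pl] by (simp add: B.counitT Qo.counitT Tj lin_smult[OF Tm_lin[OF B.modA Q.modA pl]] Tm_one[OF B.modA Q.modA pl])
 qed
 show ?thesis
 proof
  fix x y assume "x \<in> carrier Q" "y \<in> carrier Q"
  then obtain x' y' where x: "x' \<in> carrier B" "x = p x'" and y: "y' \<in> carrier B" "y = p y'" using p(2) by blast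
  have xy: "x \<cdot>[Q] y = p (x' \<cdot>[B] y')" using alg_hom_mult[OF p(1)] x y by simp
  show "comult Q (x \<cdot>[Q] y) = Q.M 0 (Q.M 2 (Q.C 1 (comult Q x *[Q] comult Q y)))"
   unfolding xy unfolding x(2) y(2) using x(1) y(1) B.comult_mult dd by (simp add: TC TM Tmu)
  show "counit Q (x \<cdot>[Q] y) = counit Q x \<cdot>[K] counit Q y"
   unfolding xy unfolding x(2) y(2) using x(1) y(1) B.counit_mult ee by simp
 next
  show "comult Q \<one>\<^bsub>Q\<^esub> = Q.e *[Q] Q.e" using dd[of "\<one>\<^bsub>B\<^esub>"] B.comult_one by (simp add: p1 Tmu Tj)
  show "counit Q \<one>\<^bsub>Q\<^esub> = \<one>\<^bsub>K\<^esub>" using ee[of "\<one>\<^bsub>B\<^esub>"] B.counit_one by (simp add: p1)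
 next
  fix x assume "x \<in> carrier Q"
  then obtain x' where x: "x' \<in> carrier B" "x = p x'" using p(2) by blast
  show "Qo.D 0 (comult Q x) = Qo.D 1 (comult Q x)" "Qo.E 0 (comult Q x) = Q.j x" "Qo.E 1 (comult Q x) = Q.j x"
   unfolding x(2) using x(1) B.DD0[OF x(1)] B.ED0[OF x(1)] B.ED1[OF x(1)] dd by (simp_all add: TD[symmetric] TE[symmetric] Tj)
 next
  fix t assume "t \<in> tp Q 2"
  then obtain s where s: "s \<in> tp B 2" "t = ?T s" using surj by blast
  have sc: "s \<in> carrier (T B)" by (rule wsp_cl_tp[OF B.modA s(1)])
  show "Qo.D 0 (Q.C 0 t) = Q.C 1 (Q.C 0 (Qo.D 1 t))" "Qo.D 1 (Q.C 0 t) = Q.C 0 (Q.C 1 (Qo.D 0 t))"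
   "Qo.E 0 (Q.C 0 t) = Qo.E 1 t" "Qo.E 1 (Q.C 0 t) = Qo.E 0 t"
   using B.DC0[OF s(1)] B.DC1[OF s(1)] B.EC0[OF s(1)] B.EC1[OF s(1)] sc unfolding s(2)
   by (simp_all add: TC[symmetric] TD[symmetric] TE[symmetric])
 qed
qed

end

section \<open>Maps acting on one tensor factor, and quotients of braided algebras\<close>

context alg_op begin

abbreviation "Fa g i \<equiv> sh A i (Suc 0) (deg1 K A A g)"

lemma lopF: "lin K A A g ==> lop A (Suc 0) (Suc 0) (deg1 K A A g)"
 using deg1_lop[OF modA, of g] by simp

lemma F_lin: "lin K A A g ==> lin K TA TA (Fa g i)"
 by (rule sh_lin[OF modA lopF])

lemma F_cl [simp]: "lin K A A g ==> t \<in> carrier TA ==> Fa g i t \<in> carrier TA"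
 by (rule sh_cl[OF modA lopF])

lemma F_tp: "lin K A A g ==> t \<in> tp A n ==> Fa g i t \<in> tp A n"
 by (rule sh_tp[OF modA lopF]) auto

lemma F_mult: assumes "lin K A A g" "x \<in> carrier A" "t \<in> carrier TA" shows "Fa g 0 (j x * t) = j (g x) * t"
 using sh_mid[OF modA lopF[OF assms(1)], of "\<one>\<^bsub>TA\<^esub>" 0 "j x" t] assms iota_tp(1)[OF modA assms(2)] lin_cl[OF assms(1,2)]
 by (simp add: deg1_iota[OF modA])

lemma F_j: "lin K A A g ==> x \<in> carrier A ==> Fa g 0 (j x) = j (g x)"
 using F_mult[of g x "\<one>\<^bsub>TA\<^esub>"] lin_cl[of A A g x] by simp

lemma F_pure: assumes "lin K A A g" "x \<in> carrier A" "y \<in> carrier A"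
 shows "Fa g 0 (j x * j y) = j (g x) * j y" "Fa g (Suc 0) (j x * j y) = j x * j (g y)"
 using assms at_rules[OF lopF[OF assms(1)]] by (simp_all add: F_mult F_j)

lemma F_pure3: assumes "lin K A A g" "x \<in> carrier A" "y \<in> carrier A" "z \<in> carrier A"
 shows "Fa g 0 (j x * (j y * j z)) = j (g x) * (j y * j z)" "Fa g (Suc 0) (j x * (j y * j z)) = j x * (j (g y) * j z)"
  "Fa g 2 (j x * (j y * j z)) = j x * (j y * j (g z))"
 using assms at_rules[OF lopF[OF assms(1)]] by (simp_all add: F_mult F_j)

lemma tp3_eqI:
 assumes t: "t \<in> tp A 3" and f: "lin K TA TA f" and g: "lin K TA TA g"
  and eq: "\<And>x y z. x \<in> carrier A ==> y \<in> carrier A ==> z \<in> carrier A ==> f (j x * (j y * j z)) = g (j x * (j y * j z))"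
 shows "f t = g t"
proof (rule tp_lin_eq[OF t modA])
 show "lin K (tpm1 A 3) TA f" "lin K (tpm1 A 3) TA g" by (rule lin_sub[OF f] lin_sub[OF g], use wsp_cl_tp[OF modA] in auto)+
 fix w assume "w \<in> lists (carrier A)" "length w = 3"
 then obtain x y z where "w = [x, y, z]" "x \<in> carrier A" "y \<in> carrier A" "z \<in> carrier A"
  by (auto simp: numeral_3_eq_3 length_Suc_conv)
 then show "f (pt A w) = g (pt A w)" using eq by (simp add: pt_Cons)
qed simp

lemma F_zero: assumes g: "lin K A A g" "\<And>x. x \<in> carrier A ==> g x = \<zero>\<^bsub>A\<^esub>" and t: "t \<in> tp A 2" and i: "i < 2"
 shows "Fa g i t = \<zero>\<^bsub>TA\<^esub>"
proof (rule tp2_eqI[OF t F_lin[OF g(1)] lin_const_zero])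
 fix x y assume "x \<in> carrier A" "y \<in> carrier A"
 moreover have "j \<zero>\<^bsub>A\<^esub> = \<zero>\<^bsub>TA\<^esub>" by (rule lin_zero[OF iota_lin]) simp_all
 ultimately have "Fa g 0 (j x * j y) = \<zero>\<^bsub>TA\<^esub>" "Fa g (Suc 0) (j x * j y) = \<zero>\<^bsub>TA\<^esub>"
  using F_pure[OF g(1), of x y] g(2)[of x] g(2)[of y] by simp_all
 then show "Fa g i (j x * j y) = \<zero>\<^bsub>TA\<^esub>" using i by (cases i) simp_all
qed simp

lemma F_comp: assumes g: "lin K A A g" and h: "lin K A A h" and t: "t \<in> tp A 2" and i: "i < 2"
 shows "Fa g i (Fa h i t) = Fa (%x. g (h x)) i t"
proof (rule tp2_eqI[OF t])
 show "lin K TA TA (%t. Fa g i (Fa h i t))" by (rule lin_comp'[OF F_lin[OF h] F_lin[OF g]])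
 show "lin K TA TA (Fa (%x. g (h x)) i)" by (rule F_lin[OF lin_comp'[OF h g]])
 fix x y assume "x \<in> carrier A" "y \<in> carrier A"
 then have "x \<in> carrier A" "y \<in> carrier A" "h x \<in> carrier A" "h y \<in> carrier A" using lin_cl[OF h] by blast+
 then have "Fa g 0 (Fa h 0 (j x * j y)) = Fa (%x. g (h x)) 0 (j x * j y)"
   "Fa g (Suc 0) (Fa h (Suc 0) (j x * j y)) = Fa (%x. g (h x)) (Suc 0) (j x * j y)"
  using F_pure[OF h, of x y] F_pure[OF g, of "h x" y] F_pure[OF g, of x "h y"] F_pure[OF lin_comp'[OF h g], of x y] by simp_all
 then show "Fa g i (Fa h i (j x * j y)) = Fa (%x. g (h x)) i (j x * j y)" using i by (cases i) simp_all
qed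

end

text \<open>The hypotheses say that \<open>\<pi>\<close> has kernel the ideal J generated by
  \<open>S\<close> and picks a representative of each class linearly. A tensor lies in A \<otimes> J
  or J \<otimes> A when \<open>\<pi>\<close> at position 1 or 0 kills it; thus \<open>S0\<close> and
  \<open>S1\<close> express that c maps S \<otimes> A into A \<otimes> J and A \<otimes> S into J
  \<otimes> A.\<close>

locale br_ideal = br_alg K A c for K :: "('k, 'z) ring_scheme" and A :: "('k, 'a, 'm) module_scheme" and c +
 fixes S \<pi>
 assumes S: "S \<subseteq> carrier A" and \<pi>_lin: "lin K A A \<pi>"
  and \<pi>_zero: "x \<in> genideal A S ==> \<pi> x = \<zero>\<^bsub>A\<^esub>" and \<pi>_diff: "x \<in> carrier A ==> x \<ominus>\<^bsub>A\<^esub> \<pi> x \<in> genideal A S"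
  and S0: "x \<in> S ==> y \<in> carrier A ==> Fa \<pi> (Suc 0) (c (j x * j y)) = \<zero>\<^bsub>TA\<^esub>"
  and S1: "x \<in> S ==> y \<in> carrier A ==> Fa \<pi> 0 (c (j y * j x)) = \<zero>\<^bsub>TA\<^esub>"
begin

abbreviation "J \<equiv> genideal A S"
abbreviation "R i \<equiv> Fa \<pi> i"

lemma idJ: "ideal J A" by (rule gen_ideal[OF alg S])
lemmas R_lin = F_lin[OF \<pi>_lin]
lemma \<pi>_cl [simp]: "x \<in> carrier A ==> \<pi> x \<in> carrier A" by (rule lin_cl[OF \<pi>_lin])

lemma \<pi>_eq: assumes "x \<in> carrier A" "y \<in> carrier A" "x \<ominus>\<^bsub>A\<^esub> y \<in> J" shows "\<pi> x = \<pi> y"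
 using \<pi>_zero[OF assms(3)] assms(1,2) minus_eq_zero_iff[of A "\<pi> x" "\<pi> y"] by (simp add: lin_minus[OF \<pi>_lin])

lemma \<pi>_mult: assumes "x \<in> carrier A" "y \<in> carrier A"
 shows "\<pi> (\<pi> x \<cdot>[A] y) = \<pi> (x \<cdot>[A] y)" "\<pi> (x \<cdot>[A] \<pi> y) = \<pi> (x \<cdot>[A] y)"
proof -
 have "(x \<ominus>\<^bsub>A\<^esub> \<pi> x) \<cdot>[A] y \<in> J" "x \<cdot>[A] (y \<ominus>\<^bsub>A\<^esub> \<pi> y) \<in> J"
  using assms ideal.I_r_closed[OF idJ \<pi>_diff] ideal.I_l_closed[OF idJ \<pi>_diff] by auto
 moreover have "(x \<ominus>\<^bsub>A\<^esub> \<pi> x) \<cdot>[A] y = x \<cdot>[A] y \<ominus>\<^bsub>A\<^esub> \<pi> x \<cdot>[A] y" "x \<cdot>[A] (y \<ominus>\<^bsub>A\<^esub> \<pi> y) = x \<cdot>[A] y \<ominus>\<^bsub>A\<^esub> x \<cdot>[A] \<pi> y"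
  using assms by (simp_all add: a_minus_def add_mult mult_add neg_mult)
 ultimately show "\<pi> (\<pi> x \<cdot>[A] y) = \<pi> (x \<cdot>[A] y)" "\<pi> (x \<cdot>[A] \<pi> y) = \<pi> (x \<cdot>[A] y)"
  using assms \<pi>_eq[of "x \<cdot>[A] y" "\<pi> x \<cdot>[A] y"] \<pi>_eq[of "x \<cdot>[A] y" "x \<cdot>[A] \<pi> y"] by simp_all
qed

text \<open>Because J is a two-sided ideal, \<open>\<pi>\<close> after a multiplication does not
  notice whether \<open>\<pi>\<close> was already applied to one of the two arguments.\<close>

lemma RM: assumes t: "t \<in> tp A 3"
 shows "R 1 (M 1 t) = R 1 (M 1 (R 1 t))" "R 1 (M 1 t) = R 1 (M 1 (R 2 t))"
  "R 0 (M 0 t) = R 0 (M 0 (R 0 t))" "R 0 (M 0 t) = R 0 (M 0 (R 1 t))"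
proof -
 have l: "lin K TA TA (%t. R i (M k t))" "lin K TA TA (%t. R i (M k (R l t)))" for i k l
  by (rule lin_comp'[OF M_lin R_lin], rule lin_comp'[OF R_lin lin_comp'[OF M_lin R_lin]])
 note eq = \<pi>_mult F_pure3[OF \<pi>_lin] F_pure[OF \<pi>_lin] M_mult M_mult' ats
 show "R 1 (M 1 t) = R 1 (M 1 (R 1 t))" by (rule tp3_eqI[OF t l]) (simp add: eq)
 show "R 1 (M 1 t) = R 1 (M 1 (R 2 t))" by (rule tp3_eqI[OF t l]) (simp add: eq)
 show "R 0 (M 0 t) = R 0 (M 0 (R 0 t))" by (rule tp3_eqI[OF t l]) (simp add: eq F_mult[OF \<pi>_lin])
 show "R 0 (M 0 t) = R 0 (M 0 (R 1 t))" by (rule tp3_eqI[OF t l]) (simp add: eq F_mult[OF \<pi>_lin])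
qed

lemma pure_cl [simp]: "x \<in> carrier A ==> y \<in> carrier A ==> C i (j x * j y) \<in> tp A 2"
 by (rule C_tp) simp

lemma c_pure: "x \<in> carrier A ==> y \<in> carrier A ==> c (j x * j y) = C 0 (j x * j y)"
 by (rule C_base[symmetric]) simp

lemma zero_subm:
 assumes "\<And>y. y \<in> carrier A ==> lin K A TA (%x. f x y)"
 shows "submodule {x \<in> carrier A. \<forall>y\<in>carrier A. f x y = \<zero>\<^bsub>TA\<^esub>} K A"
 by (rule submI) (use assms in \<open>auto simp: lin_add[OF assms] lin_smult[OF assms] lin_zero[OF assms]\<close>)

lemma RF_zero: assumes z: "R i s = \<zero>\<^bsub>TA\<^esub>" and x: "x \<in> carrier A" and s: "s \<in> carrier TA"
 shows "R (Suc i) (j x * s) = \<zero>\<^bsub>TA\<^esub>"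
 using sh_Suc[OF lopF[OF \<pi>_lin] x s, of i] z x by simp

text \<open>The elements x such that c maps x \<otimes> A into A \<otimes> J form a two-sided ideal,
  by the product rules of the braiding. It contains the generators, hence all of J.\<close>

lemma C_J0: assumes x: "x \<in> J" and y: "y \<in> carrier A" shows "R 1 (C 0 (j x * j y)) = \<zero>\<^bsub>TA\<^esub>"
proof -
 let ?H = "{x \<in> carrier A. \<forall>y\<in>carrier A. R 1 (C 0 (j x * j y)) = \<zero>\<^bsub>TA\<^esub>}"
 have "ideal ?H A"
 proof (rule idealI'[OF alg])
  show "submodule ?H K A"
   by (rule zero_subm) (auto intro!: lin_comp'[OF lin_comp'[OF _ C_lin] R_lin] lin_mult_right iota_lin)
  fix x a assume x: "x \<in> ?H" and a: "a \<in> carrier A"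
  then have xc: "x \<in> carrier A" by simp
  have "R 1 (C 0 (j (a \<cdot>[A] x) * j y)) = \<zero>\<^bsub>TA\<^esub> \<and> R 1 (C 0 (j (x \<cdot>[A] a) * j y)) = \<zero>\<^bsub>TA\<^esub>" if y: "y \<in> carrier A" for y
  proof
   have tp3: "j u * s \<in> tp A 3" if "u \<in> carrier A" "s \<in> tp A 2" for u s
    by (rule iota_mult_tp[where n = 2]) (use that in simp_all)
   define s where "s = C 0 (j x * j y)"
   have s: "s \<in> tp A 2" unfolding s_def using xc y by simp
   have sc: "s \<in> carrier TA" by (rule wsp_cl_tp[OF modA s])
   have Rs: "R 1 s = \<zero>\<^bsub>TA\<^esub>" unfolding s_def using x y by blast
   have q: "j a * (j x * j y) \<in> tp A 3" "j x * (j a * j y) \<in> tp A 3" using a xc y by (auto intro!: tp3)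
   have as: "j a * s \<in> tp A 3" using tp3[OF a s] .
   have "C 1 (j a * (j x * j y)) = j a * s" unfolding s_def using a xc y by (simp add: ats)
   then have "C 0 (j (a \<cdot>[A] x) * j y) = M 1 (C 0 (j a * s))" using CM0[OF q(1)] a xc y by (simp add: M_mult)
   then have "R 1 (C 0 (j (a \<cdot>[A] x) * j y)) = R 1 (M 1 (R 2 (C 0 (j a * s))))" using RM(2)[OF C_tp[OF as]] by simp
   also have "R 2 (C 0 (j a * s)) = C 0 (R 2 (j a * s))"
    by (rule C_far[OF lopF[OF \<pi>_lin], symmetric]) (use tp_tge[OF as, of 3] in \<open>simp_all add: numeral_3_eq_3[symmetric]\<close>)
   also have "R 2 (j a * s) = \<zero>\<^bsub>TA\<^esub>" using RF_zero[OF Rs a sc] by simp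
   finally show "R 1 (C 0 (j (a \<cdot>[A] x) * j y)) = \<zero>\<^bsub>TA\<^esub>"
    by (simp add: lin_zero[OF C_lin] lin_zero[OF M_lin] lin_zero[OF R_lin])
   have z: "R 1 (C 0 (j x * t)) = \<zero>\<^bsub>TA\<^esub>" if t: "t \<in> tp A 2" for t
   proof (rule tp2_eqI[OF t, where g = "%t. \<zero>\<^bsub>TA\<^esub>"])
    show "lin K TA TA (%t. R 1 (C 0 (j x * t)))"
     using xc by (auto intro!: lin_comp'[OF lin_comp'[OF _ C_lin] R_lin] lin_mult_left)
    fix u v assume uv: "u \<in> carrier A" "v \<in> carrier A"
    have jj: "j x * j u \<in> tge A 2" "C 0 (j x * j u) \<in> tge A 2" using tp_tge[of "j x * j u" A 2 2] xc uv by auto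
    have "C 0 (j x * (j u * j v)) = C 0 (j x * j u) * j v" using jj xc uv sh_right[OF modA lopC, of "j x * j u" 0 "j v"] by (simp add: Tassoc)
    moreover have "R 1 (C 0 (j x * j u) * j v) = R 1 (C 0 (j x * j u)) * j v" using sh_right[OF modA lopF[OF \<pi>_lin], of "C 0 (j x * j u)" 1 "j v"] jj uv by simp
    ultimately show "R 1 (C 0 (j x * (j u * j v))) = \<zero>\<^bsub>TA\<^esub>" using x uv by simp
   qed (auto intro: lin_const_zero)
   have "C 1 (j x * (j a * j y)) = j x * C 0 (j a * j y)" using a xc y by (simp add: ats)
   then have "C 0 (j (x \<cdot>[A] a) * j y) = M 1 (C 0 (j x * C 0 (j a * j y)))" using CM0[OF q(2)] a xc y by (simp add: M_mult)
   then have "R 1 (C 0 (j (x \<cdot>[A] a) * j y)) = R 1 (M 1 (R 1 (C 0 (j x * C 0 (j a * j y)))))"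
    using RM(1)[OF C_tp[OF tp3[OF xc pure_cl[OF a y]]]] a y by simp
   then show "R 1 (C 0 (j (x \<cdot>[A] a) * j y)) = \<zero>\<^bsub>TA\<^esub>"
    using z[OF pure_cl] a y by (simp add: lin_zero[OF M_lin] lin_zero[OF R_lin])
  qed
  then show "a \<cdot>[A] x \<in> ?H" "x \<cdot>[A] a \<in> ?H" using a xc by auto
 qed
 moreover have "S \<subseteq> ?H"
 proof
  fix x assume x: "x \<in> S"
  then have "x \<in> carrier A" using S by blast
  then show "x \<in> ?H" using S0[OF x] c_pure[of x] by simp
 qed
 ultimately have "J \<subseteq> ?H" using gen_ideal_min[OF alg] by blast
 then show ?thesis using x y by blast
qed

lemma C_J1: assumes x: "x \<in> J" and y: "y \<in> carrier A" shows "R 0 (C 0 (j y * j x)) = \<zero>\<^bsub>TA\<^esub>"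
proof -
 let ?H = "{x \<in> carrier A. \<forall>y\<in>carrier A. R 0 (C 0 (j y * j x)) = \<zero>\<^bsub>TA\<^esub>}"
 have "ideal ?H A"
 proof (rule idealI'[OF alg])
  show "submodule ?H K A"
   by (rule zero_subm) (auto intro!: lin_comp'[OF lin_comp'[OF _ C_lin] R_lin] lin_mult_left iota_lin)
  fix x a assume x: "x \<in> ?H" and a: "a \<in> carrier A"
  then have xc: "x \<in> carrier A" by simp
  have "R 0 (C 0 (j y * j (a \<cdot>[A] x))) = \<zero>\<^bsub>TA\<^esub> \<and> R 0 (C 0 (j y * j (x \<cdot>[A] a))) = \<zero>\<^bsub>TA\<^esub>" if y: "y \<in> carrier A" for y
  proof
   have tp3: "s * j u \<in> tp A 3" if "u \<in> carrier A" "s \<in> tp A 2" for u s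
    by (rule tp_mult[OF modA that(2) iota_tp(1)[OF modA that(1)]]) simp
   define s where "s = C 0 (j y * j x)"
   have s: "s \<in> tp A 2" unfolding s_def using xc y by simp
   have sc: "s \<in> carrier TA" by (rule wsp_cl_tp[OF modA s])
   have Rs: "R 0 s = \<zero>\<^bsub>TA\<^esub>" unfolding s_def using x y by blast
   have q: "(j y * j x) * j a \<in> tp A 3" "(j y * j a) * j x \<in> tp A 3" using a xc y by (auto intro!: tp3)
   have jj: "j y * j x \<in> tge A 2" "j y * j a \<in> tge A 2" using tp_tge[of "j y * j x" A 2 2] tp_tge[of "j y * j a" A 2 2] a xc y by auto
   have as: "s * j a \<in> tp A 3" using tp3[OF a s] .
   have R1C: "R 0 (C 1 t) = C 1 (R 0 t)" if t: "t \<in> tp A 3" for t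
    by (rule far[OF lopF[OF \<pi>_lin] lopC]) (use tp_tge[OF t, of 3] in \<open>simp_all add: numeral_3_eq_3[symmetric]\<close>)
   have "C 0 ((j y * j x) * j a) = s * j a" unfolding s_def using sh_right[OF modA lopC, of "j y * j x" 0 "j a"] jj a by simp
   moreover have "j y * j (x \<cdot>[A] a) = M 1 ((j y * j x) * j a)" using a xc y by (simp add: M_mult' ats Tassoc)
   ultimately have "C 0 (j y * j (x \<cdot>[A] a)) = M 0 (C 1 (s * j a))" using CM1[OF q(1)] by simp
   then have "R 0 (C 0 (j y * j (x \<cdot>[A] a))) = R 0 (M 0 (C 1 (R 0 (s * j a))))"
    using RM(3)[OF C_tp[OF as]] R1C[OF as] by simp
   also have "R 0 (s * j a) = R 0 s * j a" using sh_right[OF modA lopF[OF \<pi>_lin], of s 0 "j a"] tp_tge[OF s, of 1] a by simp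
   finally show "R 0 (C 0 (j y * j (x \<cdot>[A] a))) = \<zero>\<^bsub>TA\<^esub>"
    using Rs a by (simp add: lin_zero[OF C_lin] lin_zero[OF M_lin] lin_zero[OF R_lin])
   have z: "R 1 (C 1 (t * j x)) = \<zero>\<^bsub>TA\<^esub>" if t: "t \<in> tp A 2" for t
   proof (rule tp2_eqI[OF t, where g = "%t. \<zero>\<^bsub>TA\<^esub>"])
    show "lin K TA TA (%t. R 1 (C 1 (t * j x)))"
     using xc by (auto intro!: lin_comp'[OF lin_comp'[OF _ C_lin] R_lin] lin_mult_right)
    fix u v assume uv: "u \<in> carrier A" "v \<in> carrier A"
    have "C 1 ((j u * j v) * j x) = j u * C 0 (j v * j x)" using xc uv by (simp add: Tassoc ats)
    then show "R 1 (C 1 ((j u * j v) * j x)) = \<zero>\<^bsub>TA\<^esub>" using RF_zero[of 0 "C 0 (j v * j x)" u] x xc uv by simp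
   qed (auto intro: lin_const_zero)
   have "C 0 ((j y * j a) * j x) = C 0 (j y * j a) * j x" using sh_right[OF modA lopC, of "j y * j a" 0 "j x"] jj xc by simp
   moreover have "j y * j (a \<cdot>[A] x) = M 1 ((j y * j a) * j x)" using a xc y by (simp add: M_mult' ats Tassoc)
   ultimately have "C 0 (j y * j (a \<cdot>[A] x)) = M 0 (C 1 (C 0 (j y * j a) * j x))" using CM1[OF q(2)] by simp
   then have "R 0 (C 0 (j y * j (a \<cdot>[A] x))) = R 0 (M 0 (R 1 (C 1 (C 0 (j y * j a) * j x))))"
    using RM(4)[OF C_tp[OF tp3[OF xc pure_cl[OF y a]]]] a y by simp
   then show "R 0 (C 0 (j y * j (a \<cdot>[A] x))) = \<zero>\<^bsub>TA\<^esub>"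
    using z[OF pure_cl] a y by (simp add: lin_zero[OF M_lin] lin_zero[OF R_lin])
  qed
  then show "a \<cdot>[A] x \<in> ?H" "x \<cdot>[A] a \<in> ?H" using a xc by auto
 qed
 moreover have "S \<subseteq> ?H"
 proof
  fix x assume x: "x \<in> S"
  then have "x \<in> carrier A" using S by blast
  then show "x \<in> ?H" using S1[OF x] c_pure[of _ x] by simp
 qed
 ultimately have "J \<subseteq> ?H" using gen_ideal_min[OF alg] by blast
 then show ?thesis using x y by blast
qed

abbreviation "Q \<equiv> quot_alg A J"
abbreviation "p \<equiv> quot_proj A J"
abbreviation "P2 \<equiv> Tm A Q p"

lemmas p_hom = quot_proj_hom[OF alg idJ]
lemmas p_lin = quot_proj_lin[OF alg idJ]
lemma algQ: "assoc_algebra K Q" by (rule quot_assoc_algebra[OF alg idJ])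
lemma modQ: "module K Q" using algQ by simp

lemma p_cl [simp]: "x \<in> carrier A ==> p x \<in> carrier A"
 by (rule quot_proj_cl[OF alg idJ])

lemma Q_sub: "x \<in> carrier Q ==> x \<in> carrier A" by (auto simp: quot_sel[OF alg idJ])

lemma \<pi>_p: assumes "x \<in> carrier A" shows "\<pi> (p x) = \<pi> x"
proof (rule \<pi>_eq)
 show "p x \<ominus>\<^bsub>A\<^esub> x \<in> J" using quot_proj_eq_iff[OF alg idJ, of "p x" x] quot_proj_idem[OF alg idJ, of x] assms by simp
qed (use assms in auto)

lemma p_\<pi>: assumes "x \<in> carrier A" shows "p (\<pi> x) = p x"
 using quot_proj_eq_iff[OF alg idJ, of x "\<pi> x"] \<pi>_diff assms by simp

lemma \<pi>_linQ: "lin K Q A \<pi>"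
proof (rule linI)
 fix x assume x: "x \<in> carrier Q"
 then obtain x' where x': "x' \<in> carrier A" "x = p x'" by (auto simp: quot_sel[OF alg idJ])
 show "\<pi> x \<in> carrier A" using Q_sub[OF x] by simp
 show "\<pi> (x +[Q] y) = \<pi> x +[A] \<pi> y" if y: "y \<in> carrier Q" for y
 proof -
  obtain y' where y': "y' \<in> carrier A" "y = p y'" using y by (auto simp: quot_sel[OF alg idJ])
  show ?thesis using x' y' by (simp add: quot_sel[OF alg idJ] \<pi>_p lin_add[OF \<pi>_lin])
 qed
 show "\<pi> (a *:[Q] x) = a *:[A] \<pi> x" if "a \<in> carrier K" for a
  using x' that by (simp add: quot_sel[OF alg idJ] \<pi>_p lin_smult[OF \<pi>_lin])
qed

lemma P2_R: assumes t: "t \<in> tp A 2" and i: "i < 2" shows "P2 (R i t) = P2 t"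
proof (rule tp2_lin_eq[OF t modA alg_mod[OF T_alg[OF modQ]]])
 show "lin K (tpm1 A 2) (T Q) (%t. P2 (R i t))" "lin K (tpm1 A 2) (T Q) P2"
  by (rule lin_sub[OF lin_comp'[OF R_lin Tm_lin[OF modA modQ p_lin]]] lin_sub[OF Tm_lin[OF modA modQ p_lin]], use wsp_cl_tp[OF modA] in auto)+
 fix x y assume "x \<in> carrier A" "y \<in> carrier A"
 then show "P2 (R i (j x * j y)) = P2 (j x * j y)"
  using i by (cases i) (simp_all add: F_pure[OF \<pi>_lin] Tm_mult[OF modA modQ p_lin] Tm_iota[OF modA modQ p_lin] p_\<pi>)
qed

lemma P2_C_\<pi>: assumes t: "t \<in> tp A 2" shows "P2 (c (Tm A A \<pi> t)) = P2 (c t)"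
proof (rule tp2_lin_eq[OF t modA alg_mod[OF T_alg[OF modQ]]])
 note pl = Tm_lin[OF modA modQ p_lin]
 show "lin K (tpm1 A 2) (T Q) (%t. P2 (c (Tm A A \<pi> t)))"
  by (rule lin_comp'[OF lin_comp'[OF Tm_tp_lin[OF modA modA \<pi>_lin] lop_lin[OF modA lopC]] pl])
 show "lin K (tpm1 A 2) (T Q) (%t. P2 (c t))" by (rule lin_comp'[OF lop_lin[OF modA lopC] pl])
 fix x y assume xy: "x \<in> carrier A" "y \<in> carrier A"
 \<comment> \<open>The difference between x' and its representative lies in J, and its contribution
   vanishes in the quotient by \<open>C_J0\<close>.\<close>
 have 1: "P2 (C 0 (j x' * j y')) = P2 (C 0 (j (\<pi> x') * j y'))" if "x' \<in> carrier A" "y' \<in> carrier A" for x' y'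
 proof -
  define d where "d = x' \<ominus>\<^bsub>A\<^esub> \<pi> x'"
  have d: "d \<in> J" "d \<in> carrier A" "x' = d +[A] \<pi> x'" unfolding d_def using that \<pi>_diff minus_add_cancel[of A x' "\<pi> x'"] by auto
  have "P2 (C 0 (j d * j y')) = \<zero>\<^bsub>T Q\<^esub>"
   using P2_R[OF pure_cl[OF d(2) that(2)], of 1 0] C_J0[OF d(1) that(2)] by (simp add: lin_zero[OF pl] modQ)
  moreover have l: "lin K A (T Q) (%u. P2 (C 0 (j u * j y')))"
   using that by (intro lin_comp'[OF lin_comp'[OF lin_mult_right C_lin] pl] iota_lin) auto
  have "P2 (C 0 (j x' * j y')) = P2 (C 0 (j d * j y')) +[T Q] P2 (C 0 (j (\<pi> x') * j y'))"
   by (subst d(3), rule lin_add[OF l d(2)]) (use that in simp)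
  ultimately show ?thesis using that lin_cl[OF l, of "\<pi> x'"] modQ by simp
 qed
 have 2: "P2 (C 0 (j y' * j x')) = P2 (C 0 (j y' * j (\<pi> x')))" if "x' \<in> carrier A" "y' \<in> carrier A" for x' y'
 proof -
  define d where "d = x' \<ominus>\<^bsub>A\<^esub> \<pi> x'"
  have d: "d \<in> J" "d \<in> carrier A" "x' = d +[A] \<pi> x'" unfolding d_def using that \<pi>_diff minus_add_cancel[of A x' "\<pi> x'"] by auto
  have "P2 (C 0 (j y' * j d)) = \<zero>\<^bsub>T Q\<^esub>"
   using P2_R[OF pure_cl[OF that(2) d(2)], of 0 0] C_J1[OF d(1) that(2)] by (simp add: lin_zero[OF pl] modQ)
  moreover have l: "lin K A (T Q) (%u. P2 (C 0 (j y' * j u)))"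
   using that by (intro lin_comp'[OF lin_comp'[OF lin_mult_left C_lin] pl] iota_lin) auto
  have "P2 (C 0 (j y' * j x')) = P2 (C 0 (j y' * j d)) +[T Q] P2 (C 0 (j y' * j (\<pi> x')))"
   by (subst d(3), rule lin_add[OF l d(2)]) (use that in simp)
  ultimately show ?thesis using that lin_cl[OF l, of "\<pi> x'"] modQ by simp
 qed
 show "P2 (c (Tm A A \<pi> (j x * j y))) = P2 (c (j x * j y))"
  using xy 1[of x y] 2[of y "\<pi> x"] by (simp add: Tm_mult[OF modA modA \<pi>_lin] Tm_iota[OF modA modA \<pi>_lin] c_pure)
qed

text \<open>The braiding of the quotient is defined through arbitrary preimages. Lifting linearly
  with \<open>\<pi>\<close> gives a formula in which linearity is evident; the two are identified
  afterwards.\<close>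

definition "cQ = (%t. P2 (c (Tm Q A \<pi> t)))"

lemma cQ_lop: "lop Q 2 2 cQ"
 unfolding lop_def cQ_def
 by (rule lin_comp'[OF lin_comp'[OF Tm_tp_lin[OF modQ modA \<pi>_linQ] lopC[unfolded lop_def]] Tm_tp_lin[OF modA modQ p_lin]])

lemma cQ_P2: assumes t: "t \<in> tp A 2" shows "cQ (P2 t) = P2 (c t)"
proof -
 have tc: "t \<in> carrier TA" by (rule wsp_cl_tp[OF modA t])
 have "Tm Q A \<pi> (P2 t) = Tm A A (%x. \<pi> (p x)) t" by (rule Tm_Tm[OF modA modQ modA p_lin \<pi>_linQ tc])
 also have "\<dots> = Tm A A \<pi> t" using Tm_cong[of A "%x. \<pi> (p x)" \<pi> A] \<pi>_p by simp
 finally show ?thesis unfolding cQ_def using P2_C_\<pi>[OF t] by simp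
qed

lemma induced_cQ: assumes t: "t \<in> tp Q 2"
 shows "induced (tp A 2) (tsquare K A Q p) (tsquare K A Q p \<circ> c) t = cQ t"
proof -
 obtain s where s: "s \<in> tp A 2" "t = P2 s"
  using Tm_surj[OF modA modQ p_lin, of t "{2}"] t unfolding tpow_wsp by (auto simp: quot_sel[OF alg idJ])
 have sq: "tsquare K A Q p u = P2 u" if "u \<in> tp A 2" for u by (rule tsquare_Tm[OF modA modQ p_lin that])
 have cs: "c u \<in> tp A 2" if "u \<in> tp A 2" for u by (rule lop_cl[OF lopC that])
 have "induced (tp A 2) (tsquare K A Q p) (tsquare K A Q p \<circ> c) (tsquare K A Q p s) = (tsquare K A Q p \<circ> c) s"
 proof (rule induced_eq[OF s(1)])
  fix u assume u: "u \<in> tp A 2" "tsquare K A Q p u = tsquare K A Q p s"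
  then show "(tsquare K A Q p \<circ> c) u = (tsquare K A Q p \<circ> c) s" using cQ_P2[OF u(1)] cQ_P2[OF s(1)] by (simp add: sq cs s(1))
 qed
 then show ?thesis using s cs[OF s(1)] by (simp add: sq cQ_P2)
qed

end

section \<open>Primitive elements and the braiding of the infinitesimal part\<close>

context fld begin

lemma prim_carrier: "carrier (prim_mod K B) = prims K B"
 "ring.add (prim_mod K B) = ring.add B" "smult (prim_mod K B) = smult B" "ring.zero (prim_mod K B) = ring.zero B"
 by (simp_all add: prim_mod_def module.defs)

end

context br_bialg begin

abbreviation "P \<equiv> prims K B"

lemma prims_comult: "x \<in> P ==> comult B x = j x * e +[TA] e * j x" by (simp add: prims_def)

lemma prims_cl [simp]: "x \<in> P ==> x \<in> carrier B" by (simp add: prims_def)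

text \<open>The counit law applied to a primitive element shows that its counit times the unit is
  zero; a second application of the counit removes the unit.\<close>

lemma prims_counit: assumes x: "x \<in> P" shows "counit B x = \<zero>\<^bsub>K\<^esub>"
proof -
 have jx: "j x \<in> carrier TA" "counit B x *:[TA] e \<in> carrier TA" using x by simp_all
 have "j x = E 0 (comult B x)" using ED0[of x] x by simp
 also have "\<dots> = counit B x *:[TA] e +[TA] j x"
  unfolding prims_comult[OF x] using x by (simp add: lin_add[OF E_lin] E_mult counit_one)
 finally have "j x +[TA] \<ominus>\<^bsub>TA\<^esub> j x = (counit B x *:[TA] e +[TA] j x) +[TA] \<ominus>\<^bsub>TA\<^esub> j x" by simp
 then have "counit B x *:[TA] e = \<zero>\<^bsub>TA\<^esub>" using jx add_assoc[of TA "counit B x *:[TA] e" "j x" "\<ominus>\<^bsub>TA\<^esub> j x"] by simp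
 then have "j (counit B x *:[B] \<one>\<^bsub>B\<^esub>) = j \<zero>\<^bsub>B\<^esub>"
  using x lin_zero[OF iota_lin[OF modA]] by (simp add: lin_smult[OF iota_lin[OF modA]])
 then have "counit B x *:[B] \<one>\<^bsub>B\<^esub> = \<zero>\<^bsub>B\<^esub>" using x by (intro iota_inj[OF modA]) simp_all
 then have "counit B (counit B x *:[B] \<one>\<^bsub>B\<^esub>) = \<zero>\<^bsub>K\<^esub>" using lin_zero[OF counit_lin modA module_ground] by (simp add: ground_def)
 then show ?thesis using x counit_one lin_smult[OF counit_lin, of "counit B x" "\<one>\<^bsub>B\<^esub>"] by (simp add: ground_def)
qed

lemma comult_TA: "lin K B TA (comult B)"
 by (rule lin_subD[OF comult_lin]) (use wsp_cl_tp[OF modA] in auto)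

definition "\<delta> x = comult B x \<ominus>\<^bsub>TA\<^esub> (j x * e +[TA] e * j x)"

lemma \<delta>_lin: "lin K B TA \<delta>"
 unfolding \<delta>_def by (intro lin_diff lin_sum lin_mult_left lin_mult_right comult_TA iota_lin) simp_all

lemma \<delta>_tp: "x \<in> carrier B ==> \<delta> x \<in> tp B 2"
 unfolding \<delta>_def a_minus_def
 by (intro subm_add[OF _ tp_subm] subm_neg[OF _ tp_subm] comult_tp) simp_all

lemma prims_\<delta>: "x \<in> P \<longleftrightarrow> x \<in> carrier B \<and> \<delta> x = \<zero>\<^bsub>TA\<^esub>"
proof (cases "x \<in> carrier B")
 case True
 then have "j x * e +[TA] e * j x \<in> carrier TA" "comult B x \<in> carrier TA" by simp_all
 then have "\<delta> x = \<zero>\<^bsub>TA\<^esub> \<longleftrightarrow> comult B x = j x * e +[TA] e * j x"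
  unfolding \<delta>_def using minus_eq_zero_iff[of TA] by simp
 then show ?thesis unfolding prims_def using True by blast
qed (use prims_cl in blast)

lemma prims_subm: "submodule P K B"
proof -
 have "P = {x \<in> carrier B. \<delta> x = \<zero>\<^bsub>TA\<^esub>}" using prims_\<delta> by blast
 moreover have "submodule {x \<in> carrier B. \<delta> x = \<zero>\<^bsub>TA\<^esub>} K B" by (rule ker_subm[OF modA _ \<delta>_lin]) simp
 ultimately show ?thesis by (simp only:)
qed

abbreviation "PM \<equiv> prim_mod K B"

lemma modP: "module K PM"
 by (rule same_module[OF _ _ _ _ subm_mod[OF modA prims_subm]]) (simp_all add: prim_carrier)

lemma incl_lin: "lin K PM B id"
 by (rule linI) (auto simp: prim_carrier)

text \<open>A chosen linear projection of B onto the primitive elements. A tensor is shown to have a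
  primitive factor by showing that \<open>rP\<close> at that position fixes it.\<close>

definition "rP = (SOME q. lin K B B q \<and> (\<forall>x\<in>carrier B. q x \<in> P) \<and> (\<forall>x\<in>P. q x = x))"

lemma rP: "lin K B B rP" "x \<in> carrier B ==> rP x \<in> P" "x \<in> P ==> rP x = x"
 using someI_ex[OF subspace_projection[OF modA prims_subm]] unfolding rP_def by blast+

lemma rP_lin: "lin K B PM rP"
 using rP unfolding lin_def by (simp add: prim_carrier Pi_def)

abbreviation "RP i \<equiv> Fa rP i"

text \<open>P is the kernel of \<open>\<delta>\<close>, so the projection along P onto a complement
  factors through \<open>\<delta>\<close>. This replaces the exactness argument that the kernel of
  \<open>\<delta>\<close> applied to one tensor factor is P in that factor.\<close>

lemma \<delta>_factor: "\<exists>g. lin K TA B g \<and> (\<forall>x\<in>carrier B. g (\<delta> x) = x \<ominus>\<^bsub>B\<^esub> rP x)"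
proof -
 define N where "N = TA\<lparr>carrier := \<delta> ` carrier B\<rparr>"
 have TM: "module K TA" by simp
 have sub: "submodule (\<delta> ` carrier B) K TA"
 proof (rule submI[OF TM])
  show "\<delta> ` carrier B \<subseteq> carrier TA" using lin_cl[OF \<delta>_lin] by blast
  have "\<delta> \<zero>\<^bsub>B\<^esub> = \<zero>\<^bsub>TA\<^esub>" by (rule lin_zero[OF \<delta>_lin]) simp_all
  then show "\<zero>\<^bsub>TA\<^esub> \<in> \<delta> ` carrier B" by (metis image_eqI modA zero_cl)
  fix x y assume "x \<in> \<delta> ` carrier B" "y \<in> \<delta> ` carrier B"
  then obtain x' y' where "x' \<in> carrier B" "y' \<in> carrier B" "x = \<delta> x'" "y = \<delta> y'" by blast
  then show "x +[TA] y \<in> \<delta> ` carrier B" by (intro image_eqI[of _ _ "x' +[B] y'"]) (simp_all add: lin_add[OF \<delta>_lin])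
 next
  fix a x assume "a \<in> carrier K" "x \<in> \<delta> ` carrier B"
  then obtain x' where "a \<in> carrier K" "x' \<in> carrier B" "x = \<delta> x'" by blast
  then show "a *:[TA] x \<in> \<delta> ` carrier B" by (intro image_eqI[of _ _ "a *:[B] x'"]) (simp_all add: lin_smult[OF \<delta>_lin])
 qed
 have dl: "lin K B N \<delta>" unfolding N_def by (rule lin_subI[OF \<delta>_lin]) blast
 define h where "h x = x \<ominus>\<^bsub>B\<^esub> rP x" for x
 have hl: "lin K B B h" unfolding h_def by (rule lin_diff[OF modA lin_id(2) rP(1)])
 have eq: "h x = h y" if "x \<in> carrier B" "y \<in> carrier B" "\<delta> x = \<delta> y" for x y
 proof -
  have "\<delta> (x \<ominus>\<^bsub>B\<^esub> y) = \<zero>\<^bsub>TA\<^esub>" using that lin_cl[OF \<delta>_lin, of y] by (simp add: lin_minus[OF \<delta>_lin])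
  then have "x \<ominus>\<^bsub>B\<^esub> y \<in> P" using that by (simp add: prims_\<delta>)
  then have "h (x \<ominus>\<^bsub>B\<^esub> y) = \<zero>\<^bsub>B\<^esub>" unfolding h_def by (simp add: rP(3))
  then show ?thesis using that lin_cl[OF hl, of x] lin_cl[OF hl, of y] by (simp add: lin_minus[OF hl] minus_eq_zero_iff)
 qed
 define g0 where "g0 t = h (inv_into (carrier B) \<delta> t)" for t
 have g0: "g0 (\<delta> x) = h x" if x: "x \<in> carrier B" for x
 proof -
  have "\<delta> x \<in> \<delta> ` carrier B" using x by blast
  then have "inv_into (carrier B) \<delta> (\<delta> x) \<in> carrier B" "\<delta> (inv_into (carrier B) \<delta> (\<delta> x)) = \<delta> x"
   by (rule inv_into_into, rule f_inv_into_f)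
  then show ?thesis unfolding g0_def by (intro eq) (use x in simp_all)
 qed
 have g0l: "lin K N B g0" 
 proof (rule lin_surj[where p = \<delta> and f = h])
  show "\<delta> ` carrier B = carrier N" by (simp add: N_def)
 qed (use modA dl hl g0 in auto)
 \<comment> \<open>The factorization exists so far only on the image of \<open>\<delta>\<close>; a
   projection onto that image extends it to the whole tensor algebra.\<close>
 obtain q where q: "lin K TA TA q" "\<forall>x\<in>carrier TA. q x \<in> \<delta> ` carrier B" "\<forall>x\<in>\<delta> ` carrier B. q x = x"
  using subspace_projection[OF TM sub] by blast
 have "lin K TA N q" unfolding N_def by (rule lin_subI[OF q(1)]) (use q(2) in blast)
 from lin_comp'[OF this g0l] have "lin K TA B (%t. g0 (q t))" .
 moreover have "g0 (q (\<delta> x)) = x \<ominus>\<^bsub>B\<^esub> rP x" if "x \<in> carrier B" for x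
 proof -
  have "q (\<delta> x) = \<delta> x" using q(3) that by blast
  then show ?thesis using g0[OF that] unfolding h_def by simp
 qed
 ultimately show ?thesis by blast
qed

text \<open>The equation says that the defect \<open>\<delta>\<close> at position \<open>i\<close>
  vanishes on \<open>w\<close>. Composing with the map \<open>g\<close> through which the
  complementary projection factors gives zero on one side and w minus its projection on the
  other.\<close>

lemma RP_fixI:
 assumes w: "w \<in> tp B 2" and i: "i < 2" and eq: "D i w = U (Suc i) w +[TA] U i w"
 shows "RP i w = w"
proof -
 obtain g where g: "lin K TA B g" "\<forall>x\<in>carrier B. g (\<delta> x) = x \<ominus>\<^bsub>B\<^esub> rP x" using \<delta>_factor by blast
 define jg where "jg = (%t. j (g t))"
 have jl: "lin K TA TA jg" unfolding jg_def by (rule lin_comp'[OF g(1) iota_lin[OF modA]])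
 have lG: "lop B 2 1 jg"
  by (rule lopI[OF modA jl]) (use lin_cl[OF g(1)] wsp_cl_tp[OF modA] in \<open>auto simp: jg_def\<close>)
 note Gl = sh_lin[OF modA lG]
 \<comment> \<open>\<open>H\<close> is \<open>g\<close> after \<open>\<delta>\<close>, both at
   position \<open>i\<close>, that is, the identity minus \<open>rP\<close> at that
   position.\<close>
 define H where "H = (%w. sh B i 2 jg (D i w \<ominus>\<^bsub>TA\<^esub> (U (Suc i) w +[TA] U i w)))"
 have Hl: "lin K TA TA H"
  unfolding H_def by (rule lin_comp'[OF _ Gl]) (intro lin_diff lin_sum D_lin U_lin, simp_all)
 have pure: "H (j x * j y) = (j x * j y) \<ominus>\<^bsub>TA\<^esub> RP i (j x * j y)" if x: "x \<in> carrier B" and y: "y \<in> carrier B" for x y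
 proof -
  have jgd: "jg (\<delta> u) = j u \<ominus>\<^bsub>TA\<^esub> j (rP u)" if "u \<in> carrier B" for u
   unfolding jg_def using g(2) that rP(2) by (simp add: lin_minus[OF iota_lin])
  have d: "\<delta> x \<in> tp B 2" "\<delta> y \<in> tp B 2" "\<delta> x \<in> carrier TA" "\<delta> y \<in> carrier TA" using x y \<delta>_tp lin_cl[OF \<delta>_lin] by auto
  have rc: "rP x \<in> carrier B" "rP y \<in> carrier B" using x y rP(2) by auto
  have ass: "(j x * e) * j y = j x * (e * j y)" "(e * j x) * j y = e * (j x * j y)" using x y by (simp_all add: Tassoc)
  consider "i = 0" | "i = Suc 0" using i by linarith
  then show ?thesis
  proof cases
   case 1
   have "D 0 (j x * j y) \<ominus>\<^bsub>TA\<^esub> (U 1 (j x * j y) +[TA] U 0 (j x * j y)) = \<delta> x * j y"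
    unfolding \<delta>_def using x y by (simp add: D_mult U_0 U_1 a_minus_def add_mult neg_mult ass)
   then have "H (j x * j y) = sh B 0 2 jg (\<delta> x * j y)" unfolding H_def 1 by simp
   then have "H (j x * j y) = jg (\<delta> x) * j y"
    using sh_mid[OF modA lG, of "\<one>\<^bsub>TA\<^esub>" 0 "\<delta> x" "j y"] d y lop_cl2[OF modA lG, of "\<delta> x"] by simp
   then show ?thesis using x y rc d unfolding 1 jgd[OF x] by (simp add: F_pure[OF rP(1)] a_minus_def add_mult neg_mult)
  next
   case 2
   have *: "D (Suc 0) (j x * j y) \<ominus>\<^bsub>TA\<^esub> (U (Suc (Suc 0)) (j x * j y) +[TA] U (Suc 0) (j x * j y)) = j x * \<delta> y"
    unfolding \<delta>_def using x y by (simp add: at_rules[OF lopD] at_rules[OF lopU] D_j U_0 U_1 a_minus_def mult_add neg_mult)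
   have "H (j x * j y) = j x * jg (\<delta> y)"
    unfolding H_def 2 * by (rule sh_base_left[OF modA lG iota_tp(2)[OF modA x] d(2)])
   then show ?thesis using x y rc d unfolding 2 jgd[OF y] by (simp add: F_pure[OF rP(1)] a_minus_def mult_add neg_mult)
  qed
 qed
 have wc: "w \<in> carrier TA" by (rule wsp_cl_tp[OF modA w])
 have "H w = w \<ominus>\<^bsub>TA\<^esub> RP i w"
  by (rule tp2_eqI[OF w Hl lin_diff[OF _ lin_id(2) F_lin[OF rP(1)]]]) (use pure in auto)
 moreover have "D i w \<ominus>\<^bsub>TA\<^esub> (U (Suc i) w +[TA] U i w) = \<zero>\<^bsub>TA\<^esub>" unfolding eq using wc by simp
 then have "H w = \<zero>\<^bsub>TA\<^esub>" unfolding H_def using lin_zero[OF Gl] by simp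
 ultimately show ?thesis using wc minus_eq_zero_iff[of TA w "RP i w"] rP(1) by simp
qed

text \<open>Compatibility of comultiplication with the braiding moves the computation before the
  braiding, where primitivity turns it into unit insertions. These pass back through the braiding by
  the unit axioms, and the result is the criterion \<open>RP_fixI\<close>.\<close>

lemma C_prim:
 assumes x: "x \<in> P" and y: "y \<in> carrier B"
 shows "RP 1 (C 0 (j x * j y)) = C 0 (j x * j y)" "RP 0 (C 0 (j y * j x)) = C 0 (j y * j x)"
proof -
 have xc: "x \<in> carrier B" using x by simp
 define t where "t = j x * j y"
 have t: "t \<in> tp B 2" unfolding t_def using xc y by simp
 have [simp]: "t \<in> carrier TA" "t \<in> tge B 2" "t \<in> tge B 1" "t \<in> tge B (Suc 0)" using wsp_cl_tp[OF modA t] tp_tge[OF t] by auto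
 have U3: "U i t \<in> tge B 3" for i using U_tge[of t 3 i] by simp
 have D0t: "D 0 t = U 1 t +[TA] U 0 t"
  unfolding t_def using xc y by (simp add: D_mult prims_comult[OF x] U_0 U_1 add_mult Tassoc)
 have C1U: "C 1 (U 0 t) = U 0 (C 0 t)" using U_far[OF lopC, of 0 0 t] by simp
 have C0U: "C 0 (U 2 t) = U 2 (C 0 t)" using C_far[OF lopU, of 0 2 t] by simp
 have CUC: "C 0 (U 0 (C 0 t)) = U 1 (C 0 t)" using CU(1)[of "C 0 t" 0] by simp
 have C1U1: "C 1 (U 1 t) = U 2 t" using CU(1)[of t 1] by (simp add: numeral_2_eq_2[symmetric])
 have "D 1 (C 0 t) = C 0 (C 1 (D 0 t))" using DC1[OF t] .
 also have "\<dots> = C 0 (C 1 (U 1 t)) +[TA] C 0 (C 1 (U 0 t))" unfolding D0t by (simp add: lin_add[OF C_lin])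
 also have "\<dots> = U (Suc 1) (C 0 t) +[TA] U 1 (C 0 t)" using C1U C0U CUC C1U1 by (simp add: numeral_2_eq_2[symmetric])
 finally have "RP 1 (C 0 t) = C 0 t" by (intro RP_fixI C_tp[OF t]) simp_all
 then show "RP 1 (C 0 (j x * j y)) = C 0 (j x * j y)" unfolding t_def .
 define s where "s = j y * j x"
 have s: "s \<in> tp B 2" unfolding s_def using xc y by simp
 have [simp]: "s \<in> carrier TA" "s \<in> tge B 2" "s \<in> tge B 1" "s \<in> tge B (Suc 0)" using wsp_cl_tp[OF modA s] tp_tge[OF s] by auto
 have D1s: "D 1 s = U 2 s +[TA] U 1 s"
  unfolding s_def using xc y by (simp add: at_rules[OF lopD] at_rules[OF lopU] D_j prims_comult[OF x] U_0 U_1 mult_add)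
 have C0U: "C 0 (U 2 s) = U 2 (C 0 s)" using C_far[OF lopU, of 0 2 s] by simp
 have C1U: "C 1 (U 2 (C 0 s)) = U 1 (C 0 s)" using CU(2)[of "C 0 s" 1] by (simp add: numeral_2_eq_2[symmetric])
 have C0U1: "C 0 (U 1 s) = U 0 s" using CU(2)[of s 0] by simp
 have C1U0: "C 1 (U 0 s) = U 0 (C 0 s)" using U_far[OF lopC, of 0 0 s] by simp
 have "D 0 (C 0 s) = C 1 (C 0 (D 1 s))" using DC0[OF s] .
 also have "\<dots> = C 1 (C 0 (U 2 s)) +[TA] C 1 (C 0 (U 1 s))" unfolding D1s by (simp add: lin_add[OF C_lin])
 also have "\<dots> = U (Suc 0) (C 0 s) +[TA] U 0 (C 0 s)" using C0U C1U C0U1 C1U0 by simp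
 finally have "RP 0 (C 0 s) = C 0 s" by (intro RP_fixI C_tp[OF s]) simp_all
 then show "RP 0 (C 0 (j y * j x)) = C 0 (j y * j x)" unfolding s_def .
qed

lemma C_RP: assumes t: "t \<in> tp B 2"
 shows "RP 1 (C 0 (RP 0 t)) = C 0 (RP 0 t)" "RP 0 (C 0 (RP 1 t)) = C 0 (RP 1 t)"
proof -
 note l = F_lin[OF rP(1)]
 show "RP 1 (C 0 (RP 0 t)) = C 0 (RP 0 t)"
  by (rule tp2_eqI[OF t lin_comp'[OF lin_comp'[OF l C_lin] l] lin_comp'[OF l C_lin]])
   (use C_prim(1) rP(2) in \<open>simp add: F_pure[OF rP(1)]\<close>)
 show "RP 0 (C 0 (RP 1 t)) = C 0 (RP 1 t)"
  by (rule tp2_eqI[OF t lin_comp'[OF lin_comp'[OF l C_lin] l] lin_comp'[OF l C_lin]])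
   (use C_prim(2) rP(2) in \<open>simp add: F_pure[OF rP(1)]\<close>)
qed

abbreviation "I2 \<equiv> Tm PM B id"
abbreviation "R2 \<equiv> Tm B PM rP"
abbreviation "cP \<equiv> prim_braiding K B"

lemmas I2_lin = Tm_lin[OF modP modA incl_lin] and I2_tp = Tm_tp[OF modP modA incl_lin]

lemma I2_inj: "s \<in> carrier (T PM) ==> t \<in> carrier (T PM) ==> I2 s = I2 t ==> s = t"
 by (rule Tm_inj[OF modP modA incl_lin rP_lin]) (simp_all add: prim_carrier rP(3))

lemma I2_R2: assumes t: "t \<in> tp B 2" shows "I2 (R2 t) = RP 1 (RP 0 t)"
proof -
 have "I2 (R2 t) = Tm B B rP t" using Tm_Tm[OF modA modP modA rP_lin incl_lin wsp_cl_tp[OF modA t]] by simp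
 also have "\<dots> = RP 1 (RP 0 t)"
  by (rule tp2_eqI[OF t Tm_lin[OF modA modA rP(1)] lin_comp'[OF F_lin F_lin]])
   (simp_all add: rP F_pure[OF rP(1)] Tm_mult[OF modA modA rP(1)] Tm_iota[OF modA modA rP(1)])
 finally show ?thesis .
qed

lemma RP_I2: assumes s: "s \<in> tp PM 2" and i: "i < 2" shows "RP i (I2 s) = I2 s"
proof (rule tp2_lin_eq[OF s modP])
 show "lin K (tpm1 PM 2) TA (%s. RP i (I2 s))" "lin K (tpm1 PM 2) TA I2"
  by (rule lin_sub[OF lin_comp'[OF I2_lin F_lin[OF rP(1)]]] lin_sub[OF I2_lin], use wsp_cl_tp[OF modP] in auto)+
 fix x y assume "x \<in> carrier PM" "y \<in> carrier PM"
 then show "RP i (I2 (\<iota> K PM x *[PM] \<iota> K PM y)) = I2 (\<iota> K PM x *[PM] \<iota> K PM y)"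
  using i modP by (cases i)
   (simp_all add: prim_carrier F_pure[OF rP(1)] Tm_mult[OF modP modA incl_lin] Tm_iota[OF modP modA incl_lin] rP(3))
qed simp

lemma c_I2: assumes s: "s \<in> tp PM 2" shows "I2 (R2 (braiding B (I2 s))) = braiding B (I2 s)"
proof -
 have t: "I2 s \<in> tp B 2" by (rule I2_tp[OF s])
 have "RP 0 (braiding B (I2 s)) = braiding B (I2 s)" "RP 1 (braiding B (I2 s)) = braiding B (I2 s)"
  using C_RP[OF t] RP_I2[OF s, of 0] RP_I2[OF s, of 1] C_base[OF t] by simp_all
 then show ?thesis using I2_R2[OF lop_cl[OF lopC t]] by simp
qed

text \<open>\<open>prim_braiding\<close> inverts the tensor square of the inclusion pointwise. Since
  c preserves P \<otimes> P, the inverse may be replaced by the linear map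
  T(\<open>rP\<close>).\<close>

lemma cP_eq: assumes s: "s \<in> tp PM 2" shows "cP s = R2 (braiding B (I2 s))"
proof -
 have sq: "tsquare K PM B id u = I2 u" if "u \<in> tp PM 2" for u by (rule tsquare_Tm[OF modP modA incl_lin that])
 have v: "R2 (braiding B (I2 s)) \<in> tp PM 2" by (rule Tm_tp[OF modA modP rP_lin lop_cl[OF lopC I2_tp[OF s]]])
 have inj: "inj_on (tsquare K PM B id) (tp PM 2)"
  by (rule inj_onI) (simp add: sq, rule I2_inj, use wsp_cl_tp[OF modP] in auto)
 have "cP s = inv_into (tp PM 2) (tsquare K PM B id) (tsquare K PM B id (R2 (braiding B (I2 s))))"
  unfolding prim_braiding_def using sq[OF s] sq[OF v] c_I2[OF s] by simp
 also have "\<dots> = R2 (braiding B (I2 s))" by (rule inv_into_f_f[OF inj v])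
 finally show ?thesis .
qed

lemma I2_cP: "s \<in> tp PM 2 ==> I2 (cP s) = braiding B (I2 s)"
 by (simp add: cP_eq c_I2)

lemma lop_cP: "lop PM 2 2 cP"
proof -
 have "lin K (tpm1 PM 2) (tpm1 PM 2) (%s. R2 (braiding B (I2 s)))"
  by (rule lin_comp'[OF lin_comp'[OF Tm_tp_lin[OF modP modA incl_lin] lopC[unfolded lop_def]] Tm_tp_lin[OF modA modP rP_lin]])
 then show ?thesis using lop_cong[OF modP, of 2 cP] cP_eq by (simp add: lop_def)
qed

text \<open>The braid relation is pulled back from B along the tensor cube of the inclusion, which
  is injective because the inclusion has a retraction.\<close>

lemma braided_vsP: "braided_vs K PM cP"
 unfolding braided_vs_iff
proof (intro conjI ballI modP lop_cP)
 fix s assume s: "s \<in> tp PM 3"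
 have sc: "s \<in> carrier (T PM)" by (rule wsp_cl_tp[OF modP s])
 have I2C: "I2 (sh PM i 2 cP t) = C i (I2 t)" if "t \<in> carrier (T PM)" for i t
  by (rule Tm_sh[OF modP modA incl_lin lop_cP lopC I2_cP that])
 note cl = sh_cl[OF modP lop_cP]
 show "sh PM 0 2 cP (sh PM 1 2 cP (sh PM 0 2 cP s)) = sh PM 1 2 cP (sh PM 0 2 cP (sh PM 1 2 cP s))"
  by (rule I2_inj) (use braid0[OF I2_tp[OF s]] in \<open>simp_all add: cl sc I2C\<close>)
qed

end

section \<open>Morphisms of braided bialgebras\<close>

context fld begin

lemma bialg_mor_iff:
 assumes "br_bialg K B" "br_bialg K B'"
 shows "bialg_mor K B B' f \<longleftrightarrow> alg_hom K B B' f \<and> (\<forall>t\<in>tp B 2. braiding B' (Tm B B' f t) = Tm B B' f (braiding B t)) \<and>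
  (\<forall>x\<in>carrier B. comult B' (f x) = Tm B B' f (comult B x) \<and> counit B' (f x) = counit B x)"
proof -
 interpret B: br_bialg K B by (rule assms)
 interpret B': br_bialg K B' by (rule assms)
 have "tsquare K B B' f (comult B x) = Tm B B' f (comult B x)" if "alg_hom K B B' f" "x \<in> carrier B" for x
  by (rule tsquare_Tm[OF B.modA B'.modA alg_hom_lin[OF that(1)] B.comult_tp[OF that(2)]])
 then show ?thesis unfolding bialg_mor_def braided_mor_iff[OF B.modA B'.modA B.lopC] by (auto intro: alg_hom_lin)
qed

lemma bialg_mor_prims:
 assumes B: "br_bialg K B" "br_bialg K B'" and f: "bialg_mor K B B' f" and x: "x \<in> prims K B"
 shows "f x \<in> prims K B'"
proof -
 interpret B: br_bialg K B by (rule B)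
 interpret B': br_bialg K B' by (rule B)
 have h: "alg_hom K B B' f" and d: "comult B' (f x) = Tm B B' f (comult B x)" using f x unfolding bialg_mor_iff[OF B] by auto
 note l = alg_hom_lin[OF h]
 note Tl = Tm_lin[OF B.modA B'.modA l] and Ti = Tm_iota[OF B.modA B'.modA l] and Tmu = Tm_mult[OF B.modA B'.modA l]
 have xc: "x \<in> carrier B" and fx: "f x \<in> carrier B'" using x lin_cl[OF l] by simp_all
 have "comult B' (f x) = B'.j (f x) \<cdot>[T B'] B'.e +[T B'] B'.e \<cdot>[T B'] B'.j (f x)"
  unfolding d B.prims_comult[OF x] using xc by (simp add: lin_add[OF Tl] Ti Tmu alg_hom_one[OF h])
 then show ?thesis unfolding prims_def using fx by blast
qed

lemma bialg_mor_comp: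
 assumes B: "br_bialg K B" "br_bialg K B'" "br_bialg K B''" and f: "bialg_mor K B B' f" and g: "bialg_mor K B' B'' g"
 shows "bialg_mor K B B'' (%x. g (f x))"
proof -
 interpret B: br_bialg K B by (rule B)
 interpret B': br_bialg K B' by (rule B)
 interpret B'': br_bialg K B'' by (rule B)
 have fh: "alg_hom K B B' f" and gh: "alg_hom K B' B'' g" using f g unfolding bialg_mor_iff[OF B(1,2)] bialg_mor_iff[OF B(2,3)] by auto
 note l = alg_hom_lin[OF fh] alg_hom_lin[OF gh]
 have TT: "Tm B' B'' g (Tm B B' f t) = Tm B B'' (%x. g (f x)) t" if "t \<in> carrier (T B)" for t
  by (rule Tm_Tm[OF B.modA B'.modA B''.modA l that])
 have c: "t \<in> tp B 2 ==> t \<in> carrier (T B) \<and> braiding B t \<in> carrier (T B) \<and> Tm B B' f t \<in> tp B' 2" for t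
  using wsp_cl_tp[OF B.modA] lop_cl[OF B.lopC] Tm_tp[OF B.modA B'.modA l(1)] by blast
 have "alg_hom K B B'' (%x. g (f x))" using alg_hom_comp[OF fh gh] by (simp add: comp_def)
 moreover have "braiding B'' (Tm B B'' (%x. g (f x)) t) = Tm B B'' (%x. g (f x)) (braiding B t)" if "t \<in> tp B 2" for t
 proof -
  have "braiding B'' (Tm B' B'' g (Tm B B' f t)) = Tm B' B'' g (Tm B B' f (braiding B t))"
   using f g c[OF that] that unfolding bialg_mor_iff[OF B(1,2)] bialg_mor_iff[OF B(2,3)] by simp
  then show ?thesis using c[OF that] by (simp add: TT)
 qed
 moreover have "comult B'' (g (f x)) = Tm B B'' (%x. g (f x)) (comult B x) \<and> counit B'' (g (f x)) = counit B x" if "x \<in> carrier B" for x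
 proof -
  have "f x \<in> carrier B'" using lin_cl[OF l(1) that] .
  then show ?thesis using f g that unfolding bialg_mor_iff[OF B(1,2)] bialg_mor_iff[OF B(2,3)] by (simp add: TT)
 qed
 ultimately show ?thesis unfolding bialg_mor_iff[OF B(1,3)] by blast
qed

lemma alg_hom_surj:
 assumes B: "assoc_algebra K B" and p: "alg_hom K B Q p" "p ` carrier B = carrier Q" and f: "alg_hom K B N f"
  and g: "\<And>x. x \<in> carrier B ==> g (p x) = f x"
 shows "alg_hom K Q N g"
proof (rule alg_homI)
 show "lin K Q N g" by (rule lin_surj[where p = p and f = f]) (use B p f g in \<open>auto intro: alg_hom_lin\<close>)
 fix x y assume "x \<in> carrier Q" "y \<in> carrier Q"
 then obtain x' y' where x: "x' \<in> carrier B" "x = p x'" and y: "y' \<in> carrier B" "y = p y'" using p(2) by blast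
 have "x \<cdot>[Q] y = p (x' \<cdot>[B] y')" using alg_hom_mult[OF p(1)] x y by simp
 then show "g (x \<cdot>[Q] y) = g x \<cdot>[N] g y" using x y g B alg_hom_mult[OF f] by simp
next
 show "g \<one>\<^bsub>Q\<^esub> = \<one>\<^bsub>N\<^esub>" using g[of "\<one>\<^bsub>B\<^esub>"] B alg_hom_one[OF p(1)] alg_hom_one[OF f] by simp
qed

lemma bialg_mor_quot:
 assumes B: "br_bialg K B" "br_bialg K Q" "br_bialg K B'" and p: "bialg_mor K B Q p" "p ` carrier B = carrier Q"
  and f: "bialg_mor K B B' f" and g: "\<And>x. x \<in> carrier B ==> g (p x) = f x"
 shows "bialg_mor K Q B' g"
proof -
 interpret B: br_bialg K B by (rule B)
 interpret Q: br_bialg K Q by (rule B)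
 interpret B': br_bialg K B' by (rule B)
 have ph: "alg_hom K B Q p" and fh: "alg_hom K B B' f" using f p unfolding bialg_mor_iff[OF B(1,2)] bialg_mor_iff[OF B(1,3)] by auto
 note l = alg_hom_lin[OF ph] alg_hom_lin[OF fh]
 have gl: "lin K Q B' g" by (rule lin_surj[OF B.modA l(1) p(2) l(2) g])
 have gh: "alg_hom K Q B' g" by (rule alg_hom_surj[OF B.alg ph p(2) fh g])
 have TT: "Tm Q B' g (Tm B Q p t) = Tm B B' f t" if "t \<in> carrier (T B)" for t
  using Tm_Tm[OF B.modA Q.modA B'.modA l(1) gl that] Tm_cong[of B "%x. g (p x)" f B'] g by simp
 have "braiding B' (Tm Q B' g t) = Tm Q B' g (braiding Q t)" if t: "t \<in> tp Q 2" for t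
 proof -
  obtain s where s: "s \<in> tp B 2" "t = Tm B Q p s"
   using Tm_surj[OF B.modA Q.modA l(1) p(2), of t "{2}"] t unfolding tpow_wsp by blast
  have c: "s \<in> carrier (T B)" "braiding B s \<in> carrier (T B)" using s wsp_cl_tp[OF B.modA] lop_cl[OF B.lopC] by blast+
  have "braiding Q t = Tm B Q p (braiding B s)" using p(1) s unfolding bialg_mor_iff[OF B(1,2)] by simp
  then show ?thesis using f s c unfolding bialg_mor_iff[OF B(1,3)] by (simp add: TT)
 qed
 moreover have "comult B' (g x) = Tm Q B' g (comult Q x) \<and> counit B' (g x) = counit Q x" if x: "x \<in> carrier Q" for x
 proof -
  obtain x' where x': "x' \<in> carrier B" "x = p x'" using p(2) x by blast
  have "comult Q x = Tm B Q p (comult B x')" "counit Q x = counit B x'" using p(1) x' unfolding bialg_mor_iff[OF B(1,2)] by simp_all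
  then show ?thesis using f x' g unfolding bialg_mor_iff[OF B(1,3)] by (simp add: TT)
 qed
 ultimately show ?thesis using gh unfolding bialg_mor_iff[OF B(2,3)] by blast
qed

end

section \<open>Quotients of braided bialgebras by primitive relations\<close>

locale bialg_ideal = br_bialg K B + br_ideal K B "braiding B" S \<pi> for K :: "('k, 'z) ring_scheme" and B :: "('k, 'a) bialg" and S \<pi> +
 assumes SP: "S \<subseteq> prims K B"
begin

abbreviation "QB \<equiv> quot_bialg K B J"

lemma QB_sel: "carrier QB = carrier Q" "ring.add QB = ring.add Q" "smult QB = smult Q" "ring.zero QB = ring.zero Q"
 "monoid.mult QB = monoid.mult Q" "one QB = one Q" "comult QB = induced (carrier B) p (tsquare K B Q p \<circ> comult B)"
 "counit QB = induced (carrier B) p (counit B)" "braiding QB = induced (tp B 2) (tsquare K B Q p) (tsquare K B Q p \<circ> braiding B)"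
 by (simp_all add: quot_bialg_def Let_def module.defs bialg.defs)

lemmas same_QB = same_tensor[OF QB_sel(1-3)] same_mulT[OF QB_sel(1-3,5)]
lemmas Tm_QB = same_Tm[OF QB_sel(1-3)]

lemma algQB: "assoc_algebra K QB" by (rule same_alg[OF QB_sel(1-6) algQ])

lemma p_hom': "alg_hom K B QB p" using p_hom unfolding alg_hom_def lin_def ring_hom_def by (simp add: QB_sel)

lemma p_surj: "p ` carrier B = carrier QB" by (simp add: QB_sel quot_sel[OF alg idJ])

lemma lopQB: "lop QB 2 2 (braiding QB)"
 using cQ_lop lop_cong[OF modQ, of 2 "braiding QB" cQ 2] induced_cQ by (simp add: same_QB QB_sel(9))

lemma braiding_QB: "t \<in> tp B 2 ==> braiding QB (Tm B QB p t) = Tm B QB p (braiding B t)"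
 using induced_cQ[of "P2 t"] Tm_tp[OF modA modQ p_lin, of t 2] cQ_P2[of t] by (simp add: Tm_QB QB_sel(9))

lemma br_alg_QB: "br_alg K QB (braiding QB)"
 by (rule br_alg_surj[OF _ algQB p_hom' p_surj lopQB]) (use br_alg_axioms braiding_QB in auto)

text \<open>The quotient is already a braided algebra, so its braided tensor square exists and
  comultiplication followed by the projection is an algebra map into it. That map kills the
  generators because they are primitive, so its kernel, an ideal, contains J. The counit is treated
  the same way.\<close>

lemma comult_counit_J: assumes x: "x \<in> J" shows "Tm B QB p (comult B x) = \<zero>\<^bsub>T QB\<^esub>" "counit B x = \<zero>\<^bsub>K\<^esub>"
proof -
 interpret Q: br_alg K QB "braiding QB" by (rule br_alg_QB)
 let ?A2 = "braided_tensor_square K QB (braiding QB)" and ?P = "Tm B QB p"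
 note pl = alg_hom_lin[OF p_hom']
 note Pl = Tm_lin[OF modA Q.modA pl] and Pj = Tm_iota[OF modA Q.modA pl] and Pm = Tm_mult[OF modA Q.modA pl]
 have PC: "?P (C i t) = Q.C i (?P t)" if "t \<in> carrier TA" for i t
  by (rule Tm_sh[OF modA Q.modA pl lopC Q.lopC _ that]) (simp add: braiding_QB)
 note PM = Tm_M[OF alg Q.alg p_hom']
 have ct: "?P (comult B x) \<in> tp QB 2" if "x \<in> carrier B" for x by (rule Tm_tp[OF modA Q.modA pl comult_tp[OF that]])
 have "lin K B ?A2 (%x. ?P (comult B x))"
  using lin_comp'[OF comult_TA Pl] ct unfolding lin_def by (simp add: Q.A2_sel)
 then have h: "alg_hom K B ?A2 (%x. ?P (comult B x))"
 proof (rule alg_homI)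
  fix x y assume xy: "x \<in> carrier B" "y \<in> carrier B"
  then show "?P (comult B (x \<cdot>[B] y)) = ?P (comult B x) \<cdot>[?A2] ?P (comult B y)"
   unfolding Q.A2_mult[OF ct[OF xy(1)] ct[OF xy(2)]] comult_mult[OF xy] by (simp add: PM PC Pm)
 next
  show "?P (comult B \<one>\<^bsub>B\<^esub>) = \<one>\<^bsub>?A2\<^esub>" by (simp add: comult_one Pm Pj Q.A2_sel alg_hom_one[OF p_hom'])
 qed
 have h': "alg_hom K B (ground K) (counit B)"
  by (rule alg_homI[OF counit_lin]) (simp_all add: ground_def counit_mult counit_one)
 have "x \<in> carrier B \<and> ?P (comult B x) = \<zero>\<^bsub>?A2\<^esub> \<and> counit B x = \<zero>\<^bsub>ground K\<^esub>" if xS: "x \<in> S" for x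
 proof (intro conjI)
  have xP: "x \<in> P" and xJ: "x \<in> J" using xS SP gen_ideal_incl[OF alg S] by blast+
  show "x \<in> carrier B" using xP by simp
  show "counit B x = \<zero>\<^bsub>ground K\<^esub>" using prims_counit[OF xP] by (simp add: ground_def)
  have "p x = \<zero>\<^bsub>QB\<^esub>" using quot_proj_zero_iff[OF alg idJ, of x] xJ xP by (simp add: QB_sel)
  then have "\<iota> K QB (p x) = \<zero>\<^bsub>T QB\<^esub>" using lin_zero[OF iota_lin[OF Q.modA]] by simp
  then show "?P (comult B x) = \<zero>\<^bsub>?A2\<^esub>"
   unfolding prims_comult[OF xP] using xP by (simp add: lin_add[OF Pl] Pm Pj Q.A2_sel alg_hom_one[OF p_hom'])
 qed
 then have "S \<subseteq> {x \<in> carrier B. ?P (comult B x) = \<zero>\<^bsub>?A2\<^esub>}" "S \<subseteq> {x \<in> carrier B. counit B x = \<zero>\<^bsub>ground K\<^esub>}" by blast+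
 then have "J \<subseteq> {x \<in> carrier B. ?P (comult B x) = \<zero>\<^bsub>?A2\<^esub>}" "J \<subseteq> {x \<in> carrier B. counit B x = \<zero>\<^bsub>ground K\<^esub>}"
  using gen_ideal_min[OF alg _ alg_hom_ker_ideal[OF alg Q.A2_alg h]] gen_ideal_min[OF alg _ alg_hom_ker_ideal[OF alg alg_ground h']] by blast+
 then show "?P (comult B x) = \<zero>\<^bsub>T QB\<^esub>" "counit B x = \<zero>\<^bsub>K\<^esub>" using x by (auto simp: Q.A2_sel ground_def)
qed

lemma lin_J_eq: assumes f: "lin K B N f" "module K N" "\<And>x. x \<in> J ==> f x = \<zero>\<^bsub>N\<^esub>" and xy: "x \<in> carrier B" "y \<in> carrier B" "p y = p x"
 shows "f y = f x"
proof -
 have "y \<ominus>\<^bsub>B\<^esub> x \<in> J" using quot_proj_eq_iff[OF alg idJ] xy by blast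
 then have "f y \<ominus>\<^bsub>N\<^esub> f x = \<zero>\<^bsub>N\<^esub>" using f(3) lin_minus[OF f(1) modA f(2) xy(2,1)] by simp
 then show ?thesis using minus_eq_zero_iff[OF f(2) lin_cl[OF f(1) xy(2)] lin_cl[OF f(1) xy(1)]] by simp
qed

lemma comult_QB: assumes x: "x \<in> carrier B" shows "comult QB (p x) = Tm B QB p (comult B x)" "counit QB (p x) = counit B x"
proof -
 have mQ: "module K QB" using algQB by simp
 have sq: "tsquare K B Q p (comult B y) = Tm B QB p (comult B y)" if "y \<in> carrier B" for y
  using tsquare_Tm[OF modA modQ p_lin comult_tp[OF that]] by (simp add: Tm_QB)
 have "comult QB (p x) = (tsquare K B Q p \<circ> comult B) x" unfolding QB_sel
 proof (rule induced_eq[OF x])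
  fix y assume y: "y \<in> carrier B" "p y = p x"
  have "Tm B QB p (comult B y) = Tm B QB p (comult B x)"
   by (rule lin_J_eq[OF lin_comp'[OF comult_TA Tm_lin[OF modA mQ alg_hom_lin[OF p_hom']]] _ comult_counit_J(1) x y]) (use mQ in simp)
  then show "(tsquare K B Q p \<circ> comult B) y = (tsquare K B Q p \<circ> comult B) x" using sq x y by simp
 qed
 then show "comult QB (p x) = Tm B QB p (comult B x)" using sq[OF x] by simp
 show "counit QB (p x) = counit B x" unfolding QB_sel
 proof (rule induced_eq[OF x])
  fix y assume y: "y \<in> carrier B" "p y = p x"
  show "counit B y = counit B x"
   by (rule lin_J_eq[OF counit_lin module_ground _ x y]) (simp add: comult_counit_J(2) ground_def)
 qed
qed

lemma br_bialg_QB: "br_bialg K QB"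
 by (rule br_bialg_surj[OF _ br_alg_QB p_hom' p_surj]) (use br_bialg_axioms braiding_QB comult_QB in auto)

lemma p_mor: "bialg_mor K B QB p"
 unfolding bialg_mor_iff[OF br_bialg_axioms br_bialg_QB] using p_hom' braiding_QB comult_QB by simp

end

section \<open>One stage of the construction\<close>

text \<open>
 The two brackets of the theorem are instances of one construction: \<open>V\<close> is a subspace of \<open>A\<close>
 closed under the braiding, either \<open>A\<close> itself or the space of primitive elements of \<open>A\<close>, and
 \<open>\<psi>\<close> is the map from the current stage to \<open>A\<close> whose restriction to primitive elements is the bracket.
\<close>

locale base = fld K for K :: "('k, 'z) ring_scheme" +
 fixes V :: "('k, 'a, 'm) module_scheme" and cV and A :: "('k, 'a) bialg" and r
 assumes bvsV: "braided_vs K V cV" and brA: "br_alg K A (braiding A)" and incl: "lin K V A id"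
  and r_lin: "lin K A V r" and r_id: "x \<in> carrier V ==> r x = x"
  and cVA: "t \<in> tp V 2 ==> braiding A (Tm V A id t) = Tm V A id (cV t)"
  and VA: "carrier V = carrier A \<or> br_bialg K A \<and> carrier V = prims K A"
begin

lemma modV: "module K V" and lopV: "lop V 2 2 cV" using bvsV by (simp_all add: braided_vs_iff)

sublocale A: br_alg K A "braiding A" by (rule brA)

end

text \<open>The invariant of the recursion: \<open>B\<close> is the current bialgebra,
  \<open>k\<close> the map from V into it, and \<open>gen\<close> says that k(V) generates
  \<open>B\<close> as an algebra. The condition \<open>mor\<close> is conditional because for V = A
  the map \<open>\<psi>\<close> is only known to be a braided algebra map; for V = P(A) it must be a
  bialgebra map to send primitive elements into V.\<close>

locale stage = base K V cV A r + br_bialg K B for K :: "('k, 'z) ring_scheme"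
  and V :: "('k, 'a, 'm) module_scheme" and cV and A :: "('k, 'a) bialg" and r and B :: "('k, 'u) bialg" +
 fixes k \<psi>
 assumes k_lin: "lin K V B k" and k_prim: "v \<in> carrier V ==> k v \<in> prims K B"
  and k_br: "t \<in> tp V 2 ==> braiding B (Tm V B k t) = Tm V B k (cV t)"
  and gen: "submodule H K B ==> \<one>\<^bsub>B\<^esub> \<in> H ==> (\<And>v a. v \<in> carrier V ==> a \<in> H ==> k v \<cdot>[B] a \<in> H) ==> carrier B \<subseteq> H"
  and \<psi>_hom: "alg_hom K B A \<psi>" and \<psi>_br: "s \<in> tp B 2 ==> braiding A (Tm B A \<psi> s) = Tm B A \<psi> (braiding B s)"
  and \<psi>_k: "v \<in> carrier V ==> \<psi> (k v) = v"
  and mor: "br_bialg K A ==> carrier V = prims K A ==> bialg_mor K B A \<psi>"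
begin

notation mult_TB (infixr "*" 75)

lemmas \<psi>_lin = alg_hom_lin[OF \<psi>_hom]
lemma k_cl [simp]: "v \<in> carrier V ==> k v \<in> carrier B" by (rule lin_cl[OF k_lin])
lemma \<psi>_cl [simp]: "x \<in> carrier B ==> \<psi> x \<in> carrier A" by (rule lin_cl[OF \<psi>_lin])
lemma r_cl [simp]: "x \<in> carrier A ==> r x \<in> carrier V" by (rule lin_cl[OF r_lin])

lemma \<psi>_prim: assumes x: "x \<in> P" shows "\<psi> x \<in> carrier V"
 using VA
proof
 assume "carrier V = carrier A" then show ?thesis using x by simp
next
 assume *: "br_bialg K A \<and> carrier V = prims K A"
 then have "\<psi> x \<in> prims K A" using bialg_mor_prims[OF br_bialg_axioms _ _ x] mor by blast
 then show ?thesis using * by simp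
qed

text \<open>The map i b, extended from primitive elements to all of B by the projection
  \<open>rP\<close> and the retraction \<open>r\<close>, so that it can be applied to a tensor
  factor. The companion \<open>fV\<close> is a projection of B onto k(V).\<close>

definition "f = (%x. k (r (\<psi> (rP x))))"
definition "fV = (%x. k (r (\<psi> x)))"

lemma f_lin: "lin K B B f" unfolding f_def by (rule lin_comp'[OF lin_comp'[OF lin_comp'[OF rP(1) \<psi>_lin] r_lin] k_lin])
lemma fV_lin: "lin K B B fV" unfolding fV_def by (rule lin_comp'[OF lin_comp'[OF \<psi>_lin r_lin] k_lin])

lemma f_prim: "x \<in> P ==> f x = k (\<psi> x)" by (simp add: f_def rP(3) r_id \<psi>_prim)
lemma fV_k: "v \<in> carrier V ==> fV (k v) = k v" by (simp add: fV_def \<psi>_k r_id)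
lemma f_cl [simp]: "x \<in> carrier B ==> f x \<in> carrier B" by (rule lin_cl[OF f_lin])
lemma fV_cl [simp]: "x \<in> carrier B ==> fV x \<in> carrier B" by (rule lin_cl[OF fV_lin])
lemma fVE: assumes "x \<in> carrier B" obtains v where "v \<in> carrier V" "fV x = k v"
 using that[of "r (\<psi> x)"] assms by (simp add: fV_def)

abbreviation "f' i \<equiv> Fa f i"
abbreviation "g' i \<equiv> Fa fV i"
lemmas f'_lin = F_lin[OF f_lin] and g'_lin = F_lin[OF fV_lin] and RP_lin = F_lin[OF rP(1)]
lemmas pures = F_pure[OF f_lin] F_pure[OF fV_lin] F_pure[OF rP(1)]

lemma tp3R: "s \<in> tp B 2 ==> a \<in> carrier B ==> s * j a \<in> tp B 3"
 by (rule tp_mult[OF modA _ iota_tp(1)[OF modA]]) simp_all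

lemma tp3L: "s \<in> tp B 2 ==> a \<in> carrier B ==> j a * s \<in> tp B 3"
 by (rule iota_mult_tp[where n = 2]) simp_all

lemma C2: "x \<in> carrier B ==> y \<in> carrier B ==> C 0 (j x * j y) \<in> tp B 2"
 by (rule C_tp) simp

lemma tc: "s \<in> tp B n ==> s \<in> carrier TA" by (rule wsp_cl_tp[OF modA])

lemma M0_eq: assumes "a \<in> carrier B" "b \<in> carrier B" "y \<in> carrier B"
 shows "C 0 (j (a \<cdot>[B] b) * j y) = M 1 (C 0 (j a * C 0 (j b * j y)))"
proof -
 have "C 1 (j a * (j b * j y)) = j a * C 0 (j b * j y)" using assms by (simp add: ats)
 then show ?thesis using CM0[OF tp3L[of "j b * j y" a]] assms by (simp add: M_mult)
qed

lemma M1_eq: assumes "a \<in> carrier B" "b \<in> carrier B" "y \<in> carrier B"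
 shows "C 0 (j y * j (a \<cdot>[B] b)) = M 0 (C 1 (C 0 (j y * j a) * j b))"
proof -
 have jj: "j y * j a \<in> tp B 2" using assms by simp
 have "C 0 ((j y * j a) * j b) = C 0 (j y * j a) * j b"
  using sh_right[OF modA lopC, of "j y * j a" 0 "j b"] tp_tge[OF jj, of 2] assms by simp
 moreover have "j y * j (a \<cdot>[B] b) = M 1 ((j y * j a) * j b)" using assms by (simp add: M_mult' ats Tassoc)
 ultimately show ?thesis using CM1[OF tp3R[OF jj assms(2)]] by simp
qed

lemma F_M1: "lin K B B g ==> t \<in> tp B 3 ==> Fa g 0 (M 1 t) = M 1 (Fa g 0 t)"
 by (rule far[OF lopF lopM]) (simp_all add: tp_tge[of t B 3])

lemma F_M0: "lin K B B g ==> t \<in> tp B 3 ==> Fa g 1 (M 0 t) = M 0 (Fa g 2 t)"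
 by (rule far[OF lopM lopF, symmetric]) (simp_all add: tp_tge[of t B 3] numeral_3_eq_3[symmetric])

lemma C_right: "s \<in> tp B 2 ==> a \<in> carrier B ==> C 0 (s * j a) = C 0 s * j a"
 using sh_right[OF modA lopC, of s 0 "j a"] tp_tge[of s B 2 2] by simp

lemma F_right: "lin K B B g ==> s \<in> tp B 2 ==> a \<in> carrier B ==> i < 2 ==> Fa g i (s * j a) = Fa g i s * j a"
 using sh_right[OF modA lopF, of g s i "j a"] tp_tge[of s B 2 "i + Suc 0"] by simp

lemma F_left: "lin K B B g ==> s \<in> tp B 2 ==> a \<in> carrier B ==> Fa g (Suc i) (j a * s) = j a * Fa g i s"
 using sh_Suc[OF lopF, of g a s i] tc[of s] by simp

lemma C_left: "s \<in> tp B 2 ==> a \<in> carrier B ==> C (Suc i) (j a * s) = j a * C i s"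
 using sh_Suc[OF lopC, of a s i] tc[of s] by simp

lemma k2: assumes "v \<in> carrier V" "u \<in> carrier V" shows "C 0 (j (k v) * j (k u)) = Tm V B k (cV (\<iota> K V v *[V] \<iota> K V u))"
 using k_br[of "\<iota> K V v *[V] \<iota> K V u"] C_base[of "j (k v) * j (k u)"] assms modV
 by (simp add: Tm_mult[OF modV modA k_lin] Tm_iota[OF modV modA k_lin])

lemma g'_k: assumes t: "t \<in> tp V 2" and i: "i < 2" shows "g' i (Tm V B k t) = Tm V B k t"
proof (rule tp2_lin_eq[OF t modV])
 show "lin K (tpm1 V 2) TA (%t. g' i (Tm V B k t))" "lin K (tpm1 V 2) TA (Tm V B k)"
  by (rule lin_sub[OF lin_comp'[OF Tm_lin[OF modV modA k_lin] g'_lin]] lin_sub[OF Tm_lin[OF modV modA k_lin]], use wsp_cl_tp[OF modV] in auto)+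
 fix x y assume "x \<in> carrier V" "y \<in> carrier V"
 then show "g' i (Tm V B k (\<iota> K V x *[V] \<iota> K V y)) = Tm V B k (\<iota> K V x *[V] \<iota> K V y)"
  using i modV by (cases i) (simp_all add: pures Tm_mult[OF modV modA k_lin] Tm_iota[OF modV modA k_lin] fV_k)
qed simp

lemma g'_kk: assumes "v \<in> carrier V" "u \<in> carrier V" "i < 2" shows "g' i (C 0 (j (k v) * j (k u))) = C 0 (j (k v) * j (k u))"
 unfolding k2[OF assms(1,2)] by (rule g'_k[OF lop_cl[OF lopV]]) (use assms modV in simp_all)

lemma gen_eq:
 assumes f: "\<And>w. w \<in> W ==> lin K B TA (%x. FF w x)" and g: "\<And>w. w \<in> W ==> lin K B TA (%x. GG w x)"
  and one: "\<And>w. w \<in> W ==> FF w \<one>\<^bsub>B\<^esub> = GG w \<one>\<^bsub>B\<^esub>"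
  and step: "\<And>v a w. v \<in> carrier V ==> a \<in> carrier B ==> (\<And>w. w \<in> W ==> FF w a = GG w a) ==> w \<in> W ==>
   FF w (k v \<cdot>[B] a) = GG w (k v \<cdot>[B] a)"
  and x: "x \<in> carrier B" and w: "w \<in> W"
 shows "FF w x = GG w x"
proof -
 let ?H = "{x \<in> carrier B. \<forall>w\<in>W. FF w x = GG w x}"
 have "submodule ?H K B"
 proof (rule submI[OF modA])
  show "\<zero>\<^bsub>B\<^esub> \<in> ?H" using lin_zero[OF f] lin_zero[OF g] by simp
  show "x +[B] y \<in> ?H" if "x \<in> ?H" "y \<in> ?H" for x y using that lin_add[OF f] lin_add[OF g] by simp
  show "a *:[B] x \<in> ?H" if "a \<in> carrier K" "x \<in> ?H" for a x using that lin_smult[OF f] lin_smult[OF g] by simp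
 qed blast
 moreover have "\<one>\<^bsub>B\<^esub> \<in> ?H" using one by simp
 moreover have "k v \<cdot>[B] a \<in> ?H" if "v \<in> carrier V" "a \<in> ?H" for v a using step[OF that(1)] that by simp
 ultimately have "carrier B \<subseteq> ?H" by (rule gen)
 then show ?thesis using x w by blast
qed

lemma jr: "y \<in> carrier B ==> lin K B TA (%x. j x * j y)" and jl: "y \<in> carrier B ==> lin K B TA (%x. j y * j x)"
 by (rule lin_mult_right lin_mult_left, simp_all add: iota_lin)+

lemmas C_linr = lin_comp'[OF jr C_lin] and C_linl = lin_comp'[OF jl C_lin]

lemma one_C: "y \<in> carrier B ==> C 0 (e * j y) = j y * e" "y \<in> carrier B ==> C 0 (j y * e) = e * j y"
 using C_base[of "e * j y"] C_base[of "j y * e"] CU0[of y] CU1[of y] by simp_all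

text \<open>The braiding maps B \<otimes> k(V) into k(V) \<otimes> B: it preserves k(V) \<otimes>
  k(V) because \<open>k\<close> is braided, and k(V) generates B, so the product rule extends this
  one generator at a time.\<close>

lemma g'_left: assumes x: "x \<in> carrier B" and v: "v \<in> carrier V" shows "g' 0 (C 0 (j x * j (k v))) = C 0 (j x * j (k v))"
proof (rule gen_eq[where W = "carrier V" and GG = "%v x. C 0 (j x * j (k v))", OF lin_comp'[OF C_linr g'_lin] C_linr _ _ x v])
 show "g' 0 (C 0 (e * j (k v))) = C 0 (e * j (k v))" if "v \<in> carrier V" for v
  using that by (simp add: one_C pures fV_k)
 fix u a v assume u: "u \<in> carrier V" and a: "a \<in> carrier B" and v: "v \<in> carrier V"
  and IH: "\<And>v. v \<in> carrier V ==> g' 0 (C 0 (j a * j (k v))) = C 0 (j a * j (k v))"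
 define s where "s = C 0 (j a * j (k v))"
 have s: "s \<in> tp B 2" unfolding s_def using a v by (intro C2) simp_all
 have eq: "g' 0 (C 0 (j (k u) * g' 0 s)) = C 0 (j (k u) * g' 0 s)" if s: "s \<in> tp B 2" for s
 proof (rule tp2_eqI[OF s])
  have l: "lin K TA TA (%s. C 0 (j (k u) * g' 0 s))" by (rule lin_comp'[OF lin_mult_left[OF _ _ g'_lin] C_lin]) (use u in simp_all)
  show "lin K TA TA (%s. g' 0 (C 0 (j (k u) * g' 0 s)))" "lin K TA TA (%s. C 0 (j (k u) * g' 0 s))" by (rule lin_comp'[OF l g'_lin], rule l)
  fix x y assume x: "x \<in> carrier B" and y: "y \<in> carrier B"
  obtain v where v: "v \<in> carrier V" "fV x = k v" by (rule fVE[OF x])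
  have "C 0 (j (k u) * (j (k v) * j y)) = C 0 (j (k u) * j (k v)) * j y" using C_right[of "j (k u) * j (k v)" y] u v y by (simp add: Tassoc)
  then show "g' 0 (C 0 (j (k u) * g' 0 (j x * j y))) = C 0 (j (k u) * g' 0 (j x * j y))"
   using F_right[OF fV_lin C2[of "k u" "k v"] y, of 0] g'_kk[OF u v(1), of 0] u v x y by (simp add: pures)
 qed
 have "g' 0 (C 0 (j (k u) * s)) = C 0 (j (k u) * s)" using eq[OF s] IH[OF v] unfolding s_def by simp
 then show "g' 0 (C 0 (j (k u \<cdot>[B] a) * j (k v))) = C 0 (j (k u \<cdot>[B] a) * j (k v))"
  using M0_eq[of "k u" a "k v", folded s_def] F_M1[OF fV_lin C_tp[OF tp3L[OF s]], of "k u" 0] u a v by simp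
qed (use k_cl in auto)

lemma g'_right: assumes x: "x \<in> carrier B" and v: "v \<in> carrier V" shows "g' 1 (C 0 (j (k v) * j x)) = C 0 (j (k v) * j x)"
proof (rule gen_eq[where W = "carrier V" and GG = "%v x. C 0 (j (k v) * j x)", OF lin_comp'[OF C_linl g'_lin] C_linl _ _ x v])
 show "g' 1 (C 0 (j (k v) * e)) = C 0 (j (k v) * e)" if "v \<in> carrier V" for v
  using that by (simp add: one_C pures fV_k)
 fix u a v assume u: "u \<in> carrier V" and a: "a \<in> carrier B" and v: "v \<in> carrier V"
  and IH: "\<And>v. v \<in> carrier V ==> g' 1 (C 0 (j (k v) * j a)) = C 0 (j (k v) * j a)"
 define s where "s = C 0 (j (k v) * j (k u))"
 have s: "s \<in> tp B 2" unfolding s_def using u v by (intro C2) simp_all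
 have eq: "g' 2 (C 1 (g' 1 s * j a)) = C 1 (g' 1 s * j a)" if s: "s \<in> tp B 2" for s
 proof (rule tp2_eqI[OF s])
  have l: "lin K TA TA (%s. C 1 (g' 1 s * j a))" by (rule lin_comp'[OF lin_mult_right[OF _ _ g'_lin] C_lin]) (use a in simp_all)
  show "lin K TA TA (%s. g' 2 (C 1 (g' 1 s * j a)))" "lin K TA TA (%s. C 1 (g' 1 s * j a))" by (rule lin_comp'[OF l g'_lin], rule l)
  fix x y assume x: "x \<in> carrier B" and y: "y \<in> carrier B"
  obtain w where w: "w \<in> carrier V" "fV y = k w" by (rule fVE[OF y])
  have c: "C 0 (j (k w) * j a) \<in> tp B 2" using w a by (intro C2) simp_all
  have 1: "C 1 (j x * (j (k w) * j a)) = j x * C 0 (j (k w) * j a)" using C_left[of "j (k w) * j a" x 0] w a x by simp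
  have "g' 2 (j x * C 0 (j (k w) * j a)) = j x * g' 1 (C 0 (j (k w) * j a))" using F_left[OF fV_lin c x, of 1] by simp
  then show "g' 2 (C 1 (g' 1 (j x * j y) * j a)) = C 1 (g' 1 (j x * j y) * j a)"
   using 1 IH[OF w(1)] w x y a by (simp add: pures Tassoc)
 qed
 have "g' 2 (C 1 (s * j a)) = C 1 (s * j a)" using eq[OF s] g'_kk[OF v u, of 1] unfolding s_def by simp
 then show "g' 1 (C 0 (j (k v) * j (k u \<cdot>[B] a))) = C 0 (j (k v) * j (k u \<cdot>[B] a))"
  using M1_eq[of "k u" a "k v", folded s_def] F_M0[OF fV_lin C_tp[OF tp3R[OF s]], of a 1] u a v by simp
qed (use k_cl in auto)

abbreviation "T\<psi> \<equiv> Tm B A \<psi>"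
abbreviation "Tk \<equiv> Tm A B (%x. k (r x))"

lemmas kr_lin = lin_comp'[OF r_lin k_lin]
lemmas T\<psi>_lin = Tm_lin[OF modA A.modA \<psi>_lin] and T\<psi>_m = Tm_mult[OF modA A.modA \<psi>_lin] and T\<psi>_j = Tm_iota[OF modA A.modA \<psi>_lin]

text \<open>\<open>\<psi> \<otimes> \<psi>\<close> is injective on \<open>k(V) \<otimes> k(V)\<close>, with inverse \<open>Tk\<close>.\<close>

lemma Tk_T\<psi>: assumes t: "t \<in> tp B 2" and g: "g' 0 t = t" "g' 1 t = t" shows "Tk (T\<psi> t) = t"
proof -
 have "Tk (T\<psi> t) = Tm B B fV t" unfolding fV_def by (rule Tm_Tm[OF modA A.modA modA \<psi>_lin kr_lin tc[OF t]])
 also have "\<dots> = g' 1 (g' 0 t)"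
  by (rule tp2_eqI[OF t Tm_lin[OF modA modA fV_lin] lin_comp'[OF g'_lin g'_lin]])
   (simp_all add: pures Tm_mult[OF modA modA fV_lin] Tm_iota[OF modA modA fV_lin])
 finally show ?thesis using g by simp
qed

lemma T\<psi>_f: assumes t: "t \<in> tp B 2" and i: "i < 2" shows "T\<psi> (f' i t) = T\<psi> (RP i t)"
proof (rule tp2_lin_eq[OF t modA])
 show "lin K (tpm1 B 2) (T A) (%t. T\<psi> (f' i t))" "lin K (tpm1 B 2) (T A) (%t. T\<psi> (RP i t))"
  by (rule lin_sub[OF lin_comp'[OF f'_lin T\<psi>_lin]] lin_sub[OF lin_comp'[OF RP_lin T\<psi>_lin]], use tc in auto)+
 have p: "\<psi> (f z) = \<psi> (rP z)" if "z \<in> carrier B" for z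
  using that rP(2)[OF that] by (simp add: f_def \<psi>_k \<psi>_prim r_id)
 fix x y assume x: "x \<in> carrier B" and y: "y \<in> carrier B"
 then show "T\<psi> (f' i (j x * j y)) = T\<psi> (RP i (j x * j y))"
  using i rP(2)[OF x] rP(2)[OF y] by (cases i) (simp_all add: pures T\<psi>_m T\<psi>_j p)
qed simp

lemma T\<psi>_C: "t \<in> tp B 2 ==> T\<psi> (C 0 t) = braiding A (T\<psi> t)"
 by (simp add: C_base \<psi>_br)

lemma g'_f: assumes t: "t \<in> tp B 2" and i: "i < 2" shows "g' i (f' i t) = f' i t"
proof (rule tp2_eqI[OF t lin_comp'[OF f'_lin g'_lin] f'_lin])
 have p: "fV (f z) = f z" if "z \<in> carrier B" for z using that by (simp add: f_def fV_k rP(2))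
 fix x y assume "x \<in> carrier B" "y \<in> carrier B"
 then show "g' i (f' i (j x * j y)) = f' i (j x * j y)" using i by (cases i) (simp_all add: pures p)
qed

lemma g'f': assumes t: "t \<in> tp B 2" shows "g' 0 (f' 1 t) = f' 1 (g' 0 t)" "g' 1 (f' 0 t) = f' 0 (g' 1 t)"
 by (rule tp2_eqI[OF t lin_comp'[OF f'_lin g'_lin] lin_comp'[OF g'_lin f'_lin]], simp add: pures)+

text \<open>Both sides lie in k(V) \<otimes> k(V), the left one because c(P \<otimes> k(V)) has
  second factors in P, which \<open>f\<close> sends to k(V). There \<open>\<psi>\<close> \<otimes>
  \<open>\<psi>\<close> may be applied before comparing; as \<open>\<psi>\<close> does not
  distinguish \<open>f\<close> from \<open>rP\<close>, both sides become the same braiding in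
  A.\<close>

lemma C_f_k: assumes x: "x \<in> P" and v: "v \<in> carrier V"
 shows "f' 1 (C 0 (j x * j (k v))) = C 0 (j (f x) * j (k v))" "f' 0 (C 0 (j (k v) * j x)) = C 0 (j (k v) * j (f x))"
proof -
 have xc: "x \<in> carrier B" and fx: "f x = k (\<psi> x)" "\<psi> x \<in> carrier V" and kv: "k v \<in> carrier B" using x v f_prim \<psi>_prim by simp_all
 have \<psi>f: "\<psi> (f x) = \<psi> x" using fx by (simp add: \<psi>_k)
 define w where "w = C 0 (j x * j (k v))"
 have w: "w \<in> tp B 2" "g' 0 w = w" "RP 1 w = w"
  unfolding w_def using C2[OF xc kv] g'_left[OF xc v] C_prim(1)[OF x kv] by simp_all
 have "f' 1 w = Tk (T\<psi> (f' 1 w))"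
  by (rule Tk_T\<psi>[symmetric]) (use w g'f'(1)[OF w(1)] g'_f[OF w(1), of 1] F_tp[OF f_lin w(1)] in simp_all)
 also have "T\<psi> (f' 1 w) = T\<psi> (C 0 (j (f x) * j (k v)))"
  using T\<psi>_f[OF w(1), of 1] w(3) T\<psi>_C[of "j x * j (k v)"] T\<psi>_C[of "j (f x) * j (k v)"] xc kv
  by (simp add: w_def T\<psi>_m T\<psi>_j \<psi>f)
 also have "Tk (T\<psi> (C 0 (j (f x) * j (k v)))) = C 0 (j (f x) * j (k v))"
  unfolding fx by (rule Tk_T\<psi>) (use g'_kk[OF fx(2) v] C2 fx v in simp_all)
 finally show "f' 1 (C 0 (j x * j (k v))) = C 0 (j (f x) * j (k v))" unfolding w_def .
 define z where "z = C 0 (j (k v) * j x)"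
 have z: "z \<in> tp B 2" "g' 1 z = z" "RP 0 z = z"
  unfolding z_def using C2[OF kv xc] g'_right[OF xc v] C_prim(2)[OF x kv] by simp_all
 have "f' 0 z = Tk (T\<psi> (f' 0 z))"
  by (rule Tk_T\<psi>[symmetric]) (use z g'f'(2)[OF z(1)] g'_f[OF z(1), of 0] F_tp[OF f_lin z(1)] in simp_all)
 also have "T\<psi> (f' 0 z) = T\<psi> (C 0 (j (k v) * j (f x)))"
  using T\<psi>_f[OF z(1), of 0] z(3) T\<psi>_C[of "j (k v) * j x"] T\<psi>_C[of "j (k v) * j (f x)"] xc kv
  by (simp add: z_def T\<psi>_m T\<psi>_j \<psi>f)
 also have "Tk (T\<psi> (C 0 (j (k v) * j (f x)))) = C 0 (j (k v) * j (f x))"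
  unfolding fx by (rule Tk_T\<psi>) (use g'_kk[OF v fx(2)] C2 fx v in simp_all)
 finally show "f' 0 (C 0 (j (k v) * j x)) = C 0 (j (k v) * j (f x))" unfolding z_def .
qed

text \<open>Induction on y along generators. The generator is handled by \<open>C_f_k\<close>; as
  braiding leaves a primitive second factor behind, the hypothesis for all primitive elements
  applies to the rest.\<close>

lemma C_f_right: assumes x: "x \<in> P" and y: "y \<in> carrier B" shows "f' 1 (C 0 (j x * j y)) = C 0 (j (f x) * j y)"
proof (rule gen_eq[where W = P and GG = "%x y. C 0 (j (f x) * j y)", OF lin_comp'[OF C_linl f'_lin] C_linl _ _ y x])
 show "f' 1 (C 0 (j x * e)) = C 0 (j (f x) * e)" if "x \<in> P" for x
  using that by (simp add: one_C pures)
 fix v a x assume v: "v \<in> carrier V" and a: "a \<in> carrier B" and x: "x \<in> P"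
  and IH: "\<And>x. x \<in> P ==> f' 1 (C 0 (j x * j a)) = C 0 (j (f x) * j a)"
 have xc: "x \<in> carrier B" and kv: "k v \<in> carrier B" using x v by simp_all
 define w where "w = C 0 (j x * j (k v))"
 have w: "w \<in> tp B 2" unfolding w_def by (rule C2[OF xc kv])
 have eq: "f' 2 (C 1 (RP 1 w * j a)) = C 1 (f' 1 (RP 1 w) * j a)" if w: "w \<in> tp B 2" for w
 proof (rule tp2_eqI[OF w])
  show "lin K TA TA (%w. f' 2 (C 1 (RP 1 w * j a)))" "lin K TA TA (%w. C 1 (f' 1 (RP 1 w) * j a))"
   using a by (intro lin_comp'[OF lin_comp'[OF lin_mult_right[OF _ _ RP_lin] C_lin] f'_lin] lin_comp'[OF lin_mult_right[OF _ _ lin_comp'[OF RP_lin f'_lin]] C_lin], simp_all)+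
  fix b q assume b: "b \<in> carrier B" and q: "q \<in> carrier B"
  have rq: "rP q \<in> P" "rP q \<in> carrier B" using rP(2)[OF q] by simp_all
  have 1: "C 1 (j b * (j (rP q) * j a)) = j b * C 0 (j (rP q) * j a)" using C_left[of "j (rP q) * j a" b 0] rq a b by simp
  have 2: "C 1 (j b * (j (f (rP q)) * j a)) = j b * C 0 (j (f (rP q)) * j a)" using C_left[of "j (f (rP q)) * j a" b 0] rq a b by simp
  have "f' 2 (j b * C 0 (j (rP q) * j a)) = j b * f' 1 (C 0 (j (rP q) * j a))" using F_left[OF f_lin C2[OF rq(2) a] b, of 1] by simp
  then show "f' 2 (C 1 (RP 1 (j b * j q) * j a)) = C 1 (f' 1 (RP 1 (j b * j q)) * j a)"
   using 1 2 IH[OF rq(1)] b q rq a by (simp add: pures Tassoc)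
 qed
 have "f' 2 (C 1 (w * j a)) = C 1 (C 0 (j (f x) * j (k v)) * j a)"
  using eq[OF w] C_prim(1)[OF x kv] C_f_k(1)[OF x v] unfolding w_def by simp
 then show "f' 1 (C 0 (j x * j (k v \<cdot>[B] a))) = C 0 (j (f x) * j (k v \<cdot>[B] a))"
  using M1_eq[of "k v" a x, folded w_def] M1_eq[of "k v" a "f x"] F_M0[OF f_lin C_tp[OF tp3R[OF w a]], of 1] xc a kv by simp
qed (use prims_cl in auto)

lemma C_f_left: assumes x: "x \<in> P" and y: "y \<in> carrier B" shows "f' 0 (C 0 (j y * j x)) = C 0 (j y * j (f x))"
proof (rule gen_eq[where W = P and GG = "%x y. C 0 (j y * j (f x))", OF lin_comp'[OF C_linr f'_lin] C_linr _ _ y x])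
 show "f' 0 (C 0 (e * j x)) = C 0 (e * j (f x))" if "x \<in> P" for x
  using that by (simp add: one_C pures)
 fix v a x assume v: "v \<in> carrier V" and a: "a \<in> carrier B" and x: "x \<in> P"
  and IH: "\<And>x. x \<in> P ==> f' 0 (C 0 (j a * j x)) = C 0 (j a * j (f x))"
 have xc: "x \<in> carrier B" and kv: "k v \<in> carrier B" using x v by simp_all
 define s where "s = C 0 (j a * j x)"
 have s: "s \<in> tp B 2" unfolding s_def by (rule C2[OF a xc])
 have eq: "f' 0 (C 0 (j (k v) * RP 0 s)) = C 0 (j (k v) * f' 0 (RP 0 s))" if s: "s \<in> tp B 2" for s
 proof (rule tp2_eqI[OF s])
  show "lin K TA TA (%s. f' 0 (C 0 (j (k v) * RP 0 s)))" "lin K TA TA (%s. C 0 (j (k v) * f' 0 (RP 0 s)))"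
   using kv by (intro lin_comp'[OF lin_comp'[OF lin_mult_left[OF _ _ RP_lin] C_lin] f'_lin] lin_comp'[OF lin_mult_left[OF _ _ lin_comp'[OF RP_lin f'_lin]] C_lin], simp_all)+
  fix q b assume q: "q \<in> carrier B" and b: "b \<in> carrier B"
  have rq: "rP q \<in> P" "rP q \<in> carrier B" using rP(2)[OF q] by simp_all
  have 1: "C 0 (j (k v) * (j (rP q) * j b)) = C 0 (j (k v) * j (rP q)) * j b"
   using C_right[of "j (k v) * j (rP q)" b] kv rq b by (simp add: Tassoc)
  have 2: "C 0 (j (k v) * (j (f (rP q)) * j b)) = C 0 (j (k v) * j (f (rP q))) * j b"
   using C_right[of "j (k v) * j (f (rP q))" b] kv rq b by (simp add: Tassoc)
  have "f' 0 (C 0 (j (k v) * j (rP q)) * j b) = f' 0 (C 0 (j (k v) * j (rP q))) * j b" using F_right[OF f_lin C2[OF kv rq(2)] b, of 0] by simp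
  then show "f' 0 (C 0 (j (k v) * RP 0 (j q * j b))) = C 0 (j (k v) * f' 0 (RP 0 (j q * j b)))"
   using 1 2 C_f_k(2)[OF rq(1) v] b q rq by (simp add: pures)
 qed
 have "f' 0 (C 0 (j (k v) * s)) = C 0 (j (k v) * C 0 (j a * j (f x)))"
  using eq[OF s] C_prim(2)[OF x a] IH[OF x] unfolding s_def by simp
 then show "f' 0 (C 0 (j (k v \<cdot>[B] a) * j x)) = C 0 (j (k v \<cdot>[B] a) * j (f x))"
  using M0_eq[of "k v" a x, folded s_def] M0_eq[of "k v" a "f x"] F_M1[OF f_lin C_tp[OF tp3L[OF s kv]], of 0] xc a kv by simp
qed (use prims_cl in auto)

end

context fld begin

lemma Tm_same:
 assumes "carrier W = carrier V" "ring.add W = ring.add V" "smult W = smult V"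
 shows "Tm W U f = Tm V U f"
 unfolding Tm_def by (simp add: same_tensor[OF assms] assms)

end

section \<open>Passage to the next stage and the bracket conditions\<close>

context stage begin

definition "S = {x \<ominus>\<^bsub>B\<^esub> k (\<psi> x) | x. x \<in> P}"

lemma S_f: "y \<in> S ==> \<exists>x\<in>P. y = x \<ominus>\<^bsub>B\<^esub> f x" unfolding S_def using f_prim by auto

lemma S_prims: "S \<subseteq> P"
 unfolding S_def a_minus_def using subm_add[OF modA prims_subm] subm_neg[OF modA prims_subm] \<psi>_prim k_prim by auto

lemma S_cl: "S \<subseteq> carrier B" using S_prims by auto

text \<open>A projection \<open>q\<close> onto the ideal exists, and \<open>\<pi>\<close> is the
  complementary projection. What has to be shown is that the braiding is compatible with the
  generators of the ideal, and this follows from the commutation of \<open>f\<close> with the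
  braiding.\<close>

lemma ex_ideal: "\<exists>\<pi>. bialg_ideal K B S \<pi>"
proof -
 let ?J = "genideal B S"
 have J: "submodule ?J K B" by (rule ideal_subm[OF alg gen_ideal[OF alg S_cl]])
 obtain q where q: "lin K B B q" "\<forall>x\<in>carrier B. q x \<in> ?J" "\<forall>x\<in>?J. q x = x" using subspace_projection[OF modA J] by blast
 define \<pi> where "\<pi> x = x \<ominus>\<^bsub>B\<^esub> q x" for x
 have \<pi>: "lin K B B \<pi>" unfolding \<pi>_def by (rule lin_diff[OF modA lin_id(2) q(1)])
 have Jc: "x \<in> carrier B" if "x \<in> ?J" for x using subm_subset[OF J] that by blast
 have \<pi>0: "\<pi> x = \<zero>\<^bsub>B\<^esub>" if "x \<in> ?J" for x using q(3) that Jc[OF that] by (simp add: \<pi>_def)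
 have \<pi>1: "x \<ominus>\<^bsub>B\<^esub> \<pi> x \<in> ?J" if x: "x \<in> carrier B" for x
 proof -
  have qc: "q x \<in> carrier B" by (rule lin_cl[OF q(1) x])
  have "x = q x +[B] \<pi> x"
   using minus_add_cancel[OF modA x qc] add_comm[OF modA lin_cl[OF \<pi> x] qc] by (simp add: \<pi>_def)
  then have "x \<ominus>\<^bsub>B\<^esub> \<pi> x = (q x +[B] \<pi> x) \<ominus>\<^bsub>B\<^esub> \<pi> x" by simp
  also have "\<dots> = q x" using lin_cl[OF \<pi> x] qc by (simp add: a_minus_def add_assoc)
  finally show ?thesis using q(2) x by simp
 qed
 \<comment> \<open>All values of \<open>h\<close> are elements x - i b x with x primitive, so
   \<open>\<pi>\<close> kills whatever \<open>h\<close> has been applied to.\<close>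
 define h where "h x = rP x \<ominus>\<^bsub>B\<^esub> f x" for x
 have h: "lin K B B h" unfolding h_def by (rule lin_diff[OF modA rP(1) f_lin])
 have "\<pi> (h x) = \<zero>\<^bsub>B\<^esub>" if x: "x \<in> carrier B" for x
 proof (rule \<pi>0)
  have "h x = rP x \<ominus>\<^bsub>B\<^esub> k (\<psi> (rP x))" unfolding h_def f_def using rP(2)[OF x] by (simp add: r_id \<psi>_prim)
  then have "h x \<in> S" unfolding S_def using rP(2)[OF x] by blast
  then show "h x \<in> ?J" using gen_ideal_incl[OF alg S_cl] by blast
 qed
 then have zero: "Fa \<pi> i (Fa h i w) = \<zero>\<^bsub>TA\<^esub>" if "w \<in> tp B 2" "i < 2" for w i
  using F_comp[OF \<pi> h that] F_zero[OF lin_comp'[OF h \<pi>] _ that] by simp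
 have hw: "Fa h i w = RP i w \<ominus>\<^bsub>TA\<^esub> f' i w" if w: "w \<in> tp B 2" and i: "i < 2" for w i
 proof (rule tp2_eqI[OF w F_lin[OF h] lin_diff[OF _ RP_lin f'_lin]])
  fix x y assume x: "x \<in> carrier B" and y: "y \<in> carrier B"
  then have c: "rP x \<in> carrier B" "rP y \<in> carrier B" using rP(2) by auto
  have "j (h z) = j (rP z) \<ominus>\<^bsub>TA\<^esub> j (f z)" if "z \<in> carrier B" for z
   unfolding h_def using that rP(2)[OF that] by (simp add: lin_minus[OF iota_lin])
  then show "Fa h i (j x * j y) = RP i (j x * j y) \<ominus>\<^bsub>TA\<^esub> f' i (j x * j y)"
   using i x y c by (cases i) (simp_all add: pures F_pure[OF h] a_minus_def add_mult mult_add neg_mult)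
 qed simp
 \<comment> \<open>For a generator x = u - f u, the commutation of \<open>f\<close> with the
   braiding shows that c(x \<otimes> y) is \<open>h\<close> applied to the second factor of c(u
   \<otimes> y), hence lies in B \<otimes> S. The other side is symmetric.\<close>
 have S0: "Fa \<pi> (Suc 0) (braiding B (j x * j y)) = \<zero>\<^bsub>TA\<^esub>" "Fa \<pi> 0 (braiding B (j y * j x)) = \<zero>\<^bsub>TA\<^esub>"
  if xS: "x \<in> S" and y: "y \<in> carrier B" for x y
 proof -
  obtain u where u: "u \<in> P" "x = u \<ominus>\<^bsub>B\<^esub> f u" using S_f[OF xS] by blast
  have c: "u \<in> carrier B" "f u \<in> carrier B" "x \<in> carrier B" using u S_cl xS by auto
  have "C 0 (j x * j y) = C 0 (j u * j y) \<ominus>\<^bsub>TA\<^esub> C 0 (j (f u) * j y)"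
   unfolding u(2) using lin_minus[OF C_linr[OF y, of 0] modA _ c(1,2)] by simp
  also have "\<dots> = Fa h 1 (C 0 (j u * j y))"
   using hw[OF C2[OF c(1) y], of 1] C_f_right[OF u(1) y] C_prim(1)[OF u(1) y] by simp
  finally show "Fa \<pi> (Suc 0) (braiding B (j x * j y)) = \<zero>\<^bsub>TA\<^esub>"
   using zero[OF C2[OF c(1) y], of 1] C_base[of "j x * j y"] c y by simp
  have "C 0 (j y * j x) = C 0 (j y * j u) \<ominus>\<^bsub>TA\<^esub> C 0 (j y * j (f u))"
   unfolding u(2) using lin_minus[OF C_linl[OF y, of 0] modA _ c(1,2)] by simp
  also have "\<dots> = Fa h 0 (C 0 (j y * j u))"
   using hw[OF C2[OF y c(1)], of 0] C_f_left[OF u(1) y] C_prim(2)[OF u(1) y] by simp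
  finally show "Fa \<pi> 0 (braiding B (j y * j x)) = \<zero>\<^bsub>TA\<^esub>"
   using zero[OF C2[OF y c(1)], of 0] C_base[of "j y * j x"] c y by simp
 qed
 have "bialg_ideal K B S \<pi>"
  by unfold_locales (use S_prims S_cl \<pi> \<pi>0 \<pi>1 S0 in auto)
 then show ?thesis by blast
qed

end

text \<open>The quotient is determined by \<open>S\<close> alone, so an arbitrary witness
  \<open>\<pi>\<close> can be fixed.\<close>

sublocale stage \<subseteq> N: bialg_ideal K B S "SOME \<pi>. bialg_ideal K B S \<pi>"
 by (rule someI_ex[OF ex_ideal])

context stage begin

lemma next_eq: "next_U K B k \<psi> = N.QB" "next_proj K B k \<psi> = N.p"
 by (simp_all add: next_U_def next_proj_def bracket_ideal_def S_def)

abbreviation "\<psi>' \<equiv> induced (carrier B) N.p \<psi>"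

lemma ker_J: assumes N: "assoc_algebra K N" and h: "alg_hom K B N h" and hS: "\<And>x. x \<in> S ==> h x = \<zero>\<^bsub>N\<^esub>" and x: "x \<in> N.J"
 shows "h x = \<zero>\<^bsub>N\<^esub>"
proof -
 have "S \<subseteq> {x \<in> carrier B. h x = \<zero>\<^bsub>N\<^esub>}" using hS S_cl by blast
 then have "N.J \<subseteq> {x \<in> carrier B. h x = \<zero>\<^bsub>N\<^esub>}" by (rule gen_ideal_min[OF alg _ alg_hom_ker_ideal[OF alg N h]])
 then show ?thesis using x by blast
qed

lemma \<psi>_S: assumes "x \<in> S" shows "\<psi> x = \<zero>\<^bsub>A\<^esub>"
proof -
 obtain u where u: "u \<in> P" "x = u \<ominus>\<^bsub>B\<^esub> k (\<psi> u)" using assms unfolding S_def by blast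
 then show ?thesis using \<psi>_prim[OF u(1)] by (simp add: lin_minus[OF \<psi>_lin] \<psi>_k)
qed

lemma \<psi>'_p: assumes x: "x \<in> carrier B" shows "\<psi>' (N.p x) = \<psi> x"
proof (rule induced_eq[OF x])
 fix y assume "y \<in> carrier B" "N.p y = N.p x"
 then show "\<psi> y = \<psi> x" by (intro N.lin_J_eq[OF \<psi>_lin A.modA ker_J[OF A.alg \<psi>_hom \<psi>_S] x])
qed

text \<open>Every clause of the invariant descends along the surjective projection, which is a
  morphism of braided bialgebras; the new map to A is determined by the old one because that one
  kills the generators of the ideal.\<close>

lemma next_stage: "stage K V cV A r N.QB (N.p \<circ> k) \<psi>'"
proof -
 note Q = N.br_bialg_QB
 interpret Q: br_bialg K N.QB by (rule Q)
 note pl = alg_hom_lin[OF N.p_hom']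
 have pk: "lin K V N.QB (N.p \<circ> k)" by (rule lin_comp[OF k_lin pl])
 have \<psi>'h: "alg_hom K N.QB A \<psi>'" by (rule alg_hom_surj[OF alg N.p_hom' N.p_surj \<psi>_hom \<psi>'_p])
 have Tpk: "Tm B N.QB N.p (Tm V B k t) = Tm V N.QB (N.p \<circ> k) t" if "t \<in> carrier (T V)" for t
  using Tm_Tm[OF modV modA Q.modA k_lin pl that] by (simp add: comp_def)
 have T\<psi>p: "Tm N.QB A \<psi>' (Tm B N.QB N.p t) = T\<psi> t" if "t \<in> carrier TA" for t
  using Tm_Tm[OF modA Q.modA A.modA pl alg_hom_lin[OF \<psi>'h] that] Tm_cong[of B "%x. \<psi>' (N.p x)" \<psi> A] \<psi>'_p by simp
 show ?thesis
 proof
  show "lin K V N.QB (N.p \<circ> k)" "alg_hom K N.QB A \<psi>'" by fact+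
  show "(N.p \<circ> k) v \<in> prims K N.QB" if "v \<in> carrier V" for v
   using bialg_mor_prims[OF br_bialg_axioms Q N.p_mor k_prim[OF that]] by simp
  show "\<psi>' ((N.p \<circ> k) v) = v" if "v \<in> carrier V" for v using that by (simp add: \<psi>'_p \<psi>_k)
  show "braiding N.QB (Tm V N.QB (N.p \<circ> k) t) = Tm V N.QB (N.p \<circ> k) (cV t)" if t: "t \<in> tp V 2" for t
   using N.braiding_QB[OF Tm_tp[OF modV modA k_lin t]] k_br[OF t] wsp_cl_tp[OF modV t] lop_cl2[OF modV lopV t] by (simp add: Tpk)
  show "braiding A (Tm N.QB A \<psi>' t) = Tm N.QB A \<psi>' (braiding N.QB t)" if t: "t \<in> tp N.QB 2" for t
  proof -
   obtain s where s: "s \<in> tp B 2" "t = Tm B N.QB N.p s"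
    using Tm_surj[OF modA Q.modA pl N.p_surj, of t "{2}"] t unfolding tpow_wsp by blast
   then show ?thesis using \<psi>_br[OF s(1)] tc[OF s(1)] lop_cl2[OF modA lopC s(1)] by (simp add: N.braiding_QB T\<psi>p)
  qed
  show "bialg_mor K N.QB A \<psi>'" if "br_bialg K A" "carrier V = prims K A"
   by (rule bialg_mor_quot[OF br_bialg_axioms Q that(1) N.p_mor N.p_surj mor[OF that] \<psi>'_p])
  show "carrier N.QB \<subseteq> H" if H: "submodule H K N.QB" "\<one>\<^bsub>N.QB\<^esub> \<in> H"
   and g: "\<And>v a. v \<in> carrier V ==> a \<in> H ==> (N.p \<circ> k) v \<cdot>[N.QB] a \<in> H" for H
  proof -
   let ?H = "{x \<in> carrier B. N.p x \<in> H}"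
   have "submodule ?H K B"
    by (rule submI[OF modA]) (use subm_zero[OF Q.modA H(1)] subm_add[OF Q.modA H(1)] subm_smult[OF Q.modA H(1)] lin_zero[OF pl modA Q.modA] in
     \<open>auto simp: lin_add[OF pl] lin_smult[OF pl]\<close>)
   moreover have "\<one>\<^bsub>B\<^esub> \<in> ?H" using H(2) alg_hom_one[OF N.p_hom'] by simp
   moreover have "k v \<cdot>[B] a \<in> ?H" if "v \<in> carrier V" "a \<in> ?H" for v a
    using g[OF that(1), of "N.p a"] that alg_hom_mult[OF N.p_hom', of "k v" a] by simp
   ultimately have "carrier B \<subseteq> ?H" by (rule gen)
   then show ?thesis unfolding N.p_surj[symmetric] by blast
  qed
 qed
qed

abbreviation "b \<equiv> restrict \<psi> P"

lemma b_lin: "lin K PM V b"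
proof (rule linI)
 note s = subm_add[OF modA prims_subm] subm_smult[OF modA prims_subm]
 have V: "x +[V] y = x +[A] y" "a *:[V] x = a *:[A] x" if "x \<in> carrier V" "y \<in> carrier V" "a \<in> carrier K" for x y a
  using lin_add[OF incl that(1,2)] lin_smult[OF incl that(3,1)] by simp_all
 fix x assume x: "x \<in> carrier PM"
 then show "b x \<in> carrier V" using \<psi>_prim by (simp add: prim_carrier)
 show "b (x +[PM] y) = b x +[V] b y" if "y \<in> carrier PM" for y
  using x that s(1)[of x y] V(1)[of "\<psi> x" "\<psi> y" "\<zero>\<^bsub>K\<^esub>"] \<psi>_prim by (simp add: prim_carrier lin_add[OF \<psi>_lin])
 show "b (a *:[PM] x) = a *:[V] b x" if "a \<in> carrier K" for a
  using x that s(2)[of a x] V(2)[of "\<psi> x" "\<psi> x" a] \<psi>_prim by (simp add: prim_carrier lin_smult[OF \<psi>_lin])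
qed

text \<open>The equation is compared after the injective inclusion of P \<otimes> P into B \<otimes>
  B, where the braiding of P becomes that of B.\<close>

lemma braided_mor_k: "braided_mor K V cV PM cP k"
proof -
 have kP: "lin K V PM k" using k_lin k_prim unfolding lin_def by (simp add: prim_carrier Pi_def)
 have I2k: "I2 (Tm V PM k t) = Tm V B k t" if "t \<in> carrier (T V)" for t
  using Tm_Tm[OF modV modP modA kP incl_lin that] by simp
 have "cP (Tm V PM k t) = Tm V PM k (cV t)" if t: "t \<in> tp V 2" for t
 proof (rule I2_inj)
  have Tt: "Tm V PM k t \<in> tp PM 2" by (rule Tm_tp[OF modV modP kP t])
  show "cP (Tm V PM k t) \<in> carrier (T PM)" by (rule lop_cl2[OF modP lop_cP Tt])
  show "Tm V PM k (cV t) \<in> carrier (T PM)" by (rule Tm_cl[OF modV modP kP lop_cl2[OF modV lopV t]])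
  show "I2 (cP (Tm V PM k t)) = I2 (Tm V PM k (cV t))"
   using I2_cP[OF Tt] k_br[OF t] wsp_cl_tp[OF modV t] lop_cl2[OF modV lopV t] by (simp add: I2k)
 qed
 then show ?thesis unfolding braided_mor_iff[OF modV modP lopV] using kP by blast
qed

abbreviation "X \<equiv> j ` P"
abbreviation "Y \<equiv> j ` k ` carrier V"
abbreviation "ib \<equiv> deg1 K B B (k \<circ> b)"

lemma XY: "X \<subseteq> tp B 1" "Y \<subseteq> tp B 1" by auto

lemma XY_cl: "X \<subseteq> carrier TA" "Y \<subseteq> carrier TA" using XY tc by blast+

lemma tsub_cl:
 assumes "X' \<subseteq> tp B 1" "Y' \<subseteq> tp B 1" shows "tsub K B X' Y' \<subseteq> tp B 2" "{x * y |x y. x \<in> X' \<and> y \<in> Y'} \<subseteq> tp B 2"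
proof -
 show *: "{x * y |x y. x \<in> X' \<and> y \<in> Y'} \<subseteq> tp B 2" using tp_mult[OF modA, of _ 1 _ 1 2] assms by auto
 show "tsub K B X' Y' \<subseteq> tp B 2" unfolding tsub_def by (rule lspan_min[OF tp_subm[OF modA] *])
qed

lemma tsub_eqI:
 assumes t: "t \<in> tsub K B X' Y'" and XY': "X' \<subseteq> tp B 1" "Y' \<subseteq> tp B 1" and F: "lin K TA TA g" "lin K TA TA h"
  and eq: "\<And>x y. x \<in> X' ==> y \<in> Y' ==> g (x \<cdot>[TA] y) = h (x \<cdot>[TA] y)"
 shows "g t = h t"
proof -
 have c: "tsub K B X' Y' \<subseteq> carrier TA" "{x * y |x y. x \<in> X' \<and> y \<in> Y'} \<subseteq> carrier TA" using tsub_cl[OF XY'] tc by blast+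
 show ?thesis
  by (rule lin_eq_lspan[OF t[unfolded tsub_def] _ c(2)]) (use eq lin_sub[OF F(1) c(1)] lin_sub[OF F(2) c(1)] in \<open>auto simp: tsub_def\<close>)
qed

lemma ib_j: "x \<in> P ==> ib (j x) = j (f x)"
 by (simp add: deg1_iota[OF modA] f_prim)

lemma tmap_ib:
 shows "t \<in> tsub K B X Y ==> tmap K B B X Y ib id t = f' 0 t" "t \<in> tsub K B Y X ==> tmap K B B Y X id ib t = f' 1 t"
proof -
 have c: "tsub K B X Y \<subseteq> carrier TA" "tsub K B Y X \<subseteq> carrier TA"
  using tsub_cl(1)[OF XY] tsub_cl(1)[OF XY(2,1)] tc by blast+
 have l: "lin K (TA\<lparr>carrier := tsub K B X Y\<rparr>) TA (f' 0)" "lin K (TA\<lparr>carrier := tsub K B Y X\<rparr>) TA (f' 1)"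
  by (rule lin_sub[OF f'_lin c(1)], rule lin_sub[OF f'_lin c(2)])
 show "t \<in> tsub K B X Y ==> tmap K B B X Y ib id t = f' 0 t"
  by (rule tmap_eq[OF modA modA XY_cl l(1)]) (auto simp: ib_j pures)
 show "t \<in> tsub K B Y X ==> tmap K B B Y X id ib t = f' 1 t"
  by (rule tmap_eq[OF modA modA XY_cl(2,1) l(2)]) (auto simp: ib_j pures)
qed

text \<open>The way back from projection equations to membership: a tensor that has been projected
  in both factors lies in the span required by the definition of a bracket.\<close>

lemma tsub_mem:
 assumes w: "w \<in> tp B 2" and g: "lin K B B g" "lin K B B h" and X': "X' \<subseteq> tp B 1" "Y' \<subseteq> tp B 1"
  and gh: "\<And>x. x \<in> carrier B ==> j (g x) \<in> X'" "\<And>x. x \<in> carrier B ==> j (h x) \<in> Y'"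
 shows "Fa h 1 (Fa g 0 w) \<in> tsub K B X' Y'"
proof (rule lin_image_lspan[OF w[unfolded tpow_def]])
 have c: "{x * y |x y. x \<in> X' \<and> y \<in> Y'} \<subseteq> carrier TA" using tsub_cl[OF X'] tc by blast
 show "submodule (tsub K B X' Y') K TA" unfolding tsub_def by (rule lspan_subm[OF _ c]) simp
 show "lin K TA TA (%w. Fa h 1 (Fa g 0 w))" by (rule lin_comp'[OF F_lin[OF g(1)] F_lin[OF g(2)]])
 fix s assume "s \<in> pt B ` {w \<in> lists (carrier B). length w = 2}"
 then obtain w where "w \<in> lists (carrier B)" "length w = 2" "s = pt B w" by blast
 moreover from lists_len2[OF this(1,2)] obtain x y where "w = [x, y]" "x \<in> carrier B" "y \<in> carrier B" by blast
 ultimately obtain x y where xy: "x \<in> carrier B" "y \<in> carrier B" "s = j x * j y" using that by (simp add: pt_Cons)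
 then have "Fa h 1 (Fa g 0 s) = j (g x) * j (h y)" using lin_cl[OF g(1)] by (simp add: F_pure[OF g(1)] F_pure[OF g(2)])
 then show "Fa h 1 (Fa g 0 s) \<in> tsub K B X' Y'" unfolding tsub_def using gh xy lspan_incl[of "{x * y |x y. x \<in> X' \<and> y \<in> Y'}" TA] by blast
qed (auto simp: pt_tp wsp_cl_tp)

text \<open>The value of \<open>tmap\<close> is specified only on the tensor product of the given
  subspaces. Before the right-hand side of a bracket condition can be evaluated, the braided tensor
  must be known to lie there.\<close>

lemma C_tsub:
 shows "t \<in> tsub K B X Y ==> C 0 t \<in> tsub K B Y X" "t \<in> tsub K B Y X ==> C 0 t \<in> tsub K B X Y"
proof -
 have kf: "j (fV x) \<in> Y" "j (rP x) \<in> X" if x: "x \<in> carrier B" for x using fVE[OF x] rP(2)[OF x] by (metis imageI, blast)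
 show "C 0 t \<in> tsub K B Y X" if t: "t \<in> tsub K B X Y"
 proof -
  have "RP 1 (g' 0 (C 0 t)) = C 0 t"
   by (rule tsub_eqI[OF t XY lin_comp'[OF lin_comp'[OF C_lin g'_lin] RP_lin] C_lin]) (auto simp: g'_left C_prim(1)[simplified])
  then show ?thesis using tsub_mem[OF C_tp[of t 2 0] fV_lin rP(1) XY(2,1) kf] tsub_cl(1)[OF XY] t by auto
 qed
 show "C 0 t \<in> tsub K B X Y" if t: "t \<in> tsub K B Y X"
 proof -
  have "g' 1 (RP 0 (C 0 t)) = C 0 t"
   by (rule tsub_eqI[OF t XY(2,1) lin_comp'[OF lin_comp'[OF C_lin RP_lin] g'_lin] C_lin]) (auto simp: g'_right[simplified] C_prim(2))
  then show ?thesis using tsub_mem[OF C_tp[of t 2 0] rP(1) fV_lin XY kf(2,1)] tsub_cl(1)[OF XY(2,1)] t by auto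
 qed
qed

lemma bracket_conditions:
 shows "t \<in> tsub K B X Y ==> braiding B (tmap K B B X Y ib id t) = tmap K B B Y X id ib (braiding B t)"
  "t \<in> tsub K B Y X ==> braiding B (tmap K B B Y X id ib t) = tmap K B B X Y ib id (braiding B t)"
proof -
 show "braiding B (tmap K B B X Y ib id t) = tmap K B B Y X id ib (braiding B t)" if t: "t \<in> tsub K B X Y"
 proof -
  have t2: "t \<in> tp B 2" using t tsub_cl(1)[OF XY] by blast
  have "C 0 (f' 0 t) = f' 1 (C 0 t)"
   by (rule tsub_eqI[OF t XY lin_comp'[OF f'_lin C_lin] lin_comp'[OF C_lin f'_lin]]) (auto simp: pures C_f_right[simplified])
  then show ?thesis using tmap_ib(1)[OF t] tmap_ib(2)[OF C_tsub(1)[OF t]] C_base[OF t2] C_base[OF F_tp[OF f_lin t2]] by simp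
 qed
 show "braiding B (tmap K B B Y X id ib t) = tmap K B B X Y ib id (braiding B t)" if t: "t \<in> tsub K B Y X"
 proof -
  have t2: "t \<in> tp B 2" using t tsub_cl(1)[OF XY(2,1)] by blast
  have "C 0 (f' 1 t) = f' 0 (C 0 t)"
   by (rule tsub_eqI[OF t XY(2,1) lin_comp'[OF f'_lin C_lin] lin_comp'[OF C_lin f'_lin]]) (auto simp: pures C_f_left)
  then show ?thesis using tmap_ib(2)[OF t] tmap_ib(1)[OF C_tsub(2)[OF t]] C_base[OF t2] C_base[OF F_tp[OF f_lin t2]] by simp
 qed
qed

end

section \<open>The bracket of a subspace of a braided algebra\<close>

text \<open>The recursion of \<open>canonical_stage\<close> with the subspace V and the target
  algebra A kept apart. For V = A it is the canonical bracket; for V = P(A) its maps restrict to the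
  induced bracket.\<close>

primrec rel_stage :: "('k, 'z) ring_scheme \<Rightarrow> ('k, 'a, 'm) module_scheme \<Rightarrow> (('a list \<Rightarrow> 'k) \<Rightarrow> ('a list \<Rightarrow> 'k)) \<Rightarrow>
  ('k, 'a, 'n) module_scheme \<Rightarrow> nat \<Rightarrow> ('k, 'a list \<Rightarrow> 'k) bialg \<times> ('a \<Rightarrow> 'a list \<Rightarrow> 'k) \<times> (('a list \<Rightarrow> 'k) \<Rightarrow> 'a)"
 where
  "rel_stage K V c A 0 = (tensor_bialg K V c, \<iota> K V,
   SOME f. alg_hom K (tensor_alg K V) A f \<and> (\<forall>x\<in>carrier V. f (\<iota> K V x) = x))"
 | "rel_stage K V c A (Suc n) = (let (U, i, \<phi>) = rel_stage K V c A n in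
   (next_U K U i \<phi>, next_proj K U i \<phi> \<circ> i, induced (carrier U) (next_proj K U i \<phi>) \<phi>))"

text \<open>Brackets live on primitive elements while the maps to A live on the whole stage. The
  ideal sees only primitive elements, so both recursions produce the same stages.\<close>

lemma bracket_ideal_restrict: "bracket_ideal K U i (restrict \<beta> (prims K U)) = bracket_ideal K U i \<beta>"
 unfolding bracket_ideal_def by (rule arg_cong[where f = "genideal U"]) auto

lemma next_restrict: "next_U K U i (restrict \<beta> (prims K U)) = next_U K U i \<beta>" "next_proj K U i (restrict \<beta> (prims K U)) = next_proj K U i \<beta>"
 by (simp_all only: next_U_def next_proj_def bracket_ideal_restrict)

lemma canonical_stage_rel: "canonical_stage K A c n = rel_stage K A c A n"
 by (induction n) simp_all

context base begin

definition "US n = fst (rel_stage K V cV A n)"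
definition "is n = fst (snd (rel_stage K V cV A n))"
definition "\<psi>s n = snd (snd (rel_stage K V cV A n))"
definition "bV n = restrict (\<psi>s n) (prims K (US n))"

lemma stage_0: "US 0 = tensor_bialg K V cV" "is 0 = \<iota> K V"
  "\<psi>s 0 = (SOME f. alg_hom K (tensor_alg K V) A f \<and> (\<forall>x\<in>carrier V. f (\<iota> K V x) = x))"
 by (simp_all add: US_def is_def \<psi>s_def)

lemma stage_Suc: "US (Suc n) = next_U K (US n) (is n) (\<psi>s n)" "is (Suc n) = next_proj K (US n) (is n) (\<psi>s n) \<circ> is n"
  "\<psi>s (Suc n) = induced (carrier (US n)) (next_proj K (US n) (is n) (\<psi>s n)) (\<psi>s n)"
 by (simp_all add: US_def is_def \<psi>s_def split_beta Let_def)

lemma bracket_stage_eq: "bracket_stage K V cV bV n = (US n, is n)"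
proof (induction n)
 case (Suc n)
 have "bV n = restrict (\<psi>s n) (prims K (US n))" by (rule bV_def)
 then show ?case by (simp only: bracket_stage.simps Suc Let_def prod.case next_restrict stage_Suc)
qed (simp add: stage_0)

lemma stage_eq: "stage_U K V cV bV n = US n" "stage_i K V cV bV n = is n"
  "stage_proj K V cV bV n = next_proj K (US n) (is n) (\<psi>s n)"
proof -
 show U: "stage_U K V cV bV n = US n" "stage_i K V cV bV n = is n" by (simp_all add: stage_U_def stage_i_def bracket_stage_eq)
 have "bV n = restrict (\<psi>s n) (prims K (US n))" by (rule bV_def)
 then show "stage_proj K V cV bV n = next_proj K (US n) (is n) (\<psi>s n)" by (simp only: stage_proj_def U next_restrict)
qed

text \<open>The map to A comes from the universal property of T(V) and is braided because the
  inclusion of V is. When V consists of the primitive elements of A, these also have counit zero, so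
  the map is one of bialgebras.\<close>

lemma initial_stage: "stage K V cV A r (US 0) (is 0) (\<psi>s 0)"
proof -
 interpret T: tens K V cV by unfold_locales (rule bvsV)
 let ?h = "\<psi>s 0"
 have il: "lin K V A (%x. x)" using incl by (simp add: id_def)
 from someI_ex[OF alg_hom_ext[OF modV A.alg il]]
 have h: "alg_hom K (T V) A ?h" and hi: "v \<in> carrier V ==> ?h (\<iota> K V v) = v" for v unfolding stage_0 by blast+
 have h': "alg_hom K T.BT A ?h" using h unfolding alg_hom_def lin_def ring_hom_def by simp
 have ik: "lin K V T.BT (\<iota> K V)" using iota_lin[OF modV] unfolding lin_def by simp
 have c: "braiding A (Tm V A (%x. x) t) = Tm V A (%x. x) (cV t)" if "t \<in> tp V 2" for t
  using cVA[OF that] by (simp add: id_def)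
 note Tmd = Tm_same[OF T.BT_sel(1-3)]
 interpret BB: br_bialg K T.BT by (rule T.br_bialg_BT)
 show ?thesis unfolding stage_0(1,2)
 proof
  show "lin K V T.BT (\<iota> K V)" "alg_hom K T.BT A ?h" by fact+
  show "?h (\<iota> K V v) = v" if "v \<in> carrier V" for v by (rule hi[OF that])
  show "\<iota> K V v \<in> prims K T.BT" if "v \<in> carrier V" for v
   using that T.tensor_comult(2)[OF that] by (simp add: prims_def)
  show "braiding T.BT (Tm V T.BT (\<iota> K V) t) = Tm V T.BT (\<iota> K V) (cV t)" if "t \<in> tp V 2" for t
   using T.cT(2)[OF that] by (simp add: same_Tm[OF T.BT_sel(1-3)])
  show br: "braiding A (Tm T.BT A ?h s) = Tm T.BT A ?h (braiding T.BT s)" if s: "s \<in> tp T.BT 2" for s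
  proof -
   have s': "s \<in> tp T.A 2" using s by simp
   have "Tm T.A A ?h (T.C 0 s) = A.C 0 (Tm T.A A ?h s)"
    by (rule T.universal_braided[OF brA il c h hi wsp_cl_tp[OF T.modA s']])
   then show ?thesis using T.C_base[OF s'] A.C_base[OF Tm_tp[OF T.modA A.modA alg_hom_lin[OF h] s']] by (simp add: Tmd)
  qed
  show "bialg_mor K T.BT A ?h" if A: "br_bialg K A" "carrier V = prims K A"
  proof -
   have "v \<in> prims K A" "counit A v = \<zero>\<^bsub>K\<^esub>" if "v \<in> carrier V" for v
    using that A br_bialg.prims_counit[OF A(1)] by simp_all
   then show ?thesis unfolding bialg_mor_iff[OF T.br_bialg_BT A(1)]
    using h' br T.universal_bialg[OF A(1) il c h hi] by (simp add: Tmd)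
  qed
  show "carrier T.BT \<subseteq> H" if H: "submodule H K T.BT" "\<one>\<^bsub>T.BT\<^esub> \<in> H"
   and g: "\<And>v a. v \<in> carrier V ==> a \<in> H ==> \<iota> K V v \<cdot>[T.BT] a \<in> H" for H
  proof
   fix x assume "x \<in> carrier T.BT"
   then have "x \<in> carrier (T V)" by simp
   then show "x \<in> H" using modV
   proof (induction rule: T_gen_induct)
    case (gen v)
    then show ?case using g[OF gen H(2)] modV by simp
   qed (use H g subm_add[OF BB.modA H(1)] subm_smult[OF BB.modA H(1)] in simp_all)
  qed
 qed
qed

lemma stage: "stage K V cV A r (US n) (is n) (\<psi>s n)"
proof (induction n)
 case (Suc n)
 interpret S: stage K V cV A r "US n" "is n" "\<psi>s n" by (rule Suc)
 show ?case unfolding stage_Suc S.next_eq by (rule S.next_stage)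
qed (rule initial_stage)

lemma bracket: "bracket K V cV bV"
 unfolding bracket_def Let_def stage_eq bV_def
proof (intro conjI allI bvsV)
 fix n
 interpret S: stage K V cV A r "US n" "is n" "\<psi>s n" by (rule stage)
 show "braided_bialgebra K (US n)" unfolding br_bialg_iff by (rule S.br_bialg_axioms)
 show "braided_mor K V cV S.PM S.cP (is n)" by (rule S.braided_mor_k)
 show "lin K S.PM V S.b" by (rule S.b_lin)
qed (use stage.bracket_conditions[OF stage] in blast)+

lemma braided_lie: "braided_lie_algebra K V cV bV"
proof -
 let ?p = "stage_proj K V cV bV"
 have 0: "is 0 v \<in> carrier (US 0)" if "v \<in> carrier V" for v
  using stage.k_cl[OF stage, of v 0] that by simp
 have tr: "trans_map ?p 0 n (is 0 v) = is n v" for n v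
  by (induction n) (simp_all add: stage_eq stage_Suc)
 have "inj_on (UEA_in K V cV bV) (carrier V)"
 proof (rule inj_onI)
  fix u v assume u: "u \<in> carrier V" and v: "v \<in> carrier V" and eq: "UEA_in K V cV bV u = UEA_in K V cV bV v"
  \<comment> \<open>The class of an element contains its own pair at stage 0. Equal classes
    therefore give a common later stage; as both pairs start at stage 0, the two numbers of steps
    coincide.\<close>
  have "(0, is 0 u) \<in> dlim_in (stage_U K V cV bV) ?p 0 (is 0 u)"
   using 0[OF u] unfolding dlim_in_def by (auto simp: stage_eq)
  then have "(0, is 0 u) \<in> dlim_in (stage_U K V cV bV) ?p 0 (is 0 v)" using eq by (simp add: UEA_in_def stage_eq)
  then obtain n where "trans_map ?p 0 n (is 0 v) = trans_map ?p 0 n (is 0 u)" unfolding dlim_in_def by auto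
  then have "is n v = is n u" by (simp add: tr)
  then show "u = v" using stage.\<psi>_k[OF stage, of u n] stage.\<psi>_k[OF stage, of v n] u v by simp
 qed
 moreover have "UEA_in K V cV bV v \<in> carrier (UEA K V cV bV)" if "v \<in> carrier V" for v
  using 0[OF that] by (auto simp: UEA_in_def UEA_def dlim_bialg_def dlim_alg_def Let_def stage_eq module.defs bialg.defs)
 ultimately show ?thesis unfolding braided_lie_algebra_def using bracket by blast
qed

end

section \<open>Functoriality along the inclusion of the infinitesimal part\<close>

locale inf_part = br_bialg K B for K :: "('k, 'z) ring_scheme" and B :: "('k, 'a) bialg"

text \<open>\<open>W\<close> is the construction for the whole algebra, with the identity as
  retraction; \<open>E\<close> below is the one for the infinitesimal part, with retraction
  \<open>rP\<close>.\<close>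

sublocale inf_part \<subseteq> W: base K B "braiding B" B id
proof
 show "braided_vs K B (braiding B)" by (rule braided_vsA)
 show "braiding B (Tm B B id t) = Tm B B id (braiding B t)" if t: "t \<in> tp B 2" for t
  using Tm_id[OF modA wsp_cl_tp[OF modA t]] Tm_id[OF modA lop_cl2[OF modA lopC t]] by (simp add: id_def)
qed simp_all

sublocale inf_part \<subseteq> E: base K PM cP B rP
proof
 show "braided_vs K PM cP" by (rule braided_vsP)
 show "carrier PM = carrier B \<or> br_bialg K B \<and> carrier PM = prims K B" using br_bialg_axioms by (simp add: prim_carrier)
qed (simp_all add: incl_lin rP_lin I2_cP prim_carrier rP(3))

context inf_part begin

abbreviation "Um \<equiv> U_map K PM cP E.bV B (braiding B) W.bV (%x. x)"

lemma W_bV: "W.bV = canonical_bracket K B (braiding B)"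
 by (rule ext) (simp add: canonical_bracket_def canonical_stage_rel W.bV_def W.US_def W.\<psi>s_def split_beta)

text \<open>The initial map is chosen by \<open>SOME\<close>; a candidate is the algebra map on T(P)
  extending the embedding of P into T(A). It is a bialgebra map by the universal property, since
  this embedding is braided and has primitive values.\<close>

lemma Um_0: "bialg_mor K (E.US 0) (W.US 0) (Um 0)" "v \<in> P ==> Um 0 (\<iota> K PM v) = \<iota> K B v"
proof -
 interpret TP: tens K PM cP by unfold_locales (rule braided_vsP)
 interpret S: stage K B "braiding B" B id "W.US 0" "W.is 0" "W.\<psi>s 0" by (rule W.stage)
 have l: "lin K PM (W.US 0) (W.is 0)" using lin_comp'[OF incl_lin S.k_lin] by simp
 obtain h where h: "alg_hom K (T PM) (W.US 0) h" "\<And>v. v \<in> carrier PM ==> h (\<iota> K PM v) = W.is 0 v"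
  using alg_hom_ext[OF modP S.alg l] by blast
 have TI: "Tm B (W.US 0) (W.is 0) (I2 t) = Tm PM (W.US 0) (W.is 0) t" if "t \<in> carrier (T PM)" for t
  using Tm_Tm[OF modP modA S.modA incl_lin S.k_lin that] by simp
 have c: "braiding (W.US 0) (Tm PM (W.US 0) (W.is 0) t) = Tm PM (W.US 0) (W.is 0) (cP t)" if t: "t \<in> tp PM 2" for t
  using S.k_br[OF I2_tp[OF t]] I2_cP[OF t] TI[OF wsp_cl_tp[OF modP t]] TI[OF lop_cl2[OF modP lop_cP t]] by simp
 have pr: "W.is 0 v \<in> prims K (W.US 0)" "counit (W.US 0) (W.is 0 v) = \<zero>\<^bsub>K\<^esub>" if "v \<in> carrier PM" for v
  using that S.k_prim[of v] S.prims_counit[of "W.is 0 v"] by (simp_all add: prim_carrier)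
 have "alg_hom K TP.BT (W.US 0) h" using h(1) unfolding alg_hom_def lin_def ring_hom_def by simp
 moreover have "braiding (W.US 0) (Tm TP.A (W.US 0) h s) = Tm TP.A (W.US 0) h (TP.cT s)" if s: "s \<in> tp TP.A 2" for s
  using TP.universal_braided[OF S.br_alg_axioms l c h wsp_cl_tp[OF TP.modA s], of 0] TP.C_base[OF s]
   S.C_base[OF Tm_tp[OF TP.modA S.modA alg_hom_lin[OF h(1)] s]] by simp
 ultimately have "bialg_mor K TP.BT (W.US 0) h"
  unfolding bialg_mor_iff[OF TP.br_bialg_BT S.br_bialg_axioms] using TP.universal_bialg[OF S.br_bialg_axioms l c h pr]
  by (simp add: Tm_same[OF TP.BT_sel(1-3)])
 then have "\<exists>f. bialg_mor K TP.BT (tensor_bialg K B (braiding B)) f \<and> (\<forall>v\<in>carrier PM. f (\<iota> K PM v) = \<iota> K B v)"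
  using h(2) by (auto simp: W.stage_0)
 from someI_ex[OF this] show "bialg_mor K (E.US 0) (W.US 0) (Um 0)" "v \<in> P ==> Um 0 (\<iota> K PM v) = \<iota> K B v"
  by (simp_all add: W.stage_0 E.stage_0 prim_carrier)
qed

text \<open>The three claims must be proved together. Compatibility with the embeddings and with the
  maps to A shows that a generator x - i b x goes to a generator of the same form, so the map
  descends to the next stage; the last claim is also the lifting equation for the brackets.\<close>

lemma Um: "bialg_mor K (E.US n) (W.US n) (Um n) \<and> (\<forall>v\<in>P. Um n (E.is n v) = W.is n v) \<and> (\<forall>x\<in>carrier (E.US n). W.\<psi>s n (Um n x) = E.\<psi>s n x)"
proof (induction n)
 case 0
 interpret S: stage K B "braiding B" B id "W.US 0" "W.is 0" "W.\<psi>s 0" by (rule W.stage)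
 interpret R: stage K PM cP B rP "E.US 0" "E.is 0" "E.\<psi>s 0" by (rule E.stage)
 interpret TP: tens K PM cP by unfold_locales (rule braided_vsP)
 have M: "alg_hom K (E.US 0) (W.US 0) (Um 0)" using Um_0(1) unfolding bialg_mor_iff[OF R.br_bialg_axioms S.br_bialg_axioms] by blast
 have eq: "alg_hom K (E.US 0) B g = alg_hom K (T PM) B g" for g
  unfolding E.stage_0 alg_hom_def lin_def ring_hom_def by simp
 have "(W.\<psi>s 0 \<circ> Um 0) x = E.\<psi>s 0 x" if x: "x \<in> carrier (T PM)" for x
 proof (rule alg_hom_pt_eq[OF modP alg _ _ _ x])
  show "alg_hom K (T PM) B (W.\<psi>s 0 \<circ> Um 0)" "alg_hom K (T PM) B (E.\<psi>s 0)"
   using alg_hom_comp[OF M S.\<psi>_hom] R.\<psi>_hom unfolding eq .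
  fix v assume v: "v \<in> carrier PM"
  then show "(W.\<psi>s 0 \<circ> Um 0) (\<iota> K PM v) = E.\<psi>s 0 (\<iota> K PM v)"
   using Um_0(2)[of v] S.\<psi>_k[of v] R.\<psi>_k[of v] by (simp add: prim_carrier W.stage_0(2) E.stage_0(2))
 qed
 moreover have "carrier (E.US 0) = carrier (T PM)" by (simp add: E.stage_0)
 ultimately show ?case using Um_0 by (simp add: W.stage_0(2) E.stage_0(2))
next
 case (Suc n)
 interpret S: stage K B "braiding B" B id "W.US n" "W.is n" "W.\<psi>s n" by (rule W.stage)
 interpret R: stage K PM cP B rP "E.US n" "E.is n" "E.\<psi>s n" by (rule E.stage)
 let ?M = "Um n" and ?M' = "Um (Suc n)" and ?g = "%x. S.N.p (Um n x)"
 note br = R.br_bialg_axioms S.br_bialg_axioms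
 have M: "bialg_mor K (E.US n) (W.US n) ?M" and Mk: "\<And>v. v \<in> P ==> ?M (E.is n v) = W.is n v"
  and M\<psi>: "\<And>x. x \<in> carrier (E.US n) ==> W.\<psi>s n (?M x) = E.\<psi>s n x" using Suc by blast+
 have Mh: "alg_hom K (E.US n) (W.US n) ?M" using M unfolding bialg_mor_iff[OF br] by blast
 note Ml = alg_hom_lin[OF Mh]
 have g: "bialg_mor K (E.US n) S.N.QB ?g" by (rule bialg_mor_comp[OF br S.N.br_bialg_QB M S.N.p_mor])
 have gh: "alg_hom K (E.US n) S.N.QB ?g" using g unfolding bialg_mor_iff[OF br(1) S.N.br_bialg_QB] by blast
 \<comment> \<open>The image of a generator is again a generator of the ideal on the side of A:
   primitive elements go to primitive elements, and both i and the map to A are preserved.\<close>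
 have gS: "?g x = \<zero>\<^bsub>S.N.QB\<^esub>" if xS: "x \<in> R.S" for x
 proof -
  obtain u where u: "u \<in> R.P" "x = u \<ominus>\<^bsub>E.US n\<^esub> E.is n (E.\<psi>s n u)" using xS unfolding R.S_def by blast
  have \<psi>u: "E.\<psi>s n u \<in> P" using R.\<psi>_prim[OF u(1)] by (simp add: prim_carrier)
  have "?M x = ?M u \<ominus>\<^bsub>W.US n\<^esub> W.is n (W.\<psi>s n (?M u))"
   using u \<psi>u lin_minus[OF Ml R.modA S.modA, of u "E.is n (E.\<psi>s n u)"] Mk[OF \<psi>u] M\<psi>[of u] R.k_cl[of "E.\<psi>s n u"] by (simp add: prim_carrier)
  then have "?M x \<in> S.S" unfolding S.S_def using bialg_mor_prims[OF br M u(1)] by blast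
  then have "?M x \<in> S.N.J" "?M x \<in> carrier (W.US n)" using gen_ideal_incl[OF S.alg S.S_cl] S.S_cl by blast+
  then show ?thesis using quot_proj_zero_iff[OF S.alg S.N.idJ] by (simp add: S.N.QB_sel)
 qed
 have algQ: "assoc_algebra K S.N.QB" by (rule S.N.algQB)
 have M'p: "?M' (R.N.p x) = ?g x" if x: "x \<in> carrier (E.US n)" for x
 proof -
  have "induced (carrier (E.US n)) R.N.p ?g (R.N.p x) = ?g x"
   by (rule induced_eq[OF x], rule R.N.lin_J_eq[OF alg_hom_lin[OF gh] _ R.ker_J[OF algQ gh gS] x]) (use algQ in simp_all)
  moreover have "?M' = induced (carrier (E.US n)) R.N.p (S.N.p \<circ> Um n)"
   by (simp only: U_map.simps E.stage_eq W.stage_eq R.next_eq S.next_eq)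
  ultimately show ?thesis unfolding comp_def by simp
 qed
 have "bialg_mor K R.N.QB S.N.QB ?M'"
 proof (rule bialg_mor_quot[where p = R.N.p and f = ?g])
  show "?M' (R.N.p x) = ?g x" if "x \<in> carrier (E.US n)" for x by (rule M'p[OF that])
 qed (rule br(1) R.N.br_bialg_QB S.N.br_bialg_QB R.N.p_mor R.N.p_surj g)+
 moreover have "?M' (R.N.p (E.is n v)) = S.N.p (W.is n v)" if "v \<in> P" for v
  using M'p[of "E.is n v"] Mk[OF that] R.k_cl[of v] that by (simp add: prim_carrier)
 moreover have "S.\<psi>' (?M' x) = R.\<psi>' x" if x: "x \<in> carrier R.N.QB" for x
 proof -
  obtain y where y: "y \<in> carrier (E.US n)" "x = R.N.p y" using x unfolding R.N.p_surj[symmetric] by blast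
  show ?thesis unfolding y(2) M'p[OF y(1)] using S.\<psi>'_p[OF lin_cl[OF Ml y(1)]] R.\<psi>'_p[OF y(1)] M\<psi>[OF y(1)] by simp
 qed
 ultimately show ?case unfolding E.stage_Suc W.stage_Suc R.next_eq S.next_eq by simp
qed

text \<open>The inclusion does not change elements, so the lifting equation prescribes every value
  on primitive elements, and extensionality prescribes the rest. Existence is the compatibility of
  the two maps to A.\<close>

lemma lifts: "lifts_bracket K PM cP E.bV B (braiding B) W.bV (%x. x) n \<beta> \<longleftrightarrow> \<beta> = E.bV n"
proof -
 interpret S: stage K B "braiding B" B id "W.US n" "W.is n" "W.\<psi>s n" by (rule W.stage)
 interpret R: stage K PM cP B rP "E.US n" "E.is n" "E.\<psi>s n" by (rule E.stage)
 have M: "bialg_mor K (E.US n) (W.US n) (Um n)" and M\<psi>: "\<And>x. x \<in> carrier (E.US n) ==> W.\<psi>s n (Um n x) = E.\<psi>s n x" using Um[of n] by blast+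
 have MP: "Um n x \<in> S.P" if "x \<in> R.P" for x by (rule bialg_mor_prims[OF R.br_bialg_axioms S.br_bialg_axioms M that])
 have val: "W.bV n (P_map K PM cP E.bV B (braiding B) W.bV (%x. x) n x) = E.bV n x" if "x \<in> R.P" for x
  using that MP[OF that] M\<psi>[of x] by (simp add: P_map_def E.stage_eq W.bV_def E.bV_def)
 have Pm: "P_map K PM cP E.bV B (braiding B) W.bV (%x. x) n \<in> R.P \<rightarrow> S.P"
  using MP by (auto simp: P_map_def E.stage_eq)
 show ?thesis
 proof
  assume "\<beta> = E.bV n"
  then show "lifts_bracket K PM cP E.bV B (braiding B) W.bV (%x. x) n \<beta>"
   unfolding lifts_bracket_def E.stage_eq W.stage_eq prim_carrier using val Pm R.b_lin by (simp add: E.bV_def)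
 next
  assume "lifts_bracket K PM cP E.bV B (braiding B) W.bV (%x. x) n \<beta>"
  then have "\<beta> \<in> extensional R.P" "\<forall>x\<in>R.P. \<beta> x = E.bV n x"
   unfolding lifts_bracket_def E.stage_eq W.stage_eq prim_carrier using val by simp_all
  then show "\<beta> = E.bV n" by (intro extensionalityI[of _ R.P]) (simp_all add: E.bV_def)
 qed
qed

end

theorem theorem6p5:
  fixes K :: "('k, 'z) ring_scheme" and A :: "('k, 'a) bialg"
  assumes "field K" and "braided_bialgebra K A"
  defines "P \<equiv> prim_mod K A" and "cP \<equiv> prim_braiding K A"
    and "bA \<equiv> canonical_bracket K A (braiding A)"
    and "incl \<equiv> (\<lambda>x. x)"
  shows "\<exists>bP.
    (\<forall>n. lifts_bracket K P cP bP A (braiding A) bA incl n (bP n) \<and>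
         (\<exists>!\<beta>. lifts_bracket K P cP bP A (braiding A) bA incl n \<beta>)) \<and>
    bracket K P cP bP \<and> braided_lie_algebra K P cP bP"
proof -
 interpret fld K by (rule fld.intro[OF assms(1)])
 have "br_bialg K A" using assms(2) unfolding br_bialg_iff .
 then interpret inf_part K A by (rule inf_part.intro)
 \<comment> \<open>\<open>lifts\<close> is an equivalence, so it yields existence and uniqueness of
   the lift at each stage at once.\<close>
 show ?thesis unfolding P_def cP_def bA_def incl_def W_bV[symmetric]
  using lifts E.bracket E.braided_lie by (intro exI[of _ E.bV]) simp
qed

end
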